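(* Assume $f,\phi,g\in H^3(0,T;L^2(\Omega))$; $u^0,u^{*0},u_{tt}(0)\in H^3(\Omega)\cap H^2_0(\Omega)$; $\theta^0,p^0,\theta_t(0),p_t(0),u_{ttt}(0),\theta_{tt}(0),p_{tt}(0)\in H^2(\Omega)\cap H^1_0(\Omega)$, where the values at $t=0$ are given by the compatibility conditions (K1) and (K2). Let $(u,\theta,p)$ be the weak solution of problem (P), let $(U^n,\Theta^n,P^n)$, $n=0,1$, be the discrete solution at $t_0,t_1$, and set $\zeta^n=\mathcal R_hu(t_n)-U^n$, $\Psi^n=\Pi_h\theta(t_n)-\Theta^n$, $\xi^n=\Pi_hp(t_n)-P^n$. Then $$\|\bar\partial_t\zeta^{1/2}\|^2+a_0\|\nabla\bar\partial_t\zeta^{1/2}\|^2+d_0C_{\rm Coer}\|\zeta^{1/2}\|_h^2+(a_1-|\gamma|/\gamma_0)\|\Psi^{1/2}\|^2+(a_2-|\gamma|\gamma_0)\|\xi^{1/2}\|^2+\Delta t\big[b_1\|\Psi^{1/2}\|^2+c_1\|\nabla\Psi^{1/2}\|^2+\kappa\|\nabla\xi^{1/2}\|^2\big]$$ $$\le C\big(h^{4\sigma}+L_{(u,\theta,p,t_1)}h^{4\sigma}+M_{(u,\theta,p,t_1)}(\Delta t)^4\big),$$ where $C>0$ is independent of $h$ and $\Delta t$ and depends on $C_F,C_{\rm Coer},C_{\rm Cont},C_1,C_2,C_3,T$ and the model coefficients.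
   Context: $\Omega\subset\mathbb R^2$ is a bounded polygonal Lipschitz domain with boundary $\Gamma$, $T>0$; $(\cdot,\cdot)$, $\|\cdot\|$ are the $L^2(\Omega)$ inner product and norm. The coefficients $a_0,d_0,\alpha,\beta,a_1,b_1,c_1,a_2,\kappa$ are positive constants, $\gamma\in\mathbb R$, $a_1a_2-\gamma^2>0$, and $\gamma_0>0$ is fixed with $a_1-|\gamma|/\gamma_0>0$, $a_2-|\gamma|\gamma_0>0$. Problem (P): $u_{tt}-a_0\Delta u_{tt}+d_0\Delta^2u+\alpha\Delta\theta+\beta\Delta p=f$, $a_1\theta_t-\gamma p_t+b_1\theta-c_1\Delta\theta-\alpha\Delta u_t=\phi$, $a_2p_t-\gamma\theta_t-\kappa\Delta p-\beta\Delta u_t=g$ in $\Omega\times(0,T]$, with $u=\partial_{\boldsymbol n}u=0$, $\theta=p=0$ on $\Gamma\times[0,T]$ and $u|_{t=0}=u^0$, $u_t|_{t=0}=u^{*0}$, $\theta|_{t=0}=\theta^0$, $p|_{t=0}=p^0$. For the data considered, its unique weak solution satisfies, for all $t$: $(u_{tt},v)+a_0(\nabla u_{tt},\nabla v)+d_0(\nabla^2u,\nabla^2v)-\alpha(\nabla\theta,\nabla v)-\beta(\nabla p,\nabla v)=(f,v)$ for $v\in H^2_0(\Omega)$; $a_1(\theta_t,\psi)-\gamma(p_t,\psi)+b_1(\theta,\psi)+c_1(\nabla\theta,\nabla\psi)+\alpha(\nabla u_t,\nabla\psi)=(\phi,\psi)$ for $\psi\in H^1_0(\Omega)$; $a_2(p_t,q)-\gamma(\theta_t,q)+\kappa(\nabla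 p,\nabla q)+\beta(\nabla u_t,\nabla q)=(g,q)$ for $q\in H^1_0(\Omega)$; with $u(t)\in H^2_0(\Omega)$, $\theta(t),p(t)\in H^1_0(\Omega)$. (K1): $u_{tt}(0)-a_0\Delta u_{tt}(0)=f(0)-d_0\Delta^2u^0-\alpha\Delta\theta^0-\beta\Delta p^0$; $a_1\theta_t(0)-\gamma p_t(0)=\phi(0)-b_1\theta^0+c_1\Delta\theta^0+\alpha\Delta u^{*0}$; $a_2p_t(0)-\gamma\theta_t(0)=g(0)+\kappa\Delta p^0+\beta\Delta u^{*0}$. (K2): $u_{ttt}(0)-a_0\Delta u_{ttt}(0)=f_t(0)-d_0\Delta^2u^{*0}-\alpha\Delta\theta_t(0)-\beta\Delta p_t(0)$; $a_1\theta_{tt}(0)-\gamma p_{tt}(0)=\phi_t(0)-b_1\theta_t(0)+c_1\Delta\theta_t(0)+\alpha\Delta u_{tt}(0)$; $a_2p_{tt}(0)-\gamma\theta_{tt}(0)=g_t(0)+\kappa\Delta p_t(0)+\beta\Delta u_{tt}(0)$. Elliptic regularity index: $\sigma=\min\{1,\sigma^1_{\rm reg},\sigma^2_{\rm reg}\}\in(1/2,1]$, where for $1-\sigma^1_{\rm reg}\le r\le1$ the solution $\chi\in H^1_0(\Omega)$ of $-\Delta\chi=\Phi^*\in H^{-r}(\Omega)$ satisfies $\|\chi\|_{H^{2-r}}\le C_{\rm reg}(r)\|\Phi^*\|_{H^{-r}}$ and for $2-\sigma^2_{\rm reg}\le s\le2$ the solution $w\in H^2_0(\Omega)$ of $\Delta^2w=F^*\in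 H^{-s}(\Omega)$ satisfies $\|w\|_{H^{4-s}}\le C_{\rm reg}(s)\|F^*\|_{H^{-s}}$. Space discretization. $\mathcal T$ is a shape-regular triangulation of $\bar\Omega$ with maximal diameter $h$, vertices $\mathcal V=\mathcal V(\Omega)\cup\mathcal V(\partial\Omega)$ and edges $\mathcal E=\mathcal E(\Omega)\cup\mathcal E(\partial\Omega)$ (interior and boundary); $h_e$ is the length of $e$ and $\boldsymbol n$ a fixed unit normal on $e$ (on $e=\partial K_+\cap\partial K_-$ pointing from $K_+$ to $K_-$; outward on boundary edges). Jump: $[\![\varphi]\!]=\varphi|_{K_+}-\varphi|_{K_-}$ on interior edges, $\varphi|_e$ on boundary edges; average: $\{\!\{\varphi\}\!\}=\frac12(\varphi|_{K_+}+\varphi|_{K_-})$ on interior edges, $\varphi|_e$ on boundary edges. $\mathcal P_r(\mathcal T)$: piecewise polynomials of degree at most $r$. $V_h=\mathcal P_2(\mathcal T)\cap H^1_0(\Omega)$, $W_h=\mathcal P_1(\mathcal T)\cap H^1_0(\Omega)$. With $D^2_{\rm pw}$ the piecewise Hessian and penalty parameter $\sigma_{\rm IP}>0$, $$a_h(w,v)=\int_\Omega D^2_{\rm pw}w:D^2_{\rm pw}v\,dx-\sum_{e\in\mathcal E}\int_e[\![\nabla w]\!]\cdot\{\!\{D^2_{\rm pw}v\}\!\}\boldsymbol n\,ds-\sum_{e\in\mathcal E}\int_e[\![\nabla v]\!]\cdot\{\!\{D^2_{\rm pw}w\}\!\}\boldsymbol n\,ds+\sum_{e\in\mathcal E}\frac{\sigma_{\rm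 IP}}{h_e}\int_e\Big[\!\!\Big[\frac{\partial w}{\partial\boldsymbol n}\Big]\!\!\Big]\Big[\!\!\Big[\frac{\partial v}{\partial\boldsymbol n}\Big]\!\!\Big]ds,$$ $$\|v\|_h^2=\|D^2_{\rm pw}v\|^2+\sum_{e\in\mathcal E}\frac{\sigma_{\rm IP}}{h_e}\int_e\Big[\!\!\Big[\frac{\partial v}{\partial\boldsymbol n}\Big]\!\!\Big]^2ds\quad\text{(on }V_h+H^2_0(\Omega)),$$ with $\sigma_{\rm IP}$ sufficiently large that $C_{\rm Coer}\|w_h\|_h^2\le a_h(w_h,w_h)$ and $a_h(w_h,v_h)\le C_{\rm Cont}\|w_h\|_h\|v_h\|_h$ on $V_h$ for some $C_{\rm Coer},C_{\rm Cont}>0$. Projections. ${\rm M}(\mathcal T)$ is the Morley space: piecewise quadratics continuous at interior vertices with normal derivatives continuous at midpoints of interior edges, vanishing at boundary vertices, and with normal derivatives vanishing at midpoints of boundary edges. $I_{\rm M}:H^2(\mathcal T)\to{\rm M}(\mathcal T)$ ($H^2(\mathcal T)$ = piecewise $H^2$): $(I_{\rm M}v)(z)$ is the arithmetic mean of $v|_K(z)$ over triangles $K\ni z$, $z\in\mathcal V(\Omega)$, and the mean of $\partial(I_{\rm M}v)/\partial\boldsymbol n$ over $e\in\mathcal E(\Omega)$ equals that of $\{\!\{\partial v/\partial\boldsymbol n\}\!\}$; boundary degrees of freedom are zero. $J:{\rm M}(\mathcal T)\to({\rm HCT}(\mathcal T)+\mathcal P_8(\mathcal T))\cap H^2_0(\Omega)$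 (HCT = Hsieh–Clough–Tocher space) is a fixed linear companion operator preserving the values at all vertices and the edge means of normal derivatives on all edges, with $\nabla(Jw_{\rm M})(z)$ equal to the arithmetic mean of $\nabla w_{\rm M}|_K(z)$ over $K\ni z$ for $z\in\mathcal V(\Omega)$, $|w_{\rm M}-Jw_{\rm M}|_{H^2(\mathcal T)}\lesssim\min_{v\in H^2_0(\Omega)}|w_{\rm M}-v|_{H^2(\mathcal T)}$, and, with $Q=JI_{\rm M}:V_h\to H^2_0(\Omega)$, $\|v_h-Qv_h\|_{H^s(\mathcal T)}\le C_1h^{2-s}\min_{v\in H^2_0(\Omega)}\|v-v_h\|_h$ for $v_h\in V_h$, $0\le s\le2$. $\mathcal R_h:H^2_0(\Omega)\to V_h$ is defined by $a_h(\mathcal R_hw,v_h)=(\nabla^2w,\nabla^2Qv_h)$ for all $v_h\in V_h$; $\Pi_h:H^1_0(\Omega)\to W_h$ by $(\nabla\Pi_h\chi,\nabla\chi_h)=(\nabla\chi,\nabla\chi_h)$ for all $\chi_h\in W_h$. They satisfy $\|w-\mathcal R_hw\|+\|\nabla(w-\mathcal R_hw)\|+h^\sigma\|w-\mathcal R_hw\|_h\le C_2h^{2\sigma}\|w\|_{H^{2+\sigma}(\Omega)}$ for $w\in H^2_0\cap H^{2+\sigma}$ and $\|\chi-\Pi_h\chi\|+h^\sigma\|\nabla(\chi-\Pi_h\chi)\|\le C_3h^{2\sigma}\|\chi\|_{H^{1+\sigma}(\Omega)}$ for $\chi\in H^1_0\cap H^{1+\sigma}$. Time discretization. $t_n=n\Delta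 t$, $\Delta t=T/N$; $\upsilon^{1/2}=\frac12(\upsilon^1+\upsilon^0)$, $\bar\partial_t\upsilon^{1/2}=(\upsilon^1-\upsilon^0)/\Delta t$. $(U^0,\Theta^0,P^0)=(\mathcal R_hu^0,\Pi_h\theta^0,\Pi_hp^0)$, and $(U^1,\Theta^1,P^1)\in V_h\times W_h\times W_h$ solves, for all $(v_h,\psi_h,q_h)\in V_h\times W_h\times W_h$, $$\tfrac{2}{\Delta t}\big[(\bar\partial_tU^{1/2}-u^{*0},v_h)+a_0(\nabla\bar\partial_tU^{1/2}-\nabla u^{*0},\nabla v_h)\big]+d_0a_h(U^{1/2},v_h)-\alpha(\nabla\Theta^{1/2},\nabla v_h)-\beta(\nabla P^{1/2},\nabla v_h)=(f^{1/2},v_h),$$ $$a_1(\bar\partial_t\Theta^{1/2},\psi_h)-\gamma(\bar\partial_tP^{1/2},\psi_h)+b_1(\Theta^{1/2},\psi_h)+c_1(\nabla\Theta^{1/2},\nabla\psi_h)+\alpha(\nabla\bar\partial_tU^{1/2},\nabla\psi_h)=(\phi^{1/2},\psi_h),$$ $$a_2(\bar\partial_tP^{1/2},q_h)-\gamma(\bar\partial_t\Theta^{1/2},q_h)+\kappa(\nabla P^{1/2},\nabla q_h)+\beta(\nabla\bar\partial_tU^{1/2},\nabla q_h)=(g^{1/2},q_h).$$ Constants. $C_F$ is a bound $\|F\|_{L^\infty(0,T;L^2(\Omega))}\le C_F$ for $F=f-u_{tt}+a_0\Delta u_{tt}-\alpha\Delta\theta-\beta\Delta p$. Further, $$L_{(u,\theta,p,t_1)}=\|u_t\|^2_{L^2(0,t_1;H^{2+\sigma}(\Omega))}+\|u_t\|^2_{L^\infty(0,t_1;H^{2+\sigma}(\Omega))}+\|\theta\|^2_{L^\infty(0,t_1;H^{1+\sigma}(\Omega))}+\|p\|^2_{L^\infty(0,t_1;H^{1+\sigma}(\Omega))},$$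 $$M_{(u,\theta,p,t_1)}=\|u_{ttt}\|^2_{L^\infty(0,t_1;H^1(\Omega))}+\|\theta_{ttt}\|^2_{L^2(0,t_1;L^2(\Omega))}+\|p_{ttt}\|^2_{L^2(0,t_1;L^2(\Omega))}.$$ *)

theory Defs
  imports "HOL-Analysis.Analysis" "HOL-Probability.Essential_Supremum"
begin

type_synonym pt = "real^2"
type_synonym scalar_field = "pt \<Rightarrow> real"

section \<open>Domains\<close>

definition lipschitz_domain :: "pt set \<Rightarrow> bool" where
  "lipschitz_domain \<Omega> \<longleftrightarrow>
     open \<Omega> \<and> connected \<Omega> \<and> bounded \<Omega> \<and> \<Omega> \<noteq> {} \<and>
     (\<forall>x\<in>frontier \<Omega>. \<exists>r>0. \<exists>R \<eta> L. orthogonal_transformation R \<and> L-lipschitz_on (UNIV :: real set) \<eta> \<and>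
        (\<forall>y\<in>ball x r. y \<in> \<Omega> \<longleftrightarrow> \<eta> (R y $ 1) < (R y :: pt) $ 2))"

definition polygonal :: "pt set \<Rightarrow> bool" where
  "polygonal \<Omega> \<longleftrightarrow> (\<exists>\<S>. finite \<S> \<and> (\<forall>S\<in>\<S>. \<exists>a b. S = closed_segment a b) \<and> frontier \<Omega> = \<Union>\<S>)"


section \<open>Sobolev spaces\<close>

text \<open>
  Elements of the function spaces are represented by functions on the whole plane of which only the
  values almost everywhere on the open set in question matter. A list of indices \<open>[i, j, \<dots>]\<close>
  stands for the derivative \<open>\<partial>\<^sub>i \<partial>\<^sub>j \<dots>\<close>; norms of order \<open>m\<close> are taken over all these lists, i.e. they are
  the Frobenius norms of the full derivative tensors.
\<close>

definition L2 :: "pt set \<Rightarrow> scalar_field set" where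
  "L2 U = {v. v \<in> borel_measurable (lebesgue_on U) \<and> integrable (lebesgue_on U) (\<lambda>x. (v x)\<^sup>2)}"

definition ip :: "pt set \<Rightarrow> scalar_field \<Rightarrow> scalar_field \<Rightarrow> real" where
  "ip U v w = (LINT x|lebesgue_on U. v x * w x)"

definition l2norm :: "pt set \<Rightarrow> scalar_field \<Rightarrow> real" where
  "l2norm U v = sqrt (ip U v v)"

definition ae_eq :: "pt set \<Rightarrow> scalar_field \<Rightarrow> scalar_field \<Rightarrow> bool" where
  "ae_eq U v w \<longleftrightarrow> (AE x in lebesgue_on U. v x = w x)"

primrec pds :: "2 list \<Rightarrow> scalar_field \<Rightarrow> scalar_field" where
  "pds [] v = v"
| "pds (i # is) v = (\<lambda>x. frechet_derivative (pds is v) (at x) (axis i 1))"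

definition smooth :: "scalar_field \<Rightarrow> bool" where
  "smooth v \<longleftrightarrow> (\<forall>is x. pds is v differentiable (at x))"

definition test_fun :: "pt set \<Rightarrow> scalar_field set" where
  "test_fun U = {\<phi>. smooth \<phi> \<and> compact (closure {x. \<phi> x \<noteq> 0}) \<and> closure {x. \<phi> x \<noteq> 0} \<subseteq> U}"

definition weak_deriv :: "pt set \<Rightarrow> 2 list \<Rightarrow> scalar_field \<Rightarrow> scalar_field \<Rightarrow> bool" where
  "weak_deriv U is v g \<longleftrightarrow> v \<in> L2 U \<and> g \<in> L2 U \<and>
     (\<forall>\<phi>\<in>test_fun U. ip U v (pds is \<phi>) = (-1) ^ length is * ip U g \<phi>)"

definition wder :: "pt set \<Rightarrow> 2 list \<Rightarrow> scalar_field \<Rightarrow> scalar_field" where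
  "wder U is v = (SOME g. weak_deriv U is v g)"

definition Hk :: "pt set \<Rightarrow> nat \<Rightarrow> scalar_field set" where
  "Hk U m = {v \<in> L2 U. \<forall>is. length is \<le> m \<longrightarrow> (\<exists>g. weak_deriv U is v g)}"

definition slobodeckij_sq :: "pt set \<Rightarrow> real \<Rightarrow> scalar_field \<Rightarrow> ennreal" where
  "slobodeckij_sq U \<theta> g =
     (\<integral>\<^sup>+x. \<integral>\<^sup>+y. ennreal ((g x - g y)\<^sup>2 / norm (x - y) powr (2 + 2 * \<theta>)) \<partial>lebesgue_on U \<partial>lebesgue_on U)"

text \<open>
  The squared norm of \<open>H\<^sup>s(U)\<close>, \<open>s \<ge> 0\<close>, with value \<open>\<infinity>\<close> outside the space. The weight \<open>\<theta> (1 - \<theta>)\<close> does not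
  change the space and, for a fixed \<open>s\<close>, gives an equivalent norm; it is the usual normalisation which
  keeps the norms of fractional order bounded as \<open>s\<close> approaches an integer. Without it no
  constant could serve all \<open>s \<in> [0,2]\<close> at once in the estimate \<open>smoother_bound\<close> below.
\<close>

definition sob_sq :: "pt set \<Rightarrow> real \<Rightarrow> scalar_field \<Rightarrow> ennreal" where
  "sob_sq U s v =
     (let m = nat \<lfloor>s\<rfloor>; \<theta> = frac s in
      if v \<in> Hk U m
      then ennreal (\<Sum>is | length is \<le> m. (l2norm U (wder U is v))\<^sup>2) +
           (if \<theta> = 0 then 0
            else ennreal (\<theta> * (1 - \<theta>)) * (\<Sum>is | length is = m. slobodeckij_sq U \<theta> (wder U is v)))
      else \<infinity>)"

definition Hs :: "pt set \<Rightarrow> real \<Rightarrow> scalar_field set" where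
  "Hs U s = {v. sob_sq U s v < \<infinity>}"

definition sob_norm :: "pt set \<Rightarrow> real \<Rightarrow> scalar_field \<Rightarrow> real" where
  "sob_norm U s v = sqrt (enn2real (sob_sq U s v))"

definition Hs0 :: "pt set \<Rightarrow> real \<Rightarrow> scalar_field set" where
  "Hs0 U s = {v \<in> Hs U s. \<forall>\<epsilon>>0. \<exists>\<phi>\<in>test_fun U. sob_norm U s (v - \<phi>) < \<epsilon>}"

definition grad_ip :: "pt set \<Rightarrow> scalar_field \<Rightarrow> scalar_field \<Rightarrow> real" where
  "grad_ip U v w = (\<Sum>i\<in>UNIV. ip U (wder U [i] v) (wder U [i] w))"

definition grad_norm :: "pt set \<Rightarrow> scalar_field \<Rightarrow> real" where
  "grad_norm U v = sqrt (grad_ip U v v)"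

definition hess_ip :: "pt set \<Rightarrow> scalar_field \<Rightarrow> scalar_field \<Rightarrow> real" where
  "hess_ip U v w = (\<Sum>i\<in>UNIV. \<Sum>j\<in>UNIV. ip U (wder U [i, j] v) (wder U [i, j] w))"

definition lap :: "scalar_field \<Rightarrow> scalar_field" where
  "lap \<phi> = (\<lambda>x. \<Sum>i\<in>UNIV. pds [i, i] \<phi> x)"


section \<open>Elliptic regularity\<close>

text \<open>
  \<open>H\<^sup>-\<^sup>r(U)\<close> is the dual of \<open>H\<^sup>r\<^sub>0(U)\<close> for \<open>r > 0\<close> and the space \<open>H\<^bsup>-r\<^esup>(U)\<close>, acting through the
  \<open>L\<^sup>2\<close> inner product, for \<open>r \<le> 0\<close> (a case that occurs if a regularity index is larger than 1 or 2).
  Boundedness makes a functional insensitive to changes on null sets.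
\<close>

definition neg_bounds :: "pt set \<Rightarrow> real \<Rightarrow> (scalar_field \<Rightarrow> real) \<Rightarrow> real set" where
  "neg_bounds U r \<Phi> =
     (if r > 0 then {B. 0 \<le> B \<and> (\<forall>v\<in>Hs0 U r. \<bar>\<Phi> v\<bar> \<le> B * sob_norm U r v)}
      else {sob_norm U (- r) q |q. q \<in> Hs U (- r) \<and> (\<forall>v\<in>L2 U. \<Phi> v = ip U q v)})"

definition Hneg :: "pt set \<Rightarrow> real \<Rightarrow> (scalar_field \<Rightarrow> real) set" where
  "Hneg U r = {\<Phi>. neg_bounds U r \<Phi> \<noteq> {} \<and>
     (r > 0 \<longrightarrow> (\<forall>v\<in>Hs0 U r. \<forall>w\<in>Hs0 U r. \<forall>c. \<Phi> (\<lambda>x. c * v x + w x) = c * \<Phi> v + \<Phi> w))}"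

definition neg_norm :: "pt set \<Rightarrow> real \<Rightarrow> (scalar_field \<Rightarrow> real) \<Rightarrow> real" where
  "neg_norm U r \<Phi> = Inf (neg_bounds U r \<Phi>)"

definition laplace_regularity :: "pt set \<Rightarrow> real \<Rightarrow> bool" where
  "laplace_regularity \<Omega> \<sigma>1 \<longleftrightarrow>
     (\<forall>r. 1 - \<sigma>1 \<le> r \<and> r \<le> 1 \<longrightarrow>
        (\<exists>C. \<forall>\<Phi>\<in>Hneg \<Omega> r. \<forall>\<omega>\<in>Hs0 \<Omega> 1. (\<forall>v\<in>Hs0 \<Omega> 1. grad_ip \<Omega> \<omega> v = \<Phi> v) \<longrightarrow>
           \<omega> \<in> Hs \<Omega> (2 - r) \<and> sob_norm \<Omega> (2 - r) \<omega> \<le> C * neg_norm \<Omega> r \<Phi>))"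

definition biharmonic_regularity :: "pt set \<Rightarrow> real \<Rightarrow> bool" where
  "biharmonic_regularity \<Omega> \<sigma>2 \<longleftrightarrow>
     (\<forall>s. 2 - \<sigma>2 \<le> s \<and> s \<le> 2 \<longrightarrow>
        (\<exists>C. \<forall>F\<in>Hneg \<Omega> s. \<forall>w\<in>Hs0 \<Omega> 2. (\<forall>v\<in>Hs0 \<Omega> 2. hess_ip \<Omega> w v = F v) \<longrightarrow>
           w \<in> Hs \<Omega> (4 - s) \<and> sob_norm \<Omega> (4 - s) w \<le> C * neg_norm \<Omega> s F))"

definition regularity_index :: "pt set \<Rightarrow> real \<Rightarrow> bool" where
  "regularity_index \<Omega> \<sigma> \<longleftrightarrow>
     (\<exists>\<sigma>1 \<sigma>2. laplace_regularity \<Omega> \<sigma>1 \<and> biharmonic_regularity \<Omega> \<sigma>2 \<and>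
        \<sigma> = Min {1, \<sigma>1, \<sigma>2} \<and> 1/2 < \<sigma>)"


section \<open>Functions of time with values in function spaces\<close>

definition time_continuous :: "pt set \<Rightarrow> real \<Rightarrow> (real \<Rightarrow> scalar_field) \<Rightarrow> bool" where
  "time_continuous \<Omega> T v \<longleftrightarrow>
     (\<forall>t\<in>{0..T}. v t \<in> L2 \<Omega>) \<and>
     (\<forall>t\<in>{0..T}. ((\<lambda>s. l2norm \<Omega> (v s - v t)) \<longlongrightarrow> 0) (at t within {0..T}))"

definition has_time_deriv ::
  "pt set \<Rightarrow> real \<Rightarrow> (real \<Rightarrow> scalar_field) \<Rightarrow> real \<Rightarrow> scalar_field \<Rightarrow> bool" where
  "has_time_deriv \<Omega> T v t w \<longleftrightarrow>
     (\<forall>s\<in>{0..T}. v s \<in> L2 \<Omega>) \<and> w \<in> L2 \<Omega> \<and>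
     ((\<lambda>s. l2norm \<Omega> (\<lambda>x. (v s x - v t x) / (s - t) - w x)) \<longlongrightarrow> 0) (at t within {0..T})"

text \<open>
  \<open>L\<^sup>1(0,b; L\<^sup>2(\<Omega>))\<close>. Weak and strong measurability agree by Pettis' theorem, as \<open>L\<^sup>2(\<Omega>)\<close> is separable.
\<close>

definition bochner_L1 :: "pt set \<Rightarrow> real \<Rightarrow> (real \<Rightarrow> scalar_field) \<Rightarrow> bool" where
  "bochner_L1 \<Omega> b v \<longleftrightarrow>
     (AE t in lebesgue_on {0<..<b}. v t \<in> L2 \<Omega>) \<and>
     (\<forall>\<omega>\<in>L2 \<Omega>. (\<lambda>t. ip \<Omega> (v t) \<omega>) \<in> borel_measurable (lebesgue_on {0<..<b})) \<and>
     (\<integral>\<^sup>+t. ennreal (l2norm \<Omega> (v t)) \<partial>lebesgue_on {0<..<b}) < \<infinity>"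

definition time_test_fun :: "real \<Rightarrow> (real \<Rightarrow> real) set" where
  "time_test_fun b = {\<eta>. (\<forall>k t. (deriv ^^ k) \<eta> differentiable (at t)) \<and> closure {t. \<eta> t \<noteq> 0} \<subseteq> {0<..<b}}"

definition weak_time_deriv ::
  "pt set \<Rightarrow> nat \<Rightarrow> real \<Rightarrow> (real \<Rightarrow> scalar_field) \<Rightarrow> (real \<Rightarrow> scalar_field) \<Rightarrow> bool" where
  "weak_time_deriv \<Omega> k b v w \<longleftrightarrow> bochner_L1 \<Omega> b v \<and> bochner_L1 \<Omega> b w \<and>
     (\<forall>\<eta>\<in>time_test_fun b. \<forall>\<omega>\<in>L2 \<Omega>.
        (LINT t|lebesgue_on {0<..<b}. (deriv ^^ k) \<eta> t * ip \<Omega> (v t) \<omega>) =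
        (-1) ^ k * (LINT t|lebesgue_on {0<..<b}. \<eta> t * ip \<Omega> (w t) \<omega>))"

text \<open>
  The squared norms of the \<open>k\<close>-th time derivative of \<open>v\<close> in \<open>L\<^sup>2(0,b; H\<^sup>s(\<Omega>))\<close> and \<open>L\<^sup>\<infinity>(0,b; H\<^sup>s(\<Omega>))\<close>.
  The weak derivative is unique up to null sets, so the infimum only serves to assign
  the value \<open>\<infinity>\<close> if it does not exist.
\<close>

definition L2_sq :: "pt set \<Rightarrow> real \<Rightarrow> nat \<Rightarrow> real \<Rightarrow> (real \<Rightarrow> scalar_field) \<Rightarrow> ennreal" where
  "L2_sq \<Omega> s k b v =
     (INF w\<in>{w. weak_time_deriv \<Omega> k b v w}. \<integral>\<^sup>+t. sob_sq \<Omega> s (w t) \<partial>lebesgue_on {0<..<b})"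

definition Linf_sq :: "pt set \<Rightarrow> real \<Rightarrow> nat \<Rightarrow> real \<Rightarrow> (real \<Rightarrow> scalar_field) \<Rightarrow> ennreal" where
  "Linf_sq \<Omega> s k b v =
     (INF w\<in>{w. weak_time_deriv \<Omega> k b v w}. esssup (lebesgue_on {0<..<b}) (\<lambda>t. sob_sq \<Omega> s (w t)))"

text \<open>
  \<open>H\<^sup>k(0,T; L\<^sup>2(\<Omega>))\<close>, \<open>k \<ge> 1\<close>, through continuous representatives, so that values at single times make sense.
\<close>

definition H_time :: "pt set \<Rightarrow> nat \<Rightarrow> real \<Rightarrow> (real \<Rightarrow> scalar_field) set" where
  "H_time \<Omega> k T = {v. time_continuous \<Omega> T v \<and> (\<forall>j\<le>k. L2_sq \<Omega> 0 j T v < \<infinity>)}"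


section \<open>The continuous problem\<close>

record coeffs =
  a\<^sub>0 :: real
  d\<^sub>0 :: real
  alpha :: real
  beta :: real
  a\<^sub>1 :: real
  b\<^sub>1 :: real
  c\<^sub>1 :: real
  a\<^sub>2 :: real
  kappa :: real
  gam :: real

definition admissible :: "coeffs \<Rightarrow> real \<Rightarrow> bool" where
  "admissible c \<gamma>0 \<longleftrightarrow>
     0 < a\<^sub>0 c \<and> 0 < d\<^sub>0 c \<and> 0 < alpha c \<and> 0 < beta c \<and> 0 < a\<^sub>1 c \<and> 0 < b\<^sub>1 c \<and> 0 < c\<^sub>1 c \<and> 0 < a\<^sub>2 c \<and> 0 < kappa c \<and>
     0 < a\<^sub>1 c * a\<^sub>2 c - (gam c)\<^sup>2 \<and>
     0 < \<gamma>0 \<and> 0 < a\<^sub>1 c - \<bar>gam c\<bar> / \<gamma>0 \<and> 0 < a\<^sub>2 c - \<bar>gam c\<bar> * \<gamma>0"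

text \<open>The functions \<open>ut\<close>, \<open>utt\<close>, \<open>\<theta>t\<close>, \<open>pt\<close> are the time derivatives of \<open>u\<close>, \<open>ut\<close>, \<open>\<theta>\<close>, \<open>p\<close>.\<close>

definition weak_solution ::
  "pt set \<Rightarrow> real \<Rightarrow> coeffs \<Rightarrow>
   (real \<Rightarrow> scalar_field) \<Rightarrow> (real \<Rightarrow> scalar_field) \<Rightarrow> (real \<Rightarrow> scalar_field) \<Rightarrow>
   scalar_field \<Rightarrow> scalar_field \<Rightarrow> scalar_field \<Rightarrow> scalar_field \<Rightarrow>
   (real \<Rightarrow> scalar_field) \<Rightarrow> (real \<Rightarrow> scalar_field) \<Rightarrow> (real \<Rightarrow> scalar_field) \<Rightarrow>
   (real \<Rightarrow> scalar_field) \<Rightarrow> (real \<Rightarrow> scalar_field) \<Rightarrow>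
   (real \<Rightarrow> scalar_field) \<Rightarrow> (real \<Rightarrow> scalar_field) \<Rightarrow> bool" where
  "weak_solution \<Omega> T c f \<phi> g u0 us0 \<theta>0 p0 u ut utt \<theta> \<theta>t p pt \<longleftrightarrow>
     (\<forall>t\<in>{0..T}. u t \<in> Hs0 \<Omega> 2 \<and> ut t \<in> Hs0 \<Omega> 1 \<and> utt t \<in> Hs0 \<Omega> 1 \<and> \<theta> t \<in> Hs0 \<Omega> 1 \<and> p t \<in> Hs0 \<Omega> 1) \<and>
     (\<forall>t\<in>{0..T}. has_time_deriv \<Omega> T u t (ut t) \<and> has_time_deriv \<Omega> T ut t (utt t) \<and>
                 has_time_deriv \<Omega> T \<theta> t (\<theta>t t) \<and> has_time_deriv \<Omega> T p t (pt t)) \<and>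
     ae_eq \<Omega> (u 0) u0 \<and> ae_eq \<Omega> (ut 0) us0 \<and> ae_eq \<Omega> (\<theta> 0) \<theta>0 \<and> ae_eq \<Omega> (p 0) p0 \<and>
     (\<forall>t\<in>{0..T}. \<forall>v\<in>Hs0 \<Omega> 2.
        ip \<Omega> (utt t) v + a\<^sub>0 c * grad_ip \<Omega> (utt t) v + d\<^sub>0 c * hess_ip \<Omega> (u t) v
        - alpha c * grad_ip \<Omega> (\<theta> t) v - beta c * grad_ip \<Omega> (p t) v = ip \<Omega> (f t) v) \<and>
     (\<forall>t\<in>{0..T}. \<forall>\<psi>\<in>Hs0 \<Omega> 1.
        a\<^sub>1 c * ip \<Omega> (\<theta>t t) \<psi> - gam c * ip \<Omega> (pt t) \<psi> + b\<^sub>1 c * ip \<Omega> (\<theta> t) \<psi>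
        + c\<^sub>1 c * grad_ip \<Omega> (\<theta> t) \<psi> + alpha c * grad_ip \<Omega> (ut t) \<psi> = ip \<Omega> (\<phi> t) \<psi>) \<and>
     (\<forall>t\<in>{0..T}. \<forall>q\<in>Hs0 \<Omega> 1.
        a\<^sub>2 c * ip \<Omega> (pt t) q - gam c * ip \<Omega> (\<theta>t t) q + kappa c * grad_ip \<Omega> (p t) q
        + beta c * grad_ip \<Omega> (ut t) q = ip \<Omega> (g t) q)"

text \<open>
  The compatibility relations, read as equations between distributions on \<open>\<Omega>\<close>:
  \<open>w - a\<^sub>0 \<Delta>w = F - d\<^sub>0 \<Delta>\<^sup>2 u - \<alpha> \<Delta>\<theta> - \<beta> \<Delta>p\<close>,
  \<open>a\<^sub>1 \<theta>' - \<gamma> p' = \<Phi> - b\<^sub>1 \<theta> + c\<^sub>1 \<Delta>\<theta> + \<alpha> \<Delta>v\<close>,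
  \<open>a\<^sub>2 p' - \<gamma> \<theta>' = G + \<kappa> \<Delta>p + \<beta> \<Delta>v\<close>.
\<close>

definition compatibility ::
  "pt set \<Rightarrow> coeffs \<Rightarrow> scalar_field \<Rightarrow> scalar_field \<Rightarrow> scalar_field \<Rightarrow>
   scalar_field \<Rightarrow> scalar_field \<Rightarrow> scalar_field \<Rightarrow> scalar_field \<Rightarrow>
   scalar_field \<Rightarrow> scalar_field \<Rightarrow> scalar_field \<Rightarrow> bool" where
  "compatibility \<Omega> c F \<Phi> G u v \<theta> p w \<theta>' p' \<longleftrightarrow>
     (\<forall>\<tau>\<in>test_fun \<Omega>.
        ip \<Omega> w \<tau> - a\<^sub>0 c * ip \<Omega> w (lap \<tau>) =
          ip \<Omega> F \<tau> - d\<^sub>0 c * ip \<Omega> u (lap (lap \<tau>)) - alpha c * ip \<Omega> \<theta> (lap \<tau>) - beta c * ip \<Omega> p (lap \<tau>) \<and>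
        a\<^sub>1 c * ip \<Omega> \<theta>' \<tau> - gam c * ip \<Omega> p' \<tau> =
          ip \<Omega> \<Phi> \<tau> - b\<^sub>1 c * ip \<Omega> \<theta> \<tau> + c\<^sub>1 c * ip \<Omega> \<theta> (lap \<tau>) + alpha c * ip \<Omega> v (lap \<tau>) \<and>
        a\<^sub>2 c * ip \<Omega> p' \<tau> - gam c * ip \<Omega> \<theta>' \<tau> =
          ip \<Omega> G \<tau> + kappa c * ip \<Omega> p (lap \<tau>) + beta c * ip \<Omega> v (lap \<tau>))"

definition smooth_data ::
  "pt set \<Rightarrow> real \<Rightarrow> coeffs \<Rightarrow>
   (real \<Rightarrow> scalar_field) \<Rightarrow> (real \<Rightarrow> scalar_field) \<Rightarrow> (real \<Rightarrow> scalar_field) \<Rightarrow>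
   scalar_field \<Rightarrow> scalar_field \<Rightarrow> scalar_field \<Rightarrow> scalar_field \<Rightarrow> bool" where
  "smooth_data \<Omega> T c f \<phi> g u0 us0 \<theta>0 p0 \<longleftrightarrow>
     {f, \<phi>, g} \<subseteq> H_time \<Omega> 3 T \<and>
     (\<exists>ft0 \<phi>t0 gt0 utt0 uttt0 \<theta>t0 pt0 \<theta>tt0 ptt0.
        has_time_deriv \<Omega> T f 0 ft0 \<and> has_time_deriv \<Omega> T \<phi> 0 \<phi>t0 \<and> has_time_deriv \<Omega> T g 0 gt0 \<and>
        compatibility \<Omega> c (f 0) (\<phi> 0) (g 0) u0 us0 \<theta>0 p0 utt0 \<theta>t0 pt0 \<and>
        compatibility \<Omega> c ft0 \<phi>t0 gt0 us0 utt0 \<theta>t0 pt0 uttt0 \<theta>tt0 ptt0 \<and>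
        {u0, us0, utt0} \<subseteq> Hs \<Omega> 3 \<inter> Hs0 \<Omega> 2 \<and>
        {\<theta>0, p0, \<theta>t0, pt0, uttt0, \<theta>tt0, ptt0} \<subseteq> Hs \<Omega> 2 \<inter> Hs0 \<Omega> 1)"

text \<open>\<open>\<parallel>F\<parallel> \<le> CF\<close> in \<open>L\<^sup>\<infinity>(0,T; L\<^sup>2(\<Omega>))\<close> for the distribution \<open>F = f - u\<^sub>t\<^sub>t + a\<^sub>0 \<Delta>u\<^sub>t\<^sub>t - \<alpha> \<Delta>\<theta> - \<beta> \<Delta>p\<close>.\<close>

definition F_bound ::
  "pt set \<Rightarrow> real \<Rightarrow> coeffs \<Rightarrow> (real \<Rightarrow> scalar_field) \<Rightarrow> (real \<Rightarrow> scalar_field) \<Rightarrow>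
   (real \<Rightarrow> scalar_field) \<Rightarrow> (real \<Rightarrow> scalar_field) \<Rightarrow> real \<Rightarrow> bool" where
  "F_bound \<Omega> T c f utt \<theta> p CF \<longleftrightarrow>
     (AE t in lebesgue_on {0<..<T}. \<exists>F\<in>L2 \<Omega>. l2norm \<Omega> F \<le> CF \<and>
        (\<forall>\<tau>\<in>test_fun \<Omega>. ip \<Omega> F \<tau> =
           ip \<Omega> (f t) \<tau> - ip \<Omega> (utt t) \<tau> + a\<^sub>0 c * ip \<Omega> (utt t) (lap \<tau>)
           - alpha c * ip \<Omega> (\<theta> t) (lap \<tau>) - beta c * ip \<Omega> (p t) (lap \<tau>)))"

definition L_reg ::
  "pt set \<Rightarrow> real \<Rightarrow> (real \<Rightarrow> scalar_field) \<Rightarrow> (real \<Rightarrow> scalar_field) \<Rightarrow> (real \<Rightarrow> scalar_field) \<Rightarrow> real \<Rightarrow> ennreal" where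
  "L_reg \<Omega> \<sigma> u \<theta> p t1 =
     L2_sq \<Omega> (2 + \<sigma>) 1 t1 u + Linf_sq \<Omega> (2 + \<sigma>) 1 t1 u +
     Linf_sq \<Omega> (1 + \<sigma>) 0 t1 \<theta> + Linf_sq \<Omega> (1 + \<sigma>) 0 t1 p"

definition M_reg ::
  "pt set \<Rightarrow> (real \<Rightarrow> scalar_field) \<Rightarrow> (real \<Rightarrow> scalar_field) \<Rightarrow> (real \<Rightarrow> scalar_field) \<Rightarrow> real \<Rightarrow> ennreal" where
  "M_reg \<Omega> u \<theta> p t1 = Linf_sq \<Omega> 1 3 t1 u + L2_sq \<Omega> 0 3 t1 \<theta> + L2_sq \<Omega> 0 3 t1 p"


section \<open>Triangulations\<close>

text \<open>Triangles and edges are closed sets.\<close>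

definition triangulation_of :: "pt set \<Rightarrow> real \<Rightarrow> pt set set \<Rightarrow> bool" where
  "triangulation_of \<Omega> \<rho> \<T> \<longleftrightarrow>
     triangulation \<T> \<and> (\<forall>K\<in>\<T>. 2 simplex K) \<and> \<Union>\<T> = closure \<Omega> \<and>
     0 < \<rho> \<and> (\<forall>K\<in>\<T>. \<exists>x. ball x (diameter K / \<rho>) \<subseteq> K)"

definition mesh_size :: "pt set set \<Rightarrow> real" where
  "mesh_size \<T> = Max (diameter ` \<T>)"

definition vertices :: "pt set set \<Rightarrow> pt set" where
  "vertices \<T> = {z. \<exists>K\<in>\<T>. z extreme_point_of K}"

definition edges :: "pt set set \<Rightarrow> pt set set" where
  "edges \<T> = {e. \<exists>K\<in>\<T>. e edge_of K}"

definition bd_edges :: "pt set \<Rightarrow> pt set set \<Rightarrow> pt set set" where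
  "bd_edges \<Omega> \<T> = {e\<in>edges \<T>. e \<subseteq> frontier \<Omega>}"

definition ends :: "pt set \<Rightarrow> pt \<times> pt" where
  "ends e = (SOME (a, b). e = closed_segment a b)"

definition edge_midpoint :: "pt set \<Rightarrow> pt" where
  "edge_midpoint e = (case ends e of (a, b) \<Rightarrow> midpoint a b)"

definition edge_int :: "pt set \<Rightarrow> scalar_field \<Rightarrow> real" where
  "edge_int e \<tau> = (case ends e of (a, b) \<Rightarrow>
     norm (b - a) * (LINT t|lebesgue_on {0..1}. \<tau> (linepath a b t)))"

definition edge_L2 :: "pt set \<Rightarrow> scalar_field set" where
  "edge_L2 e = {\<tau>. case ends e of (a, b) \<Rightarrow>
     (\<lambda>t. \<tau> (linepath a b t)) \<in> borel_measurable (lebesgue_on {0..1}) \<and>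
     integrable (lebesgue_on {0..1}) (\<lambda>t. (\<tau> (linepath a b t))\<^sup>2)}"

definition outer_normal :: "pt set \<Rightarrow> pt set \<Rightarrow> pt \<Rightarrow> bool" where
  "outer_normal K e \<nu> \<longleftrightarrow> norm \<nu> = 1 \<and> (\<forall>y\<in>e. \<forall>x\<in>K. (x - y) \<bullet> \<nu> \<le> 0)"

definition edge_normals :: "pt set set \<Rightarrow> (pt set \<Rightarrow> pt) \<Rightarrow> bool" where
  "edge_normals \<T> n \<longleftrightarrow> (\<forall>e\<in>edges \<T>. \<exists>K\<in>\<T>. e edge_of K \<and> outer_normal K e (n e))"

definition K_plus :: "pt set set \<Rightarrow> (pt set \<Rightarrow> pt) \<Rightarrow> pt set \<Rightarrow> pt set" where
  "K_plus \<T> n e = (THE K. K \<in> \<T> \<and> e edge_of K \<and> outer_normal K e (n e))"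

definition K_minus :: "pt set set \<Rightarrow> (pt set \<Rightarrow> pt) \<Rightarrow> pt set \<Rightarrow> pt set" where
  "K_minus \<T> n e = (THE K. K \<in> \<T> \<and> e edge_of K \<and> outer_normal K e (- n e))"

text \<open>The trace on the edge \<open>e\<close> of \<open>v \<in> H\<^sup>1(K)\<close>.\<close>

definition has_trace :: "pt set \<Rightarrow> pt set \<Rightarrow> scalar_field \<Rightarrow> scalar_field \<Rightarrow> bool" where
  "has_trace K e v \<tau> \<longleftrightarrow> v \<in> Hs (interior K) 1 \<and> \<tau> \<in> edge_L2 e \<and>
     (\<exists>w :: nat \<Rightarrow> scalar_field. (\<forall>k. smooth (w k)) \<and>
        (\<lambda>k. sob_norm (interior K) 1 (w k - v)) \<longlonglongrightarrow> 0 \<and>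
        (\<lambda>k. edge_int e (\<lambda>x. (w k x - \<tau> x)\<^sup>2)) \<longlonglongrightarrow> 0)"

definition trace_on :: "pt set \<Rightarrow> pt set \<Rightarrow> scalar_field \<Rightarrow> scalar_field" where
  "trace_on K e v = (SOME \<tau>. has_trace K e v \<tau>)"

text \<open>Value at \<open>z \<in> K\<close> of the representative of \<open>v\<close> that is continuous on \<open>K\<close>.\<close>

definition value_at :: "pt set \<Rightarrow> scalar_field \<Rightarrow> pt \<Rightarrow> real" where
  "value_at K v z = (THE c. \<exists>w. continuous_on K w \<and> ae_eq K w v \<and> w z = c)"

text \<open>Jumps and averages of piecewise functions, which are given as families indexed by the triangles.\<close>

definition jump ::
  "pt set \<Rightarrow> pt set set \<Rightarrow> (pt set \<Rightarrow> pt) \<Rightarrow> pt set \<Rightarrow> (pt set \<Rightarrow> scalar_field) \<Rightarrow> scalar_field" where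
  "jump \<Omega> \<T> n e V = (\<lambda>x.
     let K = K_plus \<T> n e; K' = K_minus \<T> n e in
     if e \<in> bd_edges \<Omega> \<T> then trace_on K e (V K) x
     else trace_on K e (V K) x - trace_on K' e (V K') x)"

definition avg ::
  "pt set \<Rightarrow> pt set set \<Rightarrow> (pt set \<Rightarrow> pt) \<Rightarrow> pt set \<Rightarrow> (pt set \<Rightarrow> scalar_field) \<Rightarrow> scalar_field" where
  "avg \<Omega> \<T> n e V = (\<lambda>x.
     let K = K_plus \<T> n e; K' = K_minus \<T> n e in
     if e \<in> bd_edges \<Omega> \<T> then trace_on K e (V K) x
     else (trace_on K e (V K) x + trace_on K' e (V K') x) / 2)"

definition pw_der :: "2 list \<Rightarrow> scalar_field \<Rightarrow> pt set \<Rightarrow> scalar_field" where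
  "pw_der is v K = wder (interior K) is v"

definition normal_der :: "pt \<Rightarrow> scalar_field \<Rightarrow> pt set \<Rightarrow> scalar_field" where
  "normal_der \<nu> v K = (\<lambda>x. \<Sum>i\<in>UNIV. \<nu> $ i * pw_der [i] v K x)"


section \<open>Finite element spaces and the discrete bilinear form\<close>

definition polys :: "nat \<Rightarrow> scalar_field set" where
  "polys r = {q. \<exists>c :: nat \<Rightarrow> nat \<Rightarrow> real. \<forall>x. q x = (\<Sum>i\<le>r. \<Sum>j\<le>r - i. c i j * (x $ 1) ^ i * (x $ 2) ^ j)}"

definition pw_polys :: "nat \<Rightarrow> pt set set \<Rightarrow> scalar_field set" where
  "pw_polys r \<T> = {v. \<forall>K\<in>\<T>. \<exists>q\<in>polys r. ae_eq K v q}"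

definition Vh :: "pt set \<Rightarrow> pt set set \<Rightarrow> scalar_field set" where
  "Vh \<Omega> \<T> = pw_polys 2 \<T> \<inter> Hs0 \<Omega> 1"

definition Wh :: "pt set \<Rightarrow> pt set set \<Rightarrow> scalar_field set" where
  "Wh \<Omega> \<T> = pw_polys 1 \<T> \<inter> Hs0 \<Omega> 1"

definition pw_hess_ip :: "pt set set \<Rightarrow> scalar_field \<Rightarrow> scalar_field \<Rightarrow> real" where
  "pw_hess_ip \<T> v w = (\<Sum>K\<in>\<T>. hess_ip (interior K) v w)"

definition pw_H2_semi :: "pt set set \<Rightarrow> scalar_field \<Rightarrow> real" where
  "pw_H2_semi \<T> v = sqrt (pw_hess_ip \<T> v v)"

definition pw_sob_norm :: "pt set set \<Rightarrow> real \<Rightarrow> scalar_field \<Rightarrow> real" where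
  "pw_sob_norm \<T> s v = sqrt (\<Sum>K\<in>\<T>. (sob_norm (interior K) s v)\<^sup>2)"

definition penalty ::
  "pt set \<Rightarrow> pt set set \<Rightarrow> (pt set \<Rightarrow> pt) \<Rightarrow> real \<Rightarrow> scalar_field \<Rightarrow> scalar_field \<Rightarrow> real" where
  "penalty \<Omega> \<T> n \<sigma>IP w v =
     (\<Sum>e\<in>edges \<T>. \<sigma>IP / diameter e *
        edge_int e (\<lambda>x. jump \<Omega> \<T> n e (normal_der (n e) w) x * jump \<Omega> \<T> n e (normal_der (n e) v) x))"

definition consistency ::
  "pt set \<Rightarrow> pt set set \<Rightarrow> (pt set \<Rightarrow> pt) \<Rightarrow> scalar_field \<Rightarrow> scalar_field \<Rightarrow> real" where
  "consistency \<Omega> \<T> n w v =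
     (\<Sum>e\<in>edges \<T>. edge_int e (\<lambda>x. \<Sum>i\<in>UNIV.
        jump \<Omega> \<T> n e (pw_der [i] w) x * (\<Sum>j\<in>UNIV. avg \<Omega> \<T> n e (pw_der [i, j] v) x * n e $ j)))"

definition ah ::
  "pt set \<Rightarrow> pt set set \<Rightarrow> (pt set \<Rightarrow> pt) \<Rightarrow> real \<Rightarrow> scalar_field \<Rightarrow> scalar_field \<Rightarrow> real" where
  "ah \<Omega> \<T> n \<sigma>IP w v =
     pw_hess_ip \<T> w v - consistency \<Omega> \<T> n w v - consistency \<Omega> \<T> n v w + penalty \<Omega> \<T> n \<sigma>IP w v"

definition h_norm :: "pt set \<Rightarrow> pt set set \<Rightarrow> (pt set \<Rightarrow> pt) \<Rightarrow> real \<Rightarrow> scalar_field \<Rightarrow> real" where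
  "h_norm \<Omega> \<T> n \<sigma>IP v = sqrt (pw_hess_ip \<T> v v + penalty \<Omega> \<T> n \<sigma>IP v v)"

definition coercive_continuous ::
  "pt set \<Rightarrow> pt set set \<Rightarrow> (pt set \<Rightarrow> pt) \<Rightarrow> real \<Rightarrow> real \<Rightarrow> real \<Rightarrow> bool" where
  "coercive_continuous \<Omega> \<T> n \<sigma>IP CCoer CCont \<longleftrightarrow>
     0 < \<sigma>IP \<and>
     (\<forall>w\<in>Vh \<Omega> \<T>. CCoer * (h_norm \<Omega> \<T> n \<sigma>IP w)\<^sup>2 \<le> ah \<Omega> \<T> n \<sigma>IP w w) \<and>
     (\<forall>w\<in>Vh \<Omega> \<T>. \<forall>v\<in>Vh \<Omega> \<T>. ah \<Omega> \<T> n \<sigma>IP w v \<le> CCont * h_norm \<Omega> \<T> n \<sigma>IP w * h_norm \<Omega> \<T> n \<sigma>IP v)"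


section \<open>Morley interpolation, companion operator, projections\<close>

definition patch :: "pt set set \<Rightarrow> pt \<Rightarrow> pt set set" where
  "patch \<T> z = {K\<in>\<T>. z \<in> K}"

definition patch_mean :: "pt set set \<Rightarrow> (pt set \<Rightarrow> scalar_field) \<Rightarrow> pt \<Rightarrow> real" where
  "patch_mean \<T> V z = (\<Sum>K\<in>patch \<T> z. value_at K (V K) z) / card (patch \<T> z)"

definition morley :: "pt set \<Rightarrow> pt set set \<Rightarrow> (pt set \<Rightarrow> pt) \<Rightarrow> scalar_field set" where
  "morley \<Omega> \<T> n = {v\<in>pw_polys 2 \<T>.
     (\<forall>z\<in>vertices \<T> \<inter> \<Omega>. \<forall>K\<in>patch \<T> z. \<forall>K'\<in>patch \<T> z. value_at K v z = value_at K' v z) \<and>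
     (\<forall>z\<in>vertices \<T> - \<Omega>. \<forall>K\<in>patch \<T> z. value_at K v z = 0) \<and>
     (\<forall>e\<in>edges \<T> - bd_edges \<Omega> \<T>. \<forall>K\<in>\<T>. \<forall>K'\<in>\<T>. e edge_of K \<longrightarrow> e edge_of K' \<longrightarrow>
        value_at K (normal_der (n e) v K) (edge_midpoint e) = value_at K' (normal_der (n e) v K') (edge_midpoint e)) \<and>
     (\<forall>e\<in>bd_edges \<Omega> \<T>. \<forall>K\<in>\<T>. e edge_of K \<longrightarrow> value_at K (normal_der (n e) v K) (edge_midpoint e) = 0)}"

text \<open>\<open>w = I\<^sub>M v\<close>; the vanishing boundary degrees of freedom are part of membership in the Morley space.\<close>

definition is_morley_interp ::
  "pt set \<Rightarrow> pt set set \<Rightarrow> (pt set \<Rightarrow> pt) \<Rightarrow> scalar_field \<Rightarrow> scalar_field \<Rightarrow> bool" where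
  "is_morley_interp \<Omega> \<T> n v w \<longleftrightarrow> w \<in> morley \<Omega> \<T> n \<and>
     (\<forall>z\<in>vertices \<T> \<inter> \<Omega>. \<forall>K\<in>patch \<T> z. value_at K w z = patch_mean \<T> (\<lambda>_. v) z) \<and>
     (\<forall>e\<in>edges \<T> - bd_edges \<Omega> \<T>. \<forall>K\<in>\<T>. e edge_of K \<longrightarrow>
        edge_int e (trace_on K e (normal_der (n e) w K)) / diameter e =
        edge_int e (avg \<Omega> \<T> n e (normal_der (n e) v)) / diameter e)"

definition morley_interp ::
  "pt set \<Rightarrow> pt set set \<Rightarrow> (pt set \<Rightarrow> pt) \<Rightarrow> scalar_field \<Rightarrow> scalar_field" where
  "morley_interp \<Omega> \<T> n v = (SOME w. is_morley_interp \<Omega> \<T> n v w)"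

definition centroid :: "pt set \<Rightarrow> pt" where
  "centroid K = (1/3) *\<^sub>R (\<Sum>z | z extreme_point_of K. z)"

text \<open>For piecewise polynomials, membership in \<open>H\<^sup>2(\<Omega>)\<close> is the same as being continuously differentiable.\<close>

definition HCT :: "pt set \<Rightarrow> pt set set \<Rightarrow> scalar_field set" where
  "HCT \<Omega> \<T> = {v\<in>Hs \<Omega> 2. \<forall>K\<in>\<T>. \<forall>e. e edge_of K \<longrightarrow>
     (\<exists>q\<in>polys 3. ae_eq (convex hull (insert (centroid K) e)) v q)}"

definition companion ::
  "pt set \<Rightarrow> pt set set \<Rightarrow> (pt set \<Rightarrow> pt) \<Rightarrow> real \<Rightarrow> (scalar_field \<Rightarrow> scalar_field) \<Rightarrow> bool" where
  "companion \<Omega> \<T> n \<Lambda> J \<longleftrightarrow>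
     (\<forall>v\<in>morley \<Omega> \<T> n. \<forall>w\<in>morley \<Omega> \<T> n. \<forall>k. ae_eq \<Omega> (J (\<lambda>x. k * v x + w x)) (\<lambda>x. k * J v x + J w x)) \<and>
     (\<forall>w\<in>morley \<Omega> \<T> n.
        J w \<in> Hs0 \<Omega> 2 \<and>
        (\<exists>v\<in>HCT \<Omega> \<T>. \<exists>q\<in>pw_polys 8 \<T>. ae_eq \<Omega> (J w) (\<lambda>x. v x + q x)) \<and>
        (\<forall>z\<in>vertices \<T>. \<forall>K\<in>patch \<T> z. value_at K (J w) z = value_at K w z) \<and>
        (\<forall>e\<in>edges \<T>. \<forall>K\<in>\<T>. e edge_of K \<longrightarrow>
           edge_int e (trace_on K e (normal_der (n e) (J w) K)) / diameter e =
           edge_int e (trace_on K e (normal_der (n e) w K)) / diameter e) \<and>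
        (\<forall>z\<in>vertices \<T> \<inter> \<Omega>. \<forall>K\<in>patch \<T> z. \<forall>i.
           value_at K (pw_der [i] (J w) K) z = patch_mean \<T> (pw_der [i] w) z) \<and>
        pw_H2_semi \<T> (w - J w) \<le> \<Lambda> * (INF v\<in>Hs0 \<Omega> 2. pw_H2_semi \<T> (w - v)))"

definition smoother ::
  "pt set \<Rightarrow> pt set set \<Rightarrow> (pt set \<Rightarrow> pt) \<Rightarrow> (scalar_field \<Rightarrow> scalar_field) \<Rightarrow> scalar_field \<Rightarrow> scalar_field" where
  "smoother \<Omega> \<T> n J v = J (morley_interp \<Omega> \<T> n v)"

definition smoother_bound ::
  "pt set \<Rightarrow> pt set set \<Rightarrow> (pt set \<Rightarrow> pt) \<Rightarrow> real \<Rightarrow> (scalar_field \<Rightarrow> scalar_field) \<Rightarrow> real \<Rightarrow> bool" where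
  "smoother_bound \<Omega> \<T> n \<sigma>IP J C1 \<longleftrightarrow>
     (\<forall>v\<in>Vh \<Omega> \<T>. \<forall>s\<in>{0..2}.
        pw_sob_norm \<T> s (v - smoother \<Omega> \<T> n J v)
          \<le> C1 * mesh_size \<T> powr (2 - s) * (INF w\<in>Hs0 \<Omega> 2. h_norm \<Omega> \<T> n \<sigma>IP (w - v)))"

definition is_Rh ::
  "pt set \<Rightarrow> pt set set \<Rightarrow> (pt set \<Rightarrow> pt) \<Rightarrow> real \<Rightarrow> (scalar_field \<Rightarrow> scalar_field) \<Rightarrow>
   (scalar_field \<Rightarrow> scalar_field) \<Rightarrow> bool" where
  "is_Rh \<Omega> \<T> n \<sigma>IP J R \<longleftrightarrow>
     (\<forall>w\<in>Hs0 \<Omega> 2. R w \<in> Vh \<Omega> \<T> \<and>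
        (\<forall>v\<in>Vh \<Omega> \<T>. ah \<Omega> \<T> n \<sigma>IP (R w) v = hess_ip \<Omega> w (smoother \<Omega> \<T> n J v)))"

definition is_Pih :: "pt set \<Rightarrow> pt set set \<Rightarrow> (scalar_field \<Rightarrow> scalar_field) \<Rightarrow> bool" where
  "is_Pih \<Omega> \<T> P \<longleftrightarrow>
     (\<forall>\<omega>\<in>Hs0 \<Omega> 1. P \<omega> \<in> Wh \<Omega> \<T> \<and> (\<forall>v\<in>Wh \<Omega> \<T>. grad_ip \<Omega> (P \<omega>) v = grad_ip \<Omega> \<omega> v))"

definition Rh_bound ::
  "pt set \<Rightarrow> pt set set \<Rightarrow> (pt set \<Rightarrow> pt) \<Rightarrow> real \<Rightarrow> (scalar_field \<Rightarrow> scalar_field) \<Rightarrow> real \<Rightarrow> real \<Rightarrow> bool" where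
  "Rh_bound \<Omega> \<T> n \<sigma>IP R \<sigma> C2 \<longleftrightarrow>
     (\<forall>w\<in>Hs0 \<Omega> 2 \<inter> Hs \<Omega> (2 + \<sigma>).
        l2norm \<Omega> (w - R w) + grad_norm \<Omega> (w - R w) + mesh_size \<T> powr \<sigma> * h_norm \<Omega> \<T> n \<sigma>IP (w - R w)
          \<le> C2 * mesh_size \<T> powr (2 * \<sigma>) * sob_norm \<Omega> (2 + \<sigma>) w)"

definition Pih_bound ::
  "pt set \<Rightarrow> pt set set \<Rightarrow> (scalar_field \<Rightarrow> scalar_field) \<Rightarrow> real \<Rightarrow> real \<Rightarrow> bool" where
  "Pih_bound \<Omega> \<T> P \<sigma> C3 \<longleftrightarrow>
     (\<forall>\<omega>\<in>Hs0 \<Omega> 1 \<inter> Hs \<Omega> (1 + \<sigma>).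
        l2norm \<Omega> (\<omega> - P \<omega>) + mesh_size \<T> powr \<sigma> * grad_norm \<Omega> (\<omega> - P \<omega>)
          \<le> C3 * mesh_size \<T> powr (2 * \<sigma>) * sob_norm \<Omega> (1 + \<sigma>) \<omega>)"


section \<open>The first time step\<close>

definition half :: "scalar_field \<Rightarrow> scalar_field \<Rightarrow> scalar_field" where
  "half v0 v1 = (\<lambda>x. (v1 x + v0 x) / 2)"

definition diffq :: "real \<Rightarrow> scalar_field \<Rightarrow> scalar_field \<Rightarrow> scalar_field" where
  "diffq \<delta> v0 v1 = (\<lambda>x. (v1 x - v0 x) / \<delta>)"

definition first_step ::
  "pt set \<Rightarrow> pt set set \<Rightarrow> (pt set \<Rightarrow> pt) \<Rightarrow> real \<Rightarrow> coeffs \<Rightarrow> real \<Rightarrow>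
   (real \<Rightarrow> scalar_field) \<Rightarrow> (real \<Rightarrow> scalar_field) \<Rightarrow> (real \<Rightarrow> scalar_field) \<Rightarrow> scalar_field \<Rightarrow>
   scalar_field \<Rightarrow> scalar_field \<Rightarrow> scalar_field \<Rightarrow> scalar_field \<Rightarrow> scalar_field \<Rightarrow> scalar_field \<Rightarrow> bool" where
  "first_step \<Omega> \<T> n \<sigma>IP c \<delta> f \<phi> g us0 U0 \<Theta>0 P0 U1 \<Theta>1 P1 \<longleftrightarrow>
     U1 \<in> Vh \<Omega> \<T> \<and> \<Theta>1 \<in> Wh \<Omega> \<T> \<and> P1 \<in> Wh \<Omega> \<T> \<and>
     (\<forall>v\<in>Vh \<Omega> \<T>.
        2 / \<delta> * (ip \<Omega> (diffq \<delta> U0 U1 - us0) v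
                  + a\<^sub>0 c * (grad_ip \<Omega> (diffq \<delta> U0 U1) v - grad_ip \<Omega> us0 v))
        + d\<^sub>0 c * ah \<Omega> \<T> n \<sigma>IP (half U0 U1) v
        - alpha c * grad_ip \<Omega> (half \<Theta>0 \<Theta>1) v - beta c * grad_ip \<Omega> (half P0 P1) v
        = ip \<Omega> (half (f 0) (f \<delta>)) v) \<and>
     (\<forall>\<psi>\<in>Wh \<Omega> \<T>.
        a\<^sub>1 c * ip \<Omega> (diffq \<delta> \<Theta>0 \<Theta>1) \<psi> - gam c * ip \<Omega> (diffq \<delta> P0 P1) \<psi>
        + b\<^sub>1 c * ip \<Omega> (half \<Theta>0 \<Theta>1) \<psi> + c\<^sub>1 c * grad_ip \<Omega> (half \<Theta>0 \<Theta>1) \<psi>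
        + alpha c * grad_ip \<Omega> (diffq \<delta> U0 U1) \<psi>
        = ip \<Omega> (half (\<phi> 0) (\<phi> \<delta>)) \<psi>) \<and>
     (\<forall>q\<in>Wh \<Omega> \<T>.
        a\<^sub>2 c * ip \<Omega> (diffq \<delta> P0 P1) q - gam c * ip \<Omega> (diffq \<delta> \<Theta>0 \<Theta>1) q
        + kappa c * grad_ip \<Omega> (half P0 P1) q + beta c * grad_ip \<Omega> (diffq \<delta> U0 U1) q
        = ip \<Omega> (half (g 0) (g \<delta>)) q)"

end

(*
  Testing the three equations for the errors with the difference quotient of zeta and the averages
  of Psi and xi cancels the coupling terms and leaves an energy identity. Its right-hand side has
  three kinds of terms. The time truncation errors are defects of the trapezoidal rule, bounded by
  the third weak time derivatives. The projection errors of theta and p enter the first equation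
  through their gradients, which are only O(h^sigma); writing v = (v - Q v) + Q v, the first part
  gains a factor h from the smoother bound, and in the second one Q v is in H^2_0, so that a
  derivative can be moved onto it. Finally, since R_h is defined with Q, consistency leaves the
  functional F applied to v - Q v, which is of order h^2.
  Since zeta^0 vanishes, the broken norm of zeta^1 - zeta^0 is twice that of the average of zeta, so
  Young's inequality absorbs these terms without an inverse estimate.
*)
theory Submission
 imports Defs "HOL-Computational_Algebra.Polynomial"
begin

section \<open>Bump functions on the line\<close>

text \<open>Two features of the formulation shape the proof. First, the regularity constants are
  essential suprema and integrals of weak time derivatives, while the scheme only sees the times 0
  and \<open>dt\<close>. Defects of quadrature are therefore bounded through third differences,
  obtained by testing the weak third derivative with a mollifier that has been averaged three times.
  For spatial regularity, a value at one time or a difference quotient is shown to satisfy every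
  linear inequality valid on a ball of H^s, and such a function lies in the ball of twice the
  squared radius. Second, weak derivatives, traces and projections are fixed only up to null sets,
  so the initial errors are functions of norm zero, and bilinearity of the discrete form needs
  uniqueness of traces.

  No time derivative of theta and p is bounded in H^(1 + sigma). Their equations are multiplied by
  \<open>dt\<close>, so that only projection errors at the two times occur; as the initial errors
  are null, \<open>dt\<close> times the difference quotient of an error is twice its average, and no
  energy is lost.\<close>

abbreviation "FD \<equiv> frechet_derivative"

abbreviation seq_limit (infixr "---->" 60) where "X ----> L \<equiv> X \<longlonglongrightarrow> L"

definition smooth1 :: "(real => real) => bool" where
 "smooth1 f \<longleftrightarrow> (\<forall>k t. (deriv ^^ k) f differentiable (at t))"

text \<open>The iterates of \<open>deriv\<close> are computed by exhibiting the whole sequence of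
  derivatives at once, which spares an induction in every application.\<close>

lemma smooth1_derivI:
 assumes "!!k t. (F k has_real_derivative F (Suc k) t) (at t)"
 shows "(deriv ^^ k) (F 0) = F k" "smooth1 (F 0)"
proof -
 have *: "(deriv ^^ k) (F 0) = F k" for k
 proof (induction k)
  case (Suc k)
  have "deriv (F k) = F (Suc k)"
   by (rule ext) (rule DERIV_imp_deriv, rule assms)
  with Suc show ?case by simp
 qed simp
 show "(deriv ^^ k) (F 0) = F k" by (rule *)
 show "smooth1 (F 0)" unfolding smooth1_def *
  using assms real_differentiable_def by blast
qed

lemma smooth1_DERIV:
 assumes "smooth1 f"
 shows "((deriv ^^ k) f has_real_derivative (deriv ^^ Suc k) f t) (at t)"
 using assms unfolding smooth1_def
 by (metis DERIV_deriv_iff_real_differentiable comp_apply funpow.simps(2))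

lemma smooth1_DERIV0: "smooth1 f ==> (f has_real_derivative deriv f t) (at t)"
 using smooth1_DERIV[of f 0 t] by simp

lemma smooth1_deriv: "smooth1 f ==> smooth1 (deriv f)"
 unfolding smooth1_def by (metis comp_apply funpow_Suc_right)

lemma smooth1_continuous: "smooth1 f ==> continuous_on A ((deriv ^^ k) f)"
 by (meson DERIV_continuous continuous_at_imp_continuous_on smooth1_DERIV)

lemma smooth1_continuous0: "smooth1 f ==> continuous_on A f"
 using smooth1_continuous[of f A 0] by simp

text \<open>Products are handled order by order: the derivative of a product of order n + 1 is a sum
  of products of order n. This gives the induction parameter that \<open>smooth1\<close> itself does
  not offer.\<close>

definition Ck1 :: "nat => (real => real) => bool" where
 "Ck1 n f \<longleftrightarrow> (\<forall>k\<le>n. \<forall>t. (deriv ^^ k) f differentiable (at t))"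

lemma Ck1_Suc: "Ck1 (Suc n) f \<longleftrightarrow> (\<forall>t. f differentiable (at t)) \<and> Ck1 n (deriv f)"
proof -
 have "Ck1 (Suc n) f \<longleftrightarrow> (\<forall>t. (deriv ^^ 0) f differentiable (at t)) \<and> (\<forall>k\<le>n. \<forall>t. (deriv ^^ Suc k) f differentiable (at t))"
  unfolding Ck1_def by (metis Suc_le_mono bot_nat_0.extremum not0_implies_Suc)
 thus ?thesis unfolding Ck1_def by (simp add: funpow_Suc_right del: funpow.simps)
qed

lemma Ck1_mono: "Ck1 (Suc n) f ==> Ck1 n f"
 unfolding Ck1_def by auto

lemma Ck1_add: "Ck1 n f ==> Ck1 n g ==> Ck1 n (%t. f t + g t)"
proof (induction n arbitrary: f g)
 case 0
 thus ?case by (auto simp: Ck1_def)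
next
 case (Suc n)
 hence d: "f differentiable (at t)" "g differentiable (at t)" for t by (auto simp: Ck1_Suc)
 have "deriv (%t. f t + g t) = (%t. deriv f t + deriv g t)"
  using d by (intro ext deriv_add) (auto simp: field_differentiable_def real_differentiable_def)
 thus ?case using Suc d by (auto simp: Ck1_Suc)
qed

lemma Ck1_mult: "Ck1 n f ==> Ck1 n g ==> Ck1 n (%t. f t * g t)"
proof (induction n arbitrary: f g)
 case 0
 thus ?case by (auto simp: Ck1_def)
next
 case (Suc n)
 hence d: "f differentiable (at t)" "g differentiable (at t)" for t by (auto simp: Ck1_Suc)
 have "deriv (%t. f t * g t) = (%t. f t * deriv g t + deriv f t * g t)"
  using d by (intro ext deriv_mult) (auto simp: field_differentiable_def real_differentiable_def)
 moreover have "Ck1 n (%t. f t * deriv g t + deriv f t * g t)"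
  using Suc.prems Ck1_mono[OF Suc.prems(1)] Ck1_mono[OF Suc.prems(2)]
  by (intro Ck1_add Suc.IH) (auto simp: Ck1_Suc[of n])
 ultimately show ?case using d by (auto simp: Ck1_Suc)
qed

lemma smooth1_Ck1: "smooth1 f \<longleftrightarrow> (\<forall>n. Ck1 n f)"
 unfolding smooth1_def Ck1_def by auto

lemma smooth1_mult: "smooth1 f ==> smooth1 g ==> smooth1 (%t. f t * g t)"
 by (simp add: smooth1_Ck1 Ck1_mult)

lemma smooth1_affine:
 assumes "smooth1 f" shows "smooth1 (%t. f (s * t + r))"
proof -
 have "smooth1 ((%k t. s ^ k * (deriv ^^ k) f (s * t + r)) 0)"
 proof (rule smooth1_derivI)
  fix k t
  show "((%t. s ^ k * (deriv ^^ k) f (s * t + r)) has_real_derivative s ^ Suc k * (deriv ^^ Suc k) f (s * t + r)) (at t)"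
   using assms by (auto intro!: derivative_eq_intros DERIV_chain2[OF smooth1_DERIV])
 qed
 thus ?thesis by simp
qed

lemma smooth1_scale:
 assumes "smooth1 f" shows "smooth1 (%t. c * f t)"
proof -
 have "smooth1 ((%k t. c * (deriv ^^ k) f t) 0)"
  by (rule smooth1_derivI) (intro DERIV_cmult smooth1_DERIV assms)
 thus ?thesis by simp
qed

text \<open>The classical smooth function exp(-c/x) with a polynomial factor in 1/x. With this
  factor the family is closed under differentiation: p becomes y^2 (c p - p').\<close>

definition flat :: "real => real poly => real => real" where
 "flat c p x = (if 0 < x then poly p (inverse x) * exp (- c * inverse x) else 0)"

lemma poly_exp_tendsto_0:
 fixes p :: "real poly"
 assumes "0 < c" shows "((%y. poly p y * exp (- c * y)) \<longlongrightarrow> 0) at_top"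
proof -
 have m: "((%y::real. y ^ k * exp (- c * y)) \<longlongrightarrow> 0) at_top" for k
 proof -
  have "((%y::real. (c * y) ^ k / exp (c * y)) \<longlongrightarrow> 0) at_top"
   by (rule filterlim_compose[OF tendsto_power_div_exp_0])
     (use assms in \<open>auto intro: filterlim_tendsto_pos_mult_at_top filterlim_ident\<close>)
  from tendsto_mult_left[OF this, of "inverse (c ^ k)"] show ?thesis
   using assms by (simp add: power_mult_distrib exp_minus field_simps)
 qed
 have "((%y. \<Sum>i\<le>degree p. coeff p i * (y ^ i * exp (- c * y))) \<longlongrightarrow> (\<Sum>i\<le>degree p. coeff p i * 0)) at_top"
  by (intro tendsto_sum tendsto_mult_left m)
 thus ?thesis by (simp add: poly_altdef sum_distrib_right mult.assoc)
qed

text \<open>Only the point 0 needs an argument. From the right the difference quotient there is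
  again of the same form, with polynomial y p(y), and tends to 0 because exponentials beat
  polynomials.\<close>

lemma flat_DERIV:
 assumes "0 < c"
 shows "(flat c p has_real_derivative flat c ([:0, 0, 1:] * (smult c p - pderiv p)) x) (at x)"
proof -
 consider "x < 0" | "x = 0" | "0 < x" by linarith
 thus ?thesis
 proof cases
  case 1
  have "((%_. 0) has_real_derivative 0) (at x)" by simp
  hence "(flat c p has_real_derivative 0) (at x)"
   by (rule has_field_derivative_transform_within_open[of _ _ _ "{..<0}"]) (use 1 in \<open>auto simp: flat_def\<close>)
  thus ?thesis using 1 by (simp add: flat_def)
 next
  case 3
  have "((%x. poly p (inverse x) * exp (- c * inverse x)) has_real_derivative
    flat c ([:0, 0, 1:] * (smult c p - pderiv p)) x) (at x)"
   using 3 by (auto intro!: derivative_eq_intros DERIV_chain2[OF poly_DERIV] simp: flat_def field_simps power2_eq_square)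
  thus ?thesis
   by (rule has_field_derivative_transform_within_open[of _ _ _ "{0<..}"]) (use 3 in \<open>auto simp: flat_def\<close>)
 next
  case 2
  have r: "((%h. flat c p h / h) \<longlongrightarrow> 0) (at_right 0)"
  proof -
   have "((%h. poly ([:0,1:] * p) (inverse h) * exp (- c * inverse h)) \<longlongrightarrow> 0) (at_right 0)"
    by (rule filterlim_compose[OF poly_exp_tendsto_0[OF assms] filterlim_inverse_at_top_right])
   thus ?thesis
    by (rule Lim_transform_eventually)
      (auto simp: flat_def eventually_at_filter field_simps intro!: always_eventually)
  qed
  have l: "((%h. flat c p h / h) \<longlongrightarrow> 0) (at_left 0)"
  proof (rule Lim_transform_eventually)
   show "((%h. 0) \<longlongrightarrow> (0::real)) (at_left (0::real))" by simp
   show "\<forall>\<^sub>F h in at_left 0. 0 = flat c p h / h"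
    by (auto simp: flat_def eventually_at_filter intro!: always_eventually)
  qed
  from l r have "((%h. flat c p h / h) \<longlongrightarrow> 0) (at 0)"
   by (simp add: filterlim_split_at)
  thus ?thesis using 2 by (simp add: DERIV_def flat_def)
 qed
qed

lemma flat_smooth: assumes "0 < c" shows "smooth1 (flat c p)"
proof -
 have "smooth1 ((%k. flat c (((%p. [:0, 0, 1:] * (smult c p - pderiv p)) ^^ k) p)) 0)"
  by (rule smooth1_derivI) (use flat_DERIV[OF assms] in simp)
 thus ?thesis by simp
qed

text \<open>For c decreasing to 0 these functions stay between 0 and 1 and tend pointwise to the
  indicator of the interval (a, b), so that test functions can replace indicators under dominated
  convergence.\<close>

definition bump :: "real => real => real => real => real" where
 "bump c a b x = flat c 1 (x - a) * flat c 1 (b - x)"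

lemma bump_smooth: "0 < c ==> smooth1 (bump c a b)"
 using smooth1_mult[OF smooth1_affine[OF flat_smooth[of c 1], of 1 "- a"] smooth1_affine[OF flat_smooth[of c 1], of "-1" b]]
 by (simp add: bump_def[abs_def] algebra_simps)

lemma flat_range: "0 < c ==> 0 <= flat c 1 x" "0 < c ==> flat c 1 x <= 1"
 by (auto simp: flat_def)

lemma bump_range: "0 < c ==> 0 <= bump c a b x" "0 < c ==> bump c a b x <= 1"
 using flat_range[of c] by (auto simp: bump_def intro!: mult_le_one)

lemma bump_zero: "bump c a b x ~= 0 \<longleftrightarrow> a < x \<and> x < b"
 by (auto simp: bump_def flat_def)

lemma bump_pos: "a < x ==> x < b ==> 0 < bump c a b x"
 by (auto simp: bump_def flat_def)

lemma bump_tendsto: "(%n. bump (inverse (Suc n)) a b x) ----> indicator {a<..<b} x"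
proof (cases "a < x \<and> x < b")
 case True
 have "(%n. exp (- inverse (real (Suc n)) * inverse (x - a)) * exp (- inverse (real (Suc n)) * inverse (b - x))) ----> exp (- 0 * inverse (x - a)) * exp (- 0 * inverse (b - x))"
  by (intro tendsto_intros LIMSEQ_inverse_real_of_nat)
 with True show ?thesis by (simp add: bump_def flat_def)
next
 case False
 hence "bump c a b x = 0" for c using bump_zero by blast
 thus ?thesis using False by simp
qed

section \<open>Weak derivatives in time\<close>

abbreviation "LI b \<equiv> lebesgue_on {0 :: real<..<b}"
abbreviation "L01 \<equiv> lebesgue_on {0 :: real..1}"

text \<open>For a Borel representative g, the measures with densities g+ and g-
  (\<open>ennreal\<close> cuts off negative values) agree and are finite on boxes. Boxes are stable
  under intersection and generate the Borel sets, so the measures coincide, and uniqueness of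
  densities gives g+ = g-, hence g = 0.\<close>

lemma AE_zero_of_integral_boxes:
 fixes G :: "'a::euclidean_space => real"
 assumes Gi: "integrable lebesgue G"
  and z: "!!a b. (LINT x|lebesgue. indicator (box a b) x * G x) = 0"
 shows "AE x in lebesgue. G x = 0"
proof -
 obtain g where gm[measurable]: "g \<in> borel_measurable lborel" and gG: "AE x in lborel. G x = g x"
  using completion_ex_borel_measurable_real[of G lborel] Gi by auto
 have gG': "AE x in lebesgue. G x = g x" using gG by (rule AE_completion)
 have gi': "integrable lebesgue g"
  using Gi gG' gm by (subst integrable_cong_AE[of _ _ G]) (auto simp: measurable_completion)
 hence gi: "integrable lborel g" by (simp add: integrable_completion)
 have gz: "(LINT x|lborel. indicator (box a b) x * g x) = 0" for a b
 proof -
  have "(LINT x|lborel. indicator (box a b) x * g x) = (LINT x|lebesgue. indicator (box a b) x * g x)"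
   by (rule integral_completion[symmetric]) simp
  also have "... = (LINT x|lebesgue. indicator (box a b) x * G x)"
   using gG' Gi by (intro integral_cong_AE) (auto simp: measurable_completion intro!: borel_measurable_times)
  finally show ?thesis using z by simp
 qed
 define P where "P = density lborel (%x. ennreal (g x))"
 define N where "N = density lborel (%x. ennreal (- g x))"
 have box: "emeasure P (box a b) = emeasure N (box a b)" "emeasure P (box a b) ~= \<infinity>" for a b
 proof -
  have i: "integrable lborel (%x. indicator (box a b) x * g x)"
   using integrable_mult_indicator[OF _ gi, of "box a b"] by simp
  have e: "emeasure P (box a b) = (\<integral>\<^sup>+x. ennreal (indicator (box a b) x * g x) \<partial>lborel)"
   "emeasure N (box a b) = (\<integral>\<^sup>+x. ennreal (- (indicator (box a b) x * g x)) \<partial>lborel)"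
   by (auto simp: P_def N_def emeasure_density intro!: nn_integral_cong split: split_indicator)
  have "enn2real (emeasure P (box a b)) = enn2real (emeasure N (box a b))"
   using real_lebesgue_integral_def[OF i] gz e by simp
  moreover show "emeasure P (box a b) ~= \<infinity>" using i unfolding e by (auto simp: real_integrable_def)
  moreover have "emeasure N (box a b) ~= \<infinity>" using i unfolding e by (auto simp: real_integrable_def)
  ultimately show "emeasure P (box a b) = emeasure N (box a b)"
   by (metis ennreal_enn2real infinity_ennreal_def less_top)
 qed
 have "P = N"
 proof (rule measure_eqI_generator_eq[where \<Omega>=UNIV and E="range (%(a, b). box a b)" and A="%n::nat. box (- (real n *\<^sub>R One)) (real n *\<^sub>R One)"])
  show "Int_stable (range (%(a, b). box a b :: 'a set))"
  proof (rule Int_stableI)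
   fix A B :: "'a set" assume "A \<in> range (%(a, b). box a b)" "B \<in> range (%(a, b). box a b)"
   then obtain a b c d where "A = box a b" "B = box c d" by auto
   thus "A \<inter> B \<in> range (%(a, b). box a b)" using box_Int_box[of a b c d] by auto
  qed
  show "(\<Union>n::nat. box (- (real n *\<^sub>R One)) (real n *\<^sub>R One)) = (UNIV :: 'a set)" by (rule UN_box_eq_UNIV)
 qed (use box in \<open>auto simp: P_def N_def borel_eq_box\<close>)
 hence "AE x in lborel. ennreal (g x) = ennreal (- g x)"
  unfolding P_def N_def by (subst (asm) sigma_finite_measure.density_unique_iff[OF sigma_finite_lborel]) auto
 hence "AE x in lborel. g x = 0"
  by (rule AE_mp) (auto intro!: AE_I2, metis ennreal_eq_0_iff le_cases neg_0_le_iff_le neg_le_0_iff_le order_antisym)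
 with gG have "AE x in lborel. G x = 0" by eventually_elim simp
 thus ?thesis by (rule AE_completion)
qed

text \<open>Countably many closed boxes exhaust \<open>U\<close>. On each of them the previous lemma
  is applied to the function cut off outside the open box; an intersection of boxes is a box, and
  the boundaries are null sets.\<close>

lemma AE_zero_of_integral_boxes_in_open:
 fixes g :: "'a::euclidean_space => real"
 assumes U: "open U" and g: "integrable (lebesgue_on U) g"
  and z: "!!a b. cbox a b \<subseteq> U ==> (LINT x|lebesgue_on U. indicator (box a b) x * g x) = 0"
 shows "AE x in lebesgue_on U. g x = 0"
proof -
 have Us: "U \<in> sets lebesgue" using U by simp
 define G where "G = (%x. if x \<in> U then g x else 0)"
 have Gi: "integrable lebesgue G" using g Us by (simp add: G_def Lebesgue_Measure.integrable_restrict_UNIV)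
 obtain \<D> where D: "countable \<D>" "\<D> \<subseteq> Pow U" "!!X. X \<in> \<D> ==> \<exists>a b. X = cbox a b" "\<Union>\<D> = U"
  using open_countable_Union_open_cbox[OF U] by metis
 have "AE x in lebesgue. x \<in> X --> G x = 0" if X: "X \<in> \<D>" for X
 proof -
  obtain a b where ab: "X = cbox a b" using D(3)[OF X] by blast
  have "AE x in lebesgue. indicator (box a b) x * G x = 0"
  proof (rule AE_zero_of_integral_boxes)
   show "integrable lebesgue (%x. indicator (box a b) x * G x)"
    using integrable_mult_indicator[OF _ Gi, of "box a b"] by simp
   fix c d :: 'a
   obtain a' b' where eq: "box c d \<inter> box a b = box a' b'" and "cbox a' b' \<subseteq> cbox a b"
    by (rule that[OF box_Int_box]) (auto simp: mem_box)
   hence "(LINT x|lebesgue_on U. indicator (box a' b') x * g x) = 0" using D(2) X ab by (intro z) auto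
   moreover have "(LINT x|lebesgue_on U. indicator (box a' b') x * g x) = (LINT x|lebesgue. indicator (box a' b') x * G x)"
    by (subst Lebesgue_Measure.integral_restrict_UNIV[OF Us, symmetric]) (auto simp: G_def intro!: Bochner_Integration.integral_cong)
   moreover have "indicator (box c d) x * (indicator (box a b) x * G x) = indicator (box a' b') x * G x" for x
    using eq by (auto simp: indicator_def)
   ultimately show "(LINT x|lebesgue. indicator (box c d) x * (indicator (box a b) x * G x)) = 0" by (simp only: )
  qed
  moreover have "AE x in lebesgue. x \<notin> cbox a b - box a b"
   using negligible_frontier_interval[of a b] by (intro AE_not_in) (simp add: negligible_iff_null_sets)
  ultimately show ?thesis unfolding ab by eventually_elim (auto simp: indicator_def)
 qed
 hence "AE x in lebesgue. \<forall>X\<in>\<D>. x \<in> X --> G x = 0" by (subst AE_ball_countable[OF D(1)]) blast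
 hence "AE x in lebesgue. x \<in> U --> g x = 0" by eventually_elim (use D(4) in \<open>auto simp: G_def split: if_splits\<close>)
 thus ?thesis using Us by (subst AE_restrict_space_iff) auto
qed

text \<open>The average over [x, x + h], times h. Its derivative is a forward difference with step
  h, so three applications to a mollifier give a test function whose third derivative is a third
  difference of mollifiers.\<close>

definition Aop :: "real => (real => real) => real => real" where
 "Aop h f x = integral {x..x + h} f"

lemma Aop_DERIV:
 assumes f: "continuous_on UNIV f" and h: "0 <= h"
 shows "(Aop h f has_real_derivative f (x + h) - f x) (at x)"
proof -
 define P where "P = (%y. integral {x - 1..y} f)"
 have c: "continuous_on A f" for A using f continuous_on_subset by blast
 have P: "(P has_real_derivative f y) (at y)" if "x - 1 < y" for y
 proof -
  have "(P has_real_derivative f y) (at y within {x - 1..y + 1})"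
   unfolding P_def using that by (intro integral_has_real_derivative c) auto
  thus ?thesis using that by (simp add: at_within_Icc_at)
 qed
 have "((%y. P (y + h)) has_real_derivative f (x + h)) (at x)"
  using P[of "x + h"] h DERIV_shift[of P "f (x + h)" x h] by simp
 hence d: "((%y. P (y + h) - P y) has_real_derivative f (x + h) - f x) (at x)"
  by (intro DERIV_diff P) auto
 show ?thesis
 proof (rule has_field_derivative_transform_within_open[OF d, of "{x - 1<..}"])
  fix y assume "y \<in> {x - 1<..}"
  hence "integral {x - 1..y} f + integral {y..y + h} f = integral {x - 1..y + h} f"
   using h by (intro Henstock_Kurzweil_Integration.integral_combine integrable_continuous_real c) auto
  thus "P (y + h) - P y = Aop h f y" by (simp add: P_def Aop_def)
 qed auto
qed

lemma Aop_smooth: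
 assumes f: "smooth1 f" and h: "0 <= h"
 shows "smooth1 (Aop h f)" and "(deriv ^^ Suc k) (Aop h f) = (%x. (deriv ^^ k) f (x + h) - (deriv ^^ k) f x)"
proof -
 define F where "F = (%k. case k of 0 => Aop h f | Suc k => (%x. (deriv ^^ k) f (x + h) - (deriv ^^ k) f x))"
 have d: "(F k has_real_derivative F (Suc k) x) (at x)" for k x
 proof (cases k)
  case 0
  thus ?thesis using Aop_DERIV[OF smooth1_continuous0[OF f] h] by (simp add: F_def)
 next
  case (Suc j)
  have "((%y. (deriv ^^ j) f (y + h)) has_real_derivative (deriv ^^ Suc j) f (x + h)) (at x)"
   using smooth1_DERIV[OF f, of j "x + h"] DERIV_shift[of "(deriv ^^ j) f" _ x h] by simp
  thus ?thesis using Suc smooth1_DERIV[OF f, of j x] unfolding F_def by (auto intro!: DERIV_diff)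
 qed
 show "smooth1 (Aop h f)" using smooth1_derivI(2)[of F, OF d] by (simp add: F_def)
 show "(deriv ^^ Suc k) (Aop h f) = (%x. (deriv ^^ k) f (x + h) - (deriv ^^ k) f x)"
  using smooth1_derivI(1)[of F, OF d, of "Suc k"] by (simp add: F_def del: funpow.simps)
qed

lemma Aop_bounds:
 assumes f: "continuous_on UNIV f" and h: "0 <= h" and b: "!!x. 0 <= f x \<and> f x <= B"
 shows "0 <= Aop h f x" "Aop h f x <= h * B"
proof -
 have i: "f integrable_on {x..x + h}" by (intro integrable_continuous_real continuous_on_subset[OF f]) auto
 show "0 <= Aop h f x" unfolding Aop_def by (rule integral_nonneg[OF i]) (use b in auto)
 have "integral {x..x + h} f <= integral {x..x + h} (%_. B)" by (rule integral_le[OF i]) (use b in auto)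
 thus "Aop h f x <= h * B" using h by (simp add: Aop_def)
qed

lemma Aop_support:
 assumes "!!x. f x ~= 0 ==> l <= x \<and> x <= r" "0 <= h" "Aop h f x ~= 0"
 shows "l - h <= x \<and> x <= r"
proof (rule ccontr)
 assume "\<not> ?thesis"
 hence "f y = 0" if "y \<in> {x..x + h}" for y
  using assms(1)[of y] that by (cases "f y = 0") auto
 hence "Aop h f x = integral {x..x + h} (%_. 0)" unfolding Aop_def by (intro Henstock_Kurzweil_Integration.integral_cong) auto
 with assms(3) show False by simp
qed

definition nbump :: "real => real => real => real" where
 "nbump x r = (%t. bump 1 (x - r) (x + r) t / integral {x - r..x + r} (bump 1 (x - r) (x + r)))"

lemma nbump:
 assumes "0 < r"
 shows "smooth1 (nbump x r)" "0 <= nbump x r t" "nbump x r t ~= 0 ==> x - r < t \<and> t < x + r"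
  "integral {x - r..x + r} (nbump x r) = 1"
proof -
 let ?I = "integral {x - r..x + r} (bump 1 (x - r) (x + r))"
 have c: "continuous_on A (bump 1 (x - r) (x + r))" for A by (intro smooth1_continuous0 bump_smooth) simp
 have I: "0 < ?I"
 proof -
  have "?I >= 0" by (intro integral_nonneg integrable_continuous_real c) (auto intro: bump_range)
  moreover have "?I ~= 0"
   using integral_eq_0_iff[OF c, of "x - r" "x + r"] bump_pos[of "x - r" x "x + r" 1] bump_range[of 1] assms by force
  ultimately show ?thesis by simp
 qed
 show "smooth1 (nbump x r)" using smooth1_scale[OF bump_smooth[of 1 "x - r" "x + r"], of "inverse ?I"]
  by (simp add: nbump_def divide_inverse mult.commute)
 show "0 <= nbump x r t" using I bump_range(1)[of 1] by (simp add: nbump_def)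
 show "nbump x r t ~= 0 ==> x - r < t \<and> t < x + r" using bump_zero[of 1 "x - r" "x + r" t] by (simp add: nbump_def)
 show "integral {x - r..x + r} (nbump x r) = 1" using I by (simp add: nbump_def)
qed

lemma lint_continuous:
 fixes f :: "real => real"
 assumes "continuous_on {a..b} f"
 shows "integrable (lebesgue_on {a<..<b}) f" "(LINT t|lebesgue_on {a<..<b}. f t) = integral {a..b} f"
proof -
 have ai: "f absolutely_integrable_on {a..b}" by (rule absolutely_integrable_continuous_real[OF assms])
 hence ao: "f absolutely_integrable_on {a<..<b}" by (rule set_integrable_subset) auto
 thus i: "integrable (lebesgue_on {a<..<b}) f" by (simp add: absolutely_integrable_imp_integrable)
 have "(LINT t|lebesgue_on {a<..<b}. f t) = integral {a<..<b} f"
  using i by (intro lebesgue_integral_eq_integral) auto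
 thus "(LINT t|lebesgue_on {a<..<b}. f t) = integral {a..b} f"
  by (simp add: integral_open_interval_real)
qed

lemma nbump_approx:
 assumes G: "continuous_on {0..b} G" and x: "0 < x" "x < b"
 shows "((%r. LINT t|LI b. nbump x r t * G t) \<longlongrightarrow> G x) (at_right 0)"
proof (rule tendstoI)
 fix e0 :: real assume "0 < e0"
 define e where "e = e0 / 2"
 have e: "0 < e" "e < e0" using \<open>0 < e0\<close> by (auto simp: e_def)
 from G x obtain d where d: "0 < d" "!!t. t \<in> {0..b} ==> dist t x < d ==> dist (G t) (G x) < e"
  unfolding continuous_on_iff using e by (metis atLeastAtMost_iff less_le)
 define D where "D = min d (min x (b - x))"
 have D: "0 < D" using d x by (auto simp: D_def)
 have "\<bar>(LINT t|LI b. nbump x r t * G t) - G x\<bar> <= e" if r: "0 < r" "r < D" for r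
 proof -
  note nb = nbump[OF r(1), of x]
  have cn: "continuous_on A (nbump x r)" for A using nb(1) smooth1_continuous0 by blast
  have sub: "{x - r..x + r} \<subseteq> {0..b}" using r by (auto simp: D_def)
  have "(LINT t|LI b. nbump x r t * G t) = integral {0..b} (%t. nbump x r t * G t)"
   by (intro lint_continuous continuous_intros cn G)
  also have "... = integral {x - r..x + r} (%t. nbump x r t * G t)"
   by (rule integral_spike_set; rule negligible_subset[of "{}"]) (use nb(3) sub in force)+
  finally have 1: "(LINT t|LI b. nbump x r t * G t) = integral {x - r..x + r} (%t. nbump x r t * G t)" .
  have "G x = integral {x - r..x + r} (%t. nbump x r t * G x)" using nb(4) by simp
  hence "(LINT t|LI b. nbump x r t * G t) - G x = 
    integral {x - r..x + r} (%t. nbump x r t * G t) - integral {x - r..x + r} (%t. nbump x r t * G x)"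
   using 1 by simp
  also have "... = integral {x - r..x + r} (%t. nbump x r t * G t - nbump x r t * G x)"
   by (intro Henstock_Kurzweil_Integration.integral_diff[symmetric] integrable_continuous_real continuous_intros cn continuous_on_subset[OF G sub])
  also have "norm ... <= integral {x - r..x + r} (%t. nbump x r t * e)"
  proof (rule Henstock_Kurzweil_Integration.integral_norm_bound_integral)
   show "(%t. nbump x r t * G t - nbump x r t * G x) integrable_on {x - r..x + r}"
    by (intro integrable_continuous_real continuous_intros cn continuous_on_subset[OF G sub])
   show "(%t. nbump x r t * e) integrable_on {x - r..x + r}"
    by (intro integrable_continuous_real continuous_intros cn)
   fix t assume t: "t \<in> {x - r..x + r}"
   hence "dist (G t) (G x) < e \<or> nbump x r t = 0" using d(2)[of t] sub r nb(3)[of t] by (auto simp: D_def dist_real_def)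
   thus "norm (nbump x r t * G t - nbump x r t * G x) <= nbump x r t * e"
    using nb(2)[of t] unfolding right_diff_distrib[symmetric] real_norm_def abs_mult dist_real_def
     by (cases "nbump x r t = 0") (auto intro!: mult_left_mono)
  qed
  also have "... = e" using nb(4) by simp
  finally show ?thesis by simp
 qed
 thus "\<forall>\<^sub>F r in at_right 0. dist (LINT t|LI b. nbump x r t * G t) (G x) < e0"
  using D e unfolding eventually_at_right_field dist_real_def by (intro exI[of _ D]) force
qed

lemma nbump_shift: "nbump x r (t + s) = nbump (x - s) r t"
proof -
 have b: "bump c (a + s) (d + s) (t + s) = bump c a d t" for c a d s t
  by (simp add: bump_def)
 have "integral {x - r..x + r} (bump 1 (x - r) (x + r)) = integral {x - s - r..x - s + r} (bump 1 (x - s - r) (x - s + r))"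
 proof -
  have "integral {x - s - r..x - s + r} (%t. bump 1 (x - r) (x + r) (t + s)) = integral {x - r..x + r} (bump 1 (x - r) (x + r))"
   using integral_shift_Icc_real[of "x - s - r" "x - s + r" "bump 1 (x - r) (x + r)" s]
   by (simp add: algebra_simps o_def)
  moreover have "(%t. bump 1 (x - r) (x + r) (t + s)) = bump 1 (x - s - r) (x - s + r)"
   by (rule ext) (simp add: bump_def algebra_simps)
  ultimately show ?thesis by simp
 qed
 thus ?thesis by (simp add: nbump_def bump_def algebra_simps)
qed

lemma continuous_le_Icc:
 fixes f :: "real => real"
 assumes "continuous_on {p..q} f" "p < q" "x \<in> {p..q}" "!!y. p < y ==> y < q ==> f y <= c"
 shows "f x <= c"
 using continuous_le_on_closure[of "{p<..<q}" f x c] assms by simp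

lemma time_test_D:
 assumes "et \<in> time_test_fun b"
 shows "smooth1 et" "deriv et \<in> time_test_fun b" "t <= 0 \<or> b <= t ==> et t = 0"
proof -
 show s: "smooth1 et" using assms by (simp add: time_test_fun_def smooth1_def)
 have cl: "closure {t. et t ~= 0} \<subseteq> {0<..<b}" using assms by (simp add: time_test_fun_def)
 thus "t <= 0 \<or> b <= t ==> et t = 0" using closure_subset[of "{t. et t ~= 0}"] by (force simp: subset_iff)
 have "deriv et x = 0" if x: "x \<notin> closure {t. et t ~= 0}" for x
 proof (rule DERIV_imp_deriv)
  show "(et has_real_derivative 0) (at x)"
   by (rule has_field_derivative_transform_within_open[of "%_. 0" _ _ "- closure {t. et t ~= 0}"])
    (use x closure_subset[of "{t. et t ~= 0}"] in auto)
 qed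
 hence "closure {t. deriv et t ~= 0} \<subseteq> closure {t. et t ~= 0}" by (intro closure_minimal) auto
 thus "deriv et \<in> time_test_fun b" using cl smooth1_deriv[OF s] by (auto simp: time_test_fun_def smooth1_def)
qed

lemma time_test_integrable:
 assumes et: "smooth1 et" and f: "integrable (LI b) f"
 shows "integrable (LI b) (%t. et t * f t)"
proof -
 have "compact (et ` {0..b})" by (rule compact_continuous_image[OF smooth1_continuous0[OF et] compact_Icc])
 then obtain B where B: "!!t. t \<in> {0..b} ==> \<bar>et t\<bar> <= B" using compact_imp_bounded bounded_real by (metis imageI)
 show ?thesis
 proof (rule Bochner_Integration.integrable_bound)
  show "integrable (LI b) (%t. B * f t)" using f by simp
  show "(%t. et t * f t) \<in> borel_measurable (LI b)"
   by (intro borel_measurable_times borel_measurable_integrable[OF f] continuous_imp_measurable_on_sets_lebesgue[OF smooth1_continuous0[OF et]]) simp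
  show "AE t in LI b. norm (et t * f t) <= norm (B * f t)"
   using order_trans[OF B abs_ge_self] by (intro AE_I2) (auto simp: abs_mult intro!: mult_right_mono)
 qed
qed

lemma time_by_parts:
 assumes et: "et \<in> time_test_fun b" and b: "0 < b" and cF: "continuous_on {0..b} F"
  and d: "!!t. t \<in> {0..b} ==> (G has_real_derivative F t) (at t within {0..b})"
 shows "(LINT t|LI b. deriv et t * G t) = - (LINT t|LI b. et t * F t)"
proof -
 note s = time_test_D(1)[OF et]
 have cG: "continuous_on {0..b} G" using d DERIV_continuous_on by blast
 have c: "continuous_on {0..b} (%t. deriv et t * G t)" "continuous_on {0..b} (%t. et t * F t)"
  by (intro continuous_on_mult smooth1_continuous0 smooth1_deriv s cG cF)+
 have "((%t. deriv et t * G t + et t * F t) has_integral et b * G b - et 0 * G 0) {0..b}"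
 proof (rule fundamental_theorem_of_calculus)
  fix t assume "t \<in> {0..b}"
  from DERIV_mult[OF has_field_derivative_at_within[OF smooth1_DERIV0[OF s]] d[OF this]]
  show "((%t. et t * G t) has_vector_derivative deriv et t * G t + et t * F t) (at t within {0..b})"
   by (simp add: has_real_derivative_iff_has_vector_derivative mult.commute add.commute)
 qed (use b in simp)
 hence "integral {0..b} (%t. deriv et t * G t + et t * F t) = 0" using time_test_D(3)[OF et] by (simp add: integral_unique)
 thus ?thesis unfolding lint_continuous(2)[OF c(1)] lint_continuous(2)[OF c(2)]
  using Henstock_Kurzweil_Integration.integral_add[OF c[THEN integrable_continuous_real]] by simp
qed

lemma nbump_support: "0 < r ==> nbump x r t ~= 0 ==> x - r <= t \<and> t <= x + r"
 using nbump(3)[of r x t] by simp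

lemma nbump_test:
 assumes "0 < r" "r < x" "x + r < b" shows "nbump x r \<in> time_test_fun b"
proof -
 have "closure {t. nbump x r t ~= 0} \<subseteq> {x - r..x + r}" by (rule closure_minimal) (use nbump_support[OF assms(1), of x] in auto)
 also have "... \<subseteq> {0<..<b}" using assms by auto
 finally show ?thesis using nbump(1)[OF assms(1)] by (auto simp: time_test_fun_def smooth1_def)
qed

text \<open>Mollifiers around an inner point are admissible test functions, so the inequality for
  \<open>k\<close> carries over to local averages of \<open>F\<close>, and by continuity to
  \<open>F\<close> itself, endpoints included. This is how bounds for almost every time become
  usable at single times.\<close>

lemma weak_le_everywhere:
 assumes F: "continuous_on {0..b} F" and k: "integrable (LI b) k" and b: "0 < b"
  and w: "!!et. et \<in> time_test_fun b ==> (LINT t|LI b. et t * F t) = (LINT t|LI b. et t * k t)"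
  and c: "AE t in LI b. k t <= c" and t: "t \<in> {0..b}"
 shows "F t <= c"
proof (rule continuous_le_Icc[OF F b t])
 fix x assume x: "0 < x" "x < b"
 have "(LINT t|LI b. nbump x r t * F t) <= (LINT t|LI b. nbump x r t * c)" if r: "0 < r" "r < min x (b - x)" for r
 proof -
  have n: "nbump x r \<in> time_test_fun b" using r by (intro nbump_test) auto
  have "integrable (LI b) (%_. c)" by (rule lint_continuous(1)) (rule continuous_on_const)
  thus ?thesis unfolding w[OF n] using c nbump(2)[OF r(1)]
   by (intro integral_mono_AE time_test_integrable time_test_D(1)[OF n] k) (auto elim!: eventually_mono intro: mult_left_mono)
 qed
 hence "\<forall>\<^sub>F r in at_right 0. (LINT t|LI b. nbump x r t * F t) <= (LINT t|LI b. nbump x r t * c)"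
  unfolding eventually_at_right_field using x by (intro exI[of _ "min x (b - x)"]) auto
 thus "F x <= c"
  by (rule tendsto_le[OF trivial_limit_at_right_real nbump_approx[OF continuous_on_const x] nbump_approx[OF F x]])
qed

text \<open>The test function is a mollifier around the right end \<open>x\<close>, averaged over
  the steps \<open>h3\<close>, \<open>h2\<close> and \<open>h1\<close>. Its third derivative is an
  alternating sum of eight shifted mollifiers, which recovers the third difference of
  \<open>G\<close> as the radius tends to 0. A mollifier has mass 1, so the first average is at most
  1 whatever the radius, and the other two contribute \<open>h2\<close> and \<open>h1\<close>. Hence
  two factors of the step appear, together with nothing but the integral of |k|.\<close>

lemma third_difference_aux:
 fixes G k :: "real => real"
 assumes G: "continuous_on {0..b} G" and k: "integrable (LI b) k"
  and w: "!!et. et \<in> time_test_fun b ==> (LINT t|LI b. (deriv ^^ 3) et t * G t) = - (LINT t|LI b. et t * k t)"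
  and y: "0 < y" "y + h1 + h2 + h3 < b" and h: "0 <= h1" "0 <= h2" "0 <= h3"
 shows "\<bar>G (y + h1 + h2 + h3) - G (y + h1 + h2) - G (y + h1 + h3) - G (y + h2 + h3) + G (y + h1) + G (y + h2) + G (y + h3) - G y\<bar>
   <= h1 * h2 * (LINT t|LI b. \<bar>k t\<bar>)" (is "\<bar>?D\<bar> <= ?R")
proof -
 define x where "x = y + h1 + h2 + h3"
 define I where "I = (%r s. LINT t|LI b. nbump (x - s) r t * G t)"
 define S where "S = (%r. I r 0 - I r h3 - I r h2 - I r h1 + I r (h2 + h3) + I r (h1 + h3) + I r (h1 + h2) - I r (h1 + h2 + h3))"
 have bound: "\<bar>S r\<bar> <= ?R" if r: "0 < r" "r < min y (b - x)" for r
 proof -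
  note nb = nbump[OF r(1), of x]
  define a3 where "a3 = Aop h3 (nbump x r)"
  define a2 where "a2 = Aop h2 a3"
  define a1 where "a1 = Aop h1 a2"
  have s3: "smooth1 a3" unfolding a3_def by (rule Aop_smooth(1)[OF nb(1) h(3)])
  have s2: "smooth1 a2" unfolding a2_def by (rule Aop_smooth(1)[OF s3 h(2)])
  have s1: "smooth1 a1" unfolding a1_def by (rule Aop_smooth(1)[OF s2 h(1)])
  have d3: "(deriv ^^ Suc 0) a3 = (%t. nbump x r (t + h3) - nbump x r t)"
   unfolding a3_def Aop_smooth(2)[OF nb(1) h(3)] by simp
  have d2: "(deriv ^^ Suc (Suc 0)) a2 = (%t. (deriv ^^ Suc 0) a3 (t + h2) - (deriv ^^ Suc 0) a3 t)"
   unfolding a2_def by (rule Aop_smooth(2)[OF s3 h(2)])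
  have d1: "(deriv ^^ 3) a1 = (%t. (deriv ^^ Suc (Suc 0)) a2 (t + h1) - (deriv ^^ Suc (Suc 0)) a2 t)"
   unfolding a1_def numeral_3_eq_3 by (rule Aop_smooth(2)[OF s2 h(1)])
  have c: "continuous_on A (nbump x r)" for A using nb(1) smooth1_continuous0 by blast
  have b3: "0 <= a3 t \<and> a3 t <= 1" for t
  proof
   show "0 <= a3 t" unfolding a3_def Aop_def by (intro integral_nonneg integrable_continuous_real c nb)
   let ?J = "{min t (x - r)..max (t + h3) (x + r)}"
   have "integral {t..t + h3} (nbump x r) <= integral ?J (nbump x r)"
    using nb(2) by (intro integral_subset_le integrable_continuous_real c) auto
   also have "... = integral {x - r..x + r} (nbump x r)"
    by (rule integral_spike_set; rule negligible_subset[of "{}"]) (use nbump_support[OF r(1), of x] in force)+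
   finally show "a3 t <= 1" using nb(4) by (simp add: a3_def Aop_def)
  qed
  have b2: "0 <= a2 t \<and> a2 t <= h2" for t
   using Aop_bounds[OF smooth1_continuous0[OF s3] h(2) b3] by (auto simp: a2_def)
  have b1: "0 <= a1 t \<and> a1 t <= h1 * h2" for t
   using Aop_bounds[OF smooth1_continuous0[OF s2] h(1) b2] by (auto simp: a1_def)
  have p3: "a3 t ~= 0 ==> x - r - h3 <= t \<and> t <= x + r" for t
   unfolding a3_def by (rule Aop_support[OF _ h(3)]) (rule nbump_support[OF r(1)])
  have p2: "a2 t ~= 0 ==> x - r - h3 - h2 <= t \<and> t <= x + r" for t
   unfolding a2_def by (rule Aop_support[OF p3 h(2)])
  have supp: "a1 t ~= 0 ==> x - r - h3 - h2 - h1 <= t \<and> t <= x + r" for t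
   unfolding a1_def by (rule Aop_support[OF p2 h(1)])
  have cl: "closure {t. a1 t ~= 0} \<subseteq> {x - r - h3 - h2 - h1..x + r}"
   by (rule closure_minimal) (use supp in auto)
  also have "... \<subseteq> {0<..<b}" using r by (auto simp: x_def)
  finally have test: "a1 \<in> time_test_fun b" using s1 by (auto simp: time_test_fun_def smooth1_def)
  have "S r = - (LINT t|LI b. (deriv ^^ 3) a1 t * G t)"
  proof -
   have i: "integrable (LI b) (%t. nbump z r t * G t)" for z
    by (intro lint_continuous continuous_intros G smooth1_continuous0 nbump r)
   have e: "(deriv ^^ 3) a1 t * G t = nbump (x - (h1 + h2 + h3)) r t * G t - nbump (x - (h1 + h2)) r t * G t
     - nbump (x - (h1 + h3)) r t * G t - nbump (x - (h2 + h3)) r t * G t + nbump (x - h1) r t * G t + nbump (x - h2) r t * G t + nbump (x - h3) r t * G t - nbump (x - 0) r t * G t" for t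
    unfolding d1 d2 d3 nbump_shift[symmetric] by (simp add: algebra_simps)
   show ?thesis
    unfolding e S_def I_def by (simp add: i)
  qed
  also have "... = (LINT t|LI b. a1 t * k t)" using w[OF test] by simp
  also have "\<bar>...\<bar> <= (LINT t|LI b. h1 * h2 * \<bar>k t\<bar>)"
  proof (rule order_trans[OF integral_abs_bound integral_mono_AE'])
   show "AE t in LI b. \<bar>a1 t * k t\<bar> <= h1 * h2 * \<bar>k t\<bar>"
    using b1 by (auto simp: abs_mult intro!: mult_right_mono AE_I2)
  qed (use k h in auto)
  finally show ?thesis by simp
 qed
 have I: "((%r. I r s) \<longlongrightarrow> G (x - s)) (at_right 0)" if "0 < x - s" "x - s < b" for s
  unfolding I_def by (rule nbump_approx[OF G that])
 have "(S \<longlongrightarrow> G (x - 0) - G (x - h3) - G (x - h2) - G (x - h1) + G (x - (h2 + h3)) + G (x - (h1 + h3)) + G (x - (h1 + h2)) - G (x - (h1 + h2 + h3))) (at_right 0)"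
  unfolding S_def by (intro tendsto_intros I) (use y h in \<open>auto simp: x_def\<close>)
 moreover have "\<forall>\<^sub>F r in at_right 0. \<bar>S r\<bar> <= ?R"
  unfolding eventually_at_right_field using bound y by (intro exI[of _ "min y (b - x)"]) (auto simp: x_def)
 ultimately have "\<bar>G (x - 0) - G (x - h3) - G (x - h2) - G (x - h1) + G (x - (h2 + h3)) + G (x - (h1 + h3)) + G (x - (h1 + h2)) - G (x - (h1 + h2 + h3))\<bar> <= ?R"
  by (intro tendsto_upperbound[OF tendsto_rabs]) auto
 thus ?thesis by (simp add: x_def algebra_simps)
qed

text \<open>The strict inequalities of the interior version are removed by continuity, in the step
  \<open>h3\<close> and in the base point. Shrinking the step first leaves room to move the base
  point into the interior.\<close>

lemma third_difference_bound:
 fixes G k :: "real => real"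
 assumes G: "continuous_on {0..b} G" and k: "integrable (LI b) k"
  and w: "!!et. et \<in> time_test_fun b ==> (LINT t|LI b. (deriv ^^ 3) et t * G t) = - (LINT t|LI b. et t * k t)"
  and y: "0 <= y" "y + h1 + h2 + h3 <= b" and h: "0 <= h1" "0 <= h2" "0 < h3"
 shows "\<bar>G (y + h1 + h2 + h3) - G (y + h1 + h2) - G (y + h1 + h3) - G (y + h2 + h3) + G (y + h1) + G (y + h2) + G (y + h3) - G y\<bar>
   <= h1 * h2 * (LINT t|LI b. \<bar>k t\<bar>)" (is "_ <= ?R")
proof -
 define D where "D = (%y z. \<bar>G (y + h1 + h2 + z) - G (y + h1 + h2) - G (y + h1 + z) - G (y + h2 + z) + G (y + h1) + G (y + h2) + G (y + z) - G y\<bar>)"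
 have "D y h3 <= ?R"
 proof (rule continuous_le_Icc[where f = "D y" and p = 0 and q = h3])
  show "continuous_on {0..h3} (D y)"
   unfolding D_def by (intro continuous_intros continuous_on_compose2[OF G]) (use y h in auto)
  fix z assume z: "0 < z" "z < h3"
  show "D y z <= ?R"
  proof (rule continuous_le_Icc[where f = "%y. D y z" and p = 0 and q = "b - h1 - h2 - z"])
   show "continuous_on {0..b - h1 - h2 - z} (%y. D y z)"
    unfolding D_def by (intro continuous_intros continuous_on_compose2[OF G]) (use z h in auto)
   show "D v z <= ?R" if "0 < v" "v < b - h1 - h2 - z" for v
    unfolding D_def by (rule third_difference_aux[OF G k w]) (use that z h in auto)
  qed (use y z h in auto)
 qed (use h in auto)
 thus ?thesis by (simp add: D_def)
qed

lemma
 fixes G :: "real => real"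
 assumes "!!t. t \<in> {0..b} ==> (G has_real_derivative F t) (at t within {0..b})"
 shows right_quotient: "0 <= x ==> x < b ==> ((%h. (G (x + h) - G x) / h) \<longlongrightarrow> F x) (at_right 0)"
  and left_quotient: "0 < x ==> x <= b ==> ((%h. (G x - G (x - h)) / h) \<longlongrightarrow> F x) (at_right 0)"
proof -
 assume x: "0 <= x" "x < b"
 have "((%y. (G y - G x) / (y - x)) \<longlongrightarrow> F x) (at x within {x..b})"
  using assms[of x] x DERIV_subset[of G "F x" x "{0..b}" "{x..b}"] by (auto simp: has_field_derivative_iff)
 hence "((%y. (G y - G x) / (y - x)) \<longlongrightarrow> F x) (at_right x)" using x by (simp add: at_within_Icc_at_right)
 hence "((%h. (G (h + x) - G x) / (h + x - x)) \<longlongrightarrow> F x) (at_right 0)" by (subst (asm) filterlim_at_right_to_0)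
 thus "((%h. (G (x + h) - G x) / h) \<longlongrightarrow> F x) (at_right 0)" by (simp add: add.commute)
next
 assume x: "0 < x" "x <= b"
 have "((%y. (G y - G x) / (y - x)) \<longlongrightarrow> F x) (at x within {0..x})"
  using assms[of x] x DERIV_subset[of G "F x" x "{0..b}" "{0..x}"] by (auto simp: has_field_derivative_iff)
 hence "((%y. (G y - G x) / (y - x)) \<longlongrightarrow> F x) (at_left x)" using x by (simp add: at_within_Icc_at_left)
 hence "((%h. (G (- (h - x)) - G x) / (- (h + - x) - x)) \<longlongrightarrow> F x) (at_right 0)"
  unfolding filterlim_at_left_to_right by (subst (asm) filterlim_at_right_to_0) simp
 thus "((%h. (G x - G (x - h)) / h) \<longlongrightarrow> F x) (at_right 0)"
  by (rule Lim_transform_eventually) (auto simp: eventually_at_filter field_simps intro!: always_eventually)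
qed

text \<open>A third difference of \<open>G\<close> is divided by one of its steps, which then tends
  to 0: one difference turns into the derivative, at the price of one factor in the bound.\<close>

lemma derivative_second_difference:
 fixes G k :: "real => real"
 assumes k: "integrable (LI b) k"
  and w: "!!et. et \<in> time_test_fun b ==> (LINT t|LI b. (deriv ^^ 3) et t * G t) = - (LINT t|LI b. et t * k t)"
  and d: "!!t. t \<in> {0..b} ==> (G has_real_derivative F t) (at t within {0..b})"
  and y: "0 <= y" "y + h1 + h2 <= b" and h: "0 < h1" "0 < h2"
 shows "\<bar>F (y + h1 + h2) - F (y + h1) - F (y + h2) + F y\<bar> <= h1 * (LINT t|LI b. \<bar>k t\<bar>)"
proof -
 let ?K = "LINT t|LI b. \<bar>k t\<bar>" and ?e = "y + h1 + h2"
 have cG: "continuous_on {0..b} G" using d DERIV_continuous_on by blast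
 define Q where "Q = (%s. (G ?e - G (?e - s)) / s - (G (y + h1) - G (y + h1 - s)) / s - (G (y + h2 + s) - G (y + h2)) / s + (G (y + s) - G y) / s)"
 have "(Q \<longlongrightarrow> F ?e - F (y + h1) - F (y + h2) + F y) (at_right 0)"
  unfolding Q_def by (intro tendsto_intros left_quotient[OF d] right_quotient[OF d]) (use y h in auto)
 moreover have "\<bar>Q s\<bar> <= h1 * ?K" if s: "0 < s" "s < h1" for s
 proof -
  \<comment> \<open>The steps \<open>s\<close>, h1 - s and \<open>h2\<close> add up to h1 + h2, so
    no point lies to the right of y + h1 + h2, which may be the endpoint \<open>b\<close>. This is
    why two of the four quotients in \<open>Q\<close> are taken from the left.\<close>
  have "\<bar>G (y + s + (h1 - s) + h2) - G (y + s + (h1 - s)) - G (y + s + h2) - G (y + (h1 - s) + h2) + G (y + s) + G (y + (h1 - s)) + G (y + h2) - G y\<bar> <= s * (h1 - s) * ?K"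
   by (rule third_difference_bound[OF cG k w]) (use y h s in auto)
  also have "... <= s * h1 * ?K" using s by (intro mult_right_mono mult_left_mono) auto
  also have "G (y + s + (h1 - s) + h2) - G (y + s + (h1 - s)) - G (y + s + h2) - G (y + (h1 - s) + h2) + G (y + s) + G (y + (h1 - s)) + G (y + h2) - G y = s * Q s"
  proof -
   have *: "s * (p / s - q / s - u / s + v / s) = p - q - u + v" for p q u v using s by (simp add: field_simps)
   have e: "y + s + (h1 - s) + h2 = ?e" "y + s + (h1 - s) = y + h1" "y + (h1 - s) = y + h1 - s" "y + h1 - s + h2 = ?e - s" "y + s + h2 = y + h2 + s" by simp_all
   show ?thesis unfolding Q_def * e by simp
  qed
  finally show ?thesis using s by (simp add: abs_mult)
 qed
 hence "\<forall>\<^sub>F s in at_right 0. \<bar>Q s\<bar> <= h1 * ?K"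
  unfolding eventually_at_right_field using h by (intro exI[of _ h1]) auto
 ultimately show ?thesis by (intro tendsto_upperbound[OF tendsto_rabs]) auto
qed

text \<open>\<open>H\<close> compares \<open>G\<close> from both ends: H(b) - H(0) is twice the
  defect of the trapezoidal rule, and by the mean value theorem it is, up to sign, b times a second
  difference of \<open>F\<close> with steps s and b - s. One derivative of \<open>G\<close> in the
  classical sense suffices for this.\<close>

lemma trapezoid_error:
 fixes G k :: "real => real"
 assumes b: "0 < b" and k: "integrable (LI b) k"
  and w: "!!et. et \<in> time_test_fun b ==> (LINT t|LI b. (deriv ^^ 3) et t * G t) = - (LINT t|LI b. et t * k t)"
  and d: "!!t. t \<in> {0..b} ==> (G has_real_derivative F t) (at t within {0..b})"
 shows "\<bar>G b - G 0 - b / 2 * (F 0 + F b)\<bar> <= b^2 / 2 * (LINT t|LI b. \<bar>k t\<bar>)"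
proof -
 let ?K = "LINT t|LI b. \<bar>k t\<bar>"
 define H where "H = (%s. G s - G (b - s) - s * (F 0 + F b))"
 have dH: "(H has_real_derivative F s + F (b - s) - (F 0 + F b)) (at s within {0..b})" if s: "s \<in> {0..b}" for s
 proof -
  have "((%s. G (b - s)) has_real_derivative F (b - s) * (- 1)) (at s within {0..b})"
  proof (rule DERIV_image_chain[where f=G and g="%s. b - s", unfolded o_def])
   have "(%s. b - s) ` {0..b} = {0..b}" using b by (auto simp: image_iff intro!: bexI[of _ "b - _"])
   thus "(G has_real_derivative F (b - s)) (at (b - s) within (%s. b - s) ` {0..b})"
    using d[of "b - s"] s by auto
  qed (auto intro!: derivative_eq_intros)
  thus ?thesis unfolding H_def using d[OF s] by (auto intro!: derivative_eq_intros)
 qed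
 have "\<exists>x\<in>{0<..<b}. H b - H 0 = (%h. (F x + F (b - x) - (F 0 + F b)) * h) (b - 0)"
  by (rule mvt_simple[OF b]) (use dH in \<open>auto simp: has_field_derivative_def mult_commute_abs\<close>)
 then obtain s where s: "0 < s" "s < b" "H b - H 0 = (F s + F (b - s) - (F 0 + F b)) * b" by auto
 have "\<bar>F (0 + s + (b - s)) - F (0 + s) - F (0 + (b - s)) + F 0\<bar> <= s * ?K"
  by (rule derivative_second_difference[OF k w d]) (use s in auto)
 also have "... <= b * ?K" using s by (intro mult_right_mono) auto
 finally have "\<bar>H b - H 0\<bar> <= b * ?K * b"
  unfolding s(3) abs_mult using b by (intro mult_mono) auto
 moreover have "H b - H 0 = 2 * (G b - G 0 - b / 2 * (F 0 + F b))"
  by (simp add: H_def algebra_simps)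
 ultimately have "\<bar>2 * (G b - G 0 - b / 2 * (F 0 + F b))\<bar> <= b * ?K * b" by simp
 thus ?thesis unfolding abs_mult by (simp add: power2_eq_square algebra_simps)
qed

text \<open>This is the defect of the starting formula of the scheme, which uses the first
  derivative at 0 and the mean of the second derivatives at both ends. The second derivative
  oscillates by at most the integral of |k|, so replacing it by the mean \<open>c\<close> of its end
  values costs that much, and two applications of the mean value theorem integrate this error
  twice.\<close>

lemma taylor_endpoint_error:
 fixes G k :: "real => real"
 assumes b: "0 < b" and k: "integrable (LI b) k"
  and w: "!!et. et \<in> time_test_fun b ==> (LINT t|LI b. (deriv ^^ 3) et t * G t) = - (LINT t|LI b. et t * k t)"
  and d: "!!t. t \<in> {0..b} ==> (G has_real_derivative F t) (at t within {0..b})"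
  and d2: "!!t. t \<in> {0..b} ==> (F has_real_derivative g t) (at t within {0..b})"
 shows "\<bar>G b - G 0 - b * F 0 - b^2 / 4 * (g 0 + g b)\<bar> <= b^2 * (LINT t|LI b. \<bar>k t\<bar>)"
proof -
 let ?K = "LINT t|LI b. \<bar>k t\<bar>"
 have K: "0 <= ?K" by simp
 \<comment> \<open>Both quotients are taken from inside [x, z]; their difference is a second
   difference of \<open>F\<close> with one step \<open>h\<close>, divided by that step.\<close>
 have osc: "\<bar>g z - g x\<bar> <= ?K" if xz: "0 <= x" "x < z" "z <= b" for x z
 proof -
  have "((%h. (F z - F (z - h)) / h - (F (x + h) - F x) / h) \<longlongrightarrow> g z - g x) (at_right 0)"
   by (intro tendsto_diff left_quotient[OF d2] right_quotient[OF d2]) (use xz in auto)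
  moreover have "\<bar>(F z - F (z - h)) / h - (F (x + h) - F x) / h\<bar> <= ?K" if h: "0 < h" "h < z - x" for h
  proof -
   have "\<bar>F (x + h + (z - h - x)) - F (x + h) - F (x + (z - h - x)) + F x\<bar> <= h * ?K"
    by (rule derivative_second_difference[OF k w d]) (use h xz in auto)
   hence "\<bar>F z - F (z - h) - (F (x + h) - F x)\<bar> / h <= ?K" using h by (simp add: field_simps)
   thus ?thesis using h by (simp add: diff_divide_distrib[symmetric])
  qed
  hence "\<forall>\<^sub>F h in at_right 0. \<bar>(F z - F (z - h)) / h - (F (x + h) - F x) / h\<bar> <= ?K"
   unfolding eventually_at_right_field using xz by (intro exI[of _ "z - x"]) auto
  ultimately show ?thesis by (intro tendsto_upperbound[OF tendsto_rabs]) auto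
 qed
 have osc': "\<bar>g z - g x\<bar> <= ?K" if "x \<in> {0..b}" "z \<in> {0..b}" for x z
  using osc[of x z] osc[of z x] that K by (cases x z rule: linorder_cases) (auto simp: abs_minus_commute)
 define c where "c = (g 0 + g b) / 2"
 have cb: "\<bar>g t - c\<bar> <= ?K" if "t \<in> {0..b}" for t
  using osc'[of 0 t] osc'[of b t] that b unfolding c_def by (auto simp: abs_le_iff field_simps)
 have step: "\<exists>s\<in>{0<..<t}. f t - f 0 = f' s * t"
  if t: "0 < t" "t <= b" and df: "!!s. s \<in> {0..b} ==> (f has_real_derivative f' s) (at s within {0..b})" for f f' :: "real => real" and t
 proof -
  have "(f has_real_derivative f' s) (at s within {0..t})" if "s \<in> {0..t}" for s
   using that t by (intro DERIV_subset[OF df[of s]]) auto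
  hence "\<exists>s\<in>{0<..<t}. f t - f 0 = (%h. f' s * h) (t - 0)"
   by (intro mvt_simple t(1)) (auto simp: has_field_derivative_def mult_commute_abs)
  thus ?thesis by simp
 qed
 have F': "\<bar>F t - F 0 - t * c\<bar> <= b * ?K" if t: "0 < t" "t <= b" for t
 proof -
  have "((%t. F t - F 0 - t * c) has_real_derivative g s - c) (at s within {0..b})" if "s \<in> {0..b}" for s
   using d2[OF that] by (auto intro!: derivative_eq_intros)
  from step[OF t this] obtain s where s: "0 < s" "s < t" "F t - F 0 - t * c = (g s - c) * t" by auto
  have "\<bar>(g s - c) * t\<bar> <= ?K * b" unfolding abs_mult using cb[of s] s t K by (intro mult_mono) auto
  thus ?thesis unfolding s(3) by (simp add: mult.commute)
 qed
 have "((%t. G t - G 0 - t * F 0 - t^2 / 2 * c) has_real_derivative F t - F 0 - t * c) (at t within {0..b})" if "t \<in> {0..b}" for t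
  using d[OF that] by (auto intro!: derivative_eq_intros)
 from step[OF b order_refl this] obtain s where s: "0 < s" "s < b" "G b - G 0 - b * F 0 - b^2 / 2 * c = (F s - F 0 - s * c) * b" by auto
 have "\<bar>(F s - F 0 - s * c) * b\<bar> <= (b * ?K) * b" unfolding abs_mult using F'[of s] s b by (intro mult_mono) auto
 thus ?thesis unfolding s(3)[symmetric] by (simp add: c_def power2_eq_square algebra_simps)
qed

section \<open>Smooth functions in the plane\<close>

lemma lborel_integral_translate:
 fixes f :: "'a::euclidean_space => real"
 assumes [measurable]: "f \<in> borel_measurable borel"
 shows "(LINT x|lborel. f (x + t)) = (LINT x|lborel. f x)"
proof -
 have "lborel = density (distr lborel borel (%x::'a. t + 1 *\<^sub>R x)) (%_. ennreal (\<bar>1\<bar> ^ DIM('a)))"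
  by (rule lborel_affine) simp
 hence "lborel = distr lborel borel (%x::'a. t + x)" by (simp add: density_1)
 hence "(LINT x|lborel. f x) = (LINT x|distr lborel borel (%x::'a. t + x). f x)" by simp
 also have "... = (LINT x|lborel. f (t + x))" by (rule integral_distr) auto
 finally show ?thesis by (simp add: add.commute)
qed

lemma has_derivative_zero_on_open:
 fixes f :: "'a::real_normed_vector => real"
 assumes "open S" "x \<in> S" "!!y. y \<in> S ==> f y = 0"
 shows "(f has_derivative (%_. 0)) (at x)"
proof (rule has_derivative_transform_within_open)
 show "((%_. 0) has_derivative (%_. 0)) (at x)" by simp
qed (use assms in auto)

text \<open>Difference quotients of \<open>F\<close> in direction \<open>e\<close> have integral 0
  by translation invariance. They are bounded by the maximum of the directional derivative and
  supported in a fixed ball, so dominated convergence passes to the derivative. Integration by parts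
  and the Poincare inequality below both rest on this.\<close>

lemma integral_directional_derivative_zero:
 fixes F :: "'a::euclidean_space => real"
 assumes d: "!!x. (F has_derivative F' x) (at x)" and c: "continuous_on UNIV (%x. F' x e)"
  and s: "!!x. F x ~= 0 ==> norm x <= R"
 shows "(LINT x|lborel. F' x e) = 0"
proof -
 have cF: "continuous_on UNIV F" using d has_derivative_continuous_on by blast
 have s': "F' x e = 0" if "norm x > R" for x
 proof -
  have "(F has_derivative (%_. 0)) (at x)"
   by (rule has_derivative_zero_on_open[of "- cball 0 R"]) (use that s in \<open>auto simp: dist_norm\<close>)
  hence "F' x = (%_. 0)" using d has_derivative_unique by blast
  thus ?thesis by simp
 qed
 have "bounded ((%x. F' x e) ` cball 0 R)"
  by (intro compact_imp_bounded compact_continuous_image continuous_on_subset[OF c]) auto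
 then obtain B where B: "0 < B" "!!x. norm x <= R ==> \<bar>F' x e\<bar> <= B" by (auto simp: bounded_pos)
 hence B': "\<bar>F' x e\<bar> <= B" for x using s'[of x] by (cases "norm x <= R") auto
 have lip: "\<bar>F (x + h *\<^sub>R e) - F x\<bar> <= h * B" if h: "0 < h" for x h
 proof -
  have "((%t. F (x + t *\<^sub>R e)) has_derivative (%t. F' (x + u *\<^sub>R e) (t *\<^sub>R e))) (at u within {0..h})" for u
   by (rule has_derivative_compose[OF _ d]) (auto intro!: derivative_eq_intros)
  hence "\<exists>u\<in>{0<..<h}. F (x + h *\<^sub>R e) - F (x + 0 *\<^sub>R e) = F' (x + u *\<^sub>R e) ((h - 0) *\<^sub>R e)"
   by (intro mvt_simple[OF h]) auto
  then obtain u where "F (x + h *\<^sub>R e) - F x = F' (x + u *\<^sub>R e) (h *\<^sub>R e)" by auto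
  also have "... = h * F' (x + u *\<^sub>R e) e" using linear_scale[OF has_derivative_linear[OF d]] by auto
  finally show ?thesis using h B'[of "x + u *\<^sub>R e"] by (simp add: abs_mult)
 qed
 define h where "h = (%n. inverse (real (Suc n)))"
 have h: "0 < h n" "h n <= 1" for n by (auto simp: h_def inverse_le_1_iff)
 have h0: "h ----> 0" unfolding h_def by (rule LIMSEQ_inverse_real_of_nat)
 have Fm[measurable]: "F \<in> borel_measurable borel" by (rule borel_measurable_continuous_onI[OF cF])
 have Fi: "integrable lborel F"
 proof -
  have "integrable lborel (%x. indicator (cball 0 R) x *\<^sub>R F x)"
   by (rule borel_integrable_compact) (auto intro: continuous_on_subset[OF cF])
  moreover have "(%x. indicator (cball 0 R) x *\<^sub>R F x) = F" using s by (fastforce simp: indicator_def)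
  ultimately show ?thesis by simp
 qed
 have Fi': "integrable lborel (%x. F (x + t))" for t
 proof -
  have "integrable lborel (%x. indicator (cball (- t) R) x *\<^sub>R F (x + t))"
   by (rule borel_integrable_compact) (auto intro!: continuous_on_compose2[OF cF] continuous_intros)
  moreover have "(%x. indicator (cball (- t) R) x *\<^sub>R F (x + t)) = (%x. F (x + t))"
   using s by (fastforce simp: indicator_def dist_norm norm_minus_commute)
  ultimately show ?thesis by simp
 qed
 have "(%n. LINT x|lborel. (F (x + h n *\<^sub>R e) - F x) / h n) ----> (LINT x|lborel. F' x e)"
 proof (rule integral_dominated_convergence[where w="%x. indicator (cball 0 (R + norm e)) x *\<^sub>R B"])
  show "(%x. F' x e) \<in> borel_measurable lborel" using borel_measurable_continuous_onI[OF c] by simp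
  show "integrable lborel (%x. indicator (cball 0 (R + norm e)) x *\<^sub>R B)"
   by (rule borel_integrable_compact) auto
  show "AE x in lborel. (%n. (F (x + h n *\<^sub>R e) - F x) / h n) ----> F' x e"
  proof (rule AE_I2)
   fix x
   have "((%t. F (x + t *\<^sub>R e)) has_derivative (%t. F' (x + 0 *\<^sub>R e) (t *\<^sub>R e))) (at 0)"
    by (rule has_derivative_compose[OF _ d]) (auto intro!: derivative_eq_intros)
   hence "((%t. F (x + t *\<^sub>R e)) has_real_derivative F' x e) (at 0)"
    unfolding has_field_derivative_def using linear_scale[OF has_derivative_linear[OF d[of x]]] by (simp add: mult_commute_abs)
   hence "((%t. (F (x + t *\<^sub>R e) - F x) / t) \<longlongrightarrow> F' x e) (at 0)"
    by (simp add: DERIV_def)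
   thus "(%n. (F (x + h n *\<^sub>R e) - F x) / h n) ----> F' x e"
   proof (rule filterlim_compose)
    have "h n ~= 0" for n using h(1)[of n] by simp
    thus "filterlim h (at 0) sequentially" using h0 by (simp add: filterlim_at)
   qed
  qed
  fix n
  show "AE x in lborel. norm ((F (x + h n *\<^sub>R e) - F x) / h n) <= indicator (cball 0 (R + norm e)) x *\<^sub>R B"
  proof (rule AE_I2)
   fix x
   show "norm ((F (x + h n *\<^sub>R e) - F x) / h n) <= indicator (cball 0 (R + norm e)) x *\<^sub>R B"
   proof (cases "x \<in> cball 0 (R + norm e)")
    case True
    thus ?thesis using lip[OF h(1)[of n], of x] h(1)[of n] by (simp add: field_simps)
   next
    case False
    have "norm x <= norm (x + h n *\<^sub>R e) + norm e"
    proof -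
     have "norm x <= norm (x + h n *\<^sub>R e) + norm (h n *\<^sub>R e)" using norm_triangle_ineq4[of "x + h n *\<^sub>R e" "h n *\<^sub>R e"] by simp
     also have "norm (h n *\<^sub>R e) <= norm e" using h[of n] by (auto simp: mult_left_le_one_le)
     finally show ?thesis by simp
    qed
    with False have "F (x + h n *\<^sub>R e) = 0" "F x = 0"
     using s[of x] s[of "x + h n *\<^sub>R e"] norm_ge_zero[of e] by (auto simp: not_le) 
    thus ?thesis using B by simp
   qed
  qed
 qed auto
 moreover have "(LINT x|lborel. (F (x + h n *\<^sub>R e) - F x) / h n) = 0" for n
  using lborel_integral_translate[OF Fm, of "h n *\<^sub>R e"] Fi Fi'[of "h n *\<^sub>R e"] by simp
 ultimately have "(%_::nat. 0) ----> (LINT x|lborel. F' x e)" by (simp only:)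
 thus ?thesis by (simp add: LIMSEQ_const_iff)
qed

lemma smooth_has_derivative: "smooth v ==> (pds is v has_derivative FD (pds is v) (at x)) (at x)"
 unfolding smooth_def using frechet_derivative_works by blast

lemma pds_append: "pds (is @ js) v = pds is (pds js v)"
 by (induction "is") auto

lemma smooth_pds: "smooth v ==> smooth (pds is v)"
 by (simp add: smooth_def pds_append[symmetric])

lemma smooth_differentiable: "smooth v ==> pds is v differentiable (at x)"
 by (simp add: smooth_def)

lemma smooth_continuous: "smooth v ==> continuous_on A (pds is v)"
 by (meson continuous_at_imp_continuous_on differentiable_imp_continuous_within smooth_differentiable)

lemma smooth_continuous0: "smooth v ==> continuous_on A v"
 using smooth_continuous[of v A "[]"] by simp

text \<open>As on the line, all partial derivatives are exhibited at once, with the index list in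
  the role of the order.\<close>

lemma pds_eqI:
 assumes "!!is x. (P is has_derivative D is x) (at x)" "!!is i x. D is x (axis i 1) = P (i # is) x"
 shows "pds is (P []) = P is" "smooth (P [])"
proof -
 have *: "pds is (P []) = P is" for "is"
 proof (induction "is")
  case (Cons i "is")
  have "FD (P is) (at x) = D is x" for x using frechet_derivative_at[OF assms(1)] by simp
  thus ?case by (simp only: pds.simps Cons assms(2))
 qed simp
 show "pds is (P []) = P is" by (rule *)
 show "smooth (P [])" unfolding smooth_def * by (intro allI differentiableI[OF assms(1)])
qed

lemma smooth_lin:
 assumes "smooth v" "smooth w"
 shows "pds is (%x. a * v x + b * w x) = (%x. a * pds is v x + b * pds is w x)" "smooth (%x. a * v x + b * w x)"
proof -
 define P where "P = (%is x. a * pds is v x + b * pds is w x)"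
 define D where "D = (%is x h. a * FD (pds is v) (at x) h + b * FD (pds is w) (at x) h)"
 have 1: "(P is has_derivative D is x) (at x)" for "is" x
  unfolding P_def D_def by (intro has_derivative_add has_derivative_mult_right smooth_has_derivative assms)
 have 2: "D is x (axis i 1) = P (i # is) x" for "is" x i by (simp add: D_def P_def)
 show "pds is (%x. a * v x + b * w x) = (%x. a * pds is v x + b * pds is w x)"
  using pds_eqI(1)[of P D "is", OF 1 2] by (simp add: P_def)
 show "smooth (%x. a * v x + b * w x)" using pds_eqI(2)[of P D, OF 1 2] by (simp add: P_def)
qed

lemma smooth_const: "smooth (%_. c)"
proof -
 define P :: "2 list => scalar_field" where "P = (%is x. case is of [] => c | _ => 0)"
 have "smooth (P [])"
  by (rule pds_eqI(2)[of P "%_ _ _. 0"]) (auto simp: P_def split: list.splits)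
 thus ?thesis by (simp add: P_def)
qed

lemma smooth_diff: "smooth v ==> smooth w ==> smooth (v - w)"
 using smooth_lin(2)[of v w 1 "-1"] by (simp add: fun_diff_def)

lemma smooth_sum: "finite I ==> (!!i. i \<in> I ==> smooth (f i)) ==> smooth (%x. \<Sum>i\<in>I. f i x)"
proof (induction I rule: finite_induct)
 case (insert j I)
 thus ?case using smooth_lin(2)[of "f j" "%x. \<Sum>i\<in>I. f i x" 1 1] by simp
qed (simp add: smooth_const)

lemma smooth_product1:
 assumes f: "smooth1 f" and g: "smooth1 g"
 shows "smooth (%x. f (x $ 1) * g (x $ 2))"
proof -
 \<comment> \<open>Each factor depends on one coordinate only, so the derivative along a list
   depends on how often either index occurs in it.\<close>
 define c where "c = (%(i::2) is. length (filter (%j. j = i) is))"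
 define P :: "2 list => scalar_field" where "P = (%is x. (deriv ^^ c 1 is) f (x $ 1) * (deriv ^^ c 2 is) g (x $ 2))"
 define D where "D = (%is (x :: pt) (h :: pt). (deriv ^^ Suc (c 1 is)) f (x $ 1) * (h $ 1) * (deriv ^^ c 2 is) g (x $ 2) +
   (deriv ^^ c 1 is) f (x $ 1) * ((deriv ^^ Suc (c 2 is)) g (x $ 2) * (h $ 2)))"
 have 1: "(P is has_derivative D is x) (at x)" for "is" x
 proof -
  have *: "((%x. (deriv ^^ k) q (x $ i)) has_derivative (%h. (deriv ^^ Suc k) q (x $ i) * (h $ i))) (at x)" if "smooth1 q" for q k i
   using smooth1_DERIV[OF that, of k "x $ i"] unfolding has_field_derivative_def
   by (rule has_derivative_compose[rotated]) (rule bounded_linear_imp_has_derivative[OF bounded_linear_vec_nth])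
  show ?thesis unfolding P_def D_def
   using has_derivative_mult[OF *[OF f, of "c 1 is" 1] *[OF g, of "c 2 is" 2]] by (simp add: algebra_simps)
 qed
 have 2: "D is x (axis i 1) = P (i # is) x" for "is" x and i :: 2
 proof -
  have "i = 1 \<or> i = 2" using exhaust_2 by blast
  thus ?thesis by (auto simp: D_def P_def c_def axis_def)
 qed
 from pds_eqI(2)[of P D, OF 1 2] show ?thesis by (simp add: P_def c_def)
qed

lemma smooth1_power: "smooth1 (%t. t ^ n)"
proof (induction n)
 case 0
 define F :: "nat => real => real" where "F = (%k t. if k = 0 then 1 else 0)"
 have "smooth1 (F 0)" by (rule smooth1_derivI) (simp add: F_def)
 thus ?case by (simp add: F_def)
next
 case (Suc n)
 define F :: "nat => real => real" where "F = (%k t. if k = 0 then t else if k = 1 then 1 else 0)"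
 have "smooth1 (F 0)" by (rule smooth1_derivI) (simp add: F_def)
 hence "smooth1 (%t. t)" by (simp add: F_def)
 thus ?case using smooth1_mult[OF _ Suc] by simp
qed

lemma smooth_polys: "q \<in> polys r ==> smooth q"
proof -
 assume "q \<in> polys r"
 then obtain c :: "nat => nat => real" where q: "!!x. q x = (\<Sum>i\<le>r. \<Sum>j\<le>r - i. c i j * (x $ 1) ^ i * (x $ 2) ^ j)"
  unfolding polys_def by blast
 have "smooth (%x. c i j * (x $ 1) ^ i * (x $ 2) ^ j)" for i j
  using smooth_product1[OF smooth1_scale[OF smooth1_power, of "c i j" i] smooth1_power[of j]] .
 hence "smooth (%x. \<Sum>i\<le>r. \<Sum>j\<le>r - i. c i j * (x $ 1) ^ i * (x $ 2) ^ j)" by (intro smooth_sum) auto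
 moreover have "q = (%x. \<Sum>i\<le>r. \<Sum>j\<le>r - i. c i j * (x $ 1) ^ i * (x $ 2) ^ j)" by (rule ext) (rule q)
 ultimately show ?thesis by (simp only:)
qed

lemma test_fun_smooth: "phi \<in> test_fun U ==> smooth phi" by (simp add: test_fun_def)

lemma test_fun_zero: "phi \<in> test_fun U ==> x \<notin> U ==> phi x = 0"
 using closure_subset[of "{x. phi x ~= 0}"] by (auto simp: test_fun_def)

lemma support_pds: "smooth v ==> closure {x. pds is v x ~= 0} \<subseteq> closure {x. v x ~= 0}"
proof (induction "is")
 case (Cons i "is")
 have "pds (i # is) v x = 0" if x: "x \<notin> closure {x. v x ~= 0}" for x
 proof -
  let ?S = "- closure {x. v x ~= 0}"
  have z: "pds is v y = 0" if "y \<in> ?S" for y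
  proof (rule ccontr)
   assume "pds is v y ~= 0"
   hence "y \<in> closure {x. pds is v x ~= 0}" by (intro subsetD[OF closure_subset]) simp
   with Cons that show False by blast
  qed
  have "(pds is v has_derivative (%_. 0)) (at x)"
   by (rule has_derivative_zero_on_open[of ?S]) (use x z in auto)
  from frechet_derivative_at[OF this, symmetric] show ?thesis by simp
 qed
 thus ?case by (intro closure_minimal) auto
qed simp

lemma test_fun_pds: "phi \<in> test_fun U ==> pds is phi \<in> test_fun U"
proof -
 assume a: "phi \<in> test_fun U"
 hence s: "closure {x. pds is phi x ~= 0} \<subseteq> closure {x. phi x ~= 0}" by (intro support_pds) (simp add: test_fun_def)
 have "compact (closure {x. phi x ~= 0} \<inter> closure {x. pds is phi x ~= 0})"
  using a by (intro compact_Int_closed) (auto simp: test_fun_def)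
 moreover have "closure {x. phi x ~= 0} \<inter> closure {x. pds is phi x ~= 0} = closure {x. pds is phi x ~= 0}" using s by blast
 ultimately have "compact (closure {x. pds is phi x ~= 0})" by simp
 thus ?thesis using a s smooth_pds[of phi "is"] by (auto simp: test_fun_def)
qed

lemma test_fun_lin: "phi \<in> test_fun U ==> psi \<in> test_fun U ==> (%x. a * phi x + b * psi x) \<in> test_fun U"
proof -
 assume a: "phi \<in> test_fun U" "psi \<in> test_fun U"
 let ?S = "closure {x. phi x ~= 0} \<union> closure {x. psi x ~= 0}"
 have c: "compact ?S" "?S \<subseteq> U" using a by (auto simp: test_fun_def)
 have sub: "closure {x. a * phi x + b * psi x ~= 0} \<subseteq> ?S"
 proof (rule closure_minimal)
  show "{x. a * phi x + b * psi x ~= 0} \<subseteq> ?S"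
  proof
   fix x assume "x \<in> {x. a * phi x + b * psi x ~= 0}"
   hence "x \<in> {x. phi x ~= 0} \<or> x \<in> {x. psi x ~= 0}" by auto
   thus "x \<in> ?S" using closure_subset[of "{x. phi x ~= 0}"] closure_subset[of "{x. psi x ~= 0}"] by blast
  qed
 qed auto
 moreover have "compact (closure {x. a * phi x + b * psi x ~= 0})"
  using compact_Int_closed[OF c(1) closed_closure[of "{x. a * phi x + b * psi x ~= 0}"]] Int_absorb1[OF sub] by (simp only:)
 ultimately show ?thesis using c a smooth_lin(2)[of phi psi a b] by (auto simp: test_fun_def)
qed

lemma test_fun_zero_mem: "(%_. 0) \<in> test_fun U"
 by (simp add: test_fun_def smooth_const)

lemma test_fun_mono: "phi \<in> test_fun U ==> U \<subseteq> V ==> phi \<in> test_fun V"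
 by (auto simp: test_fun_def)

lemma test_fun_lap: "phi \<in> test_fun U ==> lap phi \<in> test_fun U"
 using test_fun_lin[OF test_fun_pds[of phi U "[1,1]"] test_fun_pds[of phi U "[2,2]"], of 1 1]
 by (simp add: lap_def sum_2 del: pds.simps)

lemma test_fun_bump:
 assumes c: "0 < c" and s: "cbox a b \<subseteq> U"
 shows "(%x. bump c (a $ 1) (b $ 1) (x $ 1) * bump c (a $ 2) (b $ 2) (x $ 2)) \<in> test_fun U"
proof -
 let ?f = "%x :: pt. bump c (a $ 1) (b $ 1) (x $ 1) * bump c (a $ 2) (b $ 2) (x $ 2)"
 have "smooth ?f" by (intro smooth_product1 bump_smooth c)
 moreover have sub: "closure {x. ?f x ~= 0} \<subseteq> cbox a b"
  by (rule closure_minimal) (auto simp: bump_zero mem_box_cart forall_2 closed_cbox)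
 moreover have "compact (closure {x. ?f x ~= 0})"
  using compact_Int_closed[OF compact_cbox[of a b] closed_closure[of "{x. ?f x ~= 0}"]] Int_absorb1[OF sub] by (simp only:)
 ultimately show ?thesis using s by (auto simp: test_fun_def)
qed

section \<open>Square integrable functions and weak derivatives\<close>

text \<open>Sums, differences and multiples are all written in this form, so that every pairing,
  norm and space below needs a single linearity lemma. Derivatives and traces are chosen
  representatives and respect it up to null sets.\<close>

definition lc :: "real => scalar_field => real => scalar_field => scalar_field" where
 "lc a v b w = (%x. a * v x + b * w x)"

lemma diff_eq_lc: "v - w = lc 1 v (- 1) w"
 by (rule ext) (simp add: lc_def)

lemma half_eq_lc: "half v w = lc (1 / 2) w (1 / 2) v"
 by (rule ext) (simp add: lc_def half_def field_simps)

lemma diffq_eq_lc: "diffq d v w = lc (1 / d) w (- 1 / d) v"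
 by (rule ext) (simp add: lc_def diffq_def field_simps diff_divide_distrib)

text \<open>The theory is developed for an arbitrary bounded open set, because it is applied both to
  the domain and to the interiors of the triangles.\<close>

locale bdom =
 fixes U :: "pt set"
 assumes open_U: "open U" and bounded_U: "bounded U"
begin

abbreviation "MU \<equiv> lebesgue_on U"
abbreviation "nU \<equiv> l2norm U"
abbreviation "wU \<equiv> wder U"
abbreviation "slo \<equiv> slobodeckij_sq U"
abbreviation "sqU \<equiv> sob_sq U"

lemma U_sets: "U \<in> sets lebesgue" using open_U by simp

lemma U_lmeas: "U \<in> lmeasurable" using open_U bounded_U by (rule lmeasurable_open[rotated])

lemma finite_meas: "finite_measure MU" by (rule finite_measure_lebesgue_on[OF U_lmeas])

lemma L2_meas: "v \<in> L2 U ==> v \<in> borel_measurable MU" by (simp add: L2_def)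

lemma L2_mult_integrable: 
 assumes "v \<in> L2 U" "w \<in> L2 U" shows "integrable MU (%x. v x * w x)"
proof (rule Bochner_Integration.integrable_bound)
 show "integrable MU (%x. (v x)^2 + (w x)^2)" using assms by (auto simp: L2_def)
 show "(%x. v x * w x) \<in> borel_measurable MU" using assms by (auto simp: L2_def)
 have "\<bar>a * b\<bar> <= a^2 + b^2" for a b :: real
 proof -
  have "0 <= (\<bar>a\<bar> - \<bar>b\<bar>)^2" by simp
  hence "2 * \<bar>a * b\<bar> <= a^2 + b^2" by (simp add: power2_diff abs_mult)
  thus ?thesis using abs_ge_zero[of "a * b"] by linarith
 qed
 thus "AE x in MU. norm (v x * w x) <= norm ((v x)^2 + (w x)^2)" by (auto intro!: AE_I2)
qed

lemma L2_lc[simp]: assumes "v \<in> L2 U" "w \<in> L2 U" shows "lc a v b w \<in> L2 U"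
proof -
 have "(%x. (lc a v b w x)^2) = (%x. a^2 * (v x)^2 + b^2 * (w x)^2 + 2 * a * b * (v x * w x))"
  by (rule ext) (simp add: lc_def power2_eq_square algebra_simps)
 thus ?thesis using assms L2_mult_integrable[OF assms]
  by (auto simp: L2_def lc_def intro!: Bochner_Integration.integrable_add integrable_mult_right)
qed

lemma L2_zero[simp]: "(%_. 0) \<in> L2 U" by (simp add: L2_def)

lemma ip_commute: "ip U v w = ip U w v" by (simp add: ip_def mult.commute)

lemma ip_lc_left:
 assumes "v \<in> L2 U" "w \<in> L2 U" "z \<in> L2 U"
 shows "ip U (lc a v b w) z = a * ip U v z + b * ip U w z"
proof -
 have "ip U (lc a v b w) z = (LINT x|MU. a * (v x * z x) + b * (w x * z x))"
  unfolding ip_def lc_def by (intro Bochner_Integration.integral_cong) (auto simp: algebra_simps)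
 thus ?thesis using L2_mult_integrable[OF assms(1,3)] L2_mult_integrable[OF assms(2,3)]
  by (simp add: ip_def)
qed

lemma ip_lc_right:
 assumes "v \<in> L2 U" "w \<in> L2 U" "z \<in> L2 U"
 shows "ip U z (lc a v b w) = a * ip U z v + b * ip U z w"
 using ip_lc_left[OF assms] by (simp add: ip_commute)

lemma ip_self_nonneg: "0 <= ip U v v"
 unfolding ip_def by (rule integral_nonneg_AE) auto

lemma l2norm_nonneg[simp]: "0 <= nU v" by (simp add: l2norm_def ip_self_nonneg)

lemma l2norm_sq: "(nU v)^2 = ip U v v" by (simp add: l2norm_def ip_self_nonneg)

lemma ip_self_zero_iff: "v \<in> L2 U ==> ip U v v = 0 \<longleftrightarrow> (AE x in MU. v x = 0)"
proof -
 assume v: "v \<in> L2 U"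
 have "(LINT x|MU. (v x)^2) = 0 \<longleftrightarrow> (AE x in MU. (v x)^2 = 0)"
  using v by (intro integral_nonneg_eq_0_iff_AE) (auto simp: L2_def)
 thus ?thesis by (simp add: ip_def power2_eq_square)
qed

lemma ip_cong:
 assumes "ae_eq U v v'" "ae_eq U w w'" "v \<in> L2 U" "w \<in> L2 U" "v' \<in> L2 U" "w' \<in> L2 U"
 shows "ip U v w = ip U v' w'"
 unfolding ip_def
 by (rule integral_cong_AE) (use assms L2_meas in \<open>auto simp: ae_eq_def intro!: borel_measurable_times elim: AE_mp\<close>)

lemma ip_zero_left:
 assumes "ae_eq U v (%_. 0)" "v \<in> L2 U" "w \<in> L2 U" shows "ip U v w = 0"
 using ip_cong[of v "%_. 0" w w] assms by (simp add: ip_def ae_eq_def)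

lemma Cauchy_Schwarz:
 assumes "v \<in> L2 U" "w \<in> L2 U"
 shows "\<bar>ip U v w\<bar> <= nU v * nU w"
proof -
 let ?a = "nU v" and ?b = "nU w"
 have le: "ip U v w <= ?a * ?b" if vw: "v \<in> L2 U" "w \<in> L2 U" "?a = nU v" "?b = nU w" for v w
 proof (cases "?a = 0 \<or> ?b = 0")
  case True
  hence "ip U v v = 0 \<or> ip U w w = 0" using vw l2norm_sq[of v] l2norm_sq[of w] by auto
  hence "ip U v w = 0"
   using vw ip_self_zero_iff ip_zero_left[of v w] ip_zero_left[of w v] by (auto simp: ae_eq_def ip_commute[of v w])
  thus ?thesis using l2norm_nonneg vw by (simp add: vw(3)[symmetric] True)
 next
  case False
  hence pos: "0 < ?a * ?b" using l2norm_nonneg[of v] l2norm_nonneg[of w] vw(3,4) by (simp add: less_le)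
  have "0 <= ip U (lc ?b v (- ?a) w) (lc ?b v (- ?a) w)" by (rule ip_self_nonneg)
  also have "... = ?b * ?b * ip U v v + ?a * ?a * ip U w w - 2 * ?a * ?b * ip U v w"
   using vw(1,2) by (simp add: ip_lc_left ip_lc_right ip_commute[of w v] algebra_simps)
  finally have f: "0 <= ?b * ?b * ip U v v + ?a * ?a * ip U w w - 2 * ?a * ?b * ip U v w" .
  have e: "ip U v v = ?a * ?a" "ip U w w = ?b * ?b" using l2norm_sq[of v] l2norm_sq[of w] vw by (auto simp: power2_eq_square)
  have "?a * ?b * ip U v w <= ?a * ?b * (?a * ?b)" using f unfolding e by (simp add: algebra_simps)
  thus ?thesis using pos by (simp only: mult_le_cancel_left_pos)
 qed
 have m: "nU (lc (-1) v 0 v) = ?a"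
  using assms by (simp add: l2norm_def ip_lc_left ip_lc_right)
 have "ip U (lc (-1) v 0 v) w <= ?a * ?b" using assms m by (intro le) auto
 thus ?thesis using le[OF assms] assms by (auto simp: abs_le_iff ip_lc_left)
qed

lemma l2norm_lc:
 assumes "v \<in> L2 U" "w \<in> L2 U"
 shows "nU (lc a v b w) <= \<bar>a\<bar> * nU v + \<bar>b\<bar> * nU w"
proof (rule power2_le_imp_le)
 have "(nU (lc a v b w))^2 = a^2 * (nU v)^2 + b^2 * (nU w)^2 + 2 * (a * b * ip U v w)"
  using assms unfolding l2norm_sq by (simp add: ip_lc_left ip_lc_right ip_commute[of w v] power2_eq_square algebra_simps)
 also have "a * b * ip U v w <= \<bar>a\<bar> * \<bar>b\<bar> * (nU v * nU w)"
 proof -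
  have "a * b * ip U v w <= \<bar>a * b * ip U v w\<bar>" by simp
  also have "... <= \<bar>a\<bar> * \<bar>b\<bar> * (nU v * nU w)"
   unfolding abs_mult by (intro mult_left_mono Cauchy_Schwarz assms) auto
  finally show ?thesis .
 qed
 finally show "(nU (lc a v b w))^2 <= (\<bar>a\<bar> * nU v + \<bar>b\<bar> * nU w)^2"
  by (simp add: power2_sum power_mult_distrib algebra_simps)
qed simp

lemma l2norm_triangle: 
 assumes "u \<in> L2 U" "v \<in> L2 U" "w \<in> L2 U"
 shows "nU (u - w) <= nU (u - v) + nU (v - w)"
proof -
 have "u - w = lc 1 (u - v) 1 (v - w)" by (rule ext) (simp add: lc_def)
 thus ?thesis using l2norm_lc[of "u - v" "v - w" 1 1] assms by (simp add: diff_eq_lc)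
qed

lemma l2norm_minus_commute: "nU (v - w) = nU (w - v)"
 unfolding l2norm_def ip_def by (simp add: algebra_simps)

text \<open>Lebesgue measure is complete, so a change on a null set does not affect measurability;
  extension by 0 reduces the claim to the whole plane.\<close>

lemma borel_AE_on:
 assumes "v \<in> borel_measurable MU" "ae_eq U v w"
 shows "w \<in> borel_measurable MU"
proof -
 have "(%x. if x \<in> U then v x else 0) \<in> borel_measurable lebesgue"
  using assms(1) U_sets by (simp add: borel_measurable_if)
 moreover have "AE x in lebesgue. (if x \<in> U then v x else 0) = (if x \<in> U then w x else 0)"
  using assms(2) U_sets unfolding ae_eq_def by (subst (asm) AE_restrict_space_iff) (auto elim!: AE_mp)
 ultimately have "(%x. if x \<in> U then w x else 0) \<in> borel_measurable lebesgue" by (rule borel_measurable_AE)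
 thus ?thesis using U_sets by (simp add: borel_measurable_if)
qed

lemma ae_eq_sym: "ae_eq V v w ==> ae_eq V w v" unfolding ae_eq_def by (auto elim!: AE_mp)

lemma ae_eq_refl[simp]: "ae_eq V v v" by (simp add: ae_eq_def)

lemma ae_eq_trans: assumes "ae_eq V u v" "ae_eq V v w" shows "ae_eq V u w"
 using assms unfolding ae_eq_def by eventually_elim simp

lemma ae_eq_lc: assumes "ae_eq V v v'" "ae_eq V w w'" shows "ae_eq V (lc a v b w) (lc a v' b w')"
 using assms unfolding ae_eq_def lc_def by eventually_elim simp

lemma L2_cong: assumes "v \<in> L2 U" "ae_eq U v w" shows "w \<in> L2 U"
proof -
 have w: "w \<in> borel_measurable MU" using borel_AE_on[OF L2_meas[OF assms(1)] assms(2)] .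
 have "integrable MU (%x. (v x)^2) \<longleftrightarrow> integrable MU (%x. (w x)^2)"
  using assms w by (intro integrable_cong_AE) (auto simp: ae_eq_def L2_def elim: AE_mp)
 thus ?thesis using assms w by (simp add: L2_def)
qed

lemma L2_I_bounded:
 assumes "v \<in> borel_measurable MU" "!!x. x \<in> U ==> \<bar>v x\<bar> <= B"
 shows "v \<in> L2 U"
proof -
 interpret finite_measure "MU" by (rule finite_meas)
 have "integrable MU (%x. (v x)^2)"
 proof (rule integrable_const_bound[of _ "B^2"])
  show "AE x in MU. norm ((v x)^2) <= B^2"
   using assms(2) by (intro AE_I2) (metis U_sets abs_le_square_iff abs_of_nonneg abs_ge_zero order_trans norm_power power2_abs real_norm_def space_lebesgue_on)
 qed (use assms in auto)
 thus ?thesis using assms by (simp add: L2_def)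
qed

lemma continuous_L2: assumes "continuous_on UNIV v" shows "v \<in> L2 U"
proof -
 have "bounded (v ` closure U)"
  by (intro compact_imp_bounded compact_continuous_image continuous_on_subset[OF assms]) (auto simp: bounded_U)
 then obtain B where B: "!!x. x \<in> closure U ==> \<bar>v x\<bar> <= B" by (auto simp: bounded_iff)
 show ?thesis
 proof (rule L2_I_bounded[of _ B])
  show "v \<in> borel_measurable MU"
   by (rule continuous_imp_measurable_on_sets_lebesgue[OF continuous_on_subset[OF assms] U_sets]) simp
  show "!!x. x \<in> U ==> \<bar>v x\<bar> <= B" using B closure_subset by blast
 qed
qed

lemma smooth_L2: "smooth v ==> pds is v \<in> L2 U" by (intro continuous_L2 smooth_continuous)

lemma smooth_L20: "smooth v ==> v \<in> L2 U" using smooth_L2[of v "[]"] by simp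

lemma test_L2: "phi \<in> test_fun U ==> pds is phi \<in> L2 U" by (simp add: smooth_L2 test_fun_smooth)

lemma test_L20: "phi \<in> test_fun U ==> phi \<in> L2 U" using test_L2[of phi "[]"] by simp

text \<open>Products of bumps converge boundedly to the indicator of a box, so \<open>g\<close> is
  orthogonal to every box whose closure lies in \<open>U\<close>.\<close>

lemma fundamental_lemma:
 assumes g: "g \<in> L2 U" and z: "!!phi. phi \<in> test_fun U ==> ip U g phi = 0"
 shows "ae_eq U g (%_. 0)"
 unfolding ae_eq_def
proof (rule AE_zero_of_integral_boxes_in_open[OF open_U])
 interpret finite_measure "MU" by (rule finite_meas)
 have one: "(%_. 1) \<in> L2 U" by (simp add: L2_def)
 show gi: "integrable MU g" using L2_mult_integrable[OF g one] by simp
 fix a b :: pt assume s: "cbox a b \<subseteq> U"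
 define phi where "phi = (%n (x :: pt). bump (inverse (Suc n)) (a $ 1) (b $ 1) (x $ 1) * bump (inverse (Suc n)) (a $ 2) (b $ 2) (x $ 2))"
 have t: "phi n \<in> test_fun U" for n unfolding phi_def by (rule test_fun_bump) (use s in auto)
 have "(%n. LINT x|MU. phi n x * g x) ----> (LINT x|MU. indicator (box a b) x * g x)"
 proof (rule integral_dominated_convergence[where w="%x. norm (g x)"])
  show "(%x. indicator (box a b) x * g x) \<in> borel_measurable MU"
   using L2_meas[OF g] by (intro borel_measurable_times borel_measurable_indicator) (use s box_subset_cbox[of a b] in \<open>auto simp: sets_restrict_space_iff U_sets\<close>)
  show "(%x. phi n x * g x) \<in> borel_measurable MU" for n
   by (intro borel_measurable_times L2_meas test_L20 t g)
  show "integrable MU (%x. norm (g x))" using gi by simp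
  show "AE x in MU. (%n. phi n x * g x) ----> indicator (box a b) x * g x"
  proof (rule AE_I2)
   fix x
   have "(%n. phi n x) ----> indicator {a $ 1<..<b $ 1} (x $ 1) * indicator {a $ 2<..<b $ 2} (x $ 2)"
    unfolding phi_def by (intro tendsto_mult bump_tendsto)
   moreover have "indicator {a $ 1<..<b $ 1} (x $ 1) * indicator {a $ 2<..<b $ 2} (x $ 2) = (indicator (box a b) x :: real)"
    by (auto simp: indicator_def mem_box_cart forall_2)
   ultimately show "(%n. phi n x * g x) ----> indicator (box a b) x * g x" by (intro tendsto_mult_right) simp
  qed
  fix n
  have "\<bar>phi n x\<bar> <= 1" for x
   using bump_range[of "inverse (Suc n)"] by (simp add: phi_def abs_mult mult_le_one)
  thus "AE x in MU. norm (phi n x * g x) <= norm (g x)"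
   by (auto simp: abs_mult intro!: AE_I2 mult_left_le_one_le)
 qed
 moreover have "(LINT x|MU. phi n x * g x) = 0" for n
  using z[OF t[of n]] by (simp add: ip_def mult.commute)
 ultimately show "(LINT x|MU. indicator (box a b) x * g x) = 0" by (simp add: LIMSEQ_const_iff)
qed

lemma weak_deriv_unique:
 assumes "weak_deriv U is v g" "weak_deriv U is v h" shows "ae_eq U g h"
proof -
 have L: "g \<in> L2 U" "h \<in> L2 U" using assms by (auto simp: weak_deriv_def)
 have "ae_eq U (lc 1 g (- 1) h) (%_. 0)"
 proof (rule fundamental_lemma)
  fix phi assume phi: "phi \<in> test_fun U"
  have "(-1) ^ length is * ip U g phi = (-1) ^ length is * ip U h phi"
   using assms phi unfolding weak_deriv_def by metis
  thus "ip U (lc 1 g (- 1) h) phi = 0" using L test_L20[OF phi] by (simp add: ip_lc_left)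
 qed (use L in simp)
 thus ?thesis unfolding ae_eq_def lc_def by eventually_elim simp
qed

lemma weak_deriv_lc:
 assumes "weak_deriv U is v g" "weak_deriv U is w h"
 shows "weak_deriv U is (lc a v b w) (lc a g b h)"
 using assms unfolding weak_deriv_def
 by (auto simp: ip_lc_left test_L2 test_L20 algebra_simps)

lemma weak_deriv_cong_fun:
 assumes "ae_eq U v w" shows "weak_deriv U is v = weak_deriv U is w"
proof -
 have *: "weak_deriv U is w g" if "ae_eq U v w" "weak_deriv U is v g" for v w g
 proof -
  have L: "v \<in> L2 U" "g \<in> L2 U" "w \<in> L2 U" using that L2_cong by (auto simp: weak_deriv_def)
  have "ip U w (pds is phi) = ip U v (pds is phi)" if "phi \<in> test_fun U" for phi
   using \<open>ae_eq U v w\<close> L test_L2[OF that] by (intro ip_cong) (auto intro: ae_eq_sym)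
  thus ?thesis using that L by (auto simp: weak_deriv_def)
 qed
 show ?thesis using *[OF assms] *[OF ae_eq_sym[OF assms]] by blast
qed

lemma wder_cong: "ae_eq U v w ==> wU is v = wU is w"
 by (simp add: wder_def weak_deriv_cong_fun)

lemma wder_works: "weak_deriv U is v g ==> weak_deriv U is v (wU is v)"
 unfolding wder_def by (rule someI[of "weak_deriv U is v"])

lemma wder_eqI: "weak_deriv U is v g ==> ae_eq U (wU is v) g"
 using wder_works weak_deriv_unique by blast

lemma Hk_wder: "v \<in> Hk U m ==> length is <= m ==> weak_deriv U is v (wU is v)"
 unfolding Hk_def using wder_works by blast

lemma wder_L2: "v \<in> Hk U m ==> length is <= m ==> wU is v \<in> L2 U"
 using Hk_wder unfolding weak_deriv_def by blast

lemma Hk_L2: "v \<in> Hk U m ==> v \<in> L2 U" by (simp add: Hk_def)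

lemma Hk_mono: "v \<in> Hk U m ==> k <= m ==> v \<in> Hk U k" by (auto simp: Hk_def)

lemma Hk_lc[simp]: "v \<in> Hk U m ==> w \<in> Hk U m ==> lc a v b w \<in> Hk U m"
proof -
 assume "v \<in> Hk U m" "w \<in> Hk U m"
 hence "\<exists>g. weak_deriv U is (lc a v b w) g" if "length is <= m" for "is"
  using that weak_deriv_lc[of "is" v _ w _ a b] unfolding Hk_def by blast
 thus "lc a v b w \<in> Hk U m" using \<open>v \<in> Hk U m\<close> \<open>w \<in> Hk U m\<close> by (simp add: Hk_def)
qed

lemma wder_lc: "v \<in> Hk U m ==> w \<in> Hk U m ==> length is <= m ==>
  ae_eq U (wU is (lc a v b w)) (lc a (wU is v) b (wU is w))"
 by (intro wder_eqI weak_deriv_lc) (auto intro: Hk_wder)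

lemma Hk_cong: "v \<in> Hk U m ==> ae_eq U v w ==> w \<in> Hk U m"
 unfolding Hk_def using weak_deriv_cong_fun L2_cong by auto

lemma lint_on_UNIV:
 fixes f :: scalar_field
 assumes "continuous_on UNIV f" "!!x. x \<notin> U ==> f x = 0"
 shows "(LINT x|MU. f x) = (LINT x|lborel. f x)"
proof -
 have "(LINT x|MU. f x) = (LINT x|lebesgue. (if x \<in> U then f x else 0))"
  by (rule Lebesgue_Measure.integral_restrict_UNIV[OF U_sets, symmetric])
 also have "(%x. if x \<in> U then f x else 0) = f" using assms(2) by auto
 also have "(LINT x|lebesgue. f x) = (LINT x|lborel. f x)"
  by (rule integral_completion) (use borel_measurable_continuous_onI[OF assms(1)] in simp)
 finally show ?thesis .
qed

lemma test_bounded_support: "phi \<in> test_fun U ==> \<exists>R. \<forall>x. phi x ~= 0 --> norm x <= R"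
proof -
 assume "phi \<in> test_fun U"
 hence "bounded (closure {x. phi x ~= 0})" unfolding test_fun_def using compact_imp_bounded by blast
 hence "bounded {x. phi x ~= 0}" by (rule bounded_subset[OF _ closure_subset])
 thus ?thesis by (auto simp: bounded_iff)
qed

lemma by_parts1:
 assumes v: "smooth v" and phi: "phi \<in> test_fun U"
 shows "ip U v (pds [i] phi) = - ip U (pds [i] v) phi"
proof -
 have s: "smooth phi" using phi by (rule test_fun_smooth)
 define F' where "F' = (%x h. v x * FD phi (at x) h + FD v (at x) h * phi x)"
 have d: "((%x. v x * phi x) has_derivative F' x) (at x)" for x
  using has_derivative_mult[OF smooth_has_derivative[OF v, of "[]" x] smooth_has_derivative[OF s, of "[]" x]]
  by (simp add: F'_def)
 have e: "F' x (axis i 1) = v x * pds [i] phi x + pds [i] v x * phi x" for x by (simp add: F'_def)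
 obtain R where R: "!!x. phi x ~= 0 ==> norm x <= R" using test_bounded_support[OF phi] by blast
 have c: "continuous_on UNIV (%x. v x * pds [i] phi x + pds [i] v x * phi x)"
  by (intro continuous_intros smooth_continuous smooth_continuous0 v s)
 have "0 = (LINT x|lborel. F' x (axis i 1))"
  by (rule integral_directional_derivative_zero[OF d, symmetric]) (use c R in \<open>auto simp only: e mult_eq_0_iff\<close>)
 also have "... = (LINT x|MU. v x * pds [i] phi x + pds [i] v x * phi x)"
  unfolding e by (rule lint_on_UNIV[symmetric, OF c])
   (use test_fun_zero[OF phi] test_fun_zero[OF test_fun_pds[OF phi, of "[i]"]] in \<open>simp del: pds.simps\<close>)
 also have "... = ip U v (pds [i] phi) + ip U (pds [i] v) phi"
  unfolding ip_def by (rule Bochner_Integration.integral_add)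
   (intro L2_mult_integrable smooth_L2 smooth_L20 test_L2 test_L20 v phi)+
 finally show ?thesis by simp
qed

text \<open>The head of an index list is the derivative taken last. Moving the derivatives one by
  one from the test function onto \<open>v\<close> therefore reverses the list, and this is why
  \<open>rev\<close> occurs wherever weak and classical derivatives are compared.\<close>

lemma weak_deriv_smooth: "smooth v ==> weak_deriv U is v (pds (rev is) v)"
proof -
 have "ip U v (pds is phi) = (-1) ^ length is * ip U (pds (rev is) v) phi" if "phi \<in> test_fun U" "smooth v" for phi v
  using that
 proof (induction "is" arbitrary: v)
  case (Cons i "is")
  have "ip U v (pds (i # is) phi) = ip U v (pds [i] (pds is phi))" by simp
  also have "... = - ip U (pds [i] v) (pds is phi)" by (rule by_parts1) (use Cons test_fun_pds in auto)
  also have "... = - ((-1) ^ length is * ip U (pds (rev is) (pds [i] v)) phi)"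
   using Cons.IH[OF Cons.prems(1) smooth_pds[OF Cons.prems(2), of "[i]"]] by (simp del: pds.simps)
  also have "pds (rev is) (pds [i] v) = pds (rev (i # is)) v" by (simp add: pds_append)
  finally show ?case by simp
 qed simp
 moreover assume "smooth v"
 ultimately show ?thesis by (simp add: weak_deriv_def smooth_L2 smooth_L20)
qed

lemma wder_smooth: "smooth v ==> ae_eq U (wU is v) (pds (rev is) v)"
 by (rule wder_eqI[OF weak_deriv_smooth])

lemma smooth_Hk: "smooth v ==> v \<in> Hk U m"
 unfolding Hk_def using weak_deriv_smooth smooth_L20 by blast

lemma weak_deriv_Nil: "v \<in> L2 U ==> weak_deriv U [] v v" by (simp add: weak_deriv_def)

lemma wder_Nil: "v \<in> L2 U ==> ae_eq U (wU [] v) v" by (rule wder_eqI[OF weak_deriv_Nil])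

lemma Hk_0: "Hk U 0 = L2 U" unfolding Hk_def using weak_deriv_Nil by auto

lemma l2norm_cong: "ae_eq U v w ==> v \<in> L2 U ==> nU v = nU w"
 unfolding l2norm_def using ip_cong[of v w v w] L2_cong by simp

end

section \<open>Sobolev norms of real order and closures of the test functions\<close>

context bdom
begin

lemma finite_lists_le: "finite {is :: 2 list. length is <= m}"
 using finite_lists_length_le[of "UNIV :: 2 set" m] by simp

lemma finite_lists_eq: "finite {is :: 2 list. length is = m}"
 by (rule finite_subset[OF _ finite_lists_le[of m]]) auto

text \<open>The parallelogram law with weights. Being an identity it yields convexity of the squared
  norm, and it also bounds the distance of two elements by what a convex combination gains.\<close>

lemma l2norm_sq_split:
 assumes "v \<in> L2 U" "w \<in> L2 U" "rho + ta = 1"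
 shows "(nU (lc rho v ta w))^2 + rho * ta * (nU (lc 1 v (- 1) w))^2 = rho * (nU v)^2 + ta * (nU w)^2"
proof -
 have t: "ta = 1 - rho" using assms by simp
 show ?thesis using assms(1,2) unfolding t l2norm_sq by (simp add: ip_lc_left ip_lc_right ip_commute[of w v] algebra_simps)
qed

lemma slob_measurable:
 assumes "g \<in> borel_measurable MU"
 shows "(%x. \<integral>\<^sup>+y. ennreal ((g x - g y)^2 / norm (x - y) powr p) \<partial>MU) \<in> borel_measurable MU"
  "!!x. (%y. ennreal ((g x - g y)^2 / norm (x - y) powr p)) \<in> borel_measurable MU"
proof -
 note assms[measurable]
 interpret finite_measure "MU" by (rule finite_meas)
 have [measurable]: "(%x. x) \<in> borel_measurable MU"
  by (rule continuous_imp_measurable_on_sets_lebesgue[OF _ U_sets]) (auto intro: continuous_intros)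
 show "(%x. \<integral>\<^sup>+y. ennreal ((g x - g y)^2 / norm (x - y) powr p) \<partial>MU) \<in> borel_measurable MU"
  by (rule borel_measurable_nn_integral) measurable
 show "(%y. ennreal ((g x - g y)^2 / norm (x - y) powr p)) \<in> borel_measurable MU" for x
  by measurable
qed

lemma slob_cong:
 assumes "ae_eq U g h"
 shows "slo th g = slo th h"
proof -
 have 1: "(\<integral>\<^sup>+y. ennreal ((g x - g y)^2 / norm (x - y) powr (2 + 2 * th)) \<partial>MU) =
   (\<integral>\<^sup>+y. ennreal ((g x - h y)^2 / norm (x - y) powr (2 + 2 * th)) \<partial>MU)" for x
  using assms unfolding ae_eq_def by (intro nn_integral_cong_AE) (auto elim!: AE_mp)
 have "AE x in MU. (\<integral>\<^sup>+y. ennreal ((g x - h y)^2 / norm (x - y) powr (2 + 2 * th)) \<partial>MU) =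
   (\<integral>\<^sup>+y. ennreal ((h x - h y)^2 / norm (x - y) powr (2 + 2 * th)) \<partial>MU)"
  using assms unfolding ae_eq_def by eventually_elim simp
 thus ?thesis unfolding slobodeckij_sq_def 1 by (rule nn_integral_cong_AE)
qed

text \<open>The same identity holds for the squares of g(x) - g(y) under the double integral; stated
  in \<open>ennreal\<close> it covers functions of infinite seminorm.\<close>

lemma slob_split:
 assumes g: "g \<in> borel_measurable MU" and h: "h \<in> borel_measurable MU"
  and lm: "0 <= rho" "0 <= ta" "rho + ta = 1"
 shows "slo th (lc rho g ta h) + ennreal (rho * ta) * slo th (lc 1 g (-1) h)
  = ennreal rho * slo th g + ennreal ta * slo th h"
proof -
 define p where "p = 2 + 2 * th"
 define K where "K = (%f (x :: pt) y. ennreal ((f x - f y)^2 / norm (x - y) powr p))"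
 have m: "lc a g b h \<in> borel_measurable MU" for a b
  unfolding lc_def by (intro borel_measurable_add borel_measurable_times borel_measurable_const g h)
 have mK: "(%x. \<integral>\<^sup>+y. K f x y \<partial>MU) \<in> borel_measurable MU"
   "(%y. K f x y) \<in> borel_measurable MU" if "f \<in> borel_measurable MU" for f x
  using slob_measurable[OF that, where p=p] by (auto simp: K_def)
 have sl: "slo th f = (\<integral>\<^sup>+x. \<integral>\<^sup>+y. K f x y \<partial>MU \<partial>MU)" for f
  by (simp add: slobodeckij_sq_def p_def K_def)
 have point: "K (lc rho g ta h) x y + ennreal (rho * ta) * K (lc 1 g (-1) h) x y = ennreal rho * K g x y + ennreal ta * K h x y" for x y
 proof -
  have ta: "ta = 1 - rho" using lm by simp
  have e: "(lc rho g ta h x - lc rho g ta h y)^2 + rho * ta * (lc 1 g (-1) h x - lc 1 g (-1) h y)^2 = rho * (g x - g y)^2 + ta * (h x - h y)^2"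
   unfolding lc_def ta by (simp add: power2_eq_square algebra_simps)
  have "(lc rho g ta h x - lc rho g ta h y)^2 / norm (x - y) powr p + rho * ta * ((lc 1 g (-1) h x - lc 1 g (-1) h y)^2 / norm (x - y) powr p)
   = rho * ((g x - g y)^2 / norm (x - y) powr p) + ta * ((h x - h y)^2 / norm (x - y) powr p)"
   using arg_cong[OF e, of "%z. z / norm (x - y) powr p"] by (simp only: add_divide_distrib times_divide_eq_right)
  thus ?thesis unfolding K_def using lm by (simp add: ennreal_mult[symmetric] ennreal_plus[symmetric] del: ennreal_plus)
 qed
 have inner: "(\<integral>\<^sup>+y. K (lc rho g ta h) x y \<partial>MU) + ennreal (rho * ta) * (\<integral>\<^sup>+y. K (lc 1 g (-1) h) x y \<partial>MU)
  = ennreal rho * (\<integral>\<^sup>+y. K g x y \<partial>MU) + ennreal ta * (\<integral>\<^sup>+y. K h x y \<partial>MU)" for x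
  using mK(2)[OF m] mK(2)[OF g] mK(2)[OF h] point[of x]
  by (simp add: nn_integral_cmult[symmetric] nn_integral_add[symmetric])
 have "slo th (lc rho g ta h) + ennreal (rho * ta) * slo th (lc 1 g (-1) h)
  = (\<integral>\<^sup>+x. (\<integral>\<^sup>+y. K (lc rho g ta h) x y \<partial>MU) + ennreal (rho * ta) * (\<integral>\<^sup>+y. K (lc 1 g (-1) h) x y \<partial>MU) \<partial>MU)"
  unfolding sl using mK(1)[OF m] by (simp add: nn_integral_cmult[symmetric] nn_integral_add[symmetric])
 also have "... = ennreal rho * slo th g + ennreal ta * slo th h"
  unfolding inner sl using mK(1)[OF g] mK(1)[OF h] by (simp add: nn_integral_cmult[symmetric] nn_integral_add[symmetric])
 finally show ?thesis .
qed

lemma slob_scale: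
 assumes g: "g \<in> borel_measurable MU"
 shows "slo th (lc a g 0 h) = ennreal (a^2) * slo th g"
proof -
 have "ennreal ((lc a g 0 h x - lc a g 0 h y)^2 / norm (x - y) powr p) = ennreal (a^2) * ennreal ((g x - g y)^2 / norm (x - y) powr p)" for x y p
  by (simp add: lc_def ennreal_mult[symmetric] power_mult_distrib[symmetric] right_diff_distrib)
 thus ?thesis unfolding slobodeckij_sq_def using slob_measurable[OF g] by (simp add: nn_integral_cmult)
qed

lemma sob_sq_split:
 assumes v: "v \<in> Hk U (nat \<lfloor>s\<rfloor>)" and w: "w \<in> Hk U (nat \<lfloor>s\<rfloor>)" and lm: "0 <= rho" "0 <= ta" "rho + ta = 1"
 shows "sqU s (lc rho v ta w) + ennreal (rho * ta) * sqU s (lc 1 v (-1) w) = ennreal rho * sqU s v + ennreal ta * sqU s w"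
proof -
 define m where "m = nat \<lfloor>s\<rfloor>"
 note vw = v[folded m_def] w[folded m_def]
 define S where "S = (%v. \<Sum>is | length is <= m. (nU (wU is v))^2)"
 define T where "T = (%v. \<Sum>is | length is = m. slo (frac s) (wU is v))"
 define c where "c = (if frac s = 0 then 0 else ennreal (frac s * (1 - frac s)))"
 have S0: "0 <= S v" for v by (auto simp: S_def intro!: sum_nonneg)
 have q: "sqU s v = ennreal (S v) + c * T v" if "v \<in> Hk U m" for v
  using that by (simp add: sob_sq_def m_def[symmetric] S_def T_def c_def Let_def)
 have S: "S (lc rho v ta w) + rho * ta * S (lc 1 v (-1) w) = rho * S v + ta * S w"
  unfolding S_def sum_distrib_left sum.distrib[symmetric]
 proof (intro sum.cong refl)
  fix "is" :: "2 list" assume "is \<in> {is. length is <= m}"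
  hence l: "length is <= m" by simp
  have L: "wU is v \<in> L2 U" "wU is w \<in> L2 U" using vw l by (auto intro: wder_L2)
  have e: "nU (wU is (lc a v b w)) = nU (lc a (wU is v) b (wU is w))" for a b
   using vw l by (intro l2norm_cong wder_lc wder_L2[of _ m]) auto
  show "(nU (wU is (lc rho v ta w)))^2 + rho * ta * (nU (wU is (lc 1 v (-1) w)))^2 = rho * (nU (wU is v))^2 + ta * (nU (wU is w))^2"
   unfolding e by (rule l2norm_sq_split[OF L lm(3)])
 qed
 have T: "T (lc rho v ta w) + ennreal (rho * ta) * T (lc 1 v (-1) w) = ennreal rho * T v + ennreal ta * T w"
  unfolding T_def sum_distrib_left sum.distrib[symmetric]
 proof (intro sum.cong refl)
  fix "is" :: "2 list" assume "is \<in> {is. length is = m}"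
  hence l: "length is <= m" by simp
  have L: "wU is v \<in> borel_measurable MU" "wU is w \<in> borel_measurable MU"
   using vw l by (auto intro: wder_L2 L2_meas)
  have e: "slo (frac s) (wU is (lc a v b w)) = slo (frac s) (lc a (wU is v) b (wU is w))" for a b
   using vw l by (intro slob_cong wder_lc)
  show "slo (frac s) (wU is (lc rho v ta w)) + ennreal (rho * ta) * slo (frac s) (wU is (lc 1 v (-1) w)) =
    ennreal rho * slo (frac s) (wU is v) + ennreal ta * slo (frac s) (wU is w)"
   unfolding e by (rule slob_split[OF L lm])
 qed
 have S': "ennreal (S (lc rho v ta w)) + ennreal (rho * ta) * ennreal (S (lc 1 v (-1) w)) = ennreal rho * ennreal (S v) + ennreal ta * ennreal (S w)"
  using S lm S0 by (simp add: ennreal_mult[symmetric] ennreal_plus[symmetric] del: ennreal_plus)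
 have "sqU s (lc rho v ta w) + ennreal (rho * ta) * sqU s (lc 1 v (-1) w) =
  (ennreal (S (lc rho v ta w)) + ennreal (rho * ta) * ennreal (S (lc 1 v (-1) w))) + c * (T (lc rho v ta w) + ennreal (rho * ta) * T (lc 1 v (-1) w))"
  using vw by (simp add: q algebra_simps)
 also have "... = ennreal rho * sqU s v + ennreal ta * sqU s w"
  unfolding S' T using vw by (simp add: q algebra_simps)
 finally show ?thesis .
qed

lemma sob_sq_cong: "ae_eq U v w ==> sqU s v = sqU s w"
proof -
 assume e: "ae_eq U v w"
 have "v \<in> Hk U (nat \<lfloor>s\<rfloor>) \<longleftrightarrow> w \<in> Hk U (nat \<lfloor>s\<rfloor>)" using Hk_cong e ae_eq_sym by blast
 thus ?thesis unfolding sob_sq_def wder_cong[OF e] by simp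
qed

lemma sob_norm_cong: "ae_eq U v w ==> sob_norm U s v = sob_norm U s w"
 by (simp add: sob_norm_def sob_sq_cong)

lemma Hs_Hk: "v \<in> Hs U s ==> v \<in> Hk U (nat \<lfloor>s\<rfloor>)"
 by (auto simp: Hs_def sob_sq_def Let_def split: if_splits)

lemma sob_sq_scale:
 assumes v: "v \<in> Hk U (nat \<lfloor>s\<rfloor>)"
 shows "sqU s (lc a v 0 v) = ennreal (a^2) * sqU s v"
proof -
 define m where "m = nat \<lfloor>s\<rfloor>"
 note v = v[folded m_def]
 have e: "(nU (wU is (lc a v 0 v)))^2 = a^2 * (nU (wU is v))^2" if "length is <= m" for "is"
 proof -
  have L: "wU is v \<in> L2 U" using v that by (auto intro: wder_L2)
  have "nU (wU is (lc a v 0 v)) = nU (lc a (wU is v) 0 (wU is v))"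
   using v that by (intro l2norm_cong wder_lc wder_L2[of _ m]) auto
  moreover have "(nU (lc a (wU is v) 0 (wU is v)))^2 = a^2 * (nU (wU is v))^2"
   using L unfolding l2norm_sq by (simp add: ip_lc_left ip_lc_right power2_eq_square)
  ultimately show ?thesis by (simp only:)
 qed
 have f: "slo (frac s) (wU is (lc a v 0 v)) = ennreal (a^2) * slo (frac s) (wU is v)" if "length is <= m" for "is"
 proof -
  have "slo (frac s) (wU is (lc a v 0 v)) = slo (frac s) (lc a (wU is v) 0 (wU is v))"
   using v that by (intro slob_cong wder_lc)
  also have "... = ennreal (a^2) * slo (frac s) (wU is v)"
   using v that by (intro slob_scale L2_meas wder_L2)
  finally show ?thesis .
 qed
 have 1: "(\<Sum>is | length is <= m. (nU (wU is (lc a v 0 v)))^2) = a^2 * (\<Sum>is | length is <= m. (nU (wU is v))^2)"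
  unfolding sum_distrib_left by (intro sum.cong refl) (simp add: e)
 have 2: "(\<Sum>is | length is = m. slo (frac s) (wU is (lc a v 0 v))) = ennreal (a^2) * (\<Sum>is | length is = m. slo (frac s) (wU is v))"
  unfolding sum_distrib_left by (intro sum.cong refl) (simp add: f)
 show ?thesis
  unfolding sob_sq_def Let_def m_def[symmetric] 1 2 using v
  by (simp add: ennreal_mult sum_nonneg distrib_left mult_ac)
qed

text \<open>a v + b w is the midpoint of 2 a v and 2 b w, to which the weighted identity applies
  after dropping a nonnegative term.\<close>

lemma sob_sq_lc_le:
 assumes v: "v \<in> Hk U (nat \<lfloor>s\<rfloor>)" and w: "w \<in> Hk U (nat \<lfloor>s\<rfloor>)"
 shows "sqU s (lc a v b w) <= ennreal (2 * a^2) * sqU s v + ennreal (2 * b^2) * sqU s w"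
proof -
 let ?v = "lc (2 * a) v 0 v" and ?w = "lc (2 * b) w 0 w"
 have e: "lc a v b w = lc (1/2) ?v (1/2) ?w" by (rule ext) (simp add: lc_def)
 have "sqU s (lc (1/2) ?v (1/2) ?w) <= sqU s (lc (1/2) ?v (1/2) ?w) + ennreal (1/2 * (1/2)) * sqU s (lc 1 ?v (-1) ?w)"
  by simp
 also have "... = ennreal (1/2) * sqU s ?v + ennreal (1/2) * sqU s ?w"
  using v w by (intro sob_sq_split) auto
 also have "... = ennreal (2 * a^2) * sqU s v + ennreal (2 * b^2) * sqU s w"
  unfolding sob_sq_scale[OF v] sob_sq_scale[OF w] mult.assoc[symmetric]
  by (simp add: ennreal_mult[symmetric] power_mult_distrib del: ennreal_half ennreal_divide_numeral)
 finally show ?thesis by (simp only: e)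
qed

lemma Hs_lc: "v \<in> Hs U s ==> w \<in> Hs U s ==> lc a v b w \<in> Hs U s"
proof -
 assume a: "v \<in> Hs U s" "w \<in> Hs U s"
 have "sqU s (lc a v b w) <= ennreal (2 * a^2) * sqU s v + ennreal (2 * b^2) * sqU s w"
  using a by (intro sob_sq_lc_le Hs_Hk)
 also have "... < \<infinity>" using a by (auto simp: Hs_def ennreal_mult_less_top)
 finally show ?thesis by (simp add: Hs_def)
qed

lemma sob_sq_int: "v \<in> Hk U k ==> sqU (real k) v = ennreal (\<Sum>is | length is <= k. (nU (wU is v))^2)"
 by (simp add: sob_sq_def)

lemma Hs_int: "Hs U (real k) = Hk U k"
 by (auto simp: Hs_def sob_sq_def Let_def split: if_splits)

lemma sob_norm_int: "v \<in> Hk U k ==> (sob_norm U (real k) v)^2 = (\<Sum>is | length is <= k. (nU (wU is v))^2)"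
 by (simp add: sob_norm_def sob_sq_int sum_nonneg)

lemma sob_norm_nonneg[simp]: "0 <= sob_norm U s v" by (simp add: sob_norm_def)

lemma wder_le_sob_norm: 
 assumes "v \<in> Hk U k" "length is <= k" shows "nU (wU is v) <= sob_norm U (real k) v"
proof (rule power2_le_imp_le)
 have "(nU (wU is v))^2 <= (\<Sum>is | length is <= k. (nU (wU is v))^2)"
  using assms(2) by (intro member_le_sum finite_lists_le) auto
 thus "(nU (wU is v))^2 <= (sob_norm U (real k) v)^2" by (simp add: sob_norm_int assms)
qed simp

lemma Hs0_Hk: "v \<in> Hs0 U (real k) ==> v \<in> Hk U k" by (simp add: Hs0_def Hs_int)

lemma test_Hk: "phi \<in> test_fun U ==> phi \<in> Hk U k" by (simp add: test_fun_smooth smooth_Hk)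

lemma Hs0_lc: 
 assumes "v \<in> Hs0 U (real k)" "w \<in> Hs0 U (real k)" shows "lc a v b w \<in> Hs0 U (real k)"
 unfolding Hs0_def Hs_int
proof (safe)
 show "lc a v b w \<in> Hk U k" using assms Hs0_Hk by simp
 fix ep :: real assume "0 < ep"
 \<comment> \<open>With this \<open>d\<close> the bound 2 (a^2 + b^2) d^2 obtained below is less
   than ep^2; the summand 1 covers a = b = 0.\<close>
 define d where "d = ep / (2 * (\<bar>a\<bar> + \<bar>b\<bar> + 1))"
 have d: "0 < d" using \<open>0 < ep\<close> by (simp add: d_def)
 obtain phi psi where t: "phi \<in> test_fun U" "psi \<in> test_fun U" "sob_norm U (real k) (v - phi) < d" "sob_norm U (real k) (w - psi) < d"
  using assms d unfolding Hs0_def by blast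
 have H: "v - phi \<in> Hk U k" "w - psi \<in> Hk U k" using assms t by (auto simp: diff_eq_lc test_Hk Hs0_Hk)
 let ?q = "%v. sqU (real k) v"
 have eq: "lc a v b w - lc a phi b psi = lc a (v - phi) b (w - psi)" by (rule ext) (simp add: lc_def algebra_simps)
 have n: "?q f = ennreal ((sob_norm U (real k) f)^2)" if "f \<in> Hk U k" for f
  by (simp only: sob_norm_int[OF that] sob_sq_int[OF that])
 have "?q (lc a (v - phi) b (w - psi)) <= ennreal (2 * a^2) * ?q (v - phi) + ennreal (2 * b^2) * ?q (w - psi)"
  using H by (intro sob_sq_lc_le) auto
 hence "(sob_norm U (real k) (lc a (v - phi) b (w - psi)))^2 <= 2 * a^2 * (sob_norm U (real k) (v - phi))^2 + 2 * b^2 * (sob_norm U (real k) (w - psi))^2"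
  using H by (simp add: n ennreal_mult[symmetric] ennreal_plus[symmetric] del: ennreal_plus)
 also have "... <= 2 * a^2 * d^2 + 2 * b^2 * d^2"
  using t by (intro add_mono mult_left_mono power_mono) auto
 also have "... = 2 * (a^2 + b^2) * d^2" by (simp add: algebra_simps)
 also have "... < (2 * (\<bar>a\<bar> + \<bar>b\<bar> + 1))^2 * d^2"
 proof (rule mult_strict_right_mono)
  have "a^2 + b^2 <= (\<bar>a\<bar> + \<bar>b\<bar>)^2" by (simp add: power2_sum)
  also have "... < (\<bar>a\<bar> + \<bar>b\<bar> + 1)^2" by (intro power_strict_mono) auto
  finally have "a^2 + b^2 < (\<bar>a\<bar> + \<bar>b\<bar> + 1)^2" .
  moreover have "(2 * (\<bar>a\<bar> + \<bar>b\<bar> + 1))^2 = 4 * (\<bar>a\<bar> + \<bar>b\<bar> + 1)^2" by (simp only: power_mult_distrib) simp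
  moreover have "0 <= a^2 + b^2" by simp
  moreover have "x < y ==> z = 4 * y ==> 0 <= x ==> 2 * x < z" for x y z :: real by linarith
  ultimately show "2 * (a^2 + b^2) < (2 * (\<bar>a\<bar> + \<bar>b\<bar> + 1))^2" by blast
 qed (use d in simp)
 also have "... = ep^2"
 proof -
  have "0 < \<bar>a\<bar> + \<bar>b\<bar> + 1" using abs_ge_zero[of a] abs_ge_zero[of b] by linarith
  hence "2 * (\<bar>a\<bar> + \<bar>b\<bar> + 1) ~= 0" by simp
  hence "2 * (\<bar>a\<bar> + \<bar>b\<bar> + 1) * d = ep" unfolding d_def by (rule nonzero_mult_div_cancel_left[of _ ep, unfolded times_divide_eq_right[symmetric]])
  thus ?thesis by (simp only: power_mult_distrib[symmetric])
 qed
 finally have f: "(sob_norm U (real k) (lc a (v - phi) b (w - psi)))^2 < ep^2" .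
 have "sob_norm U (real k) (lc a v b w - lc a phi b psi) < ep"
  unfolding eq by (rule power2_less_imp_less[OF f less_imp_le[OF \<open>0 < ep\<close>]])
 thus "\<exists>phi\<in>test_fun U. sob_norm U (real k) (lc a v b w - phi) < ep"
  using test_fun_lin[OF t(1,2), of a b] by (auto simp: lc_def[symmetric])
qed

lemma Hs0_cong:
 assumes "v \<in> Hs0 U (real k)" "ae_eq U v w" shows "w \<in> Hs0 U (real k)"
proof -
 have "ae_eq U (v - phi) (w - phi)" for phi using ae_eq_lc[OF assms(2) ae_eq_refl[of U phi], of 1 "-1"] by (simp add: diff_eq_lc)
 hence "sob_norm U (real k) (v - phi) = sob_norm U (real k) (w - phi)" for phi by (rule sob_norm_cong)
 thus ?thesis using assms Hk_cong by (auto simp: Hs0_def Hs_int)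
qed

lemma Hs0_approx:
 assumes "v \<in> Hs0 U (real k)" "0 < ep"
 obtains phi where "phi \<in> test_fun U" "!!is. length is <= k ==> nU (wU is v - pds (rev is) phi) < ep"
proof -
 obtain phi where phi: "phi \<in> test_fun U" "sob_norm U (real k) (v - phi) < ep" using assms unfolding Hs0_def by blast
 have H: "v \<in> Hk U k" "phi \<in> Hk U k" using assms phi by (auto simp: test_Hk Hs0_Hk)
 have "nU (wU is v - pds (rev is) phi) < ep" if "length is <= k" for "is"
 proof -
  have "ae_eq U (wU is (lc 1 v (-1) phi)) (lc 1 (wU is v) (-1) (wU is phi))"
   using H that by (rule wder_lc)
  also have "ae_eq U ... (lc 1 (wU is v) (-1) (pds (rev is) phi))"
   using phi by (intro ae_eq_lc ae_eq_refl wder_smooth test_fun_smooth)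
  finally (ae_eq_trans) have "nU (wU is (lc 1 v (-1) phi)) = nU (wU is v - pds (rev is) phi)"
   unfolding diff_eq_lc using H that by (intro l2norm_cong wder_L2[of _ k]) auto
  moreover have "nU (wU is (lc 1 v (-1) phi)) <= sob_norm U (real k) (v - phi)"
   unfolding diff_eq_lc using H that by (intro wder_le_sob_norm) auto
  ultimately show ?thesis using phi(2) by simp
 qed
 thus ?thesis using that phi by blast
qed

lemma Hs0_2_1: "v \<in> Hs0 U 2 ==> v \<in> Hs0 U 1"
proof -
 assume v: "v \<in> Hs0 U 2"
 have H: "v \<in> Hk U 2" using Hs0_Hk[of v 2] v by simp
 have le: "sob_norm U 1 f <= sob_norm U 2 f" if "f \<in> Hk U 2" for f
 proof (rule power2_le_imp_le)
  have "(\<Sum>is | length is <= 1. (nU (wU is f))^2) <= (\<Sum>is | length is <= 2. (nU (wU is f))^2)"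
   by (intro sum_mono2 finite_lists_le) auto
  thus "(sob_norm U 1 f)^2 <= (sob_norm U 2 f)^2"
   using sob_norm_int[OF that] sob_norm_int[OF Hk_mono[OF that, of 1]] by simp
 qed simp
 have "\<exists>phi\<in>test_fun U. sob_norm U 1 (v - phi) < ep" if e0: "0 < ep" for ep
 proof -
  obtain phi where "phi \<in> test_fun U" "sob_norm U 2 (v - phi) < ep" using v e0 by (auto simp: Hs0_def)
  moreover have "v - phi \<in> Hk U 2" using H \<open>phi \<in> test_fun U\<close> by (simp add: diff_eq_lc test_Hk)
  ultimately show ?thesis using le by force
 qed
 thus ?thesis using Hk_mono[OF H, of 1] Hs_int[of 1] by (auto simp: Hs0_def)
qed

lemma test_Hs0: "phi \<in> test_fun U ==> phi \<in> Hs0 U (real k)"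
proof -
 assume phi: "phi \<in> test_fun U"
 have z: "(%_. 0) \<in> Hk U k" by (intro smooth_Hk smooth_const)
 have "ae_eq U (wU is (%_. 0)) (%_. 0)" for "is"
  by (rule wder_eqI) (simp add: weak_deriv_def, simp add: ip_def)
 hence "nU (wU is (%_. 0)) = 0" if "length is <= k" for "is"
  using l2norm_cong[of "wU is (%_. 0)" "%_. 0"] wder_L2[OF z that] by (simp add: l2norm_def ip_def)
 hence "sob_norm U (real k) (%_. 0) = 0" using sob_norm_int[OF z] by simp
 moreover have "phi - phi = (%_. 0)" by (rule ext) simp
 ultimately have "sob_norm U (real k) (phi - phi) = 0" by (simp only:)
 hence "\<exists>phi'\<in>test_fun U. sob_norm U (real k) (phi - phi') < ep" if "0 < ep" for ep
  using that by (intro bexI[OF _ phi]) (simp only:)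
 thus ?thesis using test_Hk[OF phi] unfolding Hs0_def Hs_int by blast
qed

end

section \<open>Density of the test functions, Poincare inequality and gradients\<close>

context bdom
begin

lemma Hs0_approx_seq:
 assumes "v \<in> Hs0 U (real k)"
 obtains phi where "!!n::nat. phi n \<in> test_fun U" "!!is. length is <= k ==> (%n. nU (wU is v - pds (rev is) (phi n))) ----> 0"
proof -
 have "\<exists>phi. phi \<in> test_fun U \<and> (\<forall>is. length is <= k --> nU (wU is v - pds (rev is) phi) < inverse (real (Suc n)))" for n
  using Hs0_approx[OF assms, of "inverse (real (Suc n))"] by (metis inverse_positive_iff_positive of_nat_0_less_iff zero_less_Suc)
 then obtain phi where phi: "!!n. phi n \<in> test_fun U" "!!n is. length is <= k ==> nU (wU is v - pds (rev is) (phi n)) < inverse (real (Suc n))"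
  by metis
 have "(%n. nU (wU is v - pds (rev is) (phi n))) ----> 0" if "length is <= k" for "is"
 proof (rule tendsto_sandwich[OF _ _ tendsto_const LIMSEQ_inverse_real_of_nat])
  show "\<forall>\<^sub>F n in sequentially. 0 <= nU (wU is v - pds (rev is) (phi n))" by simp
  show "\<forall>\<^sub>F n in sequentially. nU (wU is v - pds (rev is) (phi n)) <= inverse (real (Suc n))"
   using phi(2)[OF that] by (intro always_eventually allI less_imp_le)
 qed
 with phi(1) that show ?thesis by blast
qed

lemma ip_tendsto:
 assumes "v \<in> L2 U" "!!n. vn n \<in> L2 U" "w \<in> L2 U" "(%n. nU (v - vn n)) ----> 0"
 shows "(%n. ip U (vn n) w) ----> ip U v w"
proof -
 have "(%n. ip U v w - ip U (vn n) w) ----> 0"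
 proof (rule Lim_null_comparison)
  show "(%n. nU (v - vn n) * nU w) ----> 0" using tendsto_mult_left_zero[OF assms(4)] by simp
  show "\<forall>\<^sub>F n in sequentially. norm (ip U v w - ip U (vn n) w) <= nU (v - vn n) * nU w"
  proof (intro always_eventually allI)
   fix n
   have "ip U v w - ip U (vn n) w = ip U (v - vn n) w" using assms by (simp add: diff_eq_lc ip_lc_left)
   thus "norm (ip U v w - ip U (vn n) w) <= nU (v - vn n) * nU w"
    using Cauchy_Schwarz[of "v - vn n" w] assms by (simp add: diff_eq_lc)
  qed
 qed
 from tendsto_diff[OF tendsto_const[of "ip U v w"] this] show ?thesis by simp
qed

lemma l2norm_tendsto:
 assumes "v \<in> L2 U" "!!n. vn n \<in> L2 U" "(%n. nU (v - vn n)) ----> 0"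
 shows "(%n. nU (vn n)) ----> nU v"
proof -
 have "(%n. nU (vn n) - nU v) ----> 0"
 proof (rule Lim_null_comparison[OF _ assms(3)], intro always_eventually allI)
  fix n
  have z: "f - (%_. 0) = f" for f :: scalar_field by (rule ext) simp
  have "nU (vn n) <= nU (vn n - v) + nU v" "nU v <= nU (v - vn n) + nU (vn n)"
   using l2norm_triangle[of "vn n" v "%_. 0"] l2norm_triangle[of v "vn n" "%_. 0"] assms(1,2) by (auto simp: z)
  thus "norm (nU (vn n) - nU v) <= nU (v - vn n)"
   by (simp add: l2norm_minus_commute[of "vn n" v] abs_le_iff)
 qed
 thus ?thesis by (simp add: LIM_zero_iff)
qed

text \<open>Only \<xi> vanishes on the boundary. It is approximated by test functions, for which the
  identity comes from the definition of the weak derivatives of \<open>z\<close>. It will move the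
  derivative of a projection error onto the smoothed test function.\<close>

lemma wder_by_parts:
 assumes \<xi>: "\<xi> \<in> Hs0 U 1" and z: "z \<in> Hk U 2"
 shows "ip U (wU [i] \<xi>) (wU [i] z) = - ip U \<xi> (wU [i, i] z)"
proof -
 have \<xi>': "\<xi> \<in> Hs0 U (real 1)" using \<xi> by simp
 obtain phi where phi: "!!n::nat. phi n \<in> test_fun U" 
   "!!is. length is <= 1 ==> (%n. nU (wU is \<xi> - pds (rev is) (phi n))) ----> 0"
  using Hs0_approx_seq[OF \<xi>'] by blast
 have H: "\<xi> \<in> Hk U 1" using Hs0_Hk[OF \<xi>'] .
 have L: "wU [i] \<xi> \<in> L2 U" "wU [] \<xi> \<in> L2 U" "\<xi> \<in> L2 U" using H by (auto intro: wder_L2 Hk_L2)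
 have Z: "wU [i] z \<in> L2 U" "wU [i, i] z \<in> L2 U" using z by (auto intro: wder_L2)
 have wd: "weak_deriv U [i] z (wU [i] z)" "weak_deriv U [i, i] z (wU [i, i] z)" using z by (auto intro: Hk_wder)
 have e: "ip U (pds [i] (phi n)) (wU [i] z) = - ip U (phi n) (wU [i, i] z)" for n
 proof -
  have "ip U z (pds [i] (pds [i] (phi n))) = - ip U (wU [i] z) (pds [i] (phi n))"
   using wd(1) test_fun_pds[OF phi(1)[of n], of "[i]"] unfolding weak_deriv_def by fastforce
  moreover have "ip U z (pds [i, i] (phi n)) = ip U (wU [i, i] z) (phi n)"
   using wd(2) phi(1)[of n] unfolding weak_deriv_def by fastforce
  moreover have "pds [i] (pds [i] (phi n)) = pds [i, i] (phi n)" by simp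
  ultimately show ?thesis by (simp only: ip_commute[of "pds [i] (phi n)"] ip_commute[of "phi n"])
 qed
 have "(%n. ip U (pds [i] (phi n)) (wU [i] z)) ----> ip U (wU [i] \<xi>) (wU [i] z)"
  using phi(2)[of "[i]"] by (intro ip_tendsto L Z test_L2 phi) simp
 moreover have "(%n. - ip U (phi n) (wU [i, i] z)) ----> - ip U (wU [] \<xi>) (wU [i, i] z)"
  using phi(2)[of "[]"] by (intro tendsto_minus ip_tendsto L Z test_L20 phi) simp
 moreover have "ip U (wU [] \<xi>) (wU [i, i] z) = ip U \<xi> (wU [i, i] z)"
  using L Z by (intro ip_cong wder_Nil) auto
 ultimately show ?thesis unfolding e using LIMSEQ_unique by metis
qed

text \<open>The derivative of x_i phi^2 in direction i has integral 0, so the squared norm of phi is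
  -2 times the product of x_i phi with the derivative of phi, and |x_i| is at most R on
  \<open>U\<close>.\<close>

lemma Poincare_test:
 assumes phi: "phi \<in> test_fun U" and R: "!!x. x \<in> U ==> norm x <= R"
 shows "nU phi <= 2 * R * nU (pds [i] phi)"
proof (cases "nU phi = 0")
 case True
 have "0 <= R \<or> U = {}" using R norm_ge_zero order_trans by blast
 thus ?thesis
 proof
  assume "U = {}"
  thus ?thesis unfolding l2norm_def ip_def by simp
 qed (simp add: True)
next
 case False
 have s: "smooth phi" using phi by (rule test_fun_smooth)
 define F where "F = (%x :: pt. x $ i * (phi x * phi x))"
 define F' where "F' = (%x (h :: pt). x $ i * (phi x * FD phi (at x) h + FD phi (at x) h * phi x) + h $ i * (phi x * phi x))"
 have d0: "(phi has_derivative FD phi (at x)) (at x)" for x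
  using smooth_has_derivative[OF s, of "[]" x] by simp
 have d: "(F has_derivative F' x) (at x)" for x
  unfolding F_def F'_def
  by (intro has_derivative_mult d0 bounded_linear_imp_has_derivative bounded_linear_vec_nth)
 have e: "F' x (axis i 1) = 2 * ((x $ i * phi x) * pds [i] phi x) + phi x * phi x" for x by (simp add: F'_def algebra_simps)
 have c: "continuous_on UNIV (%x. 2 * ((x $ i * phi x) * pds [i] phi x) + phi x * phi x)"
  by (intro continuous_intros smooth_continuous smooth_continuous0 s)
 have cx: "continuous_on UNIV (%x :: pt. x $ i * phi x)" by (intro continuous_intros smooth_continuous0 s)
 obtain B where B: "!!x. phi x ~= 0 ==> norm x <= B" using test_bounded_support[OF phi] by blast
 have "0 = (LINT x|lborel. F' x (axis i 1))"
  by (rule integral_directional_derivative_zero[OF d, symmetric, where R=B]) (use c B in \<open>auto simp only: e F_def mult_eq_0_iff\<close>)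
 also have "... = (LINT x|MU. 2 * ((x $ i * phi x) * pds [i] phi x) + phi x * phi x)"
  unfolding e by (rule lint_on_UNIV[symmetric, OF c]) (use test_fun_zero[OF phi] in \<open>simp del: pds.simps\<close>)
 also have "... = 2 * ip U (%x. x $ i * phi x) (pds [i] phi) + ip U phi phi"
 proof -
  have "integrable MU (%x. 2 * ((x $ i * phi x) * pds [i] phi x))"
   by (intro integrable_mult_right L2_mult_integrable continuous_L2 cx test_L2 phi)
  moreover have "integrable MU (%x. phi x * phi x)" by (intro L2_mult_integrable test_L20 phi)
  ultimately show ?thesis by (simp add: ip_def del: pds.simps)
 qed
 finally have "ip U phi phi = - 2 * ip U (%x. x $ i * phi x) (pds [i] phi)" by simp
 hence "(nU phi)^2 <= 2 * \<bar>ip U (%x. x $ i * phi x) (pds [i] phi)\<bar>" unfolding l2norm_sq by linarith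
 also have "... <= 2 * (nU (%x. x $ i * phi x) * nU (pds [i] phi))"
  by (intro mult_left_mono Cauchy_Schwarz continuous_L2 cx test_L2 phi) auto
 finally have le1: "(nU phi)^2 <= 2 * (nU (%x. x $ i * phi x) * nU (pds [i] phi))" .
 have le2: "nU (%x. x $ i * phi x) <= R * nU phi"
 proof -
  have "U ~= {}" using False unfolding l2norm_def ip_def by auto
  hence R0: "0 <= R" using R norm_ge_zero order_trans by blast
  have "ip U (%x. x $ i * phi x) (%x. x $ i * phi x) <= (LINT x|MU. R^2 * (phi x * phi x))"
   unfolding ip_def
  proof (rule integral_mono_AE)
   show "integrable MU (%x. x $ i * phi x * (x $ i * phi x))" by (intro L2_mult_integrable continuous_L2 cx)
   show "integrable MU (%x. R^2 * (phi x * phi x))" by (intro integrable_mult_right L2_mult_integrable test_L20 phi)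
   show "AE x in MU. x $ i * phi x * (x $ i * phi x) <= R^2 * (phi x * phi x)"
   proof (rule AE_I2)
    fix x assume "x \<in> space MU"
    hence "\<bar>x $ i\<bar> <= R" using R[of x] component_le_norm_cart[of x i] by simp
    hence "(x $ i)^2 <= R^2" using R0 by (simp add: abs_le_square_iff[symmetric])
    hence "(x $ i)^2 * (phi x * phi x) <= R^2 * (phi x * phi x)" by (intro mult_right_mono) auto
    thus "x $ i * phi x * (x $ i * phi x) <= R^2 * (phi x * phi x)" by (simp add: power2_eq_square mult_ac)
   qed
  qed
  also have "... = (R * nU phi)^2" unfolding power_mult_distrib l2norm_sq by (simp add: ip_def)
  finally have f: "(nU (%x. x $ i * phi x))^2 <= (R * nU phi)^2" by (simp only: l2norm_sq)
  show ?thesis by (rule power2_le_imp_le[OF f]) (simp add: R0)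
 qed
 have pos: "0 < nU phi" using False l2norm_nonneg[of phi] by linarith
 have "nU (%x. x $ i * phi x) * nU (pds [i] phi) <= R * nU phi * nU (pds [i] phi)"
  by (rule mult_right_mono[OF le2 l2norm_nonneg])
 with le1 have "nU phi * nU phi <= nU phi * (2 * R * nU (pds [i] phi))"
  unfolding power2_eq_square by (simp only: mult_ac)
 thus ?thesis using pos by (simp only: mult_le_cancel_left_pos)
qed

text \<open>The additional index is appended at the end because, after the reversal of the list, it
  is the derivative that the smooth approximations take last.\<close>

lemma Poincare:
 assumes R: "!!x. x \<in> U ==> norm x <= R" and v: "v \<in> Hs0 U (real k)" and l: "length is < k"
 shows "nU (wU is v) <= 2 * R * nU (wU (is @ [i]) v)"
proof -
 obtain phi where phi: "!!n::nat. phi n \<in> test_fun U" 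
   "!!is. length is <= k ==> (%n. nU (wU is v - pds (rev is) (phi n))) ----> 0"
  using Hs0_approx_seq[OF v] by blast
 have H: "v \<in> Hk U k" using Hs0_Hk[OF v] .
 have L: "wU is v \<in> L2 U" "wU (is @ [i]) v \<in> L2 U" using H l by (auto intro: wder_L2)
 have r: "pds (rev (is @ [i])) (phi n) = pds [i] (pds (rev is) (phi n))" for n by simp
 have "(%n. nU (pds (rev is) (phi n))) ----> nU (wU is v)"
  using phi(2)[of "is"] l by (intro l2norm_tendsto L test_L2 phi) simp
 moreover have "(%n. 2 * R * nU (pds (rev (is @ [i])) (phi n))) ----> 2 * R * nU (wU (is @ [i]) v)"
  using phi(2)[of "is @ [i]"] l by (intro tendsto_mult_left l2norm_tendsto L test_L2 phi) (simp del: rev_append)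
 ultimately show ?thesis
 proof (rule LIMSEQ_le)
  show "\<exists>N. \<forall>n\<ge>N. nU (pds (rev is) (phi n)) <= 2 * R * nU (pds (rev (is @ [i])) (phi n))"
   unfolding r by (intro exI allI impI Poincare_test[OF test_fun_pds[OF phi(1)] R])
 qed
qed

lemma grad_ip_commute: "grad_ip U v w = grad_ip U w v" by (simp add: grad_ip_def ip_commute)

lemma grad_ip_lc_left:
 assumes "v \<in> Hk U 1" "w \<in> Hk U 1" "z \<in> Hk U 1"
 shows "grad_ip U (lc a v b w) z = a * grad_ip U v z + b * grad_ip U w z"
proof -
 have "ip U (wU [i] (lc a v b w)) (wU [i] z) = a * ip U (wU [i] v) (wU [i] z) + b * ip U (wU [i] w) (wU [i] z)" for i
 proof -
  have "ip U (wU [i] (lc a v b w)) (wU [i] z) = ip U (lc a (wU [i] v) b (wU [i] w)) (wU [i] z)"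
   using assms by (intro ip_cong wder_lc wder_L2[of _ 1] L2_lc) auto
  also have "... = a * ip U (wU [i] v) (wU [i] z) + b * ip U (wU [i] w) (wU [i] z)"
   using assms by (intro ip_lc_left wder_L2[of _ 1]) auto
  finally show ?thesis .
 qed
 thus ?thesis by (simp add: grad_ip_def sum.distrib sum_distrib_left)
qed

lemma grad_ip_lc_right:
 assumes "v \<in> Hk U 1" "w \<in> Hk U 1" "z \<in> Hk U 1"
 shows "grad_ip U z (lc a v b w) = a * grad_ip U z v + b * grad_ip U z w"
 using grad_ip_lc_left[OF assms] by (simp add: grad_ip_commute)

lemma grad_ip_self_nonneg: "0 <= grad_ip U v v" by (simp add: grad_ip_def sum_nonneg ip_self_nonneg)

lemma grad_norm_nonneg[simp]: "0 <= grad_norm U v" by (simp add: grad_norm_def grad_ip_self_nonneg)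

lemma grad_norm_sq: "(grad_norm U v)^2 = grad_ip U v v" by (simp add: grad_norm_def grad_ip_self_nonneg)

lemma grad_norm_sq2: "(grad_norm U v)^2 = (nU (wU [1] v))^2 + (nU (wU [2] v))^2"
 by (simp add: grad_norm_sq l2norm_sq grad_ip_def sum_2)

lemma wder_le_grad_norm: "nU (wU [i] v) <= grad_norm U v"
proof (rule power2_le_imp_le)
 have "i = 1 \<or> i = 2" using exhaust_2 by blast
 thus "(nU (wU [i] v))^2 <= (grad_norm U v)^2" unfolding grad_norm_sq2 by auto
qed simp

lemma grad_norm_le_sum: "grad_norm U v <= nU (wU [1] v) + nU (wU [2] v)"
 by (rule power2_le_imp_le) (simp_all add: grad_norm_sq2 power2_sum)

lemma grad_Cauchy_Schwarz:
 assumes "v \<in> Hk U 1" "w \<in> Hk U 1"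
 shows "\<bar>grad_ip U v w\<bar> <= grad_norm U v * grad_norm U w"
proof -
 let ?a = "nU (wU [1] v)" and ?b = "nU (wU [2] v)" and ?c = "nU (wU [1] w)" and ?d = "nU (wU [2] w)"
 have "\<bar>ip U (wU [i] v) (wU [i] w)\<bar> <= nU (wU [i] v) * nU (wU [i] w)" for i
  using assms by (intro Cauchy_Schwarz wder_L2[of _ 1]) auto
 from this[of 1] this[of 2] have "\<bar>grad_ip U v w\<bar> <= ?a * ?c + ?b * ?d"
  by (simp add: grad_ip_def sum_2)
 also have "... <= grad_norm U v * grad_norm U w"
 proof (rule power2_le_imp_le)
  have "0 <= (?a * ?d - ?b * ?c)^2" by simp
  hence "(?a * ?c + ?b * ?d)^2 <= (?a^2 + ?b^2) * (?c^2 + ?d^2)" by (simp add: power2_eq_square algebra_simps)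
  thus "(?a * ?c + ?b * ?d)^2 <= (grad_norm U v * grad_norm U w)^2"
   by (simp only: power_mult_distrib grad_norm_sq2)
 qed simp
 finally show ?thesis .
qed

lemma grad_ip_cong: "ae_eq U v v' ==> ae_eq U w w' ==> grad_ip U v w = grad_ip U v' w'"
 by (simp add: grad_ip_def wder_cong)

lemma grad_norm_cong: "ae_eq U v v' ==> grad_norm U v = grad_norm U v'"
 by (simp add: grad_norm_def grad_ip_cong)

lemma hess_ip_cong: "ae_eq U v v' ==> ae_eq U w w' ==> hess_ip U v w = hess_ip U v' w'"
 by (simp add: hess_ip_def wder_cong)

lemma grad_ip_test:
 assumes v: "v \<in> Hk U 1" and phi: "phi \<in> test_fun U"
 shows "grad_ip U v phi = - ip U v (lap phi)"
proof -
 have "ip U (wU [i] v) (wU [i] phi) = - ip U v (pds [i, i] phi)" for i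
 proof -
  have "ip U (wU [i] v) (wU [i] phi) = ip U (wU [i] v) (pds [i] phi)"
   using wder_smooth[OF test_fun_smooth[OF phi], of "[i]"] v test_L2[OF phi, of "[i]"]
   by (intro ip_cong ae_eq_refl) (simp_all add: wder_L2[of _ 1] test_Hk[OF phi])
  moreover have "ip U v (pds [i] (pds [i] phi)) = - ip U (wU [i] v) (pds [i] phi)"
   using Hk_wder[OF v, of "[i]"] test_fun_pds[OF phi, of "[i]"] unfolding weak_deriv_def by fastforce
  ultimately show ?thesis by simp
 qed
 moreover have "lap phi = lc 1 (pds [1, 1] phi) 1 (pds [2, 2] phi)" by (rule ext) (simp add: lap_def lc_def sum_2)
 moreover have "pds [1, 1] phi \<in> L2 U" "pds [2, 2] phi \<in> L2 U" "v \<in> L2 U" using phi v by (auto intro: test_L2 Hk_L2 simp del: pds.simps)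
 ultimately show ?thesis by (simp add: grad_ip_def sum_2 ip_lc_right del: pds.simps)
qed

lemma Hs0_1_seq:
 assumes v: "v \<in> Hs0 U 1"
 obtains phi where "!!n::nat. phi n \<in> test_fun U" "(%n. nU (v - phi n)) ----> 0" "(%n. grad_norm U (v - phi n)) ----> 0"
proof -
 have v1: "v \<in> Hs0 U (real 1)" using v by simp
 obtain phi where phi: "!!n::nat. phi n \<in> test_fun U" 
   "!!is. length is <= 1 ==> (%n. nU (wU is v - pds (rev is) (phi n))) ----> 0"
  using Hs0_approx_seq[OF v1] by blast
 have H: "v \<in> Hk U 1" using Hs0_Hk[OF v1] .
 have 0: "nU (wU [] v - pds (rev []) (phi n)) = nU (v - phi n)" for n
  unfolding diff_eq_lc using wder_Nil[OF Hk_L2[OF H]] wder_L2[OF H, of "[]"] test_L20[OF phi(1)[of n]]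
  by (intro l2norm_cong) (simp_all add: ae_eq_lc)
 have 1: "nU (wU [i] v - pds (rev [i]) (phi n)) = nU (wU [i] (v - phi n))" for n i
 proof -
  have "ae_eq U (wU [i] (lc 1 v (-1) (phi n))) (lc 1 (wU [i] v) (-1) (wU [i] (phi n)))"
   by (rule wder_lc[OF H test_Hk[OF phi(1)]]) simp
  also have "ae_eq U ... (lc 1 (wU [i] v) (-1) (pds (rev [i]) (phi n)))"
   by (intro ae_eq_lc ae_eq_refl wder_smooth test_fun_smooth[OF phi(1)])
  finally (ae_eq_trans) show ?thesis
   unfolding diff_eq_lc using wder_L2[OF Hk_lc[OF H test_Hk[OF phi(1)[of n]]], of "[i]" 1 "-1"]
   by (intro l2norm_cong[symmetric]) simp_all
 qed
 have "(%n. grad_norm U (v - phi n)) ----> 0"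
 proof (rule Lim_null_comparison)
  show "(%n. nU (wU [1] (v - phi n)) + nU (wU [2] (v - phi n))) ----> 0"
   using tendsto_add[OF phi(2)[of "[1]"] phi(2)[of "[2]"]] unfolding 1 by simp
  show "\<forall>\<^sub>F n in sequentially. norm (grad_norm U (v - phi n)) <= nU (wU [1] (v - phi n)) + nU (wU [2] (v - phi n))"
   using grad_norm_le_sum by (intro always_eventually allI) simp
 qed
 moreover have "(%n. nU (v - phi n)) ----> 0" using phi(2)[of "[]"] unfolding 0 by simp
 ultimately show ?thesis using that phi(1) by blast
qed

lemma grad_ip_tendsto:
 assumes "v \<in> Hk U 1" "!!n. vn n \<in> Hk U 1" "w \<in> Hk U 1" "(%n. grad_norm U (v - vn n)) ----> 0"
 shows "(%n. grad_ip U w (vn n)) ----> grad_ip U w v"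
proof -
 have "(%n. grad_ip U w v - grad_ip U w (vn n)) ----> 0"
 proof (rule Lim_null_comparison)
  show "(%n. grad_norm U w * grad_norm U (v - vn n)) ----> 0" using tendsto_mult_right_zero[OF assms(4)] by simp
  show "\<forall>\<^sub>F n in sequentially. norm (grad_ip U w v - grad_ip U w (vn n)) <= grad_norm U w * grad_norm U (v - vn n)"
  proof (intro always_eventually allI)
   fix n
   have "grad_ip U w v - grad_ip U w (vn n) = grad_ip U w (v - vn n)" using assms by (simp add: diff_eq_lc grad_ip_lc_right)
   thus "norm (grad_ip U w v - grad_ip U w (vn n)) <= grad_norm U w * grad_norm U (v - vn n)"
    using grad_Cauchy_Schwarz[of w "v - vn n"] assms by (simp add: diff_eq_lc)
  qed
 qed
 from tendsto_diff[OF tendsto_const[of "grad_ip U w v"] this] show ?thesis by simp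
qed

lemma grad_norm_lc:
 assumes "v \<in> Hk U 1" "w \<in> Hk U 1"
 shows "grad_norm U (lc a v b w) <= \<bar>a\<bar> * grad_norm U v + \<bar>b\<bar> * grad_norm U w"
proof (rule power2_le_imp_le)
 have "(grad_norm U (lc a v b w))^2 = a^2 * (grad_norm U v)^2 + b^2 * (grad_norm U w)^2 + 2 * (a * b * grad_ip U v w)"
  using assms unfolding grad_norm_sq by (simp add: grad_ip_lc_left grad_ip_lc_right grad_ip_commute[of w v] power2_eq_square algebra_simps)
 also have "a * b * grad_ip U v w <= \<bar>a\<bar> * \<bar>b\<bar> * (grad_norm U v * grad_norm U w)"
 proof -
  have "a * b * grad_ip U v w <= \<bar>a * b * grad_ip U v w\<bar>" by simp
  also have "... <= \<bar>a\<bar> * \<bar>b\<bar> * (grad_norm U v * grad_norm U w)"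
   unfolding abs_mult by (intro mult_left_mono grad_Cauchy_Schwarz assms) auto
  finally show ?thesis .
 qed
 finally show "(grad_norm U (lc a v b w))^2 <= (\<bar>a\<bar> * grad_norm U v + \<bar>b\<bar> * grad_norm U w)^2"
  by (simp add: power2_sum power_mult_distrib algebra_simps)
qed simp

lemma grad_norm_tendsto:
 assumes "v \<in> Hk U 1" "!!n. vn n \<in> Hk U 1" "(%n. grad_norm U (v - vn n)) ----> 0"
 shows "(%n. grad_norm U (vn n)) ----> grad_norm U v"
proof -
 have "(%n. grad_norm U (vn n) - grad_norm U v) ----> 0"
 proof (rule Lim_null_comparison[OF _ assms(3)], intro always_eventually allI)
  fix n
  have e: "lc (-1) (v - vn n) 1 v = vn n" "lc 1 (v - vn n) 1 (vn n) = v" by (auto simp: lc_def)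
  have H: "v - vn n \<in> Hk U 1" using assms by (simp add: diff_eq_lc)
  show "norm (grad_norm U (vn n) - grad_norm U v) <= grad_norm U (v - vn n)"
   using grad_norm_lc[OF H assms(1), of "-1" 1] grad_norm_lc[OF H assms(2)[of n], of 1 1] unfolding e by (simp add: abs_le_iff)
 qed
 thus ?thesis by (simp add: LIM_zero_iff)
qed

end

section \<open>Completeness of L^2 and closedness of Sobolev balls\<close>

context bdom
begin

lemma nn_integral_sq: "v \<in> L2 U ==> (\<integral>\<^sup>+x. ennreal ((v x)^2) \<partial>MU) = ennreal ((nU v)^2)"
 unfolding l2norm_sq ip_def by (subst nn_integral_eq_integral) (auto simp: L2_def power2_eq_square)

lemma Fatou_L2:
 assumes f: "!!k::nat. f k \<in> L2 U" and lim: "AE x in MU. (%k. f k x) ----> h x"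
  and h: "h \<in> borel_measurable MU" and B: "0 <= B" "!!k. nU (f k) <= B"
 shows "h \<in> L2 U" "nU h <= B"
proof -
 have m: "(%x. ennreal ((f k x)^2)) \<in> borel_measurable MU" for k
  using L2_meas[OF f] by measurable
 have "AE x in MU. ennreal ((h x)^2) = liminf (%k. ennreal ((f k x)^2))"
  using lim
 proof eventually_elim
  case (elim x)
  have "(%k. ennreal ((f k x)^2)) ----> ennreal ((h x)^2)" by (intro tendsto_ennrealI tendsto_power elim)
  thus ?case by (rule lim_imp_Liminf[OF sequentially_bot, symmetric])
 qed
 hence "(\<integral>\<^sup>+x. ennreal ((h x)^2) \<partial>MU) = (\<integral>\<^sup>+x. liminf (%k. ennreal ((f k x)^2)) \<partial>MU)"
  by (rule nn_integral_cong_AE)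
 also have "... <= liminf (%k. \<integral>\<^sup>+x. ennreal ((f k x)^2) \<partial>MU)"
  by (rule nn_integral_liminf[OF m])
 also have "... <= liminf (%k::nat. ennreal (B^2))"
  using B by (intro Liminf_mono always_eventually allI) (simp add: nn_integral_sq[OF f] ennreal_leI power_mono)
 also have "... = ennreal (B^2)" by (simp add: Liminf_const)
 finally have le: "(\<integral>\<^sup>+x. ennreal ((h x)^2) \<partial>MU) <= ennreal (B^2)" .
 have "integrable MU (%x. (h x)^2)"
  by (rule integrableI_bounded) (use h le in \<open>auto intro: le_less_trans\<close>)
 thus hL: "h \<in> L2 U" using h by (simp add: L2_def)
 have "(nU h)^2 <= B^2" using le by (simp add: nn_integral_sq[OF hL])
 thus "nU h <= B" by (rule power2_le_imp_le) (rule B(1))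
qed

text \<open>Fatou's lemma is applied twice, in the inner variable for almost every outer point and
  then in the outer one.\<close>

lemma Fatou_slob:
 assumes f: "!!k::nat. f k \<in> borel_measurable MU" and lim: "AE x in MU. (%k. f k x) ----> h x"
  and B: "!!k. slo th (f k) <= B"
 shows "slo th h <= B"
proof -
 define p where "p = 2 + 2 * th"
 define K where "K = (%f (x :: pt) y. ennreal ((f x - f y)^2 / norm (x - y) powr p))"
 have mK: "(%x. \<integral>\<^sup>+y. K (f k) x y \<partial>MU) \<in> borel_measurable MU"
   "(%y. K (f k) x y) \<in> borel_measurable MU" for k x
  using slob_measurable[OF f, where p=p] by (auto simp: K_def)
 have sl: "slo th f = (\<integral>\<^sup>+x. \<integral>\<^sup>+y. K f x y \<partial>MU \<partial>MU)" for f
  by (simp add: slobodeckij_sq_def p_def K_def)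
 have inner: "AE x in MU. (\<integral>\<^sup>+y. K h x y \<partial>MU) <= liminf (%k. \<integral>\<^sup>+y. K (f k) x y \<partial>MU)"
  using lim
 proof eventually_elim
  case (elim x)
  have "AE y in MU. K h x y = liminf (%k. K (f k) x y)"
   using lim
  proof eventually_elim
   case y: (elim y)
   have "(%k. K (f k) x y) ----> K h x y"
    unfolding K_def divide_inverse by (intro tendsto_ennrealI tendsto_mult_right tendsto_power tendsto_diff elim y)
   thus ?case by (rule lim_imp_Liminf[OF sequentially_bot, symmetric])
  qed
  hence "(\<integral>\<^sup>+y. K h x y \<partial>MU) = (\<integral>\<^sup>+y. liminf (%k. K (f k) x y) \<partial>MU)"
   by (rule nn_integral_cong_AE)
  also have "... <= liminf (%k. \<integral>\<^sup>+y. K (f k) x y \<partial>MU)" by (rule nn_integral_liminf[OF mK(2)])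
  finally show ?case .
 qed
 have "slo th h <= (\<integral>\<^sup>+x. liminf (%k. \<integral>\<^sup>+y. K (f k) x y \<partial>MU) \<partial>MU)"
  unfolding sl using inner by (rule nn_integral_mono_AE)
 also have "... <= liminf (%k. \<integral>\<^sup>+x. \<integral>\<^sup>+y. K (f k) x y \<partial>MU \<partial>MU)"
  by (rule nn_integral_liminf[OF mK(1)])
 also have "... <= liminf (%k::nat. B)"
  using B unfolding sl by (intro Liminf_mono always_eventually allI)
 finally show ?thesis by (simp add: Liminf_const)
qed

lemma L1_le_L2: "f \<in> L2 U ==> (LINT x|MU. \<bar>f x\<bar>) <= nU f * nU (%_. 1)"
proof -
 assume f: "f \<in> L2 U"
 have a: "(%x. \<bar>f x\<bar>) \<in> L2 U" using f by (auto simp: L2_def)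
 have "(%_. 1) \<in> L2 U" by (intro continuous_L2 continuous_intros)
 from Cauchy_Schwarz[OF a this] have "ip U (%x. \<bar>f x\<bar>) (%_. 1) <= nU (%x. \<bar>f x\<bar>) * nU (%_. 1)" by linarith
 thus ?thesis by (simp add: ip_def l2norm_def)
qed

lemma L2_integrable: "f \<in> L2 U ==> integrable MU f"
 using L2_mult_integrable[of f "%_. 1"] continuous_L2[of "%_. 1"] by simp

lemma L2_subseq:
 assumes f: "!!n::nat. f n \<in> L2 U" and h: "h \<in> L2 U" and lim: "(%n. nU (h - f n)) ----> 0"
 obtains r :: "nat => nat" where "strict_mono r" "AE x in MU. (%n. f (r n) x) ----> h x"
proof -
 have d: "h - f n \<in> L2 U" for n using f h by (simp add: diff_eq_lc)
 have "\<exists>r::nat=>nat. strict_mono r \<and> (AE x in MU. (%n. (h - f (r n)) x) ----> 0)"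
 proof (rule tendsto_L1_AE_subseq)
  show "integrable MU (h - f n)" for n by (rule L2_integrable[OF d])
  show "(%n. LINT x|MU. norm ((h - f n) x)) ----> 0"
  proof (rule Lim_null_comparison)
   show "(%n. nU (h - f n) * nU (%_. 1)) ----> 0" using tendsto_mult_left_zero[OF lim] .
   show "\<forall>\<^sub>F n in sequentially. norm (LINT x|MU. norm ((h - f n) x)) <= nU (h - f n) * nU (%_. 1)"
    using L1_le_L2[OF d] by (intro always_eventually allI) (simp add: integral_nonneg_AE)
  qed
 qed
 then obtain r :: "nat => nat" where r: "strict_mono r" "AE x in MU. (%n. (h - f (r n)) x) ----> 0" by blast
 from r(2) have "AE x in MU. (%n. f (r n) x) ----> h x"
 proof eventually_elim
  case (elim x)
  from tendsto_diff[OF tendsto_const[of "h x"] elim] show ?case by simp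
 qed
 with r(1) that show ?thesis by blast
qed

text \<open>On a set of finite measure an L^2 Cauchy sequence is Cauchy in L^1 and so has an almost
  everywhere convergent subsequence. Fatou's lemma, applied to the differences from a fixed member,
  turns this into convergence in L^2.\<close>

lemma L2_complete:
 assumes f: "!!n::nat. f n \<in> L2 U" and C: "!!e. 0 < e ==> \<exists>N. \<forall>m\<ge>N. \<forall>n\<ge>N. nU (f m - f n) <= e"
 obtains h where "h \<in> L2 U" "(%n. nU (h - f n)) ----> 0"
proof -
 let ?c = "nU (%_. 1) + 1"
 have c: "0 < ?c" using l2norm_nonneg[of "%_. 1"] by linarith
 have d: "f m - f n \<in> L2 U" for m n using f by (simp add: diff_eq_lc)
 obtain r where r: "strict_mono r" "AE x in MU. Cauchy (%i. f (r i) x)"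
 proof (rule cauchy_L1_AE_cauchy_subseq[of "MU" f])
  show "integrable MU (f n)" for n by (rule L2_integrable[OF f])
  fix e :: real assume e: "0 < e"
  then obtain N where N: "!!m n. m >= N ==> n >= N ==> nU (f m - f n) <= e / (2 * ?c)" using C[of "e / (2 * ?c)"] c by auto
  have "(LINT x|MU. norm (f m x - f n x)) < e" if "m >= N" "n >= N" for m n
  proof -
   have "(LINT x|MU. norm (f m x - f n x)) <= nU (f m - f n) * nU (%_. 1)"
    using L1_le_L2[OF d, of m n] by simp
   also have "... <= e / (2 * ?c) * ?c" using N[OF that] e c by (intro mult_mono) auto
   also have "... = e / 2"
   proof -
    have "e / (2 * x) * x = e / 2" if "0 < x" for x using that by simp
    from this[OF c] show ?thesis .
   qed
   also have "... < e" using e by simp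
   finally show ?thesis .
  qed
  thus "\<exists>N. \<forall>i\<ge>N. \<forall>j\<ge>N. (LINT x|MU. norm (f i x - f j x)) < e" by blast
 qed blast
 define h where "h = (%x. lim (%i. f (r i) x))"
 have hm: "h \<in> borel_measurable MU" unfolding h_def by (rule borel_measurable_lim_metric) (rule L2_meas[OF f])
 from r(2) have hl: "AE x in MU. (%i. f (r i) x) ----> h x"
  by eventually_elim (simp add: h_def Cauchy_convergent_iff convergent_LIMSEQ_iff)
 have main: "h - f n \<in> L2 U \<and> nU (h - f n) <= e" if e: "0 < e" and N: "\<forall>m\<ge>N. \<forall>n\<ge>N. nU (f m - f n) <= e" and n: "n >= N" for e N n
 proof -
  have rN: "r (k + N) >= N" for k using seq_suble[OF r(1), of "k + N"] by simp
  have "AE x in MU. (%k. (f (r (k + N)) - f n) x) ----> (h - f n) x"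
   using hl by eventually_elim (auto intro!: tendsto_intros LIMSEQ_ignore_initial_segment)
  moreover have "h - f n \<in> borel_measurable MU" 
   using borel_measurable_diff[OF hm L2_meas[OF f[of n]]] by (simp add: fun_diff_def)
  moreover have "nU (f (r (k + N)) - f n) <= e" for k using N rN n by blast
  ultimately show ?thesis using Fatou_L2[of "%k. f (r (k + N)) - f n" "h - f n" e] d e by simp
 qed
 obtain N1 where "\<forall>m\<ge>N1. \<forall>n\<ge>N1. nU (f m - f n) <= 1" using C[of 1] by auto
 from main[OF _ this, of N1] have "h - f N1 \<in> L2 U" by simp
 hence "lc 1 (h - f N1) 1 (f N1) \<in> L2 U" using f by simp
 moreover have "lc 1 (h - f N1) 1 (f N1) = h" by (rule ext) (simp add: lc_def)
 ultimately have "h \<in> L2 U" by simp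
 moreover have "(%n. nU (h - f n)) ----> 0"
 proof (rule LIMSEQ_I)
  fix e :: real assume e: "0 < e"
  obtain N where "\<forall>m\<ge>N. \<forall>n\<ge>N. nU (f m - f n) <= e / 2" using C[of "e / 2"] e by auto
  from main[OF _ this] e have "nU (h - f n) <= e / 2" if "n >= N" for n using that by simp
  moreover have "x <= e / 2 ==> 0 <= x ==> norm (x - 0) < e" for x :: real using e by simp
  ultimately have "\<forall>n\<ge>N. norm (nU (h - f n) - 0) < e" using l2norm_nonneg by blast
  thus "\<exists>N. \<forall>n\<ge>N. norm (nU (h - f n) - 0) < e" by blast
 qed
 ultimately show ?thesis by (rule that)
qed

lemma Hs_ennreal: "v \<in> Hs U s ==> sqU s v = ennreal (enn2real (sqU s v))"
 by (simp add: Hs_def ennreal_enn2real)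

lemma sob_sq_minus_commute:
 assumes "v \<in> Hk U (nat \<lfloor>s\<rfloor>)" "w \<in> Hk U (nat \<lfloor>s\<rfloor>)"
 shows "sqU s (lc 1 v (-1) w) = sqU s (lc 1 w (-1) v)"
proof -
 have "lc 1 v (-1) w = lc (-1) (lc 1 w (-1) v) 0 (lc 1 w (-1) v)" by (rule ext) (simp add: lc_def)
 thus ?thesis using sob_sq_scale[of "lc 1 w (-1) v" s "-1"] assms by simp
qed

text \<open>
 Balls of \<open>H\<^sup>s\<close> are closed in \<open>L\<^sup>2\<close> up to a factor: elements of nearly minimal norm among those close to \<open>D\<close>
 form a Cauchy sequence in \<open>H\<^sup>s\<close> by the parallelogram law.
\<close>

lemma sob_minimizing_sequence:
 assumes D: "D \<in> L2 U" and M: "0 <= M"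
  and ap: "!!ep. 0 < ep ==> \<exists>v. sqU s v <= ennreal M \<and> nU (D - v) <= ep"
 obtains E where "!!n::nat. E n \<in> Hs U s" "!!n. sqU s (E n) <= ennreal M" "(%n. nU (D - E n)) ----> 0"
  "!!e. 0 < e ==> \<exists>N. \<forall>m\<ge>N. \<forall>n\<ge>N. sqU s (lc 1 (E m) (-1) (E n)) <= ennreal e"
proof -
 define C where "C = (%ep. {v \<in> Hs U s. sqU s v <= ennreal M \<and> nU (D - v) <= ep})"
 define q where "q = (%v. enn2real (sqU s v))"
 define ep where "ep = (%n. inverse (real (Suc n)))"
 \<comment> \<open>The least squared H^s norm at L^2 distance at most \<open>ep n\<close> from
   \<open>D\<close>. It increases with \<open>n\<close> and is bounded by \<open>M\<close>, hence
   converges.\<close>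
 define d where "d = (%n. Inf (q ` C (ep n)))"
 have ep: "0 < ep n" for n by (simp add: ep_def)
 have epm: "ep n <= ep m" if "m <= n" for m n using that by (simp add: ep_def le_imp_inverse_le)
 have ep0: "ep ----> 0" unfolding ep_def by (rule LIMSEQ_inverse_real_of_nat)
 have qe: "sqU s v = ennreal (q v)" if "v \<in> Hs U s" for v using Hs_ennreal[OF that] by (simp add: q_def)
 have q0: "0 <= q v" for v by (simp add: q_def)
 have ne: "C (ep n) ~= {}" for n
 proof -
  obtain v where v: "sqU s v <= ennreal M" "nU (D - v) <= ep n" using ap[OF ep] by blast
  hence "v \<in> Hs U s" using le_less_trans[OF v(1) ennreal_less_top] by (simp add: Hs_def)
  with v show ?thesis by (auto simp: C_def)
 qed
 have CL: "v \<in> L2 U" if "v \<in> Hs U s" for v using Hk_L2[OF Hs_Hk[OF that]] .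
 have bdd: "bdd_below (q ` A)" for A using q0 by (intro bdd_belowI[of _ 0]) auto
 have Cm: "C (ep n) \<subseteq> C (ep m)" if "m <= n" for m n using epm[OF that] unfolding C_def by fastforce
 have dm: "d m <= d n" if "m <= n" for m n
  unfolding d_def by (rule cInf_superset_mono) (use ne Cm[OF that] bdd in auto)
 have qM: "q v <= M" if "v \<in> C (ep n)" for v n
  using that M unfolding C_def by (auto simp: qe)
 have dM: "d n <= M" for n
 proof -
  obtain v where "v \<in> C (ep n)" using ne by blast
  thus ?thesis using cInf_lower[OF _ bdd, of "q v" "C (ep n)"] qM[of v n] unfolding d_def by force
 qed
 have dc: "convergent d" 
 proof (rule Bseq_mono_convergent)
  show "Bseq d"
  proof (rule BseqI'[of _ "M + \<bar>d 0\<bar>"])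
   fix n show "norm (d n) <= M + \<bar>d 0\<bar>" unfolding real_norm_def using dM[of n] dm[of 0 n] M by arith
  qed
  show "\<forall>m n. m <= n --> d m <= d n" using dm by blast
 qed
 have "\<exists>v. v \<in> C (ep n) \<and> q v < d n + ep n" for n
 proof -
  have "Inf (q ` C (ep n)) < d n + ep n" using ep[of n] by (simp add: d_def)
  thus ?thesis using cInf_lessD[of "q ` C (ep n)" "d n + ep n"] ne by blast
 qed
 then obtain E where E: "!!n. E n \<in> C (ep n)" "!!n. q (E n) < d n + ep n" by metis
 have EH: "E n \<in> Hs U s" for n using E(1) by (simp add: C_def)
 \<comment> \<open>The midpoint of two members is again within \<open>ep n\<close> of
   \<open>D\<close>, so its squared norm is at least \<open>d n\<close>; the parallelogram identity
   then leaves only the stated amount for the difference.\<close>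
 have step: "q (lc 1 (E n) (-1) (E m)) <= 2 * (d m - d n) + 4 * ep n" if nm: "n <= m" for n m
 proof -
  let ?mid = "lc (1/2) (E n) (1/2) (E m)" and ?dif = "lc 1 (E n) (-1) (E m)"
  have H: "?mid \<in> Hs U s" "?dif \<in> Hs U s" using EH by (auto intro: Hs_lc)
  have "sqU s ?mid + ennreal (1/2 * (1/2)) * sqU s ?dif = ennreal (1/2) * sqU s (E n) + ennreal (1/2) * sqU s (E m)"
   by (rule sob_sq_split) (use EH Hs_Hk in auto)
  hence "ennreal (q ?mid + 1/2 * (1/2) * q ?dif) = ennreal (1/2 * q (E n) + 1/2 * q (E m))"
   using q0 unfolding qe[OF H(1)] qe[OF H(2)] qe[OF EH]
   by (simp add: ennreal_mult[symmetric] ennreal_plus[symmetric] del: ennreal_plus ennreal_half ennreal_divide_numeral)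
  moreover have "0 <= q ?mid + 1/2 * (1/2) * q ?dif" "0 <= 1/2 * q (E n) + 1/2 * q (E m)" using q0[of ?mid] q0[of ?dif] q0[of "E n"] q0[of "E m"] by linarith+
  ultimately have eq: "q ?mid + 1/2 * (1/2) * q ?dif = 1/2 * q (E n) + 1/2 * q (E m)" by simp
  have mC: "?mid \<in> C (ep n)"
  proof -
   have "q ?mid <= 1/2 * q (E n) + 1/2 * q (E m)" using eq q0[of ?dif] by linarith
   also have "... <= M" using qM[OF E(1)[of n]] qM[OF E(1)[of m]] by linarith
   finally have "sqU s ?mid <= ennreal M" unfolding qe[OF H(1)] by (rule ennreal_leI)
   moreover have "D - ?mid = lc (1/2) (D - E n) (1/2) (D - E m)" by (rule ext) (simp add: lc_def field_simps)
   hence "nU (D - ?mid) <= 1/2 * nU (D - E n) + 1/2 * nU (D - E m)"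
    using l2norm_lc[of "D - E n" "D - E m" "1/2" "1/2"] D CL[OF EH] by (simp add: diff_eq_lc)
   hence "nU (D - ?mid) <= ep n" using E(1)[of n] E(1)[of m] epm[OF nm] by (simp add: C_def)
   ultimately show ?thesis using H by (simp add: C_def)
  qed
  hence "d n <= q ?mid" unfolding d_def by (intro cInf_lower bdd) auto
  moreover have "x <= z ==> z + 1/2 * (1/2) * y = 1/2 * a + 1/2 * b ==> a < x + e ==> b < x' + e' ==> e' <= e ==> y <= 2 * (x' - x) + 4 * e"
   for x x' y z a b e e' :: real by simp
  ultimately show ?thesis using eq E(2)[of n] E(2)[of m] epm[OF nm] by blast
 qed
 have Cau: "\<exists>N. \<forall>m\<ge>N. \<forall>n\<ge>N. sqU s (lc 1 (E m) (-1) (E n)) <= ennreal e" if e: "0 < e" for e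
 proof -
  have "Cauchy d" using dc by (rule convergent_Cauchy)
  then obtain N1 where N1: "!!m n. m >= N1 ==> n >= N1 ==> \<bar>d m - d n\<bar> < e / 4"
   using e unfolding Cauchy_def dist_real_def by (metis divide_pos_pos zero_less_numeral)
  obtain N2 where N2: "!!n. n >= N2 ==> ep n < e / 8"
   using LIMSEQ_D[OF ep0, of "e / 8"] e ep by (auto simp: less_imp_le)
  have one: "sqU s (lc 1 (E n) (-1) (E m)) <= ennreal e" if "n >= max N1 N2" "n <= m" for m n
  proof -
   have "q (lc 1 (E n) (-1) (E m)) <= 2 * (d m - d n) + 4 * ep n" by (rule step[OF that(2)])
   also have "... <= e"
   proof -
    have "\<bar>d m - d n\<bar> < e / 4" "ep n < e / 8" using N1[of m n] N2[of n] that by auto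
    moreover have "\<bar>x\<bar> < e / 4 ==> y < e / 8 ==> 2 * x + 4 * y <= e" for x y :: real by (simp add: abs_less_iff)
    ultimately show ?thesis by blast
   qed
   finally show ?thesis using qe[OF Hs_lc[OF EH EH]] by (simp add: ennreal_leI)
  qed
  have "sqU s (lc 1 (E m) (-1) (E n)) <= ennreal e" if "n >= max N1 N2" "m >= max N1 N2" for m n
  proof (cases "m <= n")
   case False
   thus ?thesis using one[of n m] that sob_sq_minus_commute[OF Hs_Hk[OF EH[of m]] Hs_Hk[OF EH[of n]]] by simp
  qed (use one that in auto)
  thus ?thesis by blast
 qed
 have lim: "(%n. nU (D - E n)) ----> 0"
 proof (rule Lim_null_comparison[OF _ ep0], intro always_eventually allI)
  fix n show "norm (nU (D - E n)) <= ep n" using E(1)[of n] by (simp add: C_def)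
 qed
 show ?thesis by (rule that[OF EH _ lim Cau]) (use E(1) in \<open>simp add: C_def\<close>)
qed

text \<open>Along the minimizing sequence all derivatives converge in L^2, and their limits are weak
  derivatives of \<open>D\<close> because the defining identity passes to the limit.
  \<open>D\<close> is then a member of the sequence minus a remainder that is small in H^s; the
  factor 2 is the one in \<open>sob_sq_lc_le\<close>.\<close>

lemma sob_ball_closed:
 assumes D: "D \<in> L2 U" and M: "0 <= M"
  and ap: "!!ep. 0 < ep ==> \<exists>v. sqU s v <= ennreal M \<and> nU (D - v) <= ep"
 shows "sqU s D <= ennreal (2 * M)"
proof -
 obtain E where E: "!!n::nat. E n \<in> Hs U s" "!!n. sqU s (E n) <= ennreal M" "(%n. nU (D - E n)) ----> 0"
  "!!e. 0 < e ==> \<exists>N. \<forall>m\<ge>N. \<forall>n\<ge>N. sqU s (lc 1 (E m) (-1) (E n)) <= ennreal e"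
  using sob_minimizing_sequence[OF D M ap] by blast
 define k where "k = nat \<lfloor>s\<rfloor>"
 define c where "c = (if frac s = 0 then 0 else frac s * (1 - frac s))"
 have c0: "0 <= c" using frac_ge_0[of s] frac_lt_1[of s] by (auto simp: c_def)
 have H: "E n \<in> Hk U k" for n using Hs_Hk[OF E(1)] by (simp add: k_def)
 have q: "sqU s v = ennreal (\<Sum>is | length is <= k. (nU (wU is v))^2) + ennreal c * (\<Sum>is | length is = k. slo (frac s) (wU is v))" if "v \<in> Hk U k" for v
  using that by (simp add: sob_sq_def k_def[symmetric] c_def Let_def)
 have L: "wU is (E n) \<in> L2 U" if "length is <= k" for "is" n using wder_L2[OF H that] .
 have dae: "ae_eq U (wU is (lc 1 (E m) (-1) (E n))) (wU is (E m) - wU is (E n))" if "length is <= k" for "is" m n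
  unfolding diff_eq_lc by (rule wder_lc[OF H H that])
 have part1: "nU (wU is (E m) - wU is (E n)) <= sqrt e" 
  if "length is <= k" "sqU s (lc 1 (E m) (-1) (E n)) <= ennreal e" "0 <= e" for "is" m n e
 proof -
  have "ennreal ((nU (wU is (lc 1 (E m) (-1) (E n))))^2) <= ennreal (\<Sum>is | length is <= k. (nU (wU is (lc 1 (E m) (-1) (E n))))^2)"
   using that(1) by (intro ennreal_leI member_le_sum finite_lists_le) auto
  also have "... <= sqU s (lc 1 (E m) (-1) (E n))" using H by (subst q) auto
  also have "... <= ennreal e" by fact
  finally have "(nU (wU is (lc 1 (E m) (-1) (E n))))^2 <= e" using that(3) by simp
  hence "nU (wU is (lc 1 (E m) (-1) (E n))) <= sqrt e" by (rule real_le_rsqrt)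
  moreover have "nU (wU is (lc 1 (E m) (-1) (E n))) = nU (wU is (E m) - wU is (E n))"
   using H that(1) by (intro l2norm_cong dae wder_L2[of _ k]) auto
  ultimately show ?thesis by simp
 qed
 have "\<exists>g. g \<in> L2 U \<and> (%n. nU (g - wU is (E n))) ----> 0" if l: "length is <= k" for "is"
 proof -
  have "\<exists>N. \<forall>m\<ge>N. \<forall>n\<ge>N. nU (wU is (E m) - wU is (E n)) <= e" if e: "0 < e" for e
  proof -
   obtain N where "\<forall>m\<ge>N. \<forall>n\<ge>N. sqU s (lc 1 (E m) (-1) (E n)) <= ennreal (e^2)" using E(4)[of "e^2"] e by auto
   thus ?thesis using part1[OF l, where e="e^2"] e by (intro exI[of _ N]) simp
  qed
  from L2_complete[OF L[OF l] this] show ?thesis by metis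
 qed
 then obtain g where g: "!!is. length is <= k ==> g is \<in> L2 U" "!!is. length is <= k ==> (%n. nU (g is - wU is (E n))) ----> 0"
  by metis
 have wd: "weak_deriv U is D (g is)" if l: "length is <= k" for "is"
 proof -
  have "ip U D (pds is phi) = (-1) ^ length is * ip U (g is) phi" if phi: "phi \<in> test_fun U" for phi
  proof -
  have "ip U (E n) (pds is phi) = (-1) ^ length is * ip U (wU is (E n)) phi" for n
   using Hk_wder[OF H l] phi by (auto simp: weak_deriv_def)
  moreover have "(%n. ip U (E n) (pds is phi)) ----> ip U D (pds is phi)"
   by (intro ip_tendsto D test_L2 phi E(3) Hk_L2[OF H])
  moreover have "(%n. (-1) ^ length is * ip U (wU is (E n)) phi) ----> (-1) ^ length is * ip U (g is) phi"
   by (intro tendsto_mult_left ip_tendsto g L l test_L20 phi)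
  ultimately show ?thesis using LIMSEQ_unique by (simp only:) 
  qed
  thus ?thesis unfolding weak_deriv_def by (intro conjI ballI D g(1)[OF l])
 qed
 have ex: "\<exists>g. weak_deriv U is D g" if "length is <= k" for "is" by (rule exI[of "%g. weak_deriv U is D g" "g is"]) (rule wd[OF that])
 have DH: "D \<in> Hk U k" unfolding Hk_def mem_Collect_eq by (intro conjI allI impI D ex)
 have wg: "ae_eq U (wU is D) (g is)" if "length is <= k" for "is" using wder_eqI[OF wd[OF that]] .
 define K where "K = real (card {is :: 2 list. length is <= k}) + real (card {is :: 2 list. length is = k})"
 \<comment> \<open>One index is kept fixed while the other runs to infinity along an almost
   everywhere convergent subsequence. Fatou's lemma then carries the Cauchy estimate over to the
   difference from \<open>D\<close>, separately for each derivative; \<open>K\<close> counts the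
   terms.\<close>
 have bound: "sqU s (lc 1 (E n) (-1) D) <= ennreal (K * e)" if e: "0 < e" and N: "\<forall>m\<ge>N. \<forall>n\<ge>N. sqU s (lc 1 (E m) (-1) (E n)) <= ennreal e" and n: "n >= N" for e N n
 proof -
  have dD: "ae_eq U (wU is (lc 1 (E n) (-1) D)) (wU is (E n) - g is)" if "length is <= k" for "is"
   unfolding diff_eq_lc by (rule ae_eq_trans[OF wder_lc[OF H DH that]]) (intro ae_eq_lc ae_eq_refl wg that)
  have sub: "\<exists>r. strict_mono r \<and> (AE x in MU. (%i. (wU is (E n) - wU is (E (r i + N))) x) ----> (wU is (E n) - g is) x)" if l: "length is <= k" for "is"
  proof -
   have "(%i. nU (g is - wU is (E (i + N)))) ----> 0" using g(2)[OF l] by (rule LIMSEQ_ignore_initial_segment)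
   from L2_subseq[OF L[OF l] g(1)[OF l] this] obtain r :: "nat => nat" where r: "strict_mono r" "AE x in MU. (%i. wU is (E (r i + N)) x) ----> g is x" by blast
   from r(2) have "AE x in MU. (%i. (wU is (E n) - wU is (E (r i + N))) x) ----> (wU is (E n) - g is) x"
    by eventually_elim (auto intro!: tendsto_intros)
   with r(1) show ?thesis by blast
  qed
  have dL: "wU is (E n) - wU is (E m) \<in> L2 U" "wU is (E n) - g is \<in> L2 U" if "length is <= k" for "is" m
   using L[OF that] g(1)[OF that] by (auto simp: diff_eq_lc)
  have t1: "(nU (wU is (lc 1 (E n) (-1) D)))^2 <= e" if l: "length is <= k" for "is"
  proof -
   obtain r where r: "AE x in MU. (%i. (wU is (E n) - wU is (E (r i + N))) x) ----> (wU is (E n) - g is) x"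
    using sub[OF l] by blast
   have "nU (wU is (E n) - g is) <= sqrt e"
    using N n e by (intro Fatou_L2(2)[OF dL(1)[OF l] r L2_meas[OF dL(2)[OF l]]] part1[OF l]) auto
   hence "(nU (wU is (E n) - g is))^2 <= (sqrt e)^2" by (rule power_mono) simp
   hence "(nU (wU is (E n) - g is))^2 <= e" using e by simp
   moreover have "nU (wU is (lc 1 (E n) (-1) D)) = nU (wU is (E n) - g is)"
    using H DH l by (intro l2norm_cong dD wder_L2[of _ k]) auto
   ultimately show ?thesis by simp
  qed
  have t2: "ennreal c * slo (frac s) (wU is (lc 1 (E n) (-1) D)) <= ennreal e" if l: "length is = k" for "is"
  proof (cases "c = 0")
   case False
   hence c: "0 < c" using c0 by simp
   have l': "length is <= k" using l by simp
   obtain r where r: "AE x in MU. (%i. (wU is (E n) - wU is (E (r i + N))) x) ----> (wU is (E n) - g is) x"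
    using sub[OF l'] by blast
   have "slo (frac s) (wU is (E n) - g is) <= ennreal (e / c)"
   proof (rule Fatou_slob[OF L2_meas[OF dL(1)[OF l']] r])
    fix i
    let ?w = "lc 1 (E n) (-1) (E (r i + N))"
    have "ennreal c * slo (frac s) (wU is ?w) <= ennreal c * (\<Sum>is | length is = k. slo (frac s) (wU is ?w))"
     using l by (intro mult_left_mono member_le_sum finite_lists_eq) auto
    also have "... <= sqU s ?w" using H by (subst q) auto
    also have "... <= ennreal e" using N n by simp
    finally have "ennreal c * slo (frac s) (wU is ?w) <= ennreal e" .
    hence "ennreal (1 / c) * (ennreal c * slo (frac s) (wU is ?w)) <= ennreal (1 / c) * ennreal e" by (rule mult_left_mono) simp
    hence "slo (frac s) (wU is ?w) <= ennreal (e / c)"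
     unfolding mult.assoc[symmetric] using c e by (simp add: ennreal_mult[symmetric])
    thus "slo (frac s) (wU is (E n) - wU is (E (r i + N))) <= ennreal (e / c)"
     using slob_cong[OF dae[OF l', of n "r i + N"]] by simp
   qed
   hence "slo (frac s) (wU is (lc 1 (E n) (-1) D)) <= ennreal (e / c)" using slob_cong[OF dD[OF l']] by simp
   hence "ennreal c * slo (frac s) (wU is (lc 1 (E n) (-1) D)) <= ennreal c * ennreal (e / c)" by (rule mult_left_mono) simp
   thus ?thesis using c e by (simp add: ennreal_mult[symmetric])
  qed simp
  have "sqU s (lc 1 (E n) (-1) D) = ennreal (\<Sum>is | length is <= k. (nU (wU is (lc 1 (E n) (-1) D)))^2) + (\<Sum>is | length is = k. ennreal c * slo (frac s) (wU is (lc 1 (E n) (-1) D)))"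
   using H DH by (subst q) (auto simp: sum_distrib_left)
  also have "... <= ennreal (\<Sum>is::2 list | length is <= k. e) + (\<Sum>is::2 list | length is = k. ennreal e)"
   using t1 t2 by (intro add_mono ennreal_leI sum_mono) auto
  also have "... = ennreal (K * e)" using e by (simp add: K_def algebra_simps ennreal_plus[symmetric] ennreal_of_nat_eq_real_of_nat ennreal_mult[symmetric] del: ennreal_plus)
  finally show ?thesis .
 qed
 show ?thesis
 proof (rule ennreal_le_epsilon)
  fix ep :: real assume ep: "0 < ep"
  have K: "0 <= K" by (simp add: K_def)
  define e where "e = ep / (2 * (K + 1))"
  have e: "0 < e" using ep K by (simp add: e_def)
  have e2: "2 * (K * e) <= ep"
  proof -
   have "2 * (x * (ep / (2 * x))) = ep" if "0 < x" for x using that by simp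
   from this[of "K + 1"] have "2 * ((K + 1) * e) = ep" using K unfolding e_def by linarith
   moreover have "K * e <= (K + 1) * e" using e by (intro mult_right_mono) auto
   ultimately show ?thesis by linarith
  qed
  obtain N where N: "\<forall>m\<ge>N. \<forall>n\<ge>N. sqU s (lc 1 (E m) (-1) (E n)) <= ennreal e" using E(4)[OF e] by blast
  have eq: "D = lc 1 (E N) (-1) (lc 1 (E N) (-1) D)" by (rule ext) (simp add: lc_def)
  have "sqU s (lc 1 (E N) (-1) (lc 1 (E N) (-1) D)) <= ennreal (2 * 1^2) * sqU s (E N) + ennreal (2 * (-1)^2) * sqU s (lc 1 (E N) (-1) D)"
   using H DH by (intro sob_sq_lc_le) (auto simp: k_def[symmetric])
  also have "... <= ennreal (2 * 1^2) * ennreal M + ennreal (2 * (-1)^2) * ennreal (K * e)"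
   by (intro add_mono mult_left_mono E(2) bound[OF e N]) auto
  also have "... = ennreal (2 * M + 2 * (K * e))"
   using M K e by (simp add: ennreal_mult[symmetric] ennreal_plus[symmetric] del: ennreal_plus ennreal_numeral)
  also have "... <= ennreal (2 * M) + ennreal ep" using e2 M ep by (simp add: ennreal_plus[symmetric] ennreal_leI del: ennreal_plus)
  finally show "sqU s D <= ennreal (2 * M) + ennreal ep" using eq by simp
 qed
qed

end

section \<open>Triangles\<close>

definition cross2 :: "pt => pt => real" where
 "cross2 p q = p $ 1 * q $ 2 - p $ 2 * q $ 1"

text \<open>The barycentric coordinate of \<open>x\<close> with respect to the vertex \<open>r\<close> of the triangle \<open>p q r\<close>.\<close>

definition bary :: "pt => pt => pt => pt => real" where
 "bary p q r x = cross2 (q - p) (x - p) / cross2 (q - p) (r - p)"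

lemma cross2_cyc: "cross2 (r - q) (p - q) = cross2 (q - p) (r - p)" "cross2 (p - r) (q - r) = cross2 (q - p) (r - p)"
 by (auto simp: cross2_def algebra_simps)

lemma bary_sum:
 assumes "cross2 (q - p) (r - p) ~= 0"
 shows "bary p q r x + bary q r p x + bary r p q x = 1"
proof -
 have "cross2 (q - p) (x - p) + cross2 (r - q) (x - q) + cross2 (p - r) (x - r) = cross2 (q - p) (r - p)"
  by (simp add: cross2_def algebra_simps)
 thus ?thesis using assms by (simp add: bary_def cross2_cyc add_divide_distrib[symmetric])
qed

lemma bary_repr:
 assumes d: "cross2 (q - p) (r - p) ~= 0"
 shows "x = bary q r p x *\<^sub>R p + bary r p q x *\<^sub>R q + bary p q r x *\<^sub>R r"
proof -
 have "cross2 (q - p) (r - p) *\<^sub>R x = cross2 (r - q) (x - q) *\<^sub>R p + cross2 (p - r) (x - r) *\<^sub>R q + cross2 (q - p) (x - p) *\<^sub>R r"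
  by (simp add: vec_eq_iff forall_2 cross2_def algebra_simps)
 from arg_cong[OF this, of "%z. inverse (cross2 (q - p) (r - p)) *\<^sub>R z"] d
 show ?thesis by (simp add: bary_def cross2_cyc scaleR_add_right divide_inverse mult.commute)
qed

lemma bary_affine_comb:
 assumes "u + v + w = 1" and d: "cross2 (q - p) (r - p) ~= 0"
 shows "bary p q r (u *\<^sub>R p + v *\<^sub>R q + w *\<^sub>R r) = w"
proof -
 have u: "u = 1 - v - w" using assms by simp
 have "cross2 (q - p) (u *\<^sub>R p + v *\<^sub>R q + w *\<^sub>R r - p) = w * cross2 (q - p) (r - p)"
  unfolding u by (simp add: cross2_def algebra_simps)
 thus ?thesis using d by (simp add: bary_def)
qed

lemma mem_triangle_iff:
 assumes d: "cross2 (q - p) (r - p) ~= 0"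
 shows "x \<in> convex hull {p, q, r} \<longleftrightarrow> 0 <= bary q r p x \<and> 0 <= bary r p q x \<and> 0 <= bary p q r x"
proof
 assume "x \<in> convex hull {p, q, r}"
 then obtain u v w where x: "x = u *\<^sub>R p + v *\<^sub>R q + w *\<^sub>R r" "0 <= u" "0 <= v" "0 <= w" "u + v + w = 1"
  by (auto simp: convex_hull_3)
 have "bary p q r x = w" using x d by (simp add: bary_affine_comb)
 moreover have "bary q r p (v *\<^sub>R q + w *\<^sub>R r + u *\<^sub>R p) = u"
  using x d by (intro bary_affine_comb) (auto simp: cross2_cyc)
 moreover have "bary r p q (w *\<^sub>R r + u *\<^sub>R p + v *\<^sub>R q) = v"
  using x d by (intro bary_affine_comb) (auto simp: cross2_cyc)
 ultimately show "0 <= bary q r p x \<and> 0 <= bary r p q x \<and> 0 <= bary p q r x" using x by (simp add: algebra_simps)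
next
 assume "0 <= bary q r p x \<and> 0 <= bary r p q x \<and> 0 <= bary p q r x"
 thus "x \<in> convex hull {p, q, r}"
  unfolding convex_hull_3 mem_Collect_eq using bary_repr[OF d, of x] bary_sum[OF d, of x]
  by (intro exI[of _ "bary q r p x"] exI[of _ "bary r p q x"] exI[of _ "bary p q r x"]) simp
qed

lemma continuous_bary: "continuous_on A (bary p q r)"
proof -
 have "continuous_on A (%x. ((q - p) $ 1 * (x - p) $ 2 - (q - p) $ 2 * (x - p) $ 1) * inverse (cross2 (q - p) (r - p)))"
  by (intro continuous_intros)
 moreover have "bary p q r = (%x. ((q - p) $ 1 * (x - p) $ 2 - (q - p) $ 2 * (x - p) $ 1) * inverse (cross2 (q - p) (r - p)))"
  by (rule ext) (simp add: bary_def cross2_def divide_inverse)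
 ultimately show ?thesis by simp
qed

lemma interior_triangleI:
 assumes d: "cross2 (q - p) (r - p) ~= 0" and "0 < bary q r p x" "0 < bary r p q x" "0 < bary p q r x"
 shows "x \<in> interior (convex hull {p, q, r})"
proof (rule interiorI)
 let ?S = "{x. 0 < bary q r p x} \<inter> {x. 0 < bary r p q x} \<inter> {x. 0 < bary p q r x}"
 show "open ?S" by (intro open_Int open_Collect_less continuous_bary continuous_on_const)
 show "x \<in> ?S" using assms by simp
 show "?S \<subseteq> convex hull {p, q, r}" using d by (auto simp: mem_triangle_iff)
qed

lemma cross2_nonzero:
 assumes "\<not> affine_dependent {a, b, c :: pt}" "card {a, b, c} = 3"
 shows "cross2 (b - a) (c - a) ~= 0"
proof
 assume z: "cross2 (b - a) (c - a) = 0"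
 have ne: "a ~= b" "b ~= c" "a ~= c" using assms(2) by (auto simp: card_insert_if split: if_splits)
 have "collinear {a, b, c}"
 proof -
  have "(b - a) \<bullet> (b - a) ~= 0" using ne by simp
  define k where "k = ((c - a) \<bullet> (b - a)) / ((b - a) \<bullet> (b - a))"
  have "((b - a) \<bullet> (b - a)) *\<^sub>R (c - a) = ((c - a) \<bullet> (b - a)) *\<^sub>R (b - a)"
   using z unfolding cross2_def vec_eq_iff forall_2 inner_vec_def sum_2 by (simp add: algebra_simps; algebra)
  hence "inverse ((b - a) \<bullet> (b - a)) *\<^sub>R (((b - a) \<bullet> (b - a)) *\<^sub>R (c - a)) = inverse ((b - a) \<bullet> (b - a)) *\<^sub>R (((c - a) \<bullet> (b - a)) *\<^sub>R (b - a))" by simp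
  hence k: "c - a = k *\<^sub>R (b - a)" using \<open>(b - a) \<bullet> (b - a) ~= 0\<close> by (simp add: k_def divide_inverse mult.commute)
  have "collinear {0, b - a, c - a}" unfolding k by (rule collinear_lemma[THEN iffD2]) blast
  hence "collinear {b, a, c}" by (subst collinear_3) simp_all
  thus ?thesis by (metis insert_commute)
 qed
 thus False using ne assms(1) by (simp add: collinear_3_eq_affine_dependent)
qed

lemma triangle_repr:
 assumes "2 simplex (K :: pt set)"
 obtains a b c where "K = convex hull {a, b, c}" "\<not> affine_dependent {a, b, c}" "card {a, b, c} = 3"
proof -
 obtain C where C: "\<not> affine_dependent C" "int (card C) = 2 + 1" "K = convex hull C" using assms unfolding simplex_def by blast
 hence "card C = 3" by simp
 then obtain a b c where "C = {a, b, c}" by (auto simp: card_3_iff)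
 with C \<open>card C = 3\<close> that show ?thesis by blast
qed

text \<open>\<open>ends\<close> is a choice, but a segment determines its endpoints up to order, so
  the remaining vertex of \<open>K\<close> completes whichever pair has been chosen.\<close>

lemma edge_repr:
 assumes K: "2 simplex (K :: pt set)" and e: "e edge_of K"
 obtains a b c where "ends e = (a, b)" "e = closed_segment a b" "a ~= b" "K = convex hull {a, b, c}" "cross2 (b - a) (c - a) ~= 0"
proof -
 obtain C where C: "\<not> affine_dependent C" "int (card C) = 2 + 1" "K = convex hull C" using K unfolding simplex_def by blast
 have c3: "card C = 3" "finite C" using C card.infinite by fastforce+
 obtain D where D: "D \<subseteq> C" "e = convex hull D"
  using e C face_of_convex_hull_affine_independent[OF C(1)] unfolding edge_of_def by blast
 have fD: "finite D" using D c3 finite_subset by blast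
 have nD: "\<not> affine_dependent D" using D C affine_dependent_subset by blast
 have "aff_dim D = 1" using e D by (simp add: edge_of_def aff_dim_convex_hull)
 hence "card D = 2" using aff_dim_affine_independent[OF nD] by simp
 then obtain a b where ab: "D = {a, b}" "a ~= b" by (auto simp: card_2_iff)
 have es: "e = closed_segment a b" using D ab by (simp add: segment_convex_hull)
 have "\<exists>x. case x of (p, q) => e = closed_segment p q" using es by auto
 hence "case ends e of (p, q) => e = closed_segment p q" unfolding ends_def by (rule someI_ex)
 then obtain p q where pq: "ends e = (p, q)" "e = closed_segment p q" by (cases "ends e") auto
 hence pqab: "{p, q} = {a, b}" using es by simp
 have "card (C - D) = 1" using D fD c3 \<open>card D = 2\<close> by (simp add: card_Diff_subset)
 then obtain c where c: "C - D = {c}" using card_1_singletonE by blast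
 have "C = D \<union> (C - D)" using D(1) by blast
 also have "... = {p, q} \<union> {c}" by (simp only: c) (simp only: ab(1) pqab)
 finally have "C = {p, q} \<union> {c}" .
 moreover have "{p, q} \<union> {c} = {p, q, c}" by blast
 ultimately have Cpq: "C = {p, q, c}" by (simp only:)
 have "card {p, q} = 2" using ab by (simp only: pqab card_2_iff) blast
 hence "p ~= q" by auto
 moreover have "cross2 (q - p) (c - p) ~= 0" using C(1) c3(1) unfolding Cpq by (rule cross2_nonzero)
 ultimately show ?thesis using that[OF pq] C(3) Cpq by blast
qed

text \<open>A vector orthogonal to the unit vector \<open>nu\<close> is a multiple of
  \<open>nu\<close> turned by a right angle, so the cross product with it is a multiple of the inner
  product with \<open>nu\<close>. This links barycentric coordinates to the normals of
  edges.\<close>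

lemma perp_parallel:
 assumes n: "norm (nu :: pt) = 1" and t: "t \<bullet> nu = 0"
 shows "cross2 t w = - (- nu $ 2 * t $ 1 + nu $ 1 * t $ 2) * (nu \<bullet> w)"
proof -
 have n2: "nu $ 1 * nu $ 1 + nu $ 2 * nu $ 2 = 1" using n by (simp add: norm_eq_1 inner_vec_def sum_2)
 have t2: "t $ 1 * nu $ 1 + t $ 2 * nu $ 2 = 0" using t by (simp add: inner_vec_def sum_2)
 define k where "k = - nu $ 2 * t $ 1 + nu $ 1 * t $ 2"
 have "t $ 1 = - k * nu $ 2" "t $ 2 = k * nu $ 1"
  unfolding k_def using n2 t2 by algebra+
 thus ?thesis unfolding cross2_def k_def[symmetric] by (simp add: inner_vec_def sum_2 algebra_simps)
qed

lemma bary_normal: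
 assumes n: "norm (nu :: pt) = 1" and t: "(b - a) \<bullet> nu = 0" and d: "cross2 (b - a) (c - a) ~= 0"
 shows "nu \<bullet> (x - a) = bary a b c x * (nu \<bullet> (c - a))" "nu \<bullet> (c - a) ~= 0"
proof -
 define k where "k = - (- nu $ 2 * (b - a) $ 1 + nu $ 1 * (b - a) $ 2)"
 have e: "cross2 (b - a) w = k * (nu \<bullet> w)" for w unfolding k_def by (rule perp_parallel[OF n t])
 have kn: "k ~= 0" "nu \<bullet> (c - a) ~= 0" using d e[of "c - a"] by auto
 thus "nu \<bullet> (c - a) ~= 0" by simp
 show "nu \<bullet> (x - a) = bary a b c x * (nu \<bullet> (c - a))" using kn by (simp add: bary_def e)
qed

lemma outer_normal_perp:
 assumes "outer_normal K e nu" "e = closed_segment a b" "e \<subseteq> K"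
 shows "norm nu = 1" "(b - a) \<bullet> nu = 0"
proof -
 have ab: "a \<in> e" "b \<in> e" using assms by auto
 have "(b - a) \<bullet> nu <= 0" "(a - b) \<bullet> nu <= 0" using assms ab unfolding outer_normal_def by blast+
 thus "(b - a) \<bullet> nu = 0" by (simp add: inner_diff_left)
 show "norm nu = 1" using assms by (simp add: outer_normal_def)
qed

text \<open>At an inner point of the edge two barycentric coordinates are positive and remain so
  under small shifts; the third one vanishes there and increases against the outer normal.\<close>

lemma near_edge_interior:
 assumes K: "2 simplex (K :: pt set)" and e: "e edge_of K" and nu: "outer_normal K e nu"
  and ab: "e = closed_segment a b" and y: "y \<in> open_segment a b"
 shows "\<forall>\<^sub>F s in at_right 0. y - s *\<^sub>R nu \<in> interior K"
proof -
 obtain p q c where E: "ends e = (p, q)" "e = closed_segment p q" "p ~= q" "K = convex hull {p, q, c}" and d: "cross2 (q - p) (c - p) ~= 0"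
  using edge_repr[OF K e] by metis
 have eK: "e \<subseteq> K" using e by (auto simp: edge_of_def face_of_def)
 note n = outer_normal_perp[OF nu E(2) eK]
 have pqab: "{p, q} = {a, b}" using E(2) ab by simp
 hence y': "y \<in> open_segment p q" using y by (auto simp: doubleton_eq_iff open_segment_commute)
 then obtain t where t: "0 < t" "t < 1" "y = (1 - t) *\<^sub>R p + t *\<^sub>R q" by (auto simp: in_segment)
 have b1: "bary q c p (t *\<^sub>R q + 0 *\<^sub>R c + (1 - t) *\<^sub>R p) = 1 - t" by (rule bary_affine_comb) (use d in \<open>auto simp: cross2_cyc\<close>)
 have b2: "bary c p q (0 *\<^sub>R c + (1 - t) *\<^sub>R p + t *\<^sub>R q) = t" by (rule bary_affine_comb) (use d in \<open>auto simp: cross2_cyc\<close>)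
 have B: "bary q c p y = 1 - t" "bary c p q y = t" using b1 b2 by (auto simp: t(3) add.commute)
 have lim: "((%s. bary u v w (y - s *\<^sub>R nu)) \<longlongrightarrow> bary u v w y) (at_right 0)" for u v w
 proof (rule continuous_on_tendsto_compose[OF continuous_bary[of UNIV]])
  have "((%s. y - s *\<^sub>R nu) \<longlongrightarrow> y - 0 *\<^sub>R nu) (at_right 0)" by (intro tendsto_intros)
  thus "((%s. y - s *\<^sub>R nu) \<longlongrightarrow> y) (at_right 0)" by simp
 qed auto
 have cn: "nu \<bullet> (c - p) < 0"
 proof -
  have "c \<in> K" "p \<in> e" using E by (auto simp: hull_inc)
  hence "(c - p) \<bullet> nu <= 0" using nu by (simp add: outer_normal_def)
  thus ?thesis using bary_normal(2)[OF n d] by (simp add: inner_commute)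
 qed
 have py: "nu \<bullet> (y - p) = 0"
 proof -
  have "y - p = t *\<^sub>R (q - p)" using t(3) by (simp add: algebra_simps)
  thus ?thesis using n(2) by (simp add: inner_commute)
 qed
 have third: "0 < bary p q c (y - s *\<^sub>R nu)" if s: "0 < s" for s
 proof -
  have "nu \<bullet> (y - s *\<^sub>R nu - p) = nu \<bullet> (y - p) - s * (nu \<bullet> nu)" by (simp add: inner_diff_right)
  also have "... = - s" using py n(1) by (simp add: norm_eq_1)
  finally have "bary p q c (y - s *\<^sub>R nu) * (nu \<bullet> (c - p)) = - s" by (simp only: bary_normal(1)[OF n d, of "y - s *\<^sub>R nu"])
  hence "bary p q c (y - s *\<^sub>R nu) * (nu \<bullet> (c - p)) < 0" using s by simp
  thus ?thesis using cn by (simp add: mult_less_0_iff)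
 qed
 have "\<forall>\<^sub>F s in at_right 0. 0 < bary q c p (y - s *\<^sub>R nu)" "\<forall>\<^sub>F s in at_right 0. 0 < bary c p q (y - s *\<^sub>R nu)"
  using order_tendstoD(1)[OF lim, of 0 q c p] order_tendstoD(1)[OF lim, of 0 c p q] B t by auto
 moreover have "\<forall>\<^sub>F s :: real in at_right 0. 0 < s" by (simp add: eventually_at_filter)
 ultimately show ?thesis
 proof eventually_elim
  case (elim s)
  show ?case unfolding E(4) by (rule interior_triangleI[OF d elim(1,2) third[OF elim(3)]])
 qed
qed

section \<open>Incidence of triangles, edges and normals\<close>

locale tri_mesh =
 fixes Z :: "pt set" and rho :: real and \<T> :: "pt set set" and n :: "pt set => pt"
 assumes lip: "lipschitz_domain Z" and tria: "triangulation_of Z rho \<T>" and normals: "edge_normals \<T> n"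
begin

lemma finite_T: "finite \<T>" using tria by (simp add: triangulation_of_def triangulation_def)

lemma simplex_T: "K \<in> \<T> ==> 2 simplex K" using tria by (simp add: triangulation_of_def)

lemma face_T: "K \<in> \<T> ==> K' \<in> \<T> ==> (K \<inter> K') face_of K" using tria by (simp add: triangulation_of_def triangulation_def)

lemma cover_T: "\<Union>\<T> = closure Z" using tria by (simp add: triangulation_of_def)

lemma compact_T: "K \<in> \<T> ==> compact K"
proof -
 assume "K \<in> \<T>"
 then obtain a b c where "K = convex hull {a, b, c}" by (rule triangle_repr[OF simplex_T])
 thus ?thesis by (simp add: finite_imp_compact_convex_hull)
qed

lemma convex_T: "K \<in> \<T> ==> convex K"
proof -
 assume "K \<in> \<T>"
 then obtain a b c where "K = convex hull {a, b, c}" by (rule triangle_repr[OF simplex_T])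
 thus ?thesis by simp
qed

lemma open_Z: "open Z" and bounded_Z: "bounded Z" and nonempty_Z: "Z ~= {}"
 using lip by (auto simp: lipschitz_domain_def)

lemma int_nonempty: "K \<in> \<T> ==> interior K ~= {}"
proof -
 assume "K \<in> \<T>"
 then obtain a b c where K: "K = convex hull {a, b, c}" "\<not> affine_dependent {a, b, c}" "card {a, b, c} = 3"
  using triangle_repr[OF simplex_T] by metis
 have d: "cross2 (b - a) (c - a) ~= 0" using K cross2_nonzero by blast
 let ?x = "(1/3) *\<^sub>R a + (1/3) *\<^sub>R b + (1/3) *\<^sub>R c"
 have "bary a b c ?x = 1/3" by (rule bary_affine_comb) (use d in auto)
 moreover have "bary b c a ((1/3) *\<^sub>R b + (1/3) *\<^sub>R c + (1/3) *\<^sub>R a) = 1/3" by (rule bary_affine_comb) (use d in \<open>auto simp: cross2_cyc\<close>)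
 moreover have "bary c a b ((1/3) *\<^sub>R c + (1/3) *\<^sub>R a + (1/3) *\<^sub>R b) = 1/3" by (rule bary_affine_comb) (use d in \<open>auto simp: cross2_cyc\<close>)
 ultimately have "?x \<in> interior (convex hull {a, b, c})" by (intro interior_triangleI d) (simp_all add: add.commute add.left_commute)
 thus ?thesis using K by auto
qed

text \<open>A proper face has smaller dimension, while all triangles of the mesh have dimension
  2.\<close>

lemma face_eq_same_dim: "K \<in> \<T> ==> K' \<in> \<T> ==> K \<inter> K' = K ==> K = K'"
proof (rule ccontr)
 assume a: "K \<in> \<T>" "K' \<in> \<T>" "K \<inter> K' = K" "K ~= K'"
 have "K face_of K'" using face_T[OF a(2,1)] a(3) by (simp add: Int_commute)
 hence "K \<inter> interior K' = {}" "aff_dim K < aff_dim K'"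
  using a face_of_disjoint_interior face_of_aff_dim_lt[OF convex_T[OF a(2)]] by auto
 moreover have "aff_dim L = 2" if "L \<in> \<T>" for L
  using int_nonempty[OF that] by (simp add: aff_dim_nonempty_interior)
 ultimately show False using a by simp
qed

lemma interiors_disjoint: "K \<in> \<T> ==> K' \<in> \<T> ==> K ~= K' ==> K' \<inter> interior K = {}"
proof -
 assume a: "K \<in> \<T>" "K' \<in> \<T>" "K ~= K'"
 have "(K \<inter> K') \<inter> interior K = {}"
  using face_of_disjoint_interior[OF face_T[OF a(1,2)]] face_eq_same_dim[OF a(1,2)] a(3) by blast
 thus ?thesis using interior_subset by blast
qed

text \<open>The mesh covers the closure of the domain, so the interiors of its triangles could
  contain slits of the domain. A Lipschitz domain has none: it lies locally above a graph, and
  points strictly below the graph are not in its closure.\<close>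

lemma interior_closure_Z: "interior (closure Z) = Z"
proof
 show "Z \<subseteq> interior (closure Z)" by (rule interior_maximal[OF closure_subset open_Z])
 show "interior (closure Z) \<subseteq> Z"
 proof (rule ccontr)
  assume "\<not> ?thesis"
  then obtain x where x: "x \<in> interior (closure Z)" "x \<notin> Z" by blast
  hence "x \<in> frontier Z" using interior_subset[of "closure Z"] open_Z by (auto simp: frontier_def interior_open)
  then obtain r R et L where r: "0 < r" "orthogonal_transformation R" "L-lipschitz_on (UNIV :: real set) et"
   "!!y. y \<in> ball x r ==> y \<in> Z \<longleftrightarrow> et (R y $ 1) < (R y :: pt) $ 2"
   using lip unfolding lipschitz_domain_def by metis
  have R: "linear R" "inj R" "surj R" using r(2) by (auto simp: orthogonal_transformation_linear orthogonal_transformation_inj orthogonal_transformation_surj)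
  obtain v where v: "R v = axis 2 1" using R(3) by (metis surjD)
  have cR: "continuous_on UNIV R" using R(1) by (simp add: linear_continuous_on linear_conv_bounded_linear)
  have cet: "continuous_on UNIV et" using r(3) by (rule lipschitz_on_continuous_on)
  obtain r2 where r2: "0 < r2" "ball x r2 \<subseteq> closure Z" using x(1) by (auto simp: mem_interior)
  \<comment> \<open>Moving from \<open>x\<close> by \<open>m\<close> against \<open>v\<close> lowers
    the second rotated coordinate and leads strictly below the graph; the size of \<open>m\<close>
    keeps the point in both balls.\<close>
  define m where "m = min r r2 / (2 * (norm v + 1))"
  have "0 < norm v + 1" using norm_ge_zero[of v] by linarith
  hence m: "0 < m" using r(1) r2(1) unfolding m_def by (intro divide_pos_pos) auto
  define y where "y = x - m *\<^sub>R v"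
  have "dist x y = m * norm v" using m by (simp add: y_def dist_norm)
  also have "... < min r r2"
  proof -
   have "m * norm v <= m * (norm v + 1)" using m by simp
   also have "... = min r r2 / 2"
   proof -
    have "a / (2 * b) * b = a / 2" if "0 < b" for a b :: real using that by simp
    from this[of "norm v + 1" "min r r2"] show ?thesis unfolding m_def using norm_ge_zero[of v] by linarith
   qed
   also have "... < min r r2" using r(1) r2(1) by (simp add: min_def)
   finally show ?thesis .
  qed
  finally have yb: "y \<in> ball x r" "y \<in> ball x r2" by auto
  have "x \<in> ball x r" using r by simp
  hence "R x $ 2 <= et (R x $ 1)" using r(4) x(2) by (simp add: not_less[symmetric])
  moreover have Ry: "R y = R x - m *\<^sub>R axis 2 1" unfolding y_def using R(1) v by (simp add: linear_diff linear_scale)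
  ultimately have lt: "R y $ 2 < et (R y $ 1)" using m by (simp add: axis_def)
  define W where "W = ball x r \<inter> {z. R z $ 2 < et (R z $ 1)}"
  have "open W" unfolding W_def
   by (intro open_Int open_ball open_Collect_less continuous_intros cR continuous_on_compose2[OF cet]) auto
  moreover have "y \<in> W" using lt yb by (simp add: W_def)
  moreover have "y \<in> closure Z" using yb r2 by blast
  ultimately obtain z where "z \<in> W" "z \<in> Z" using closure_iff_nhds_not_empty[of y Z] by blast
  thus False using r(4)[of z] by (auto simp: W_def)
 qed
qed

lemma int_subset: "K \<in> \<T> ==> interior K \<subseteq> Z"
 using interior_mono[of K "closure Z"] interior_closure_Z cover_T by blast

text \<open>Two triangles on the same side of an edge share points close to its midpoint, against
  disjointness of interiors. This justifies the definite descriptions in \<open>K_plus\<close> and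
  \<open>K_minus\<close>.\<close>

lemma normal_unique:
 assumes "K \<in> \<T>" "K' \<in> \<T>" "e edge_of K" "e edge_of K'" "outer_normal K e nu" "outer_normal K' e nu"
 shows "K = K'"
proof (rule ccontr)
 assume ne: "K ~= K'"
 obtain a b c where E: "e = closed_segment a b" "a ~= b" using edge_repr[OF simplex_T[OF assms(1)] assms(3)] by metis
 have y: "midpoint a b \<in> open_segment a b" using E by simp
 have "\<forall>\<^sub>F s in at_right 0. midpoint a b - s *\<^sub>R nu \<in> interior K \<and> midpoint a b - s *\<^sub>R nu \<in> interior K'"
  using near_edge_interior[OF simplex_T assms(3) assms(5) E(1) y] near_edge_interior[OF simplex_T assms(4) assms(6) E(1) y] assms
  by (auto intro: eventually_conj)
 then obtain s where "midpoint a b - s *\<^sub>R nu \<in> interior K" "midpoint a b - s *\<^sub>R nu \<in> interior K'"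
  using eventually_happens[of _ "at_right (0 :: real)"] by fastforce
 thus False using interiors_disjoint[OF assms(1,2) ne] interior_subset by blast
qed

lemma K_plus_works: "e \<in> edges \<T> ==> K_plus \<T> n e \<in> \<T> \<and> e edge_of K_plus \<T> n e \<and> outer_normal (K_plus \<T> n e) e (n e)"
 unfolding K_plus_def
proof (rule theI')
 assume "e \<in> edges \<T>"
 then obtain K where K: "K \<in> \<T>" "e edge_of K" "outer_normal K e (n e)" using normals unfolding edge_normals_def by blast
 thus "\<exists>!K. K \<in> \<T> \<and> e edge_of K \<and> outer_normal K e (n e)" using normal_unique by blast
qed

text \<open>An edge not contained in the boundary has an inner point \<open>y\<close> in the domain.
  Points slightly beyond it lie in the domain, hence in a triangle \<open>K'\<close>, and since
  triangles meet in common faces \<open>K'\<close> has the same edge.\<close>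

lemma K_minus_works:
 assumes e: "e \<in> edges \<T>" "e \<notin> bd_edges Z \<T>"
 shows "K_minus \<T> n e \<in> \<T> \<and> e edge_of K_minus \<T> n e \<and> outer_normal (K_minus \<T> n e) e (- n e)"
 unfolding K_minus_def
proof (rule theI')
 define K where "K = K_plus \<T> n e"
 define nu where "nu = n e"
 have K: "K \<in> \<T>" "e edge_of K" "outer_normal K e nu" using K_plus_works[OF e(1)] by (auto simp: K_def nu_def)
 obtain a b where E: "e = closed_segment a b" "a ~= b" using edge_repr[OF simplex_T[OF K(1)] K(2)] by metis
 have eK: "e \<subseteq> K" using K(2) by (auto simp: edge_of_def face_of_def)
 note nn = outer_normal_perp[OF K(3) E(1) eK]
 have "\<not> e \<subseteq> frontier Z" using e by (simp add: bd_edges_def)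
 then obtain x where x: "x \<in> e" "x \<in> - frontier Z" by blast
 have "x \<in> closure (open_segment a b)" using x(1) E by (simp add: closure_open_segment)
 \<comment> \<open>\<open>x\<close> may be an endpoint of the edge; the complement of the boundary
   is open and so also meets the open segment.\<close>
 then obtain y where y: "y \<in> open_segment a b" "y \<in> - frontier Z"
  using x(2) closure_iff_nhds_not_empty[of x "open_segment a b"] by (metis Int_emptyI closed_Compl double_compl frontier_closed open_Compl subset_refl)
 have ye: "y \<in> e" using y(1) E segment_open_subset_closed[of a b] by blast
 hence "y \<in> closure Z" using eK K(1) cover_T by blast
 hence yZ: "y \<in> Z" using y(2) open_Z by (auto simp: frontier_def interior_open)
 have tend: "((%s. y + s *\<^sub>R nu) \<longlongrightarrow> y) (at_right 0)"
 proof -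
  have "((%s. y + s *\<^sub>R nu) \<longlongrightarrow> y + 0 *\<^sub>R nu) (at_right 0)" by (intro tendsto_intros)
  thus ?thesis by simp
 qed
 have evZ: "\<forall>\<^sub>F s in at_right 0. y + s *\<^sub>R nu \<in> Z" by (rule topological_tendstoD[OF tend open_Z yZ])
 \<comment> \<open>As the mesh is finite, one triangle meets the normal ray at arbitrarily small
   distances; being closed, it contains \<open>y\<close>.\<close>
 have "\<exists>K'\<in>\<T>. \<not> (\<forall>\<^sub>F s in at_right 0. y + s *\<^sub>R nu \<notin> K')"
 proof (rule ccontr)
  assume "\<not> ?thesis"
  hence "\<forall>\<^sub>F s in at_right 0. \<forall>K'\<in>\<T>. y + s *\<^sub>R nu \<notin> K'" using finite_T by (intro eventually_ball_finite) auto
  with evZ have "\<forall>\<^sub>F s :: real in at_right 0. False"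
  proof eventually_elim
   case (elim s)
   thus ?case using cover_T closure_subset[of Z] by blast
  qed
  thus False by simp
 qed
 then obtain K' where K': "K' \<in> \<T>" and fr: "\<not> (\<forall>\<^sub>F s in at_right 0. y + s *\<^sub>R nu \<notin> K')" by blast
 have yK': "y \<in> K'"
 proof (rule ccontr)
  assume "y \<notin> K'"
  hence "\<forall>\<^sub>F s in at_right 0. y + s *\<^sub>R nu \<in> - K'"
   using compact_T[OF K'] by (intro topological_tendstoD[OF tend]) (auto intro: compact_imp_closed)
  thus False using fr by simp
 qed
 have "\<exists>s>0. y + s *\<^sub>R nu \<in> K'"
 proof (rule ccontr)
  assume "\<not> ?thesis"
  hence "\<forall>\<^sub>F s in at_right 0. y + s *\<^sub>R nu \<notin> K'" by (auto simp: eventually_at_filter intro!: always_eventually)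
  thus False using fr by simp
 qed
 then obtain s where s: "0 < s" "y + s *\<^sub>R nu \<in> K'" by blast
 have ne: "K ~= K'"
 proof
  assume "K = K'"
  hence "(y + s *\<^sub>R nu - y) \<bullet> nu <= 0" using K(3) s(2) ye unfolding outer_normal_def by blast
  thus False using s nn(1) by (simp add: norm_eq_1)
 qed
 have F: "(K \<inter> K') face_of K" using face_T K K' by blast
 have aK: "a \<in> K" "b \<in> K" using eK E by auto
 have yK: "y \<in> K \<inter> K'" using ye eK yK' by blast
 hence "a \<in> K \<inter> K'" "b \<in> K \<inter> K'" using F aK y(1) unfolding face_of_def by blast+
 hence sub: "e \<subseteq> K \<inter> K'" unfolding E(1) by (intro closed_segment_subset face_of_imp_convex[OF F])
 have eF: "e face_of (K \<inter> K')" using K(2) sub by (auto simp: edge_of_def intro: face_of_subset)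
 \<comment> \<open>The common face has dimension at most 1 and the edge is one of its faces, so the
   two coincide.\<close>
 have "aff_dim (K \<inter> K') < aff_dim K"
  using face_of_aff_dim_lt[OF convex_T[OF K(1)] F] face_eq_same_dim[OF K(1) K'] ne by blast
 moreover have "aff_dim K = 2" using int_nonempty[OF K(1)] by (simp add: aff_dim_nonempty_interior)
 ultimately have "\<not> aff_dim e < aff_dim (K \<inter> K')" using K(2) by (simp add: edge_of_def)
 hence "e = K \<inter> K'" using face_of_aff_dim_lt[OF face_of_imp_convex[OF F] eF] by blast
 hence e': "e edge_of K'" using face_T[OF K' K(1)] K(2) by (simp add: edge_of_def Int_commute)
 obtain p q c where E': "e = closed_segment p q" "K' = convex hull {p, q, c}" and d: "cross2 (q - p) (c - p) ~= 0"
  using edge_repr[OF simplex_T[OF K'] e'] by metis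
 have nn': "norm nu = 1" "(q - p) \<bullet> nu = 0" using outer_normal_perp[OF K(3) E'(1) eK] by auto
 have perp: "(z - p) \<bullet> nu = 0" if z: "z \<in> e" for z
 proof -
  obtain t where "z = (1 - t) *\<^sub>R p + t *\<^sub>R q" using z E'(1) by (auto simp: in_segment)
  hence "z - p = t *\<^sub>R (q - p)" by (simp add: algebra_simps)
  thus ?thesis using nn'(2) by simp
 qed
 have mono: "0 <= bary p q c z" if "z \<in> K'" for z using that unfolding E'(2) mem_triangle_iff[OF d] by blast
 have "nu \<bullet> (y + s *\<^sub>R nu - p) = (y - p) \<bullet> nu + s * (nu \<bullet> nu)" by (simp add: algebra_simps inner_commute)
 hence "0 < nu \<bullet> (y + s *\<^sub>R nu - p)" using perp[OF ye] s nn'(1) by (simp add: norm_eq_1)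
 hence cpos: "0 < nu \<bullet> (c - p)" using bary_normal(1)[OF nn' d, of "y + s *\<^sub>R nu"] mono[OF s(2)] by (auto simp: zero_less_mult_iff)
 have on: "outer_normal K' e (- nu)"
  unfolding outer_normal_def
 proof (intro conjI ballI)
  show "norm (- nu) = 1" using nn' by simp
  fix z x assume z: "z \<in> e" and x: "x \<in> K'"
  have "0 <= nu \<bullet> (x - p)" using bary_normal(1)[OF nn' d, of x] mono[OF x] cpos by simp
  moreover have "(x - z) \<bullet> - nu = - (nu \<bullet> (x - p)) + (z - p) \<bullet> nu" by (simp add: algebra_simps inner_commute)
  ultimately show "(x - z) \<bullet> - nu <= 0" using perp[OF z] by simp
 qed
 show "\<exists>!K. K \<in> \<T> \<and> e edge_of K \<and> outer_normal K e (- n e)"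
  using K' e' on normal_unique unfolding nu_def by blast
qed

end

section \<open>Traces on edges\<close>

text \<open>Fubini's theorem for pairs, transported by the coordinate map, which preserves boxes and
  their content.\<close>

lemma integral_vec2_iterated:
 fixes f :: "real^2 => real"
 assumes f: "continuous_on UNIV f"
 shows "integral (cbox (vector [a, c]) (vector [b, d])) f = integral {a..b} (%x. integral {c..d} (%y. f (vector [x, y])))"
proof -
 define g where "g = (%z :: real \<times> real. (vector [fst z, snd z] :: real^2))"
 define h where "h = (%z :: real^2. (z $ 1, z $ 2))"
 have cg: "continuous_on UNIV g"
 proof -
  have "g = (%z. fst z *\<^sub>R axis 1 1 + snd z *\<^sub>R axis 2 1)"
   by (rule ext) (simp add: g_def vec_eq_iff forall_2 axis_def)
  thus ?thesis by (simp add: continuous_intros)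
 qed
 have memP: "z \<in> cbox u v \<longleftrightarrow> fst u <= fst z \<and> fst z <= fst v \<and> snd u <= snd z \<and> snd z <= snd v" for z u v :: "real \<times> real"
  by (cases u; cases v; cases z) (auto simp: cbox_Pair_eq)
 have gim: "g ` cbox u v = cbox (g u) (g v)" for u v
 proof
  show "g ` cbox u v \<subseteq> cbox (g u) (g v)"
   by (auto simp: g_def mem_box_cart forall_2 memP)
  show "cbox (g u) (g v) \<subseteq> g ` cbox u v"
  proof
   fix z assume "z \<in> cbox (g u) (g v)"
   hence "z = g (h z)" "h z \<in> cbox u v" by (auto simp: g_def h_def mem_box_cart forall_2 vec_eq_iff memP)
   thus "z \<in> g ` cbox u v" by blast
  qed
 qed
 have him: "h ` cbox u v = cbox (h u) (h v)" for u v
 proof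
  show "h ` cbox u v \<subseteq> cbox (h u) (h v)" by (auto simp: h_def mem_box_cart forall_2 memP)
  show "cbox (h u) (h v) \<subseteq> h ` cbox u v"
  proof
   fix z assume z: "z \<in> cbox (h u) (h v)"
   hence "z = h (g z)" "g z \<in> cbox u v" by (auto simp: g_def h_def mem_box_cart forall_2 memP)
   thus "z \<in> h ` cbox u v" by blast
  qed
 qed
 have cont: "measure lborel (g ` cbox u v) = 1 * measure lborel (cbox u v)" for u v
 proof -
  have "measure lborel (cbox (g u) (g v)) = measure lborel (cbox u v)"
  proof (cases "fst u <= fst v \<and> snd u <= snd v")
   case True
   hence "cbox (g u) (g v) ~= {}" by (auto simp: g_def interval_ne_empty_cart forall_2)
   hence "measure lborel (cbox (g u) (g v)) = (fst v - fst u) * (snd v - snd u)"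
    by (simp add: content_cbox_cart prod_2 g_def) (simp add: UNIV_2)
   moreover have "measure lborel (cbox u v) = (fst v - fst u) * (snd v - snd u)"
    using True content_Pair[of "fst u" "snd u" "fst v" "snd v"] by simp
   ultimately show ?thesis by simp
  next
   case False
   have "z \<notin> cbox (g u) (g v)" for z
    using False order_trans[of "fst u" "z $ 1" "fst v"] order_trans[of "snd u" "z $ 2" "snd v"]
    by (auto simp: g_def mem_box_cart forall_2)
   hence 1: "cbox (g u) (g v) = {}" by blast
   have "z \<notin> cbox u v" for z
    using False order_trans[of "fst u" "fst z" "fst v"] order_trans[of "snd u" "snd z" "snd v"] by (auto simp: memP)
   hence 2: "cbox u v = {}" by blast
   show ?thesis by (simp only: 1 2 measure_empty)
  qed
  thus ?thesis by (simp add: gim)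
 qed
 have "(f has_integral integral (cbox (vector [a, c]) (vector [b, d])) f) (cbox (vector [a, c]) (vector [b, d]))"
  by (intro integrable_integral integrable_continuous continuous_on_subset[OF f]) auto
 hence "((%z. f (g z)) has_integral (1 / 1) *\<^sub>R integral (cbox (vector [a, c]) (vector [b, d])) f) (h ` cbox (vector [a, c]) (vector [b, d]))"
 proof (rule has_integral_twiddle[rotated -1])
  show "h (g x) = x" for x by (simp add: g_def h_def)
  show "g (h x) = x" for x by (simp add: g_def h_def vec_eq_iff forall_2)
  show "continuous (at x) g" for x using continuous_on_eq_continuous_at[OF open_UNIV, of g] cg by blast
  show "\<exists>w z. g ` cbox u v = cbox w z" for u v using gim by blast
  show "\<exists>w z. h ` cbox u v = cbox w z" for u v using him by blast
  show "measure lborel (g ` cbox u v) = 1 * measure lborel (cbox u v)" for u v by (rule cont)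
 qed simp
 hence "integral (cbox (a, c) (b, d)) (%z. f (g z)) = integral (cbox (vector [a, c]) (vector [b, d])) f"
  unfolding him by (simp add: h_def integral_unique)
 moreover have "integral (cbox (a, c) (b, d)) (%z. f (g z)) = integral (cbox a b) (%x. integral (cbox c d) (%y. f (g (x, y))))"
  by (rule integral_prod_continuous) (rule continuous_on_compose2[OF f continuous_on_subset[OF cg]], auto)
 ultimately show ?thesis by (simp add: g_def)
qed

text \<open>\<open>f\<close> is read as a function with one-dimensional vectors as values, to fit
  the vector-valued change of variables.\<close>

lemma integral_linear_image_real:
 fixes f :: "real^2 => real" and g :: "real^2 => real^2"
 assumes f: "continuous_on UNIV f" and g: "linear g"
 shows "integral (g ` cbox u v) f = \<bar>det (matrix g)\<bar> * integral (cbox u v) (%x. f (g x))"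
proof -
 define F where "F = (%x. (vec (f x) :: real^1))"
 have cg: "continuous_on UNIV g" using g by (simp add: linear_continuous_on linear_conv_bounded_linear)
 have cF: "continuous_on UNIV (%x. F (g x))"
  unfolding F_def vec_def by (intro continuous_on_vec_lambda continuous_on_compose2[OF f cg]) simp
 have ai: "(F \<circ> g) absolutely_integrable_on cbox u v"
  unfolding o_def by (rule absolutely_integrable_continuous) (rule continuous_on_subset[OF cF], simp)
 have "integral (g ` cbox u v) F = \<bar>det (matrix g)\<bar> *\<^sub>R integral (cbox u v) (F \<circ> g)"
  by (rule integral_change_of_variables_linear[OF g]) (use ai in blast)
 hence "integral (g ` cbox u v) F $ 1 = \<bar>det (matrix g)\<bar> * (integral (cbox u v) (F \<circ> g) $ 1)" by simp
 moreover have "integral (g ` cbox u v) F $ 1 = integral (g ` cbox u v) (%x. F x $ 1)"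
 proof (rule integral_component_eq_cart[symmetric])
  have "F absolutely_integrable_on (g ` cbox u v)" using absolutely_integrable_on_linear_image[OF g] ai by blast
  thus "F integrable_on g ` cbox u v" using absolutely_integrable_on_def by blast
 qed
 moreover have "integral (cbox u v) (F \<circ> g) $ 1 = integral (cbox u v) (%x. (F \<circ> g) x $ 1)"
  by (rule integral_component_eq_cart[symmetric]) (use ai absolutely_integrable_on_def in blast)
 ultimately show ?thesis by (simp add: F_def)
qed

lemma bdom_interior: "bounded K ==> bdom (interior K)"
 using bounded_subset[OF _ interior_subset] by (auto simp: bdom_def)

text \<open>The linear map from the coordinate rectangle onto the parallelogram has determinant
  \<open>cross2 p q\<close>, and for nonnegative \<open>f\<close> the integral over the
  parallelogram is at most the one over the triangle. Boundaries of convex sets are null sets, which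
  allows passing to the interior.\<close>

lemma parallelogram_integral_le:
 fixes f :: "real^2 => real" and a p q :: "real^2"
 assumes f: "continuous_on UNIV f" and f0: "!!x. 0 <= f x" and K: "compact K" "convex K"
  and sub: "!!t s. t \<in> {u1..v1} ==> s \<in> {u2..v2} ==> a + t *\<^sub>R p + s *\<^sub>R q \<in> K"
 shows "\<bar>cross2 p q\<bar> * integral {u1..v1} (%t. integral {u2..v2} (%s. f (a + t *\<^sub>R p + s *\<^sub>R q))) <= (LINT x|lebesgue_on (interior K). f x)"
proof -
 define g where "g = (%z :: real^2. z $ 1 *\<^sub>R p + z $ 2 *\<^sub>R q)"
 define fa where "fa = (%x. f (x + a))"
 have g: "linear g" unfolding g_def by (rule linearI) (auto simp: algebra_simps)
 have cfa: "continuous_on UNIV fa" unfolding fa_def by (rule continuous_on_compose2[OF f]) (auto intro: continuous_intros)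
 have det: "det (matrix g) = cross2 p q" by (simp add: det_2 matrix_def g_def axis_def cross2_def)
 let ?S = "g ` cbox (vector [u1, u2]) (vector [v1, v2])"
 have cS: "compact ?S" using g by (intro compact_continuous_image linear_continuous_on) (auto simp: linear_conv_bounded_linear)
 have Kb: "K \<in> sets borel" using K(1) by (simp add: compact_imp_closed)
 have "integral ?S fa = \<bar>cross2 p q\<bar> * integral {u1..v1} (%t. integral {u2..v2} (%s. f (a + t *\<^sub>R p + s *\<^sub>R q)))"
  unfolding integral_linear_image_real[OF cfa g] det
 proof -
  have "continuous_on UNIV g" using g by (simp add: linear_continuous_on linear_conv_bounded_linear)
  hence "continuous_on UNIV (%z. fa (g z))" by (intro continuous_on_compose2[OF cfa]) auto
  from integral_vec2_iterated[OF this] show "\<bar>cross2 p q\<bar> * integral (cbox (vector [u1, u2]) (vector [v1, v2])) (%x. fa (g x)) =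
   \<bar>cross2 p q\<bar> * integral {u1..v1} (%t. integral {u2..v2} (%s. f (a + t *\<^sub>R p + s *\<^sub>R q)))"
   by (simp add: fa_def g_def add_ac)
 qed
 moreover have "integral ?S fa = (LINT x|lborel. indicator ?S x * fa x)"
 proof -
  have "integrable lborel (%x. indicator ?S x *\<^sub>R fa x)" by (rule borel_integrable_compact[OF cS continuous_on_subset[OF cfa]]) simp
  hence "((%x. indicator ?S x *\<^sub>R fa x) has_integral (LINT x|lborel. indicator ?S x *\<^sub>R fa x)) UNIV" by (rule has_integral_integral_lborel)
  moreover have "(%x. indicator ?S x *\<^sub>R fa x) = (%x. if x \<in> ?S then fa x else 0)" by (auto simp: indicator_def)
  ultimately have "(fa has_integral (LINT x|lborel. indicator ?S x *\<^sub>R fa x)) ?S" by (simp only: has_integral_restrict_UNIV)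
  thus ?thesis by (simp add: integral_unique)
 qed
 moreover have "(LINT x|lborel. indicator ?S x * fa x) <= (LINT x|lborel. indicator K (x + a) * f (x + a))"
 proof (rule integral_mono)
  show "integrable lborel (%x. indicator ?S x * fa x)"
   using borel_integrable_compact[OF cS continuous_on_subset[OF cfa, of ?S]] by simp
  have "compact ((%x. x - a) ` K)" using K(1) by (intro compact_continuous_image continuous_intros)
  hence "integrable lborel (%x. indicator ((%x. x - a) ` K) x *\<^sub>R fa x)"
   by (rule borel_integrable_compact) (rule continuous_on_subset[OF cfa], simp)
  moreover have "indicator ((%x. x - a) ` K) x *\<^sub>R fa x = indicator K (x + a) * f (x + a)" for x
  proof -
   have "x \<in> (%x. x - a) ` K \<longleftrightarrow> x + a \<in> K" by (auto simp: image_iff intro!: bexI[of _ "x + a"])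
   thus ?thesis by (simp add: indicator_def fa_def)
  qed
  ultimately show "integrable lborel (%x. indicator K (x + a) * f (x + a))" by simp
  fix x
  have "x + a \<in> K" if xS: "x \<in> ?S"
  proof -
   obtain z where z: "z \<in> cbox (vector [u1, u2]) (vector [v1, v2])" "x = g z" using xS by blast
   hence "a + z $ 1 *\<^sub>R p + z $ 2 *\<^sub>R q \<in> K" by (intro sub) (auto simp: mem_box_cart forall_2)
   thus ?thesis using z by (simp add: g_def algebra_simps)
  qed
  thus "indicator ?S x * fa x <= indicator K (x + a) * f (x + a)" using f0 by (auto simp: indicator_def fa_def)
 qed
 moreover have "(LINT x|lborel. indicator K (x + a) * f (x + a)) = (LINT x|lborel. indicator K x * f x)"
 proof (rule lborel_integral_translate)
  show "(%x. indicator K x * f x) \<in> borel_measurable borel"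
   using Kb borel_measurable_continuous_onI[OF f] by simp
 qed
 moreover have "(LINT x|lborel. indicator K x * f x) = (LINT x|lebesgue_on (interior K). f x)"
 proof -
  have "(LINT x|lborel. indicator K x * f x) = (LINT x|lebesgue. indicator K x * f x)"
   using Kb borel_measurable_continuous_onI[OF f] by (intro integral_completion[symmetric]) simp
  also have "... = (LINT x|lebesgue. (if x \<in> interior K then f x else 0))"
  proof (rule integral_cong_AE)
   have fm: "f \<in> borel_measurable lebesgue" using borel_measurable_continuous_onI[OF f] by (simp add: measurable_completion)
   show "(%x. indicator K x * f x) \<in> borel_measurable lebesgue" using Kb fm by (intro borel_measurable_times) (auto simp: borel_measurable_indicator)
   show "(%x. if x \<in> interior K then f x else 0) \<in> borel_measurable lebesgue"
    using fm by (intro measurable_If) auto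
   have "frontier K \<in> null_sets lebesgue" using negligible_convex_frontier[OF K(2)] by (simp add: negligible_iff_null_sets)
   hence "AE x in lebesgue. x \<notin> frontier K" by (rule AE_not_in)
   thus "AE x in lebesgue. indicator K x * f x = (if x \<in> interior K then f x else 0)"
   proof eventually_elim
    case (elim x)
    thus ?case using interior_subset[of K] closure_closed[OF compact_imp_closed[OF K(1)]]
     by (auto simp: indicator_def frontier_def)
   qed
  qed
  also have "... = (LINT x|lebesgue_on (interior K). f x)" by (rule Lebesgue_Measure.integral_restrict_UNIV) simp
  finally show ?thesis .
 qed
 ultimately show ?thesis by linarith
qed

text \<open>Half of the edge is a side of a parallelogram contained in the triangle.\<close>

lemma trace_bound:
 assumes d: "cross2 (b - a) (c - a) ~= 0" and w: "smooth w" and u: "u = 0 \<and> q = c - a \<or> u = 1/2 \<and> q = c - b"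
 defines "U \<equiv> interior (convex hull {a, b, c})"
 shows "integral {u..u + 1/2} (%t. \<bar>w (linepath a b t)\<bar>) * (1/2 * \<bar>cross2 (b - a) q\<bar>)
  <= l2norm U (%_. 1) * (l2norm U w + 1/2 * (\<bar>q $ 1\<bar> * l2norm U (pds [1] w) + \<bar>q $ 2\<bar> * l2norm U (pds [2] w)))"
proof -
 define K where "K = convex hull {a, b, c}"
 have K: "compact K" "convex K" by (auto simp: K_def finite_imp_compact_convex_hull)
 interpret bdom U unfolding U_def by (rule bdom_interior) (use K(1) in \<open>simp add: K_def compact_imp_bounded\<close>)
 define D where "D = (%x. q $ 1 * pds [1] w x + q $ 2 * pds [2] w x)"
 define T where "T = (%t s. a + t *\<^sub>R (b - a) + s *\<^sub>R q)"
 have cw: "continuous_on A w" for A by (rule smooth_continuous0[OF w])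
 have cD: "continuous_on A D" for A unfolding D_def by (intro continuous_intros smooth_continuous w)
 \<comment> \<open>\<open>u\<close> = 0 gives the half of the edge at \<open>a\<close>, shifted
   along the side from \<open>a\<close> to \<open>c\<close>; \<open>u\<close> = 1/2 gives the half
   at \<open>b\<close>, shifted along the side from \<open>b\<close> to \<open>c\<close>. Shifting
   the whole edge in one direction would leave the triangle.\<close>
 have TK: "T t s \<in> K" if "t \<in> {u..u + 1/2}" "s \<in> {0..1/2}" for t s
 proof -
  have "T t s = (1 - t - s) *\<^sub>R a + t *\<^sub>R b + s *\<^sub>R c \<and> 0 <= 1 - t - s \<and> 0 <= t \<or>
   T t s = (1 - t) *\<^sub>R a + (t - s) *\<^sub>R b + s *\<^sub>R c \<and> 0 <= 1 - t \<and> 0 <= t - s"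
   using u
  proof (elim disjE conjE)
   assume 1: "u = 0" "q = c - a"
   thus ?thesis using that 1(1) by (intro disjI1) (simp add: T_def 1(2) algebra_simps)
  next
   assume 1: "u = 1/2" "q = c - b"
   thus ?thesis using that 1(1) by (intro disjI2) (simp add: T_def 1(2) algebra_simps)
  qed
  moreover have "1 - t - s + t + s = 1" "1 - t + (t - s) + s = 1" "0 <= s" using that by auto
  ultimately show ?thesis unfolding K_def convex_hull_3 by blast
 qed
 have cT: "continuous_on A (%s. T t s)" for A t unfolding T_def by (intro continuous_intros)
 have cT1: "continuous_on A (%t. T t s)" for A s unfolding T_def by (intro continuous_intros)
 have cT2: "continuous_on A (%z. T (fst z) (snd z))" for A unfolding T_def by (intro continuous_intros)
 have inner_c: "continuous_on {u..u + 1/2} (%t. integral {0..1/2} (%s. \<bar>f (T t s)\<bar>))" if "!!A. continuous_on A f" for f :: "pt => real"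
 proof -
  have "continuous_on ({u..u + 1/2} \<times> cbox 0 (1/2)) (%(t, s). \<bar>f (T t s)\<bar>)"
   unfolding split_beta by (intro continuous_on_rabs continuous_on_compose2[OF that[of UNIV] cT2]) auto
  from integral_continuous_on_param[OF this] show ?thesis by simp
 qed
 have dw: "((%s. w (T t s)) has_vector_derivative D (T t s)) (at s within A)" for t s A
 proof -
  have 1: "(w has_derivative FD w (at x)) (at x)" for x using smooth_has_derivative[OF w, of "[]" x] by simp
  have qe: "q = q $ 1 *\<^sub>R axis 1 1 + q $ 2 *\<^sub>R axis 2 1" by (simp add: vec_eq_iff forall_2 axis_def)
  have lin: "linear (FD w (at x))" for x using has_derivative_linear[OF 1] .
  have "FD w (at x) q = D x" for x
   by (subst qe) (simp add: linear_add[OF lin] linear_scale[OF lin] D_def)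
  moreover have "((%s. w (T t s)) has_derivative (%h. FD w (at (T t s)) (h *\<^sub>R q))) (at s within A)"
   by (rule has_derivative_compose[OF _ 1]) (auto simp: T_def intro!: derivative_eq_intros)
  ultimately show ?thesis unfolding has_vector_derivative_def by (simp add: linear_scale[OF lin])
 qed
 \<comment> \<open>The value on the edge is the value at depth \<open>s\<close> minus the integral
   of the derivative in direction \<open>q\<close>; integration over all depths up to 1/2 produces
   area terms.\<close>
 have point: "1/2 * \<bar>w (T t 0)\<bar> <= integral {0..1/2} (%s. \<bar>w (T t s)\<bar>) + 1/2 * integral {0..1/2} (%s. \<bar>D (T t s)\<bar>)" for t
 proof -
  let ?I = "integral {0..1/2} (%s. \<bar>D (T t s)\<bar>)"
  have cDT: "continuous_on A (%s. D (T t s))" for A by (rule continuous_on_compose2[OF cD[of UNIV] cT]) simp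
  have cwT: "continuous_on A (%s. w (T t s))" for A by (rule continuous_on_compose2[OF cw[of UNIV] cT]) simp
  have le: "\<bar>w (T t 0)\<bar> <= \<bar>w (T t s)\<bar> + ?I" if s: "s \<in> {0..1/2}" for s
  proof -
   have "((%s. D (T t s)) has_integral w (T t s) - w (T t 0)) {0..s}"
    by (rule fundamental_theorem_of_calculus) (use s dw in auto)
   hence "w (T t s) - w (T t 0) = integral {0..s} (%s. D (T t s))" by (simp add: integral_unique)
   hence "\<bar>w (T t s) - w (T t 0)\<bar> = norm (integral {0..s} (%s. D (T t s)))" by simp
   also have "... <= integral {0..s} (%s. \<bar>D (T t s)\<bar>)"
    by (rule Henstock_Kurzweil_Integration.integral_norm_bound_integral) (auto intro!: integrable_continuous_real continuous_intros cDT)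
   also have "... <= ?I" using s by (intro integral_subset_le) (auto intro!: integrable_continuous_real continuous_intros cDT)
   finally show ?thesis by linarith
  qed
  have "integral {0..1/2} (%s::real. \<bar>w (T t 0)\<bar>) <= integral {0..1/2} (%s. \<bar>w (T t s)\<bar> + ?I)"
   by (rule integral_le) (auto intro!: integrable_continuous_real continuous_intros cwT le)
  also have "... = integral {0..1/2} (%s. \<bar>w (T t s)\<bar>) + integral {0..1/2} (%s::real. ?I)"
   by (rule Henstock_Kurzweil_Integration.integral_add) (auto intro!: integrable_continuous_real continuous_intros cwT)
  finally show ?thesis by simp
 qed
 have L: "\<bar>cross2 (b - a) q\<bar> * integral {u..u + 1/2} (%t. integral {0..1/2} (%s. \<bar>f (T t s)\<bar>)) <= l2norm U f * l2norm U (%_. 1)" if f: "!!A. continuous_on A f" for f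
 proof -
  have "\<bar>cross2 (b - a) q\<bar> * integral {u..u + 1/2} (%t. integral {0..1/2} (%s. \<bar>f (T t s)\<bar>)) <= (LINT x|lebesgue_on (interior K). \<bar>f x\<bar>)"
   unfolding T_def by (rule parallelogram_integral_le[OF continuous_on_rabs[OF f] _ K]) (use TK in \<open>auto simp: T_def\<close>)
  also have "... = (LINT x|lebesgue_on U. \<bar>f x\<bar>)" by (simp add: U_def K_def)
  also have "... <= l2norm U f * l2norm U (%_. 1)" by (rule L1_le_L2[OF continuous_L2[OF f]])
  finally show ?thesis .
 qed
 let ?J = "%f. integral {u..u + 1/2} (%t. integral {0..1/2} (%s. \<bar>f (T t s)\<bar>))"
 have lp: "linepath a b t = T t 0" for t by (simp add: linepath_def T_def algebra_simps)
 have "1/2 * integral {u..u + 1/2} (%t. \<bar>w (linepath a b t)\<bar>) = integral {u..u + 1/2} (%t. 1/2 * \<bar>w (T t 0)\<bar>)"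
  by (simp add: lp)
 also have "... <= integral {u..u + 1/2} (%t. integral {0..1/2} (%s. \<bar>w (T t s)\<bar>) + 1/2 * integral {0..1/2} (%s. \<bar>D (T t s)\<bar>))"
  by (rule integral_le) (auto intro!: integrable_continuous_real continuous_intros inner_c cw cD point[simplified] continuous_on_compose2[OF cw[of UNIV] cT1])
 also have "... = ?J w + 1/2 * ?J D"
  by (subst Henstock_Kurzweil_Integration.integral_add) (auto intro!: integrable_continuous_real continuous_intros inner_c cw cD)
 finally have main: "1/2 * integral {u..u + 1/2} (%t. \<bar>w (linepath a b t)\<bar>) <= ?J w + 1/2 * ?J D" .
 have "integral {u..u + 1/2} (%t. \<bar>w (linepath a b t)\<bar>) * (1/2 * \<bar>cross2 (b - a) q\<bar>) <= (?J w + 1/2 * ?J D) * \<bar>cross2 (b - a) q\<bar>"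
  using mult_right_mono[OF main abs_ge_zero[of "cross2 (b - a) q"]] by (simp only: mult_ac)
 also have "... = \<bar>cross2 (b - a) q\<bar> * ?J w + 1/2 * (\<bar>cross2 (b - a) q\<bar> * ?J D)"
 proof -
  have "(p + e * r) * x = x * p + e * (x * r)" for p r x e :: real by (simp add: algebra_simps)
  thus ?thesis .
 qed
 also have "... <= l2norm U w * l2norm U (%_. 1) + 1/2 * (l2norm U D * l2norm U (%_. 1))"
  by (intro add_mono mult_left_mono L cw cD) auto
 also have "... = l2norm U (%_. 1) * (l2norm U w + 1/2 * l2norm U D)"
 proof -
  have "p * x + e * (r * x) = x * (p + e * r)" for p r x e :: real by (simp add: algebra_simps)
  thus ?thesis .
 qed
 also have "... <= l2norm U (%_. 1) * (l2norm U w + 1/2 * (\<bar>q $ 1\<bar> * l2norm U (pds [1] w) + \<bar>q $ 2\<bar> * l2norm U (pds [2] w)))"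
 proof -
  have "D = lc (q $ 1) (pds [1] w) (q $ 2) (pds [2] w)" by (rule ext) (simp add: D_def lc_def)
  hence "l2norm U D <= \<bar>q $ 1\<bar> * l2norm U (pds [1] w) + \<bar>q $ 2\<bar> * l2norm U (pds [2] w)"
   by (simp only:) (rule l2norm_lc; rule smooth_L2[OF w])
  thus ?thesis by (intro mult_left_mono add_left_mono) auto
 qed
 finally show ?thesis .
qed

text \<open>The smooth functions in the definition of a trace differ from \<open>r\<close> by
  functions tending to 0 in H^1 of the triangle, hence by \<open>trace_bound\<close> in L^1 of the
  edge, while they tend to \<open>ta\<close> in L^2 of the edge.\<close>

lemma trace_unique:
 assumes K: "2 simplex (K :: pt set)" and e: "e edge_of K" and E: "ends e = (a, b)"
  and tr: "has_trace K e v ta" and r: "smooth r" and vr: "ae_eq (interior K) v r"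
 shows "AE t in L01. ta (linepath a b t) = r (linepath a b t)"
proof -
 obtain c where ab: "e = closed_segment a b" "a ~= b" and Kh: "K = convex hull {a, b, c}" and d: "cross2 (b - a) (c - a) ~= 0"
  using edge_repr[OF K e] E by (metis Pair_inject)
 define U where "U = interior K"
 have bK: "bounded K" unfolding Kh by (simp add: finite_imp_compact_convex_hull compact_imp_bounded)
 interpret bdom U unfolding U_def by (rule bdom_interior[OF bK])
 obtain w where w: "!!k::nat. smooth (w k)" "(%k. sob_norm U 1 (w k - v)) ----> 0"
   "(%k. edge_int e (%x. (w k x - ta x)^2)) ----> 0" and ta: "ta \<in> edge_L2 e"
  using tr unfolding has_trace_def U_def by blast
 define z where "z = (%k. w k - r)"
 have sz: "smooth (z k)" for k unfolding z_def by (intro smooth_diff w r)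
 have zn: "sob_norm U 1 (w k - v) = sob_norm U (real 1) (z k)" for k
 proof -
  have "ae_eq U (w k - v) (z k)" unfolding z_def diff_eq_lc using vr by (intro ae_eq_lc) (auto simp: U_def)
  thus ?thesis by (simp add: sob_norm_cong)
 qed
 have zl: "(%k. l2norm U (pds (rev is) (z k))) ----> 0" if l: "length is <= 1" for "is"
 proof (rule Lim_null_comparison[OF _ w(2)], intro always_eventually allI)
  fix k
  have "l2norm U (pds (rev is) (z k)) = l2norm U (wder U is (z k))"
   by (rule l2norm_cong[OF wder_smooth[OF sz], symmetric]) (rule wder_L2[OF smooth_Hk[OF sz] l])
  also have "... <= sob_norm U (real 1) (z k)" by (rule wder_le_sob_norm[OF smooth_Hk[OF sz] l])
  finally show "norm (l2norm U (pds (rev is) (z k))) <= sob_norm U 1 (w k - v)" unfolding zn by simp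
 qed
 have zl': "(%k. l2norm U (z k)) ----> 0" "(%k. l2norm U (pds [1] (z k))) ----> 0" "(%k. l2norm U (pds [2] (z k))) ----> 0"
  using zl[of "[]"] zl[of "[1]"] zl[of "[2]"] by auto
 let ?l = "linepath a b"
 have cl: "continuous_on A ?l" for A by (rule continuous_on_linepath)
 have cz: "continuous_on A (%t. \<bar>z k (?l t)\<bar>)" for A k
  by (intro continuous_intros continuous_on_compose2[OF smooth_continuous0[OF sz, of UNIV] cl]) auto
 have zh: "(%k. integral {u..u + 1/2} (%t. \<bar>z k (?l t)\<bar>)) ----> 0"
  if u: "u = 0 \<and> q = c - a \<or> u = 1/2 \<and> q = c - b" for u q
 proof -
  let ?c = "1/2 * \<bar>cross2 (b - a) q\<bar>"
  let ?B = "%k. l2norm U (%_. 1) * (l2norm U (z k) + 1/2 * (\<bar>q $ 1\<bar> * l2norm U (pds [1] (z k)) + \<bar>q $ 2\<bar> * l2norm U (pds [2] (z k))))"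
  have "cross2 (b - a) (c - b) = cross2 (b - a) (c - a)" by (simp add: cross2_def algebra_simps)
  hence c: "0 < ?c" using u d by auto
  have "?B ----> l2norm U (%_. 1) * (0 + 1/2 * (\<bar>q $ 1\<bar> * 0 + \<bar>q $ 2\<bar> * 0))" by (intro tendsto_intros zl')
  hence B: "(%k. ?B k / ?c) ----> 0" using tendsto_divide_zero[of ?B sequentially ?c] by simp
  show ?thesis
  proof (rule Lim_null_comparison[OF _ B], intro always_eventually allI)
   fix k
   have n: "0 <= integral {u..u + 1/2} (%t. \<bar>z k (?l t)\<bar>)" by (intro integral_nonneg integrable_continuous_real cz) auto
   have "integral {u..u + 1/2} (%t. \<bar>z k (?l t)\<bar>) * ?c <= ?B k" using trace_bound[OF d sz u] unfolding U_def Kh .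
   hence "integral {u..u + 1/2} (%t. \<bar>z k (?l t)\<bar>) <= ?B k / ?c" using c by (simp only: pos_le_divide_eq)
   thus "norm (integral {u..u + 1/2} (%t. \<bar>z k (?l t)\<bar>)) <= ?B k / ?c" using n by (simp only: real_norm_def abs_of_nonneg)
  qed
 qed
 have zi: "(%k. integral {0..1} (%t. \<bar>z k (?l t)\<bar>)) ----> 0"
 proof -
  have "integral {0..1/2} (%t. \<bar>z k (?l t)\<bar>) + integral {1/2..1} (%t. \<bar>z k (?l t)\<bar>) = integral {0..1} (%t. \<bar>z k (?l t)\<bar>)" for k
   by (intro Henstock_Kurzweil_Integration.integral_combine integrable_continuous_real cz) auto
  thus ?thesis using tendsto_add[OF zh[of 0 "c - a"] zh[of "1/2" "c - b"]] by simp
 qed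
 have tam: "(%t. ta (?l t)) \<in> borel_measurable (L01)" and tai: "integrable (L01) (%t. (ta (?l t))^2)"
  using ta E by (auto simp: edge_L2_def)
 have cm: "(%t. f (?l t)) \<in> borel_measurable (lebesgue_on A)" if "smooth f" "A \<in> sets lebesgue" for f A
  using that by (intro continuous_imp_measurable_on_sets_lebesgue continuous_on_compose2[OF smooth_continuous0[OF that(1), of UNIV] cl]) auto
 interpret I: finite_measure "L01" by (rule finite_measure_lebesgue_on) simp
 have sqi: "integrable (L01) (%t. (w k (?l t) - ta (?l t))^2)" for k
 proof -
  have ci: "continuous_on {0..1} (%t. (w k (?l t))^2)"
   by (intro continuous_intros continuous_on_compose2[OF smooth_continuous0[OF w(1), of UNIV] cl]) auto
  have "integrable (L01) (%t. (w k (?l t))^2)"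
   using absolutely_integrable_continuous_real[OF ci] by (simp add: absolutely_integrable_imp_integrable)
  hence "integrable (L01) (%t. 2 * (w k (?l t))^2 + 2 * (ta (?l t))^2)" using tai by simp
  thus ?thesis
  proof (rule Bochner_Integration.integrable_bound)
   show "(%t. (w k (?l t) - ta (?l t))^2) \<in> borel_measurable (L01)" by (intro borel_measurable_power borel_measurable_diff cm w(1) tam) simp
   have "(x - y)^2 <= 2 * x^2 + 2 * y^2" for x y :: real
    using zero_le_power2[of "x + y"] by (simp add: power2_sum power2_diff)
   thus "AE t in L01. norm ((w k (?l t) - ta (?l t))^2) <= norm (2 * (w k (?l t))^2 + 2 * (ta (?l t))^2)"
    by (auto intro!: AE_I2)
  qed
 qed
 have sq0: "(%k. LINT t|L01. (w k (?l t) - ta (?l t))^2) ----> 0"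
 proof -
  have "(%k. inverse (norm (b - a)) * (norm (b - a) * (LINT t|L01. (w k (?l t) - ta (?l t))^2))) ----> inverse (norm (b - a)) * 0"
   using w(3) E by (intro tendsto_mult_left) (simp add: edge_int_def)
  thus ?thesis using ab by (simp add: mult.assoc[symmetric])
 qed
 define f where "f = (%t. \<bar>r (?l t) - ta (?l t)\<bar>)"
 have fm: "f \<in> borel_measurable (L01)" unfolding f_def
  by (intro borel_measurable_abs borel_measurable_diff cm r tam) simp
 \<comment> \<open>|x| <= et + x^2 / et turns the squared distance into an L^1 bound;
   \<open>et\<close> is sent to 0 after \<open>k\<close> has gone to infinity.\<close>
 have bound: "f t <= \<bar>z k (?l t)\<bar> + (et + (w k (?l t) - ta (?l t))^2 / et)" if "0 < et" for t k et
 proof -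
  have "\<bar>x\<bar> <= et + x^2 / et" for x
  proof -
   have "0 <= (\<bar>x\<bar> - et)^2 + \<bar>x\<bar> * et" using that by simp
   hence "\<bar>x\<bar> * et <= (et + x^2 / et) * et" using that by (simp add: distrib_right power2_diff power2_eq_square[of et] algebra_simps)
   thus ?thesis using that by (simp only: mult_le_cancel_right_pos)
  qed
  from this[of "w k (?l t) - ta (?l t)"] show ?thesis by (simp add: f_def z_def)
 qed
 have zint: "integrable (L01) (%t. \<bar>z k (?l t)\<bar>)"
  "(LINT t|L01. \<bar>z k (?l t)\<bar>) = integral {0..1} (%t. \<bar>z k (?l t)\<bar>)" for k
 proof -
  show 1: "integrable (L01) (%t. \<bar>z k (?l t)\<bar>)"
   using absolutely_integrable_continuous_real[OF cz] by (simp add: absolutely_integrable_imp_integrable)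
  show "(LINT t|L01. \<bar>z k (?l t)\<bar>) = integral {0..1} (%t. \<bar>z k (?l t)\<bar>)"
   by (rule lebesgue_integral_eq_integral[OF 1]) simp
 qed
 have f0: "0 <= f t" for t by (simp add: f_def)
 have majo: "integrable (L01) (%t. \<bar>z k (?l t)\<bar> + (et + (w k (?l t) - ta (?l t))^2 / et))" for k et
  using zint(1)[of k] sqi[of k] by simp
 have fi: "integrable (L01) f"
  by (rule Bochner_Integration.integrable_bound[OF majo[of 0 1] fm]) (use bound[of 1 _ 0] f0 in \<open>auto intro!: AE_I2 simp: abs_of_nonneg[OF order_trans[OF f0 bound]]\<close>)
 have le: "integral\<^sup>L (L01) f <= et" if et: "0 < et" for et
 proof -
  have "integral\<^sup>L (L01) f <= integral {0..1} (%t. \<bar>z k (?l t)\<bar>) + (et + (LINT t|L01. (w k (?l t) - ta (?l t))^2) / et)" for k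
  proof -
   have "integral\<^sup>L (L01) f <= (LINT t|L01. \<bar>z k (?l t)\<bar> + (et + (w k (?l t) - ta (?l t))^2 / et))"
    by (rule integral_mono[OF fi majo]) (rule bound[OF et])
   also have "... = (LINT t|L01. \<bar>z k (?l t)\<bar>) + (LINT t|L01. et + (w k (?l t) - ta (?l t))^2 / et)"
    by (rule Bochner_Integration.integral_add[OF zint(1)]) (use sqi[of k] in simp)
   also have "(LINT t|L01. et + (w k (?l t) - ta (?l t))^2 / et) = (LINT t|L01. et) + (LINT t|L01. (w k (?l t) - ta (?l t))^2 / et)"
    by (rule Bochner_Integration.integral_add) (use sqi[of k] in simp_all)
   finally show ?thesis unfolding zint(2) by (simp add: measure_restrict_space)
  qed
  moreover have "(%k. integral {0..1} (%t. \<bar>z k (?l t)\<bar>) + (et + (LINT t|L01. (w k (?l t) - ta (?l t))^2) / et)) ----> 0 + (et + 0 / et)"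
   by (intro tendsto_add tendsto_const tendsto_divide zi sq0) (use et in simp)
  ultimately show ?thesis by (intro LIMSEQ_le_const) auto
 qed
 have "integral\<^sup>L (L01) f <= 0" by (rule field_le_epsilon) (use le in simp)
 moreover have "0 <= integral\<^sup>L (L01) f" by (rule integral_nonneg_AE) (use f0 in simp)
 ultimately have "AE t in L01. f t = 0"
  using integral_nonneg_eq_0_iff_AE[OF fi] f0 by auto
 thus ?thesis by eventually_elim (simp add: f_def)
qed

section \<open>The discrete bilinear form\<close>

text \<open>The constant sequence \<open>r\<close> serves as approximation, with zero error in both
  norms.\<close>

lemma has_trace_smooth:
 assumes K: "2 simplex (K :: pt set)" and e: "e edge_of K" and r: "smooth r" and vr: "ae_eq (interior K) v r"
 shows "has_trace K e v r"
proof -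
 obtain a b c where E: "ends e = (a, b)" and Kh: "K = convex hull {a, b, c}" using edge_repr[OF K e] by metis
 define U where "U = interior K"
 have bK: "bounded K" unfolding Kh by (simp add: finite_imp_compact_convex_hull compact_imp_bounded)
 interpret bdom U unfolding U_def by (rule bdom_interior[OF bK])
 have rv: "ae_eq U r v" using vr ae_eq_sym by (simp add: U_def)
 have "v \<in> Hk U 1" using smooth_Hk[OF r] rv by (rule Hk_cong)
 hence 1: "v \<in> Hs U 1" using Hs_int[of 1] by simp
 have c: "continuous_on {0..1} (%t. r (linepath a b t))"
  by (rule continuous_on_compose2[OF smooth_continuous0[OF r, of UNIV] continuous_on_linepath]) simp
 have 2: "r \<in> edge_L2 e"
 proof -
  have "continuous_on {0..1} (%t. (r (linepath a b t))^2)" using c by (intro continuous_intros)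
  from absolutely_integrable_continuous_real[OF this] have "integrable (L01) (%t. (r (linepath a b t))^2)"
   by (simp add: absolutely_integrable_imp_integrable)
  thus ?thesis unfolding edge_L2_def E using continuous_imp_measurable_on_sets_lebesgue[OF c] by simp
 qed
 have "ae_eq U (r - v) (lc 1 v (-1) v)" unfolding diff_eq_lc by (intro ae_eq_lc rv ae_eq_refl)
 moreover have "lc 1 v (-1) v = (%_. 0)" by (rule ext) (simp add: lc_def)
 ultimately have "sob_norm U 1 (r - v) = sob_norm U 1 (%_. 0)" using sob_norm_cong by metis
 also have "... = 0"
 proof -
  have "lc 0 v 0 v = (%_. 0)" by (rule ext) (simp add: lc_def)
  moreover have "sob_sq U 1 (lc 0 v 0 v) = 0" using sob_sq_scale[of v 1 0] \<open>v \<in> Hk U 1\<close> by simp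
  ultimately show ?thesis by (simp add: sob_norm_def)
 qed
 finally have z: "sob_norm U 1 (r - v) = 0" .
 have "edge_int e (%x. (r x - r x)^2) = 0" unfolding edge_int_def E by simp
 thus ?thesis unfolding has_trace_def using 1 2 r z
  by (intro conjI exI[of _ "%_. r"]) (auto simp: U_def)
qed

text \<open>Traces are determined only almost everywhere on an edge; the measure is that of the
  parameter interval which \<open>edge_int\<close> uses.\<close>

definition eae :: "pt set => scalar_field => scalar_field => bool" where
 "eae e sg ta \<longleftrightarrow> (case ends e of (a, b) => AE t in L01. sg (linepath a b t) = ta (linepath a b t))"

lemma trace_on_eae:
 assumes K: "2 simplex (K :: pt set)" and e: "e edge_of K" and r: "smooth r" and vr: "ae_eq (interior K) v r"
 shows "eae e (trace_on K e v) r"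
proof -
 obtain a b c where E: "ends e = (a, b)" using edge_repr[OF K e] by metis
 have "has_trace K e v (trace_on K e v)" unfolding trace_on_def by (rule someI[of "has_trace K e v"]) (rule has_trace_smooth[OF assms])
 from trace_unique[OF K e E this r vr] show ?thesis by (simp add: eae_def E)
qed

lemma eae_refl[simp]: "eae e ta ta" by (simp add: eae_def split: prod.split)

lemma eae_trans: assumes "eae e sg ta" "eae e ta \<upsilon>" shows "eae e sg \<upsilon>"
proof -
 obtain a b where E: "ends e = (a, b)" by force
 from assms show ?thesis unfolding eae_def E prod.case by eventually_elim simp
qed

lemma eae_sym: assumes "eae e sg ta" shows "eae e ta sg"
proof -
 obtain a b where E: "ends e = (a, b)" by force
 from assms show ?thesis unfolding eae_def E prod.case by eventually_elim simp
qed

lemma eae_op2: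
 assumes "eae e sg sg'" "eae e ta ta'" shows "eae e (%x. F (sg x) (ta x)) (%x. F (sg' x) (ta' x))"
proof -
 obtain a b where E: "ends e = (a, b)" by force
 from assms show ?thesis unfolding eae_def E prod.case by eventually_elim simp
qed

lemma eae_sum2: 
 fixes sg :: "2 => scalar_field"
 assumes "!!i. eae e (sg i) (ta i)" shows "eae e (%x. \<Sum>i\<in>UNIV. sg i x) (%x. \<Sum>i\<in>UNIV. ta i x)"
 unfolding sum_2 by (rule eae_op2[where F="(+)", OF assms assms])

lemma eae_lc: "eae e sg sg' ==> eae e ta ta' ==> eae e (lc a sg b ta) (lc a sg' b ta')"
 unfolding lc_def by (rule eae_op2[where F="%x y. a * x + b * y"])

text \<open>A class of edge functions closed under arithmetic and containing the traces of piecewise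
  smooth functions. Its members are measurable and integrable, without which the edge integral of a
  sum could not be split.\<close>

definition ecn :: "pt set => scalar_field => bool" where
 "ecn e ta \<longleftrightarrow> (\<exists>r. continuous_on UNIV r \<and> eae e ta r)"

lemma ecn_op2:
 assumes "ecn e sg" "ecn e ta" "continuous_on UNIV (%z. F (fst z) (snd z))" shows "ecn e (%x. F (sg x) (ta x))"
proof -
 obtain r s where rs: "continuous_on UNIV r" "eae e sg r" "continuous_on UNIV s" "eae e ta s" using assms by (auto simp: ecn_def)
 have "continuous_on UNIV (%x. F (fst (r x, s x)) (snd (r x, s x)))"
  by (rule continuous_on_compose2[OF assms(3)]) (auto intro!: continuous_on_Pair rs)
 thus ?thesis using eae_op2[OF rs(2,4), of F] unfolding ecn_def by auto
qed

lemma ecn_add: "ecn e sg ==> ecn e ta ==> ecn e (%x. sg x + ta x)"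
 by (rule ecn_op2[where F = "(+)"]) (auto intro!: continuous_intros)

lemma ecn_mult: "ecn e sg ==> ecn e ta ==> ecn e (%x. sg x * ta x)"
 by (rule ecn_op2[where F = "(*)"]) (auto intro!: continuous_intros)

lemma ecn_const: "ecn e (%_. c)" unfolding ecn_def by (intro exI[of _ "%_. c"]) simp

lemma edge_int_cong: 
 assumes "eae e sg ta" "ecn e sg" shows "edge_int e sg = edge_int e ta"
proof -
 obtain a b where E: "ends e = (a, b)" by force
 obtain r where r: "continuous_on UNIV r" "eae e sg r" using assms by (auto simp: ecn_def)
 have c: "continuous_on {0..1} (%t. r (linepath a b t))" by (rule continuous_on_compose2[OF r(1) continuous_on_linepath]) simp
 have rm: "(%t. r (linepath a b t)) \<in> borel_measurable (L01)" 
  by (rule continuous_imp_measurable_on_sets_lebesgue[OF c]) simp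
 have m: "(%t. f (linepath a b t)) \<in> borel_measurable (L01)" if "eae e r f" for f
 proof -
  have "(%t. if t \<in> {0..1} then r (linepath a b t) else 0) \<in> borel_measurable lebesgue"
   using rm by (subst borel_measurable_if) auto
  moreover have "AE t in lebesgue. t \<in> {0..1} --> r (linepath a b t) = f (linepath a b t)"
   using that unfolding eae_def E prod.case by (subst (asm) AE_restrict_space_iff) auto
  hence "AE t in lebesgue. (if t \<in> {0..1} then r (linepath a b t) else 0) = (if t \<in> {0..1} then f (linepath a b t) else 0)"
   by eventually_elim simp
  ultimately have "(%t. if t \<in> {0..1} then f (linepath a b t) else 0) \<in> borel_measurable lebesgue" by (rule borel_measurable_AE)
  thus ?thesis by (subst (asm) borel_measurable_if) auto
 qed
 have "(LINT t|L01. sg (linepath a b t)) = (LINT t|L01. ta (linepath a b t))"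
  using assms(1) m[OF eae_sym[OF r(2)]] m[OF eae_trans[OF eae_sym[OF r(2)] assms(1)]]
  by (intro integral_cong_AE) (auto simp: eae_def E)
 thus ?thesis by (simp add: edge_int_def E)
qed

lemma edge_int_lin:
 assumes "ecn e sg" "ecn e ta" shows "edge_int e (%x. a * sg x + b * ta x) = a * edge_int e sg + b * edge_int e ta"
proof -
 obtain p q where E: "ends e = (p, q)" by force
 obtain r s where rs: "continuous_on UNIV r" "eae e sg r" "continuous_on UNIV s" "eae e ta s" using assms by (auto simp: ecn_def)
 have i: "integrable (L01) (%t. f (linepath p q t))" if "continuous_on UNIV f" for f :: "pt => real"
 proof -
  have "continuous_on {0..1} (%t. f (linepath p q t))" by (rule continuous_on_compose2[OF that continuous_on_linepath]) simp
  from absolutely_integrable_continuous_real[OF this] show ?thesis by (simp add: absolutely_integrable_imp_integrable)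
 qed
 have "edge_int e (%x. a * sg x + b * ta x) = edge_int e (%x. a * r x + b * s x)"
  by (rule edge_int_cong[OF eae_op2[OF rs(2,4), where F="%x y. a * x + b * y"]]) (intro ecn_add ecn_mult ecn_const assms)
 also have "... = a * edge_int e r + b * edge_int e s"
  using i[OF rs(1)] i[OF rs(3)] by (simp add: edge_int_def E algebra_simps)
 finally show ?thesis using edge_int_cong[OF rs(2) assms(1)] edge_int_cong[OF rs(4) assms(2)] by simp
qed

text \<open>A family over the triangles, in the form that jumps and averages take; elementwise
  derivatives are such families and do not come from one function on the domain.\<close>

definition pwsm :: "pt set set => (pt set => scalar_field) => bool" where
 "pwsm \<T> V \<longleftrightarrow> (\<forall>K\<in>\<T>. \<exists>r. smooth r \<and> ae_eq (interior K) (V K) r)"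

section \<open>Bilinearity of the discrete form\<close>

context tri_mesh
begin

lemma bdom_T: "K \<in> \<T> ==> bdom (interior K)"
 by (intro bdom_interior compact_imp_bounded compact_T)

lemma bdom_Z: "bdom Z" using open_Z bounded_Z by (simp add: bdom_def)

text \<open>\<open>trace_on\<close> is a choice, but both sides agree almost everywhere on the edge
  with one and the same smooth function.\<close>

lemma trace_lin:
 assumes K: "K \<in> \<T>" "e edge_of K" and V: "pwsm \<T> V" and W: "pwsm \<T> W" and X: "!!K. K \<in> \<T> ==> ae_eq (interior K) (X K) (lc a (V K) b (W K))"
 shows "eae e (trace_on K e (X K)) (lc a (trace_on K e (V K)) b (trace_on K e (W K)))"
proof -
 interpret bdom "interior K" by (rule bdom_T[OF K(1)])
 obtain r s where rs: "smooth r" "ae_eq (interior K) (V K) r" "smooth s" "ae_eq (interior K) (W K) s" using V W K unfolding pwsm_def by metis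
 have "ae_eq (interior K) (X K) (lc a r b s)" using X[OF K(1)] ae_eq_lc[OF rs(2,4)] by (rule ae_eq_trans)
 moreover have "smooth (lc a r b s)" unfolding lc_def by (rule smooth_lin(2)[OF rs(1,3)])
 ultimately have "eae e (trace_on K e (X K)) (lc a r b s)" by (intro trace_on_eae simplex_T K)
 moreover have "eae e (lc a (trace_on K e (V K)) b (trace_on K e (W K))) (lc a r b s)"
  by (intro eae_lc trace_on_eae simplex_T K rs)
 ultimately show ?thesis using eae_trans eae_sym by blast
qed

lemma trace_ecn: "K \<in> \<T> ==> e edge_of K ==> pwsm \<T> V ==> ecn e (trace_on K e (V K))"
proof -
 assume a: "K \<in> \<T>" "e edge_of K" "pwsm \<T> V"
 then obtain r where "smooth r" "ae_eq (interior K) (V K) r" unfolding pwsm_def by metis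
 thus ?thesis unfolding ecn_def using trace_on_eae[OF simplex_T[OF a(1)] a(2)] smooth_continuous0 by blast
qed

lemma jump_lin:
 assumes e: "e \<in> edges \<T>" and V: "pwsm \<T> V" and W: "pwsm \<T> W" and X: "!!K. K \<in> \<T> ==> ae_eq (interior K) (X K) (lc a (V K) b (W K))"
 shows "eae e (jump Z \<T> n e X) (lc a (jump Z \<T> n e V) b (jump Z \<T> n e W))"
proof (cases "e \<in> bd_edges Z \<T>")
 case True
 have "eae e (trace_on (K_plus \<T> n e) e (X (K_plus \<T> n e))) (lc a (trace_on (K_plus \<T> n e) e (V (K_plus \<T> n e))) b (trace_on (K_plus \<T> n e) e (W (K_plus \<T> n e))))"
  using K_plus_works[OF e] by (intro trace_lin V W X) auto
 thus ?thesis using True by (simp add: jump_def Let_def)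
next
 case False
 let ?K = "K_plus \<T> n e" and ?K' = "K_minus \<T> n e"
 have "eae e (trace_on ?K e (X ?K)) (lc a (trace_on ?K e (V ?K)) b (trace_on ?K e (W ?K)))"
  "eae e (trace_on ?K' e (X ?K')) (lc a (trace_on ?K' e (V ?K')) b (trace_on ?K' e (W ?K')))"
  using K_plus_works[OF e] K_minus_works[OF e False] by (auto intro!: trace_lin V W X)
 from eae_op2[OF this, of "(-)"] show ?thesis using False by (simp add: jump_def Let_def lc_def algebra_simps)
qed

lemma avg_lin:
 assumes e: "e \<in> edges \<T>" and V: "pwsm \<T> V" and W: "pwsm \<T> W" and X: "!!K. K \<in> \<T> ==> ae_eq (interior K) (X K) (lc a (V K) b (W K))"
 shows "eae e (avg Z \<T> n e X) (lc a (avg Z \<T> n e V) b (avg Z \<T> n e W))"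
proof (cases "e \<in> bd_edges Z \<T>")
 case True
 have "eae e (trace_on (K_plus \<T> n e) e (X (K_plus \<T> n e))) (lc a (trace_on (K_plus \<T> n e) e (V (K_plus \<T> n e))) b (trace_on (K_plus \<T> n e) e (W (K_plus \<T> n e))))"
  using K_plus_works[OF e] by (intro trace_lin V W X) auto
 thus ?thesis using True by (simp add: avg_def Let_def)
next
 case False
 let ?K = "K_plus \<T> n e" and ?K' = "K_minus \<T> n e"
 have "eae e (trace_on ?K e (X ?K)) (lc a (trace_on ?K e (V ?K)) b (trace_on ?K e (W ?K)))"
  "eae e (trace_on ?K' e (X ?K')) (lc a (trace_on ?K' e (V ?K')) b (trace_on ?K' e (W ?K')))"
  using K_plus_works[OF e] K_minus_works[OF e False] by (auto intro!: trace_lin V W X)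
 from eae_op2[OF this, of "%x y. (x + y) / 2"] show ?thesis using False by (simp add: avg_def Let_def lc_def algebra_simps add_divide_distrib)
qed

lemma jump_ecn:
 assumes e: "e \<in> edges \<T>" and V: "pwsm \<T> V" shows "ecn e (jump Z \<T> n e V)"
proof (cases "e \<in> bd_edges Z \<T>")
 case True
 thus ?thesis using trace_ecn[OF _ _ V] K_plus_works[OF e] by (auto simp: jump_def Let_def)
next
 case False
 have "ecn e (%x. trace_on (K_plus \<T> n e) e (V (K_plus \<T> n e)) x - trace_on (K_minus \<T> n e) e (V (K_minus \<T> n e)) x)"
  using K_plus_works[OF e] K_minus_works[OF e False] by (intro ecn_op2[where F="(-)"] trace_ecn V) (auto intro!: continuous_intros)
 thus ?thesis using False by (simp add: jump_def Let_def)
qed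

lemma avg_ecn:
 assumes e: "e \<in> edges \<T>" and V: "pwsm \<T> V" shows "ecn e (avg Z \<T> n e V)"
proof (cases "e \<in> bd_edges Z \<T>")
 case True
 thus ?thesis using trace_ecn[OF _ _ V] K_plus_works[OF e] by (auto simp: avg_def Let_def)
next
 case False
 have "ecn e (%x. (trace_on (K_plus \<T> n e) e (V (K_plus \<T> n e)) x + trace_on (K_minus \<T> n e) e (V (K_minus \<T> n e)) x) / 2)"
  using K_plus_works[OF e] K_minus_works[OF e False] by (intro ecn_op2[where F="%x y. (x + y) / 2"] trace_ecn V) (auto intro!: continuous_intros)
 thus ?thesis using False by (simp add: avg_def Let_def)
qed

text \<open>The boundary of a convex set is a null set. Local Sobolev spaces live on open triangles,
  polynomial pieces on closed ones.\<close>

lemma ae_eq_interior: 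
 assumes K: "K \<in> \<T>" shows "ae_eq (interior K) v w \<longleftrightarrow> ae_eq K v w"
proof -
 have "frontier K \<in> null_sets lebesgue" using negligible_convex_frontier[OF convex_T[OF K]] by (simp add: negligible_iff_null_sets)
 hence fr: "AE x in lebesgue. x \<notin> frontier K" by (rule AE_not_in)
 have cK: "closed K" using compact_T[OF K] by (rule compact_imp_closed)
 have Ks: "K \<in> sets lebesgue" by (rule fmeasurableD[OF lmeasurable_compact[OF compact_T[OF K]]])
 have eq: "AE x in lebesgue. x \<in> K \<longleftrightarrow> x \<in> interior K"
  using fr by eventually_elim (use interior_subset[of K] cK in \<open>auto simp: frontier_def\<close>)
 have "(AE x in lebesgue. x \<in> interior K --> v x = w x) \<longleftrightarrow> (AE x in lebesgue. x \<in> K --> v x = w x)"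
 proof
  assume "AE x in lebesgue. x \<in> interior K --> v x = w x"
  with eq show "AE x in lebesgue. x \<in> K --> v x = w x" by eventually_elim blast
 next
  assume "AE x in lebesgue. x \<in> K --> v x = w x"
  with eq show "AE x in lebesgue. x \<in> interior K --> v x = w x" by eventually_elim blast
 qed
 thus ?thesis unfolding ae_eq_def using Ks by (simp add: AE_restrict_space_iff)
qed

text \<open>A space containing the finite element functions in which all trace terms are governed by
  smooth representatives; bilinearity of the form is proved on it.\<close>

definition PS :: "scalar_field set" where
 "PS = {v. \<forall>K\<in>\<T>. \<exists>r. smooth r \<and> ae_eq (interior K) v r}"

lemma pw_polys_PS: "v \<in> pw_polys r \<T> ==> v \<in> PS"
 unfolding PS_def pw_polys_def using ae_eq_interior smooth_polys by blast

lemma Vh_PS: "v \<in> Vh Z \<T> ==> v \<in> PS" by (auto simp: Vh_def intro: pw_polys_PS)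

lemma PS_Hk: "v \<in> PS ==> K \<in> \<T> ==> v \<in> Hk (interior K) m"
proof -
 assume a: "v \<in> PS" "K \<in> \<T>"
 interpret bdom "interior K" by (rule bdom_T[OF a(2)])
 obtain r where "smooth r" "ae_eq (interior K) v r" using a unfolding PS_def by blast
 thus ?thesis using Hk_cong[OF smooth_Hk ae_eq_sym] by blast
qed

lemma pwsm_pw_der: "v \<in> PS ==> pwsm \<T> (pw_der is v)"
 unfolding pwsm_def
proof
 fix K assume v: "v \<in> PS" and K: "K \<in> \<T>"
 interpret bdom "interior K" by (rule bdom_T[OF K])
 obtain r where r: "smooth r" "ae_eq (interior K) v r" using v K unfolding PS_def by blast
 have "ae_eq (interior K) (pw_der is v K) (pds (rev is) r)" unfolding pw_der_def wder_cong[OF r(2)] by (rule wder_smooth[OF r(1)])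
 thus "\<exists>r. smooth r \<and> ae_eq (interior K) (pw_der is v K) r" using smooth_pds[OF r(1)] by blast
qed

lemma pw_der_lc: "v \<in> PS ==> w \<in> PS ==> K \<in> \<T> ==> ae_eq (interior K) (pw_der is (lc a v b w) K) (lc a (pw_der is v K) b (pw_der is w K))"
 unfolding pw_der_def by (rule bdom.wder_lc[OF bdom_T PS_Hk PS_Hk order_refl])

lemma normal_der_eq: "normal_der nu v K = lc (nu $ 1) (pw_der [1] v K) (nu $ 2) (pw_der [2] v K)"
 by (rule ext) (simp add: normal_der_def lc_def sum_2)

lemma pwsm_lc: 
 assumes "pwsm \<T> V" "pwsm \<T> W" shows "pwsm \<T> (%K. lc a (V K) b (W K))"
 unfolding pwsm_def
proof
 fix K assume K: "K \<in> \<T>"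
 interpret bdom "interior K" by (rule bdom_T[OF K])
 obtain r s where rs: "smooth r" "ae_eq (interior K) (V K) r" "smooth s" "ae_eq (interior K) (W K) s" using assms K unfolding pwsm_def by metis
 have "smooth (lc a r b s)" unfolding lc_def by (rule smooth_lin(2)[OF rs(1,3)])
 thus "\<exists>r. smooth r \<and> ae_eq (interior K) (lc a (V K) b (W K)) r" using ae_eq_lc[OF rs(2,4)] by blast
qed

lemma pwsm_normal: "v \<in> PS ==> pwsm \<T> (normal_der nu v)"
 using pwsm_lc[OF pwsm_pw_der pwsm_pw_der, of v v "nu $ 1" "[1]" "nu $ 2" "[2]"] by (simp add: normal_der_eq[abs_def])

lemma normal_der_lc: 
 assumes "v \<in> PS" "w \<in> PS" "K \<in> \<T>" shows "ae_eq (interior K) (normal_der nu (lc a v b w) K) (lc a (normal_der nu v K) b (normal_der nu w K))"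
proof -
 interpret bdom "interior K" by (rule bdom_T[OF assms(3)])
 have "ae_eq (interior K) (normal_der nu (lc a v b w) K) (lc (nu $ 1) (lc a (pw_der [1] v K) b (pw_der [1] w K)) (nu $ 2) (lc a (pw_der [2] v K) b (pw_der [2] w K)))"
  unfolding normal_der_eq by (intro ae_eq_lc pw_der_lc assms)
 moreover have "lc (nu $ 1) (lc a (pw_der [1] v K) b (pw_der [1] w K)) (nu $ 2) (lc a (pw_der [2] v K) b (pw_der [2] w K)) = lc a (normal_der nu v K) b (normal_der nu w K)"
  unfolding normal_der_eq by (rule ext) (simp add: lc_def algebra_simps)
 ultimately show ?thesis by simp
qed

lemma edge_int_prod_lin:
 assumes "eae e P (lc a P1 b P2)" "ecn e P1" "ecn e P2" "ecn e Q"
 shows "edge_int e (%x. P x * Q x) = a * edge_int e (%x. P1 x * Q x) + b * edge_int e (%x. P2 x * Q x)"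
proof -
 have "edge_int e (%x. lc a P1 b P2 x * Q x) = edge_int e (%x. P x * Q x)"
  by (rule edge_int_cong[OF eae_op2[OF eae_sym[OF assms(1)] eae_refl]]) 
    (unfold lc_def, intro ecn_mult ecn_add ecn_const assms)
 moreover have "(%x. lc a P1 b P2 x * Q x) = (%x. a * (P1 x * Q x) + b * (P2 x * Q x))" by (rule ext) (simp add: lc_def algebra_simps)
 ultimately show ?thesis using edge_int_lin[OF ecn_mult[OF assms(2,4)] ecn_mult[OF assms(3,4)], of a b] by simp
qed

lemma penalty_lc:
 assumes "v \<in> PS" "w \<in> PS" "z \<in> PS"
 shows "penalty Z \<T> n s (lc a v b w) z = a * penalty Z \<T> n s v z + b * penalty Z \<T> n s w z"
proof -
 have "edge_int e (%x. jump Z \<T> n e (normal_der (n e) (lc a v b w)) x * jump Z \<T> n e (normal_der (n e) z) x) =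
  a * edge_int e (%x. jump Z \<T> n e (normal_der (n e) v) x * jump Z \<T> n e (normal_der (n e) z) x) +
  b * edge_int e (%x. jump Z \<T> n e (normal_der (n e) w) x * jump Z \<T> n e (normal_der (n e) z) x)" if "e \<in> edges \<T>" for e
  by (intro edge_int_prod_lin jump_lin jump_ecn that pwsm_normal normal_der_lc assms)
 thus ?thesis unfolding penalty_def sum_distrib_left sum.distrib[symmetric] by (intro sum.cong refl) (simp add: algebra_simps)
qed

lemma avgn_ecn: "e \<in> edges \<T> ==> v \<in> PS ==> ecn e (%x. \<Sum>j\<in>UNIV. avg Z \<T> n e (pw_der [i, j] v) x * n e $ j)"
 unfolding sum_2 by (intro ecn_add ecn_mult ecn_const avg_ecn pwsm_pw_der)

lemma edge_int_sum2: "(!!i :: 2. ecn e (f i)) ==> edge_int e (%x. \<Sum>i\<in>UNIV. f i x) = (\<Sum>i\<in>UNIV. edge_int e (f i))"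
 using edge_int_lin[of e "f 1" "f 2" 1 1] by (simp add: sum_2)

lemma consistency_left:
 assumes "v \<in> PS" "w \<in> PS" "z \<in> PS"
 shows "consistency Z \<T> n (lc a v b w) z = a * consistency Z \<T> n v z + b * consistency Z \<T> n w z"
proof -
 have H: "lc a v b w \<in> PS" using assms pwsm_lc[of "%_. v" "%_. w"] by (auto simp: PS_def pwsm_def)
 let ?A = "%e i x. \<Sum>j\<in>UNIV. avg Z \<T> n e (pw_der [i, j] z) x * n e $ j"
 have "edge_int e (%x. \<Sum>i\<in>UNIV. jump Z \<T> n e (pw_der [i] (lc a v b w)) x * ?A e i x) =
  a * edge_int e (%x. \<Sum>i\<in>UNIV. jump Z \<T> n e (pw_der [i] v) x * ?A e i x) +
  b * edge_int e (%x. \<Sum>i\<in>UNIV. jump Z \<T> n e (pw_der [i] w) x * ?A e i x)" if e: "e \<in> edges \<T>" for e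
 proof -
  have c: "ecn e (%x. jump Z \<T> n e (pw_der [i] f) x * ?A e i x)" if "f \<in> PS" for f i
   by (intro ecn_mult jump_ecn avgn_ecn e pwsm_pw_der that assms)
  have "edge_int e (%x. jump Z \<T> n e (pw_der [i] (lc a v b w)) x * ?A e i x) = a * edge_int e (%x. jump Z \<T> n e (pw_der [i] v) x * ?A e i x) + b * edge_int e (%x. jump Z \<T> n e (pw_der [i] w) x * ?A e i x)" for i
   by (intro edge_int_prod_lin jump_lin jump_ecn e pwsm_pw_der pw_der_lc avgn_ecn assms)
  thus ?thesis using c[OF H] c[OF assms(1)] c[OF assms(2)] by (simp only: edge_int_sum2) (simp add: sum_2 algebra_simps)
 qed
 thus ?thesis unfolding consistency_def sum_distrib_left sum.distrib[symmetric] by (intro sum.cong refl) simp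
qed

lemma consistency_right:
 assumes "v \<in> PS" "w \<in> PS" "z \<in> PS"
 shows "consistency Z \<T> n z (lc a v b w) = a * consistency Z \<T> n z v + b * consistency Z \<T> n z w"
proof -
 have H: "lc a v b w \<in> PS" using assms pwsm_lc[of "%_. v" "%_. w"] by (auto simp: PS_def pwsm_def)
 let ?A = "%f e i x. \<Sum>j\<in>UNIV. avg Z \<T> n e (pw_der [i, j] f) x * n e $ j"
 have "edge_int e (%x. \<Sum>i\<in>UNIV. jump Z \<T> n e (pw_der [i] z) x * ?A (lc a v b w) e i x) =
  a * edge_int e (%x. \<Sum>i\<in>UNIV. jump Z \<T> n e (pw_der [i] z) x * ?A v e i x) +
  b * edge_int e (%x. \<Sum>i\<in>UNIV. jump Z \<T> n e (pw_der [i] z) x * ?A w e i x)" if e: "e \<in> edges \<T>" for e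
 proof -
  have c: "ecn e (%x. jump Z \<T> n e (pw_der [i] z) x * ?A f e i x)" if "f \<in> PS" for f i
   by (intro ecn_mult jump_ecn avgn_ecn e pwsm_pw_der that assms)
  have A: "eae e (?A (lc a v b w) e i) (lc a (?A v e i) b (?A w e i))" for i
  proof -
   have "eae e (%x. avg Z \<T> n e (pw_der [i, j] (lc a v b w)) x * n e $ j) (%x. lc a (avg Z \<T> n e (pw_der [i, j] v)) b (avg Z \<T> n e (pw_der [i, j] w)) x * n e $ j)" for j
    using eae_op2[OF avg_lin[OF e pwsm_pw_der[OF assms(1), of "[i, j]"] pwsm_pw_der[OF assms(2), of "[i, j]"] pw_der_lc[OF assms(1,2)]] eae_refl[of e "%_. n e $ j"], of "(*)"] .
   from eae_sum2[OF this] have "eae e (?A (lc a v b w) e i) (%x. \<Sum>j\<in>UNIV. lc a (avg Z \<T> n e (pw_der [i, j] v)) b (avg Z \<T> n e (pw_der [i, j] w)) x * n e $ j)" .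
   moreover have "(%x. \<Sum>j\<in>UNIV. lc a (avg Z \<T> n e (pw_der [i, j] v)) b (avg Z \<T> n e (pw_der [i, j] w)) x * n e $ j) = lc a (?A v e i) b (?A w e i)"
    by (rule ext) (simp add: lc_def sum_2 algebra_simps)
   ultimately show ?thesis by simp
  qed
  have "edge_int e (%x. ?A (lc a v b w) e i x * jump Z \<T> n e (pw_der [i] z) x) = a * edge_int e (%x. ?A v e i x * jump Z \<T> n e (pw_der [i] z) x) + b * edge_int e (%x. ?A w e i x * jump Z \<T> n e (pw_der [i] z) x)" for i
   by (intro edge_int_prod_lin A jump_ecn e pwsm_pw_der avgn_ecn assms)
  hence "edge_int e (%x. jump Z \<T> n e (pw_der [i] z) x * ?A (lc a v b w) e i x) = a * edge_int e (%x. jump Z \<T> n e (pw_der [i] z) x * ?A v e i x) + b * edge_int e (%x. jump Z \<T> n e (pw_der [i] z) x * ?A w e i x)" for i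
   by (simp only: mult.commute[of "jump Z \<T> n e (pw_der [i] z) _"])
  thus ?thesis using c[OF H] c[OF assms(1)] c[OF assms(2)] by (simp only: edge_int_sum2) (simp add: sum_2 algebra_simps)
 qed
 thus ?thesis unfolding consistency_def sum_distrib_left sum.distrib[symmetric] by (intro sum.cong refl) simp
qed

lemma pw_hess_lc:
 assumes "v \<in> PS" "w \<in> PS" "z \<in> PS"
 shows "pw_hess_ip \<T> (lc a v b w) z = a * pw_hess_ip \<T> v z + b * pw_hess_ip \<T> w z"
proof -
 have "hess_ip (interior K) (lc a v b w) z = a * hess_ip (interior K) v z + b * hess_ip (interior K) w z" if K: "K \<in> \<T>" for K
 proof -
  interpret bdom "interior K" by (rule bdom_T[OF K])
  have H: "v \<in> Hk (interior K) 2" "w \<in> Hk (interior K) 2" "z \<in> Hk (interior K) 2" using assms K by (auto intro: PS_Hk)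
  have "ip (interior K) (wder (interior K) [i, j] (lc a v b w)) (wder (interior K) [i, j] z) =
   a * ip (interior K) (wder (interior K) [i, j] v) (wder (interior K) [i, j] z) + b * ip (interior K) (wder (interior K) [i, j] w) (wder (interior K) [i, j] z)" for i j
  proof -
   have L: "wder (interior K) [i, j] f \<in> L2 (interior K)" if "f \<in> Hk (interior K) 2" for f using wder_L2[OF that] by simp
   have "ip (interior K) (wder (interior K) [i, j] (lc a v b w)) (wder (interior K) [i, j] z) = ip (interior K) (lc a (wder (interior K) [i, j] v) b (wder (interior K) [i, j] w)) (wder (interior K) [i, j] z)"
    using H by (intro ip_cong wder_lc[of _ 2] ae_eq_refl L L2_lc Hk_lc) auto
   thus ?thesis using H L by (simp add: ip_lc_left)
  qed
  thus ?thesis by (simp add: hess_ip_def sum_2 algebra_simps)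
 qed
 thus ?thesis unfolding pw_hess_ip_def sum_distrib_left sum.distrib[symmetric] by (intro sum.cong refl) simp
qed

lemma hess_ip_commute: "hess_ip U v w = hess_ip U w v"
 by (simp add: hess_ip_def ip_def mult.commute)

lemma ah_commute: "ah Z \<T> n s v w = ah Z \<T> n s w v"
 by (simp add: ah_def pw_hess_ip_def penalty_def hess_ip_commute[of _ v w] mult.commute)

lemma ah_lc:
 assumes "v \<in> PS" "w \<in> PS" "z \<in> PS"
 shows "ah Z \<T> n s (lc a v b w) z = a * ah Z \<T> n s v z + b * ah Z \<T> n s w z"
 unfolding ah_def using assms by (simp add: pw_hess_lc consistency_left consistency_right penalty_lc algebra_simps)

lemma penalty_nonneg: "0 < s ==> 0 <= penalty Z \<T> n s v v"
proof -
 assume s: "0 < s"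
 have "0 <= diameter (e :: pt set)" if eE: "e \<in> edges \<T>" for e
 proof -
  obtain K where K: "K \<in> \<T>" "e edge_of K" using eE unfolding edges_def by blast
  hence "bounded e" using compact_T[THEN compact_imp_bounded] by (meson bounded_subset edge_of_imp_subset)
  thus ?thesis by (rule diameter_ge_0)
 qed
 thus ?thesis unfolding penalty_def edge_int_def using s
  by (intro sum_nonneg mult_nonneg_nonneg) (auto split: prod.split intro!: integral_nonneg_AE mult_nonneg_nonneg)
qed

lemma pw_hess_nonneg: "0 <= pw_hess_ip \<T> v v"
 unfolding pw_hess_ip_def hess_ip_def ip_def by (intro sum_nonneg integral_nonneg_AE) auto

lemma h_norm_sq: "0 < s ==> (h_norm Z \<T> n s v)^2 = pw_hess_ip \<T> v v + penalty Z \<T> n s v v"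
 using penalty_nonneg pw_hess_nonneg by (simp add: h_norm_def)

lemma h_norm_nonneg: "0 < s ==> 0 <= h_norm Z \<T> n s v"
 using penalty_nonneg pw_hess_nonneg by (simp add: h_norm_def)

end

section \<open>Functions of time\<close>

lemma AE_interval_dense:
 assumes "AE t in lebesgue_on {0<..<b :: real}. P t" "0 <= c" "c < d" "d <= b"
 obtains t where "c < t" "t < d" "P t"
proof -
 have "\<exists>t. c < t \<and> t < d \<and> P t"
 proof (rule ccontr)
  assume n: "\<nexists>t. c < t \<and> t < d \<and> P t"
  have "AE t in lebesgue. t \<in> {0<..<b} --> P t" using assms(1) by (simp add: AE_restrict_space_iff)
  hence "AE t in lebesgue. t \<notin> {c<..<d}" by eventually_elim (use n assms in auto)
  hence "{c<..<d} \<in> null_sets lebesgue" by (subst AE_iff_null_sets) auto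
  hence "emeasure lebesgue {c<..<d} = 0" by (rule null_setsD1)
  thus False using assms(3) by simp
 qed
 thus thesis using that by blast
qed

section \<open>Scalar products with functions of time\<close>

context bdom
begin

lemma has_time_deriv_L2: "has_time_deriv U T v t w ==> s \<in> {0..T} ==> v s \<in> L2 U" "has_time_deriv U T v t w ==> w \<in> L2 U"
 by (auto simp: has_time_deriv_def)

lemma time_quot: "(%x. (v s x - v t x) / (s - t) - w x) = lc 1 (lc (1 / (s - t)) (v s) (- 1 / (s - t)) (v t)) (- 1) w"
 by (rule ext) (simp add: lc_def diff_divide_distrib)

text \<open>Testing with a fixed function turns the vector-valued derivative into a real one, to
  which the mean value theorem and the quadrature bounds on the line apply.\<close>

lemma has_time_deriv_ip:
 assumes d: "has_time_deriv U T v t w" and t: "t \<in> {0..T}" and z: "z \<in> L2 U"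
 shows "((%s. ip U (v s) z) has_real_derivative ip U w z) (at t within {0..T})"
proof -
 let ?Q = "%s. lc 1 (lc (1 / (s - t)) (v s) (- 1 / (s - t)) (v t)) (- 1) w"
 have w: "w \<in> L2 U" and vt: "v t \<in> L2 U" using has_time_deriv_L2[OF d] t by auto
 have l: "((%s. nU (?Q s)) \<longlongrightarrow> 0) (at t within {0..T})" using d unfolding has_time_deriv_def time_quot by blast
 hence l2: "((%s. nU (?Q s) * nU z) \<longlongrightarrow> 0) (at t within {0..T})" using tendsto_mult_left_zero by blast
 have "((%s. (ip U (v s) z - ip U (v t) z) / (s - t) - ip U w z) \<longlongrightarrow> 0) (at t within {0..T})"
 proof (rule Lim_null_comparison[OF _ l2])
  have "norm ((ip U (v s) z - ip U (v t) z) / (s - t) - ip U w z) <= nU (?Q s) * nU z" if "s \<in> {0..T}" for s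
  proof -
   have vs: "v s \<in> L2 U" using has_time_deriv_L2(1)[OF d that] .
   have "ip U (?Q s) z = (ip U (v s) z - ip U (v t) z) / (s - t) - ip U w z"
    using vs vt w z by (simp add: ip_lc_left diff_divide_distrib)
   moreover have "\<bar>ip U (?Q s) z\<bar> <= nU (?Q s) * nU z" using vs vt w z by (intro Cauchy_Schwarz L2_lc)
   ultimately show ?thesis by simp
  qed
  thus "\<forall>\<^sub>F s in at t within {0..T}. norm ((ip U (v s) z - ip U (v t) z) / (s - t) - ip U w z) <= nU (?Q s) * nU z"
   by (simp add: eventually_at_filter)
 qed
 thus ?thesis by (simp add: has_field_derivative_iff LIM_zero_iff)
qed

lemma l2norm_lc_sq:
 assumes "v \<in> L2 U" "w \<in> L2 U"
 shows "(nU (lc a v b w))^2 = a^2 * (nU v)^2 + b^2 * (nU w)^2 + 2 * (a * b * ip U v w)"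
 using assms unfolding l2norm_sq by (simp add: ip_lc_left ip_lc_right ip_commute[of w v] power2_eq_square algebra_simps)

lemma has_time_deriv_ip_sub:
 assumes d: "!!t. t \<in> {0..T} ==> has_time_deriv U T v t (v' t)" and b: "b <= T" and t: "t \<in> {0..b}" and z: "z \<in> L2 U"
 shows "((%s. ip U (v s) z) has_real_derivative ip U (v' t) z) (at t within {0..b})"
 using has_field_derivative_subset[OF has_time_deriv_ip[OF d _ z], of t "{0..b}"] b t by auto

lemma l2norm_le_sob_sq: assumes v: "v \<in> Hs U s" shows "ennreal ((nU v)^2) <= sqU s v"
proof -
 have H: "v \<in> Hk U (nat \<lfloor>s\<rfloor>)" by (rule Hs_Hk[OF v])
 have L: "v \<in> L2 U" by (rule Hk_L2[OF H])
 have "nU v = nU (wU [] v)" by (rule l2norm_cong[OF ae_eq_sym[OF wder_Nil[OF L]] L])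
 hence "ennreal ((nU v)^2) = ennreal ((nU (wU [] v))^2)" by simp
 also have "... <= ennreal (\<Sum>is | length is <= nat \<lfloor>s\<rfloor>. (nU (wU is v))^2)"
  by (intro ennreal_leI member_le_sum finite_lists_le) auto
 also have "... <= sqU s v" using H by (simp add: sob_sq_def Let_def)
 finally show ?thesis .
qed

lemma bochner_ip_integrable:
 assumes v: "bochner_L1 U b v" and z: "z \<in> L2 U"
 shows "integrable (LI b) (%t. ip U (v t) z)"
proof -
 \<comment> \<open>After scaling \<open>z\<close> to norm at most 1 the norm of v(t) is itself an
   integrable majorant; the summand 1 avoids a division by 0.\<close>
 define m where "m = 1 + nU z"
 have m: "1 <= m" by (simp add: m_def)
 define y where "y = lc (1 / m) z 0 z"
 have y: "y \<in> L2 U" using z by (simp add: y_def)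
 have ny: "nU y <= 1"
 proof -
  have "nU y <= \<bar>1 / m\<bar> * nU z + \<bar>0\<bar> * nU z" unfolding y_def by (rule l2norm_lc[OF z z])
  also have "... = nU z / m" using m by simp
  also have "... <= 1" using m by (simp add: pos_divide_le_eq) (simp add: m_def)
  finally show ?thesis .
 qed
 have "integrable (LI b) (%t. ip U (v t) y)"
 proof (rule integrableI_bounded)
  show "(%t. ip U (v t) y) \<in> borel_measurable (LI b)" using v y by (simp add: bochner_L1_def)
  have "AE t in LI b. v t \<in> L2 U" using v by (simp add: bochner_L1_def)
  hence "AE t in LI b. ennreal (norm (ip U (v t) y)) <= ennreal (nU (v t))"
  proof eventually_elim
   case (elim t)
   have "\<bar>ip U (v t) y\<bar> <= nU (v t) * nU y" by (rule Cauchy_Schwarz[OF elim y])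
   also have "... <= nU (v t) * 1" using ny by (rule mult_left_mono) simp
   finally show ?case by (simp add: ennreal_leI)
  qed
  hence "(\<integral>\<^sup>+t. ennreal (norm (ip U (v t) y)) \<partial>LI b) <= (\<integral>\<^sup>+t. ennreal (nU (v t)) \<partial>LI b)"
   by (rule nn_integral_mono_AE)
  also have "... < \<infinity>" using v by (simp add: bochner_L1_def)
  finally show "(\<integral>\<^sup>+t. ennreal (norm (ip U (v t) y)) \<partial>LI b) < \<infinity>" .
 qed
 hence "integrable (LI b) (%t. m * ip U (v t) y)" by simp
 \<comment> \<open>This holds for every \<open>f\<close>: a scalar factor can also be taken out of
   an integral that does not exist, since its value is then 0.\<close>
 moreover have "m * ip U f y = ip U f z" for f
 proof -
  have "ip U f y = (LINT x|MU. (1 / m) * (f x * z x))" unfolding ip_def y_def lc_def by (simp add: mult_ac)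
  also have "... = (1 / m) * ip U f z" unfolding ip_def by (rule integral_mult_right_zero)
  finally show ?thesis using m by simp
 qed
 ultimately show ?thesis by simp
qed

lemma time_deriv_L2:
 assumes d: "!!t. t \<in> {0..T} ==> has_time_deriv U T v t (v' t)" and t: "t \<in> {0..b}" "b <= T"
 shows "v t \<in> L2 U" "v' t \<in> L2 U"
proof -
 have "t \<in> {0..T}" using t by auto
 thus "v t \<in> L2 U" "v' t \<in> L2 U" using has_time_deriv_L2[OF d] by blast+
qed

lemma sob_sq_convex:
 assumes "sqU s v <= ennreal M" "sqU s w <= ennreal M" "0 <= rho" "0 <= ta" "rho + ta = 1" "0 <= M"
 shows "sqU s (lc rho v ta w) <= ennreal M"
proof -
 have H: "v \<in> Hk U (nat \<lfloor>s\<rfloor>)" "w \<in> Hk U (nat \<lfloor>s\<rfloor>)"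
  using assms(1,2) le_less_trans[OF _ ennreal_less_top] by (auto intro!: Hs_Hk simp: Hs_def)
 have "sqU s (lc rho v ta w) <= ennreal rho * sqU s v + ennreal ta * sqU s w"
  unfolding sob_sq_split[OF H assms(3-5), symmetric] by simp
 also have "... <= ennreal rho * ennreal M + ennreal ta * ennreal M" using assms by (intro add_mono mult_left_mono) auto
 also have "... = ennreal (rho * M + ta * M)" using assms by (simp add: ennreal_mult ennreal_plus)
 also have "rho * M + ta * M = M" using assms(5) by (metis distrib_right mult_1)
 finally show ?thesis .
qed

lemma weak_time_deriv_0_le:
 assumes w: "weak_time_deriv U 0 b v w" and b: "0 < b" and z: "z \<in> L2 U" and c: "AE t in LI b. ip U (w t) z <= c"
  and cv: "continuous_on {0..b} (%t. ip U (v t) z)" and t: "t \<in> {0..b}"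
 shows "ip U (v t) z <= c"
 by (rule weak_le_everywhere[OF cv bochner_ip_integrable[OF _ z] b _ c t]) (use w z in \<open>auto simp: weak_time_deriv_def\<close>)

lemma weak_time_deriv_1_le:
 assumes w: "weak_time_deriv U 1 b v w" and b: "0 < b" "b <= T" and z: "z \<in> L2 U" and c: "AE t in LI b. ip U (w t) z <= c"
  and d: "!!t. t \<in> {0..T} ==> has_time_deriv U T v t (v' t)" and cv: "continuous_on {0..b} (%t. ip U (v' t) z)" and t: "t \<in> {0..b}"
 shows "ip U (v' t) z <= c"
proof (rule weak_le_everywhere[OF cv bochner_ip_integrable[OF _ z] b(1) _ c t])
 show "bochner_L1 U b w" using w by (simp add: weak_time_deriv_def)
 fix et assume et: "et \<in> time_test_fun b"
 have "(LINT t|LI b. deriv et t * ip U (v t) z) = - (LINT t|LI b. et t * ip U (v' t) z)"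
  by (rule time_by_parts[OF et b(1) cv has_time_deriv_ip_sub[OF d b(2) _ z]])
 moreover have "(LINT t|LI b. deriv et t * ip U (v t) z) = - (LINT t|LI b. et t * ip U (w t) z)"
  using w et z by (auto simp: weak_time_deriv_def)
 ultimately show "(LINT t|LI b. et t * ip U (v' t) z) = (LINT t|LI b. et t * ip U (w t) z)" by simp
qed

text \<open>
 A function that satisfies all linear inequalities valid on a ball of \<open>H\<^sup>s\<close> is approximated in \<open>L\<^sup>2\<close> by
 near-minimizers of the distance to the ball, as in the existence proof for the projection onto a convex set.
 This turns bounds for almost every time into bounds at the two times \<open>0\<close> and \<open>t\<^sub>1\<close>.
\<close>

lemma sob_ball_support:
 assumes v: "v \<in> L2 U" and M: "0 <= M"
  and sup: "!!z c. z \<in> L2 U ==> (!!y. sqU s y <= ennreal M ==> ip U y z <= c) ==> ip U v z <= c"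
 shows "sqU s v <= ennreal (2 * M)"
proof (rule sob_ball_closed[OF v M])
 define C where "C = {y. sqU s y <= ennreal M}"
 define q where "q = (%y. (nU (v - y))^2)"
 have CH: "y \<in> Hs U s" if "y \<in> C" for y using that le_less_trans[OF _ ennreal_less_top] by (auto simp: C_def Hs_def)
 have CL: "y \<in> L2 U" if "y \<in> C" for y using Hk_L2[OF Hs_Hk[OF CH[OF that]]] .
 have CM: "(nU y)^2 <= M" if "y \<in> C" for y
 proof -
  have "ennreal ((nU y)^2) <= sqU s y" by (rule l2norm_le_sob_sq[OF CH[OF that]])
  also have "... <= ennreal M" using that by (simp add: C_def)
  finally show ?thesis using M by simp
 qed
 \<comment> \<open>For an empty ball the hypothesis, with \<open>z\<close> = 0 and \<open>c\<close>
   = -1, would give 0 <= -1.\<close>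
 have ne: "C ~= {}"
 proof
  assume "C = {}"
  hence "ip U v (%_. 0) <= -1" by (intro sup) (auto simp: C_def)
  thus False by (simp add: ip_def)
 qed
 fix ep :: real assume ep: "0 < ep"
 \<comment> \<open>\<open>et\<close> is the weight of \<open>y\<close> in a convex combination with
   the near-minimizer \<open>c\<close>, and its square is the tolerance for the infimum. After
   division by \<open>et\<close> an error of order \<open>et\<close> remains, which is at most
   ep^2.\<close>
 define et where "et = min 1 (ep^2 / (1 + 4 * M))"
 have et: "0 < et" "et <= 1" "et <= ep^2 / (1 + 4 * M)" using ep M by (auto simp: et_def)
 have et': "et * (1 + 4 * M) <= ep^2" using et(3) M by (simp add: pos_le_divide_eq)
 have bdd: "bdd_below (q ` C)" by (rule bdd_belowI2[where m = 0]) (simp add: q_def)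
 have "Inf (q ` C) < Inf (q ` C) + et^2" using et by simp
 then obtain c where c: "c \<in> C" "q c < Inf (q ` C) + et^2" using cInf_lessD[of "q ` C"] ne by blast
 let ?z = "v - c"
 have zL: "?z \<in> L2 U" unfolding diff_eq_lc using v CL[OF c(1)] by simp
 \<comment> \<open>Near-minimality gives the variational inequality of the projection up to a small
   error. This is a linear inequality valid on the ball, so by hypothesis it also holds for
   \<open>v\<close>.\<close>
 have A: "ip U v ?z <= ip U c ?z + et * (1 + 4 * M) / 2"
 proof (rule sup[OF zL])
  fix y assume "sqU s y <= ennreal M"
  hence y: "y \<in> C" by (simp add: C_def)
  let ?d = "lc 1 y (-1) c"
  have dL: "?d \<in> L2 U" using CL[OF y] CL[OF c(1)] by simp
  have m: "lc et y (1 - et) c \<in> C" unfolding C_def mem_Collect_eq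
   by (rule sob_sq_convex) (use y c et M in \<open>auto simp: C_def\<close>)
  have "v - lc et y (1 - et) c = lc 1 ?z (- et) ?d" by (rule ext) (simp add: lc_def algebra_simps)
  hence "q (lc et y (1 - et) c) = q c - 2 * et * ip U ?d ?z + et^2 * (nU ?d)^2"
   unfolding q_def using l2norm_lc_sq[OF zL dL, of 1 "- et"] by (simp add: ip_commute[of ?z ?d])
  moreover have "Inf (q ` C) <= q (lc et y (1 - et) c)" using m by (intro cInf_lower bdd) auto
  moreover have "(nU ?d)^2 <= 4 * M"
  proof -
   have "(nU ?d)^2 <= (nU y + nU c)^2" using l2norm_lc[OF CL[OF y] CL[OF c(1)], of 1 "-1"] by (intro power_mono) auto
   also have "... <= 2 * (nU y)^2 + 2 * (nU c)^2"
    using zero_le_power2[of "nU y - nU c"] by (simp add: power2_sum power2_diff)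
   finally show ?thesis using CM[OF y] CM[OF c(1)] by linarith
  qed
  hence "et^2 * (nU ?d)^2 <= et^2 * (4 * M)" by (rule mult_left_mono) simp
  ultimately have "et * (2 * ip U ?d ?z) <= et * (et * (1 + 4 * M))" using c(2) by (simp add: power2_eq_square algebra_simps)
  hence "2 * ip U ?d ?z <= et * (1 + 4 * M)" using et(1) by simp
  thus "ip U y ?z <= ip U c ?z + et * (1 + 4 * M) / 2" using CL[OF y] CL[OF c(1)] zL by (simp add: ip_lc_left)
 qed
 have "(nU ?z)^2 = ip U v ?z - ip U c ?z"
  using ip_lc_left[OF v CL[OF c(1)] zL, of 1 "-1"] by (simp add: l2norm_sq diff_eq_lc[symmetric])
 also have "... <= et * (1 + 4 * M) / 2" using A by (simp only: diff_le_eq add.commute)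
 also have "... <= et * (1 + 4 * M)" using et M by simp
 also note et'
 finally have "(nU ?z)^2 <= ep^2" .
 hence "nU ?z <= ep" by (rule power2_le_imp_le) (use ep in simp)
 thus "\<exists>y. sqU s y <= ennreal M \<and> nU (v - y) <= ep" using c(1) by (auto simp: C_def)
qed

text \<open>The norm is an infimum over the weak derivatives, so it takes a strict upper bound to
  obtain one of them.\<close>

lemma Linf_sq_witness:
 assumes "Linf_sq U s k b v < ennreal M"
 obtains w where "weak_time_deriv U k b v w" "AE t in LI b. sqU s (w t) <= ennreal M"
proof -
 obtain w where w: "weak_time_deriv U k b v w" "esssup (LI b) (%t. sqU s (w t)) < ennreal M"
  using assms unfolding Linf_sq_def INF_less_iff by blast
 have "AE t in LI b. sqU s (w t) <= esssup (LI b) (%t. sqU s (w t))" by (rule esssup_AE)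
 hence "AE t in LI b. sqU s (w t) <= ennreal M" by eventually_elim (use w(2) in order)
 thus thesis using w(1) that by blast
qed

lemma Linf_sq_0_bound:
 assumes L: "Linf_sq U s 0 b v < ennreal M" and M: "0 <= M" and b: "0 < b" "b <= T"
  and d: "!!t. t \<in> {0..T} ==> has_time_deriv U T v t (v' t)" and t: "t \<in> {0..b}"
 shows "sqU s (v t) <= ennreal (2 * M)"
proof (rule sob_ball_support[OF _ M])
 obtain w where w: "weak_time_deriv U 0 b v w" "AE t in LI b. sqU s (w t) <= ennreal M" using Linf_sq_witness[OF L] .
 show "v t \<in> L2 U" using has_time_deriv_L2(1)[OF d, of t t] t b by auto
 fix z c assume z: "z \<in> L2 U" and c: "!!y. sqU s y <= ennreal M ==> ip U y z <= c"
 show "ip U (v t) z <= c"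
  by (rule weak_time_deriv_0_le[OF w(1) b(1) z _ DERIV_continuous_on[OF has_time_deriv_ip_sub[OF d b(2) _ z]] t])
   (use w(2) c in \<open>auto elim!: eventually_mono\<close>)
qed

text \<open>For each \<open>z\<close> the mean value theorem gives a time at which the derivative
  has the same product with \<open>z\<close> as the difference quotient. That time depends on
  \<open>z\<close>, which is harmless because the linear inequalities are tested one at a
  time.\<close>

lemma Linf_sq_1_bound:
 assumes L: "Linf_sq U s 1 b v < ennreal M" and M: "0 <= M" and b: "0 < b" "b <= T"
  and d: "!!t. t \<in> {0..T} ==> has_time_deriv U T v t (v' t)" "!!t. t \<in> {0..T} ==> has_time_deriv U T v' t (v'' t)"
 shows "sqU s (diffq b (v 0) (v b)) <= ennreal (2 * M)"
proof (rule sob_ball_support[OF _ M])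
 obtain w where w: "weak_time_deriv U 1 b v w" "AE t in LI b. sqU s (w t) <= ennreal M" using Linf_sq_witness[OF L] .
 have vL: "v 0 \<in> L2 U" "v b \<in> L2 U" using has_time_deriv_L2(1)[OF d(1)[of 0]] b by auto
 show "diffq b (v 0) (v b) \<in> L2 U" unfolding diffq_eq_lc using vL by simp
 fix z c assume z: "z \<in> L2 U" and c: "!!y. sqU s y <= ennreal M ==> ip U y z <= c"
 have "\<exists>x\<in>{0<..<b}. ip U (v b) z - ip U (v 0) z = (%h. ip U (v' x) z * h) (b - 0)"
  by (rule mvt_simple[OF b(1)]) (use has_time_deriv_ip_sub[OF d(1) b(2) _ z] in \<open>auto simp: has_field_derivative_def mult_commute_abs\<close>)
 then obtain x where x: "x \<in> {0<..<b}" "ip U (v b) z - ip U (v 0) z = ip U (v' x) z * b" by auto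
 have "ip U (diffq b (v 0) (v b)) z = (ip U (v b) z - ip U (v 0) z) / b"
  unfolding diffq_eq_lc using vL z by (simp add: ip_lc_left diff_divide_distrib)
 also have "... = ip U (v' x) z" unfolding x(2) using b by simp
 also have "... <= c"
  by (rule weak_time_deriv_1_le[OF w(1) b z _ d(1) DERIV_continuous_on[OF has_time_deriv_ip_sub[OF d(2) b(2) _ z]]])
   (use w(2) c x(1) in \<open>auto elim!: eventually_mono\<close>)
 finally show "ip U (diffq b (v 0) (v b)) z <= c" .
qed

section \<open>Defects of the time discretization in L^2 and H^1\<close>

lemma l2norm_dual:
 assumes E: "E \<in> L2 U" and B: "!!z. z \<in> L2 U ==> nU z <= 1 ==> \<bar>ip U E z\<bar> <= B"
 shows "nU E <= B"
proof (cases "nU E = 0")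
 case True
 have "nU (%_. 0) <= 1" by (simp add: l2norm_def ip_def)
 from B[OF L2_zero this] True show ?thesis by linarith
next
 case False
 define m where "m = nU E"
 have m: "0 < m" using False l2norm_nonneg[of E] unfolding m_def by linarith
 let ?z = "lc (1 / m) E 0 E"
 have "nU ?z <= \<bar>1 / m\<bar> * nU E + \<bar>0\<bar> * nU E" by (rule l2norm_lc[OF E E])
 also have "... = 1" using m by (simp add: m_def)
 finally have "\<bar>ip U E ?z\<bar> <= B" using E by (intro B) auto
 moreover have "ip U E ?z = m"
 proof -
  have "ip U E ?z = 1 / m * ip U E E + 0 * ip U E E" by (rule ip_lc_right[OF E E E])
  also have "ip U E E = m^2" unfolding m_def by (rule l2norm_sq[symmetric])
  finally show ?thesis using m by (simp add: power2_eq_square)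
 qed
 ultimately show ?thesis by (simp add: m_def)
qed

lemma sob_sq_0: "v \<in> L2 U ==> sqU 0 v = ennreal ((nU v)^2)"
proof -
 assume v: "v \<in> L2 U"
 have "{is :: 2 list. length is <= 0} = {[]}" by auto
 moreover have "nU (wU [] v) = nU v" using l2norm_cong[OF ae_eq_sym[OF wder_Nil[OF v]] v] by simp
 ultimately show ?thesis using sob_sq_int[of v 0] v by (simp add: Hk_0)
qed

text \<open>Cauchy-Schwarz in time, where the interval contributes the factor sqrt b.\<close>

lemma third_derivative_L2_bound:
 assumes w: "weak_time_deriv U 3 b v w" and B: "(\<integral>\<^sup>+t. sqU 0 (w t) \<partial>LI b) <= ennreal M"
  and b: "0 < b" and M: "0 <= M" and z: "z \<in> L2 U" "nU z <= 1"
 shows "(LINT t|LI b. \<bar>ip U (w t) z\<bar>) <= sqrt b * sqrt M"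
proof -
 let ?N = "LI b"
 have wb: "bochner_L1 U b w" using w by (simp add: weak_time_deriv_def)
 have i: "integrable ?N (%t. ip U (w t) z)" by (rule bochner_ip_integrable[OF wb z(1)])
 hence m: "(%t. ip U (w t) z) \<in> borel_measurable ?N" by (rule borel_measurable_integrable)
 have "AE t in ?N. w t \<in> L2 U" using wb by (simp add: bochner_L1_def)
 hence "AE t in ?N. (ennreal \<bar>ip U (w t) z\<bar>)^2 <= sqU 0 (w t)"
 proof eventually_elim
  case (elim t)
  have "\<bar>ip U (w t) z\<bar> <= nU (w t) * nU z" by (rule Cauchy_Schwarz[OF elim z(1)])
  also have "... <= nU (w t) * 1" using z(2) by (rule mult_left_mono) simp
  finally have "\<bar>ip U (w t) z\<bar>^2 <= (nU (w t))^2" by (intro power_mono) auto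
  thus ?case unfolding sob_sq_0[OF elim] ennreal_power[OF abs_ge_zero] by (rule ennreal_leI)
 qed
 hence "(\<integral>\<^sup>+t. (ennreal \<bar>ip U (w t) z\<bar>)^2 \<partial>?N) <= (\<integral>\<^sup>+t. sqU 0 (w t) \<partial>?N)" by (rule nn_integral_mono_AE)
 hence sq: "(\<integral>\<^sup>+t. (ennreal \<bar>ip U (w t) z\<bar>)^2 \<partial>?N) <= ennreal M" using B by (rule order_trans)
 have one: "(\<integral>\<^sup>+t. (1 :: ennreal)^2 \<partial>?N) = ennreal b" using b by (simp add: emeasure_restrict_space)
 have "(\<integral>\<^sup>+t. ennreal \<bar>ip U (w t) z\<bar> * 1 \<partial>?N)^2 <= (\<integral>\<^sup>+t. (ennreal \<bar>ip U (w t) z\<bar>)^2 \<partial>?N) * (\<integral>\<^sup>+t. 1^2 \<partial>?N)"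
  by (rule Cauchy_Schwarz_nn_integral) (use m in measurable)
 also have "... <= ennreal M * ennreal b" unfolding one using sq by (rule mult_right_mono) simp
 also have "... = ennreal (M * b)" using M b by (simp add: ennreal_mult)
 finally have "(\<integral>\<^sup>+t. ennreal \<bar>ip U (w t) z\<bar> \<partial>?N)^2 <= ennreal (M * b)" by simp
 moreover have "(\<integral>\<^sup>+t. ennreal \<bar>ip U (w t) z\<bar> \<partial>?N) = ennreal (LINT t|?N. \<bar>ip U (w t) z\<bar>)"
  by (rule nn_integral_eq_integral) (use i in auto)
 moreover have n: "0 <= (LINT t|?N. \<bar>ip U (w t) z\<bar>)" by (rule integral_nonneg_AE) simp
 ultimately have "(LINT t|?N. \<bar>ip U (w t) z\<bar>)^2 <= M * b" using M b by (simp add: ennreal_power)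
 thus ?thesis using real_le_rsqrt by (metis mult.commute real_sqrt_mult)
qed

lemma trapezoid_L2:
 assumes L: "L2_sq U 0 3 b v < ennreal M" and M: "0 <= M" and b: "0 < b" "b <= T"
  and d: "!!t. t \<in> {0..T} ==> has_time_deriv U T v t (v' t)"
 shows "nU (lc 1 (lc 1 (v b) (-1) (v 0)) (- (b / 2)) (lc 1 (v' 0) 1 (v' b))) <= b^2 * (sqrt b * sqrt M)"
proof -
 obtain w where w: "weak_time_deriv U 3 b v w" "(\<integral>\<^sup>+t. sqU 0 (w t) \<partial>LI b) < ennreal M"
  using L unfolding L2_sq_def INF_less_iff by blast
 have wb: "bochner_L1 U b w" using w by (simp add: weak_time_deriv_def)
 have sub: "{0..b} \<subseteq> {0..T}" using b by auto
 have vL: "v t \<in> L2 U" "v' t \<in> L2 U" if "t \<in> {0..b}" for t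
  by (rule time_deriv_L2[OF d that b(2)], assumption)+
 have D: "((%s. ip U (v s) z) has_real_derivative ip U (v' t) z) (at t within {0..b})" if "t \<in> {0..b}" "z \<in> L2 U" for t z
  using has_field_derivative_subset[OF has_time_deriv_ip[OF d] sub] that sub by blast
 have m: "v b \<in> L2 U" "v 0 \<in> L2 U" "v' 0 \<in> L2 U" "v' b \<in> L2 U" using vL b by auto
 show ?thesis
 proof (rule l2norm_dual)
  show "lc 1 (lc 1 (v b) (-1) (v 0)) (- (b / 2)) (lc 1 (v' 0) 1 (v' b)) \<in> L2 U" using m by simp
  fix z assume z: "z \<in> L2 U" "nU z <= 1"
  have "\<bar>ip U (v b) z - ip U (v 0) z - b / 2 * (ip U (v' 0) z + ip U (v' b) z)\<bar> <= b^2 / 2 * (LINT t|LI b. \<bar>ip U (w t) z\<bar>)"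
  proof (rule trapezoid_error[OF b(1) bochner_ip_integrable[OF wb z(1)]])
   show "(LINT t|LI b. (deriv ^^ 3) et t * ip U (v t) z) = - (LINT t|LI b. et t * ip U (w t) z)" if "et \<in> time_test_fun b" for et
    using w(1) that z(1) by (auto simp: weak_time_deriv_def)
  qed (rule D[OF _ z(1)])
  also have "... <= b^2 / 2 * (sqrt b * sqrt M)"
   by (intro mult_left_mono third_derivative_L2_bound[OF w(1)] b M z less_imp_le[OF w(2)]) simp
  also have "... <= b^2 * (sqrt b * sqrt M)" using b M by (intro mult_right_mono) auto
  also have "ip U (v b) z - ip U (v 0) z - b / 2 * (ip U (v' 0) z + ip U (v' b) z) = ip U (lc 1 (lc 1 (v b) (-1) (v 0)) (- (b / 2)) (lc 1 (v' 0) 1 (v' b))) z"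
   using m z by (simp add: ip_lc_left)
  finally show "\<bar>ip U (lc 1 (lc 1 (v b) (-1) (v 0)) (- (b / 2)) (lc 1 (v' 0) 1 (v' b))) z\<bar> <= b^2 * (sqrt b * sqrt M)" .
 qed
qed

text \<open>The amount by which the starting formula, 2/b times (difference quotient minus v'(0)) =
  mean of v'' at the two ends, fails, multiplied by b^2 / 2.\<close>

definition taylor_defect :: "real => (real => scalar_field) => (real => scalar_field) => (real => scalar_field) => scalar_field" where
 "taylor_defect b v v' v'' = lc 1 (lc 1 (lc 1 (v b) (-1) (v 0)) (- b) (v' 0)) (- (b^2 / 4)) (lc 1 (v'' 0) 1 (v'' b))"

text \<open>The hypothesis pairs \<open>E\<close> with arbitrary L^2 functions. Duality gives the
  L^2 norm; for the gradient, \<open>z\<close> is the Laplacian of a test function, so that both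
  pairings become gradient products, and the test functions then tend to \<open>E\<close> in H^1.
  The third factor b is the length of the time interval.\<close>

lemma defect_bound:
 assumes L: "AE t in LI b. sqU 1 (w t) <= ennreal M" and wb: "bochner_L1 U b w" and M: "0 <= M" and b: "0 < b"
  and EH: "E \<in> Hs0 U 1" and key: "!!z. z \<in> L2 U ==> \<bar>ip U E z\<bar> <= b^2 * (LINT t|LI b. \<bar>ip U (w t) z\<bar>)"
 shows "nU E <= b ^ 3 * sqrt M" "grad_norm U E <= b ^ 3 * sqrt M"
proof -
 let ?E = E
 have H1: "f \<in> Hk U 1" if "f \<in> Hs0 U 1" for f using Hs0_Hk[of f 1] that by simp
 have HL: "f \<in> L2 U" if "f \<in> Hs0 U 1" for f using Hk_L2[OF H1[OF that]] .
 have LB: "(LINT t|LI b. \<bar>ip U (w t) z\<bar>) <= b * B"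
  if z: "z \<in> L2 U" and B: "AE t in LI b. \<bar>ip U (w t) z\<bar> <= B" for z B
 proof -
  have "(LINT t|LI b. \<bar>ip U (w t) z\<bar>) <= (LINT t|LI b. B)"
  proof (rule integral_mono_AE)
   show "integrable (LI b) (%t. \<bar>ip U (w t) z\<bar>)" using bochner_ip_integrable[OF wb z] by simp
   show "integrable (LI b) (%t. B)" by (rule finite_measure.integrable_const) (rule finite_measure_lebesgue_on, simp)
  qed (rule B)
  also have "... = b * B" using b by (simp add: measure_restrict_space)
  finally show ?thesis .
 qed
 have wH: "AE t in LI b. w t \<in> Hk U 1 \<and> nU (w t) <= sqrt M \<and> grad_norm U (w t) <= sqrt M"
  using L
 proof eventually_elim
  case (elim t)
  have "w t \<in> Hs U 1" using elim le_less_trans[OF _ ennreal_less_top] by (auto simp: Hs_def)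
  hence h: "w t \<in> Hk U 1" using Hs_int[of 1] by simp
  have fin: "finite {is :: 2 list. length is <= 1}" by (rule finite_lists_le)
  have s: "(\<Sum>is | length is <= 1. (nU (wU is (w t)))^2) <= M"
   using elim sob_sq_int[OF h] M by (simp add: sum_nonneg)
  have "(nU (wU [] (w t)))^2 <= (\<Sum>is | length is <= 1. (nU (wU is (w t)))^2)"
   using fin by (intro member_le_sum) auto
  moreover have "nU (wU [] (w t)) = nU (w t)" using l2norm_cong[OF ae_eq_sym[OF wder_Nil[OF Hk_L2[OF h]]] Hk_L2[OF h]] by simp
  ultimately have 1: "(nU (w t))^2 <= M" using s by simp
  have "(\<Sum>is\<in>{[1], [2]}. (nU (wU is (w t)))^2) <= (\<Sum>is | length is <= 1. (nU (wU is (w t)))^2)"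
   using fin by (intro sum_mono2) auto
  hence 2: "(grad_norm U (w t))^2 <= M" using s by (simp add: grad_norm_sq2)
  show ?case using h 1 2 by (auto intro!: real_le_rsqrt)
 qed
 show "nU ?E <= b ^ 3 * sqrt M"
 proof (rule l2norm_dual[OF HL[OF EH]])
  fix z assume z: "z \<in> L2 U" "nU z <= 1"
  have "AE t in LI b. \<bar>ip U (w t) z\<bar> <= sqrt M" using wH
  proof eventually_elim
   case (elim t)
   have "\<bar>ip U (w t) z\<bar> <= nU (w t) * nU z" using elim z by (intro Cauchy_Schwarz) (auto intro: Hk_L2)
   also have "... <= nU (w t) * 1" using z(2) by (rule mult_left_mono) simp
   finally show ?case using elim by simp
  qed
  from mult_left_mono[OF LB[OF z(1) this], of "b^2"] key[OF z(1)]
  show "\<bar>ip U ?E z\<bar> <= b ^ 3 * sqrt M" by (simp add: power2_eq_square power3_eq_cube mult_ac)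
 qed
 have gt: "\<bar>grad_ip U ?E phi\<bar> <= b ^ 3 * sqrt M * grad_norm U phi" if phi: "phi \<in> test_fun U" for phi
 proof -
  have lp: "lap phi \<in> L2 U" using test_L2[OF test_fun_lap[OF phi], of "[]"] by simp
  have "AE t in LI b. \<bar>ip U (w t) (lap phi)\<bar> <= sqrt M * grad_norm U phi" using wH
  proof eventually_elim
   case (elim t)
   have "ip U (w t) (lap phi) = - grad_ip U (w t) phi" using grad_ip_test[OF _ phi] elim by simp
   hence "\<bar>ip U (w t) (lap phi)\<bar> = \<bar>grad_ip U (w t) phi\<bar>" by simp
   also have "... <= grad_norm U (w t) * grad_norm U phi" using elim test_Hk[OF phi] by (intro grad_Cauchy_Schwarz) auto
   also have "... <= sqrt M * grad_norm U phi" using elim by (intro mult_right_mono) auto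
   finally show ?case .
  qed
  from mult_left_mono[OF LB[OF lp this], of "b^2"] key[OF lp]
  show ?thesis using grad_ip_test[OF H1[OF EH] phi] by (simp add: power2_eq_square power3_eq_cube mult_ac)
 qed
 obtain phi where phi: "!!n::nat. phi n \<in> test_fun U" "(%n. grad_norm U (?E - phi n)) ----> 0" using Hs0_1_seq[OF EH] by metis
 have p1: "phi n \<in> Hk U 1" for n using test_Hk[OF phi(1)] .
 have "(%n. \<bar>grad_ip U ?E (phi n)\<bar>) ----> \<bar>grad_ip U ?E ?E\<bar>" by (intro tendsto_rabs grad_ip_tendsto[OF H1[OF EH] p1 H1[OF EH] phi(2)])
 moreover have "(%n. b ^ 3 * sqrt M * grad_norm U (phi n)) ----> b ^ 3 * sqrt M * grad_norm U ?E" by (intro tendsto_mult_left grad_norm_tendsto[OF H1[OF EH] p1 phi(2)])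
 ultimately have "\<bar>grad_ip U ?E ?E\<bar> <= b ^ 3 * sqrt M * grad_norm U ?E" by (rule LIMSEQ_le) (use gt[OF phi(1)] in blast)
 hence le: "(grad_norm U ?E)^2 <= b ^ 3 * sqrt M * grad_norm U ?E" by (simp add: grad_norm_sq)
 show "grad_norm U ?E <= b ^ 3 * sqrt M"
 proof (cases "grad_norm U ?E = 0")
  case True
  thus ?thesis using b M by simp
 next
  case False
  hence "0 < grad_norm U ?E" using grad_norm_nonneg[of ?E] by linarith
  thus ?thesis using le by (simp add: power2_eq_square)
 qed
qed

lemma taylor_defect_bound:
 assumes L: "Linf_sq U 1 3 b v < ennreal M" and M: "0 <= M" and b: "0 < b" "b <= T"
  and d: "!!t. t \<in> {0..T} ==> has_time_deriv U T v t (v' t)" "!!t. t \<in> {0..T} ==> has_time_deriv U T v' t (v'' t)"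
  and H: "!!t. t \<in> {0..T} ==> v t \<in> Hs0 U 1" "!!t. t \<in> {0..T} ==> v' t \<in> Hs0 U 1" "!!t. t \<in> {0..T} ==> v'' t \<in> Hs0 U 1"
 shows "nU (taylor_defect b v v' v'') <= b ^ 3 * sqrt M" "grad_norm U (taylor_defect b v v' v'') <= b ^ 3 * sqrt M"
  "taylor_defect b v v' v'' \<in> Hs0 U 1"
proof -
 let ?E = "taylor_defect b v v' v''"
 obtain w where w: "weak_time_deriv U 3 b v w" "AE t in LI b. sqU 1 (w t) <= ennreal M" using Linf_sq_witness[OF L] .
 have wb: "bochner_L1 U b w" using w by (simp add: weak_time_deriv_def)
 have sub: "{0..b} \<subseteq> {0..T}" using b by auto
 have bm: "b \<in> {0..T}" "0 \<in> {0..T}" using b by auto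
 have Hm: "v b \<in> Hs0 U 1" "v 0 \<in> Hs0 U 1" "v' 0 \<in> Hs0 U 1" "v'' 0 \<in> Hs0 U 1" "v'' b \<in> Hs0 U 1" using H bm by auto
 have lc1: "lc x f y g \<in> Hs0 U 1" if "f \<in> Hs0 U 1" "g \<in> Hs0 U 1" for f g x y using Hs0_lc[of f 1 g] that by simp
 have EH: "?E \<in> Hs0 U 1" unfolding taylor_defect_def by (intro lc1 Hm)
 thus "taylor_defect b v v' v'' \<in> Hs0 U 1" .
 have H1: "f \<in> Hk U 1" if "f \<in> Hs0 U 1" for f using Hs0_Hk[of f 1] that by simp
 have HL: "f \<in> L2 U" if "f \<in> Hs0 U 1" for f using Hk_L2[OF H1[OF that]] .
 have D: "((%s. ip U (v s) z) has_real_derivative ip U (v' t) z) (at t within {0..b})" if "t \<in> {0..b}" "z \<in> L2 U" for t z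
  using has_field_derivative_subset[OF has_time_deriv_ip[OF d(1)] sub] that sub by blast
 have D2: "((%s. ip U (v' s) z) has_real_derivative ip U (v'' t) z) (at t within {0..b})" if "t \<in> {0..b}" "z \<in> L2 U" for t z
  using has_field_derivative_subset[OF has_time_deriv_ip[OF d(2)] sub] that sub by blast
 have key: "\<bar>ip U ?E z\<bar> <= b^2 * (LINT t|LI b. \<bar>ip U (w t) z\<bar>)" if z: "z \<in> L2 U" for z
 proof -
  have "\<bar>ip U (v b) z - ip U (v 0) z - b * ip U (v' 0) z - b^2 / 4 * (ip U (v'' 0) z + ip U (v'' b) z)\<bar> <= b^2 * (LINT t|LI b. \<bar>ip U (w t) z\<bar>)"
  proof (rule taylor_endpoint_error[OF b(1) bochner_ip_integrable[OF wb z(1)]])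
   show "(LINT t|LI b. (deriv ^^ 3) et t * ip U (v t) z) = - (LINT t|LI b. et t * ip U (w t) z)" if "et \<in> time_test_fun b" for et
    using w(1) that z(1) by (auto simp: weak_time_deriv_def)
  qed (rule D[OF _ z(1)], assumption, rule D2[OF _ z(1)], assumption)
  moreover have "ip U ?E z = ip U (v b) z - ip U (v 0) z - b * ip U (v' 0) z - b^2 / 4 * (ip U (v'' 0) z + ip U (v'' b) z)"
   unfolding taylor_defect_def using HL Hm z by (simp add: ip_lc_left)
  ultimately show ?thesis by simp
 qed
 show "nU ?E <= b ^ 3 * sqrt M" "grad_norm U ?E <= b ^ 3 * sqrt M"
  by (rule defect_bound[OF w(2) wb M b(1) EH key], assumption)+
qed

text \<open>The trapezoidal defect is needed in the gradient norm as well, since the coupling terms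
  contain the gradient of u_t.\<close>

lemma trapezoid_grad:
 assumes L: "Linf_sq U 1 3 b v < ennreal M" and M: "0 <= M" and b: "0 < b" "b <= T"
  and d: "!!t. t \<in> {0..T} ==> has_time_deriv U T v t (v' t)"
  and H: "!!t. t \<in> {0..T} ==> v t \<in> Hs0 U 1" "!!t. t \<in> {0..T} ==> v' t \<in> Hs0 U 1"
 shows "grad_norm U (lc 1 (lc 1 (v b) (-1) (v 0)) (- (b / 2)) (lc 1 (v' 0) 1 (v' b))) <= b ^ 3 * sqrt M"
  "lc 1 (lc 1 (v b) (-1) (v 0)) (- (b / 2)) (lc 1 (v' 0) 1 (v' b)) \<in> Hs0 U 1"
proof -
 let ?E = "lc 1 (lc 1 (v b) (-1) (v 0)) (- (b / 2)) (lc 1 (v' 0) 1 (v' b))"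
 obtain w where w: "weak_time_deriv U 3 b v w" "AE t in LI b. sqU 1 (w t) <= ennreal M" using Linf_sq_witness[OF L] .
 have wb: "bochner_L1 U b w" using w by (simp add: weak_time_deriv_def)
 have sub: "{0..b} \<subseteq> {0..T}" using b by auto
 have bm: "b \<in> {0..T}" "0 \<in> {0..T}" using b by auto
 have Hm: "v b \<in> Hs0 U 1" "v 0 \<in> Hs0 U 1" "v' 0 \<in> Hs0 U 1" "v' b \<in> Hs0 U 1" using H bm by auto
 have lc1: "lc x f y g \<in> Hs0 U 1" if "f \<in> Hs0 U 1" "g \<in> Hs0 U 1" for f g x y using Hs0_lc[of f 1 g] that by simp
 have EH: "?E \<in> Hs0 U 1" by (intro lc1 Hm)
 have HL: "f \<in> L2 U" if "f \<in> Hs0 U 1" for f using Hs0_Hk[of f 1] Hk_L2 that by simp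
 have D: "((%s. ip U (v s) z) has_real_derivative ip U (v' t) z) (at t within {0..b})" if "t \<in> {0..b}" "z \<in> L2 U" for t z
  using has_field_derivative_subset[OF has_time_deriv_ip[OF d] sub] that sub by blast
 have key: "\<bar>ip U ?E z\<bar> <= b^2 * (LINT t|LI b. \<bar>ip U (w t) z\<bar>)" if z: "z \<in> L2 U" for z
 proof -
  let ?I = "LINT t|LI b. \<bar>ip U (w t) z\<bar>"
  have "\<bar>ip U (v b) z - ip U (v 0) z - b / 2 * (ip U (v' 0) z + ip U (v' b) z)\<bar> <= b^2 / 2 * ?I"
  proof (rule trapezoid_error[OF b(1) bochner_ip_integrable[OF wb z(1)]])
   show "(LINT t|LI b. (deriv ^^ 3) et t * ip U (v t) z) = - (LINT t|LI b. et t * ip U (w t) z)" if "et \<in> time_test_fun b" for et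
    using w(1) that z(1) by (auto simp: weak_time_deriv_def)
  qed (rule D[OF _ z(1)])
  also have "... <= b^2 * ?I" by (intro mult_right_mono integral_nonneg_AE) auto
  also have "ip U (v b) z - ip U (v 0) z - b / 2 * (ip U (v' 0) z + ip U (v' b) z) = ip U ?E z"
   using HL Hm z by (simp add: ip_lc_left)
  finally show ?thesis .
 qed
 show "grad_norm U ?E <= b ^ 3 * sqrt M" by (rule defect_bound(2)[OF w(2) wb M b(1) EH key])
 show "?E \<in> Hs0 U 1" by (rule EH)
qed

end

section \<open>Morley interpolation\<close>

lemma polys_lc: assumes "q \<in> polys r" "s \<in> polys r" shows "lc a q b s \<in> polys r"
proof -
 obtain c d where "!!x. q x = (\<Sum>i\<le>r. \<Sum>j\<le>r - i. c i j * (x $ 1) ^ i * (x $ 2) ^ j)"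
  "!!x. s x = (\<Sum>i\<le>r. \<Sum>j\<le>r - i. d i j * (x $ 1) ^ i * (x $ 2) ^ j)" using assms by (auto simp: polys_def)
 hence h: "lc a q b s x = (\<Sum>i\<le>r. \<Sum>j\<le>r - i. (a * c i j + b * d i j) * (x $ 1) ^ i * (x $ 2) ^ j)" for x
  by (simp add: lc_def sum_distrib_left sum.distrib[symmetric] distrib_right mult.assoc)
 show ?thesis unfolding polys_def by (intro CollectI exI allI) (rule h)
qed

lemma affine_prod_polys: "(%x. (u0 + u1 * x $ 1 + u2 * x $ 2) * (w0 + w1 * x $ 1 + w2 * x $ 2)) \<in> polys 2"
proof -
 let ?c = "%i j :: nat. if i = 0 then (if j = 0 then u0 * w0 else if j = 1 then u0 * w2 + u2 * w0 else u2 * w2)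
  else if i = 1 then (if j = 0 then u0 * w1 + u1 * w0 else u1 * w2 + u2 * w1) else u1 * w1"
 have h: "(u0 + u1 * x $ 1 + u2 * x $ 2) * (w0 + w1 * x $ 1 + w2 * x $ 2) = (\<Sum>i\<le>2. \<Sum>j\<le>2 - i. ?c i j * (x $ 1) ^ i * (x $ 2) ^ j)" for x :: pt
  by (simp add: numeral_2_eq_2 algebra_simps)
 show ?thesis unfolding polys_def by (rule CollectI, rule exI[of _ ?c], rule allI, rule h)
qed

definition bary_grad :: "pt => pt => pt => pt" where
 "bary_grad p q r = (1 / cross2 (q - p) (r - p)) *\<^sub>R vector [- (q - p) $ 2, (q - p) $ 1]"

lemma bary_inner: "bary p q r x = bary_grad p q r \<bullet> (x - p)"
proof -
 have "vector [- (q - p) $ 2, (q - p) $ 1] \<bullet> (x - p) = cross2 (q - p) (x - p)"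
  by (simp add: inner_vec_def sum_2 cross2_def algebra_simps)
 thus ?thesis by (simp add: bary_def bary_grad_def)
qed

lemma bary_quadratic_polys: "(%x. bary p q r x * (bary p q r x - 1)) \<in> polys 2" "bary p q r \<in> polys 2"
proof -
 let ?g = "bary_grad p q r"
 have e: "bary p q r = (%x. - (?g $ 1 * p $ 1 + ?g $ 2 * p $ 2) + ?g $ 1 * x $ 1 + ?g $ 2 * x $ 2)"
  by (rule ext) (simp add: bary_inner inner_vec_def sum_2 algebra_simps)
 have "(%x. bary p q r x * (bary p q r x - 1)) = (%x. (- (?g $ 1 * p $ 1 + ?g $ 2 * p $ 2) + ?g $ 1 * x $ 1 + ?g $ 2 * x $ 2) *
  ((- (?g $ 1 * p $ 1 + ?g $ 2 * p $ 2) - 1) + ?g $ 1 * x $ 1 + ?g $ 2 * x $ 2))" unfolding e by (rule ext) (simp add: algebra_simps)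
 thus "(%x. bary p q r x * (bary p q r x - 1)) \<in> polys 2" by (simp only: affine_prod_polys)
 show "bary p q r \<in> polys 2" unfolding e
  using affine_prod_polys[of "- (?g $ 1 * p $ 1 + ?g $ 2 * p $ 2)" "?g $ 1" "?g $ 2" 1 0 0] by simp
qed

lemma bary_midpoint: "bary p q r (midpoint x y) = (bary p q r x + bary p q r y) / 2"
 by (simp add: bary_inner midpoint_def inner_diff_right inner_add_right)

lemma bary_linepath: "bary p q r (linepath x y t) = (1 - t) * bary p q r x + t * bary p q r y"
 by (simp add: bary_inner linepath_def inner_diff_right inner_add_right algebra_simps)

text \<open>The functions \<open>b * (b - 1)\<close>, for the three barycentric coordinates \<open>b\<close>, vanish at the vertices, and their
 gradients vanish at the midpoints of the two edges where \<open>b\<close> is not constant.\<close>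

lemma quadratic_exists:
 assumes d: "cross2 (b - a) (c - a) ~= 0"
  and n1: "norm nu1 = 1" "(b - a) \<bullet> nu1 = 0" and n2: "norm nu2 = 1" "(c - b) \<bullet> nu2 = 0" and n3: "norm nu3 = 1" "(a - c) \<bullet> nu3 = 0"
 obtains Q dQ where "Q \<in> polys 2" "Q a = Va" "Q b = Vb" "Q c = Vc" "!!x. (Q has_derivative dQ x) (at x)"
  "!!x y h t. dQ (linepath x y t) h = (1 - t) * dQ x h + t * dQ y h"
  "dQ (midpoint a b) nu1 = D1" "dQ (midpoint b c) nu2 = D2" "dQ (midpoint c a) nu3 = D3"
proof -
 let ?L1 = "bary a b c" and ?L2 = "bary b c a" and ?L3 = "bary c a b"
 let ?g1 = "bary_grad a b c" and ?g2 = "bary_grad b c a" and ?g3 = "bary_grad c a b"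
 have d2: "cross2 (c - b) (a - b) ~= 0" and d3: "cross2 (a - c) (b - c) ~= 0" using d cross2_cyc by metis+
 have val: "bary p q r p = 0" "bary p q r q = 0" for p q r by (simp_all add: bary_def cross2_def)
 have one: "bary p q r r = 1" if "cross2 (q - p) (r - p) ~= 0" for p q r using that by (simp add: bary_def)
 have nz: "bary_grad p q r \<bullet> nu ~= 0" if "norm nu = 1" "(q - p) \<bullet> nu = 0" "cross2 (q - p) (r - p) ~= 0" for p q r nu
 proof -
  have "nu \<bullet> ((p + nu) - p) = bary p q r (p + nu) * (nu \<bullet> (r - p))" by (rule bary_normal(1)[OF that])
  moreover have "nu \<bullet> nu = 1" using that(1) by (simp add: norm_eq_1)
  ultimately show ?thesis by (auto simp: bary_inner)
 qed
 define G where "G = (%h. Va * (?g2 \<bullet> h) + Vb * (?g3 \<bullet> h) + Vc * (?g1 \<bullet> h))"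
 \<comment> \<open>\<open>G\<close> is the derivative of the linear interpolant. At the midpoint of
   an edge the coordinate b vanishing on it has 2 b - 1 = -1, while the other two equal 1/2 and have
   2 b - 1 = 0. So the three corrections decouple.\<close>
 define k1 where "k1 = (G nu1 - D1) / (?g1 \<bullet> nu1)"
 define k2 where "k2 = (G nu2 - D2) / (?g2 \<bullet> nu2)"
 define k3 where "k3 = (G nu3 - D3) / (?g3 \<bullet> nu3)"
 have k: "k1 * (?g1 \<bullet> nu1) = G nu1 - D1" "k2 * (?g2 \<bullet> nu2) = G nu2 - D2" "k3 * (?g3 \<bullet> nu3) = G nu3 - D3"
  using nz[OF n1 d] nz[OF n2 d2] nz[OF n3 d3] by (simp_all add: k1_def k2_def k3_def)
 define Q where "Q = (%x. (Va * ?L2 x + Vb * ?L3 x + Vc * ?L1 x) + k1 * (?L1 x * (?L1 x - 1)) + k2 * (?L2 x * (?L2 x - 1)) + k3 * (?L3 x * (?L3 x - 1)))"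
 define dQ where "dQ = (%x h. G h + k1 * ((2 * ?L1 x - 1) * (?g1 \<bullet> h)) + k2 * ((2 * ?L2 x - 1) * (?g2 \<bullet> h)) + k3 * ((2 * ?L3 x - 1) * (?g3 \<bullet> h)))"
 have "Q = lc 1 (lc 1 (lc 1 (lc 1 (lc Va ?L2 Vb ?L3) Vc ?L1) k1 (%x. ?L1 x * (?L1 x - 1))) k2 (%x. ?L2 x * (?L2 x - 1))) k3 (%x. ?L3 x * (?L3 x - 1))"
  by (rule ext) (simp add: Q_def lc_def)
 hence 1: "Q \<in> polys 2" by (simp only: polys_lc bary_quadratic_polys)
 have D: "(bary p q r has_derivative (%h. bary_grad p q r \<bullet> h)) (at x)" for p q r x
  unfolding bary_inner[abs_def] by (auto intro!: derivative_eq_intros)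
 have "(Q has_derivative dQ x) (at x)" for x
  unfolding Q_def dQ_def G_def by (rule derivative_eq_intros D refl)+ (simp add: algebra_simps)
 moreover have "dQ (linepath x y t) h = (1 - t) * dQ x h + t * dQ y h" for x y h t
  unfolding dQ_def bary_linepath by (simp add: algebra_simps)
 moreover have "Q a = Va" "Q b = Vb" "Q c = Vc" unfolding Q_def by (simp_all add: val one d d2 d3)
 moreover have "dQ (midpoint a b) nu1 = D1" "dQ (midpoint b c) nu2 = D2" "dQ (midpoint c a) nu3 = D3"
  unfolding dQ_def bary_midpoint using k by (simp_all add: val one d d2 d3)
 ultimately show thesis using that 1 by blast
qed

lemma normal_der_frechet:
 assumes "smooth Q"
 shows "lc (nu $ 1) (pds [1] Q) (nu $ 2) (pds [2] Q) x = FD Q (at x) nu"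
proof -
 have "(Q has_derivative FD Q (at x)) (at x)" using smooth_has_derivative[OF assms, of "[]"] by simp
 hence l: "linear (FD Q (at x))" by (rule has_derivative_linear)
 have "nu = nu $ 1 *\<^sub>R axis 1 1 + nu $ 2 *\<^sub>R axis 2 1" by (simp add: vec_eq_iff forall_2 axis_def)
 hence "FD Q (at x) nu = FD Q (at x) (nu $ 1 *\<^sub>R axis 1 1 + nu $ 2 *\<^sub>R axis 2 1)" by simp
 also have "... = nu $ 1 * FD Q (at x) (axis 1 1) + nu $ 2 * FD Q (at x) (axis 2 1)"
  by (simp only: linear_add[OF l] linear_cmul[OF l] real_scaleR_def)
 finally show ?thesis by (simp add: lc_def)
qed

lemma diameter_closed_segment: "diameter (closed_segment a b) = dist a (b :: pt)"
proof (rule antisym)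
 show "diameter (closed_segment a b) <= dist a b"
 proof (rule diameter_le)
  fix x y assume "x \<in> closed_segment a b" "y \<in> closed_segment a b"
  then obtain s t where st: "x = (1 - s) *\<^sub>R a + s *\<^sub>R b" "0 <= s" "s <= 1" "y = (1 - t) *\<^sub>R a + t *\<^sub>R b" "0 <= t" "t <= 1"
   unfolding closed_segment_def by blast
  have "x - y = (t - s) *\<^sub>R (a - b)" unfolding st by (simp add: algebra_simps)
  hence "norm (x - y) = \<bar>t - s\<bar> * dist a b" by (simp add: dist_norm)
  also have "... <= 1 * dist a b" using st by (intro mult_right_mono) auto
  finally show "norm (x - y) <= dist a b" by simp
 qed simp
 show "dist a b <= diameter (closed_segment a b)" by (rule diameter_bounded_bound) (auto intro: compact_imp_bounded)
qed

section \<open>Existence of the Morley interpolant\<close>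

context tri_mesh
begin

text \<open>A triangle is the closure of its interior, so a disagreement at one point would spread
  to a nonempty open set, which is not a null set.\<close>

lemma continuous_ae_eq:
 assumes K: "K \<in> \<T>" and c: "continuous_on K f" "continuous_on K g" and e: "ae_eq K f g" and z: "z \<in> K"
 shows "f z = g z"
proof (rule ccontr)
 assume ne: "f z ~= g z"
 define d where "d = (%x. \<bar>f x - g x\<bar>)"
 have cd: "continuous_on K d" unfolding d_def by (intro continuous_intros c)
 have "0 < d z" using ne by (simp add: d_def)
 then obtain r where r: "0 < r" "!!x. x \<in> K ==> dist x z < r ==> dist (d x) (d z) < d z" using cd z unfolding continuous_on_iff by blast
 hence nz: "f x ~= g x" if "x \<in> K" "dist x z < r" for x using r(2)[OF that] by (auto simp: d_def dist_real_def)
 have "z \<in> closure (interior K)"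
  using convex_closure_interior[OF convex_T[OF K] int_nonempty[OF K]] z closure_subset by blast
 then obtain y where y: "y \<in> interior K" "dist y z < r" using r(1) closure_approachable by blast
 have cK: "K \<in> sets lebesgue" by (rule fmeasurableD[OF lmeasurable_compact[OF compact_T[OF K]]])
 have "AE x in lebesgue. x \<in> K --> f x = g x" using e cK by (simp add: ae_eq_def AE_restrict_space_iff)
 hence "AE x in lebesgue. x \<notin> interior K \<inter> ball z r"
  by eventually_elim (use nz interior_subset[of K] in \<open>auto simp: dist_commute\<close>)
 moreover have op: "open (interior K \<inter> ball z r)" by auto
 ultimately have "interior K \<inter> ball z r \<in> null_sets lebesgue" by (subst AE_iff_null_sets) auto
 hence "negligible (interior K \<inter> ball z r)" by (simp add: negligible_iff_null_sets)
 hence "interior K \<inter> ball z r = {}" using open_not_negligible[OF op] by blast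
 thus False using y by (auto simp: dist_commute)
qed

lemma value_at_eq:
 assumes K: "K \<in> \<T>" and c: "continuous_on K g" and e: "ae_eq K f g" and z: "z \<in> K"
 shows "value_at K f z = g z"
 unfolding value_at_def
proof (rule the_equality)
 have ge: "ae_eq K g f" using e unfolding ae_eq_def by eventually_elim simp
 show "\<exists>w. continuous_on K w \<and> ae_eq K w f \<and> w z = g z" using c ge by blast
 fix v assume "\<exists>w. continuous_on K w \<and> ae_eq K w f \<and> w z = v"
 then obtain w where w: "continuous_on K w" "ae_eq K w f" "w z = v" by blast
 have "ae_eq K w g" using w(2) e unfolding ae_eq_def by eventually_elim simp
 from continuous_ae_eq[OF K w(1) c this z] show "v = g z" using w(3) by simp
qed

lemma normal_unit: "e \<in> edges \<T> ==> e = closed_segment a b ==> norm (n e) = 1 \<and> (b - a) \<bullet> n e = 0"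
proof -
 assume e: "e \<in> edges \<T>" "e = closed_segment a b"
 have K: "K_plus \<T> n e \<in> \<T>" "e edge_of K_plus \<T> n e" "outer_normal (K_plus \<T> n e) e (n e)" using K_plus_works[OF e(1)] by auto
 hence "e \<subseteq> K_plus \<T> n e" using edge_of_imp_subset by blast
 from outer_normal_perp[OF K(3) e(2) this] show ?thesis by blast
qed

text \<open>A quadratic has six degrees of freedom, three vertex values and three normal
  derivatives. That its derivative is affine along lines is recorded because edge means are computed
  from it.\<close>

lemma local_quadratic:
 assumes K: "K \<in> \<T>"
 obtains Q where "Q \<in> polys 2" "!!z. z extreme_point_of K ==> Q z = V z"
  "!!e a b. e edge_of K ==> ends e = (a, b) ==> FD Q (at (midpoint a b)) (n e) = D e"
  "!!x y h t. FD Q (at (linepath x y t)) h = (1 - t) * FD Q (at x) h + t * FD Q (at y) h"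
proof -
 obtain a b c where Kh: "K = convex hull {a, b, c}" and ai: "\<not> affine_dependent {a, b, c}" and c3: "card {a, b, c} = 3"
  using triangle_repr[OF simplex_T[OF K]] .
 have d: "cross2 (b - a) (c - a) ~= 0" by (rule cross2_nonzero[OF ai c3])
 have ext: "z extreme_point_of K \<longleftrightarrow> z \<in> {a, b, c}" for z unfolding Kh by (rule extreme_point_of_convex_hull_affine_independent[OF ai])
 \<comment> \<open>The prescribed normals belong to edges of the mesh; a side not yet identified as
   an edge may take any unit normal.\<close>
 have nrm: "\<exists>nu. norm nu = 1 \<and> (q - p) \<bullet> nu = 0 \<and> (closed_segment p q \<in> edges \<T> --> nu = n (closed_segment p q))" if "p ~= q" for p q
 proof (cases "closed_segment p q \<in> edges \<T>")
  case True
  thus ?thesis using normal_unit[OF True refl] by blast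
 next
  case False
  define m where "m = (vector [- (q - p) $ 2, (q - p) $ 1] :: pt)"
  have "m ~= 0" using that by (auto simp: m_def vec_eq_iff forall_2)
  moreover have "(q - p) \<bullet> m = 0" by (simp add: m_def inner_vec_def sum_2 algebra_simps)
  ultimately have "norm (m /\<^sub>R norm m) = 1 \<and> (q - p) \<bullet> (m /\<^sub>R norm m) = 0" by simp
  thus ?thesis using False by blast
 qed
 have dist: "a ~= b" "b ~= c" "c ~= a" using c3 by (auto simp: card_insert_if split: if_splits)
 obtain nu1 nu2 nu3 where n1: "norm nu1 = 1" "(b - a) \<bullet> nu1 = 0" "closed_segment a b \<in> edges \<T> ==> nu1 = n (closed_segment a b)"
  and n2: "norm nu2 = 1" "(c - b) \<bullet> nu2 = 0" "closed_segment b c \<in> edges \<T> ==> nu2 = n (closed_segment b c)"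
  and n3: "norm nu3 = 1" "(a - c) \<bullet> nu3 = 0" "closed_segment c a \<in> edges \<T> ==> nu3 = n (closed_segment c a)"
  using nrm[OF dist(1)] nrm[OF dist(2)] nrm[OF dist(3)] by metis
 obtain Q dQ where Q: "Q \<in> polys 2" "Q a = V a" "Q b = V b" "Q c = V c" and dQ: "!!x. (Q has_derivative dQ x) (at x)"
  and lin: "!!x y h t. dQ (linepath x y t) h = (1 - t) * dQ x h + t * dQ y h"
  and m: "dQ (midpoint a b) nu1 = D (closed_segment a b)" "dQ (midpoint b c) nu2 = D (closed_segment b c)" "dQ (midpoint c a) nu3 = D (closed_segment c a)"
  using quadratic_exists[OF d n1(1,2) n2(1,2) n3(1,2)] by metis
 have fr: "FD Q (at x) = dQ x" for x using frechet_derivative_at[OF dQ] by simp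
 show thesis
 proof (rule that[OF Q(1)])
  show "Q z = V z" if "z extreme_point_of K" for z using that Q by (auto simp: ext)
  show "FD Q (at (linepath x y t)) h = (1 - t) * FD Q (at x) h + t * FD Q (at y) h" for x y h t
   unfolding fr by (rule lin)
  fix e p q assume e: "e edge_of K" and E: "ends e = (p, q)"
  have eT: "e \<in> edges \<T>" using e K by (auto simp: edges_def)
  obtain r where r: "e = closed_segment p q" "p ~= q" "K = convex hull {p, q, r}" "cross2 (q - p) (r - p) ~= 0"
   using edge_repr[OF simplex_T[OF K] e] E by (metis prod.inject)
  have "{p, q} \<subseteq> {a, b, c}"
  proof -
   have "z \<in> {a, b, c}" if "z \<in> {p, q}" for z
   proof -
    have "z extreme_point_of e" using that unfolding r(1) by (auto simp: extreme_point_of_segment)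
    hence "z extreme_point_of K" using e extreme_point_of_face unfolding edge_of_def by blast
    thus ?thesis using ext by blast
   qed
   thus ?thesis by blast
  qed
  hence "(e = closed_segment a b \<and> midpoint p q = midpoint a b) \<or> (e = closed_segment b c \<and> midpoint p q = midpoint b c) \<or> (e = closed_segment c a \<and> midpoint p q = midpoint c a)"
  proof -
   have "p = a \<and> q = b \<or> p = b \<and> q = a \<or> p = b \<and> q = c \<or> p = c \<and> q = b \<or> p = c \<and> q = a \<or> p = a \<and> q = c"
    using \<open>{p, q} \<subseteq> {a, b, c}\<close> r(2) by blast
   thus ?thesis using r(1) by (elim disjE conjE) (simp_all add: closed_segment_commute midpoint_sym)
  qed
  then consider (1) "e = closed_segment a b" "midpoint p q = midpoint a b" | (2) "e = closed_segment b c" "midpoint p q = midpoint b c"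
   | (3) "e = closed_segment c a" "midpoint p q = midpoint c a" by blast
  thus "FD Q (at (midpoint p q)) (n e) = D e"
  proof cases
   case 1
   hence "nu1 = n e" using n1(3) eT by simp
   thus ?thesis using m(1) 1 by (simp add: fr)
  next
   case 2
   hence "nu2 = n e" using n2(3) eT by simp
   thus ?thesis using m(2) 2 by (simp add: fr)
  next
   case 3
   hence "nu3 = n e" using n3(3) eT by simp
   thus ?thesis using m(3) 3 by (simp add: fr)
  qed
 qed
qed

text \<open>\<open>morley_interp\<close> is a choice, so existence is what gives it its properties.
  The local quadratics take their data from one function on the vertices and one on the edges, hence
  all matching conditions hold by construction; the mean of an affine normal derivative over an edge
  is its value at the midpoint.\<close>

lemma morley_interp_exists: "\<exists>w. is_morley_interp Z \<T> n v w"
proof -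
 define V where "V = (%z. if z \<in> Z then patch_mean \<T> (%_. v) z else 0)"
 define Dn where "Dn = (%e. if e \<in> bd_edges Z \<T> then 0 else edge_int e (avg Z \<T> n e (normal_der (n e) v)) / diameter e)"
 have "\<forall>K\<in>\<T>. \<exists>Q. Q \<in> polys 2 \<and> (\<forall>z. z extreme_point_of K --> Q z = V z) \<and>
  (\<forall>e a b. e edge_of K --> ends e = (a, b) --> FD Q (at (midpoint a b)) (n e) = Dn e) \<and>
  (\<forall>x y h t. FD Q (at (linepath x y t)) h = (1 - t) * FD Q (at x) h + t * FD Q (at y) h)"
 proof
  fix K assume K: "K \<in> \<T>"
  obtain Q where "Q \<in> polys 2" "!!z. z extreme_point_of K ==> Q z = V z"
   "!!e a b. e edge_of K ==> ends e = (a, b) ==> FD Q (at (midpoint a b)) (n e) = Dn e"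
   "!!x y h t. FD Q (at (linepath x y t)) h = (1 - t) * FD Q (at x) h + t * FD Q (at y) h"
   using local_quadratic[OF K, of V Dn] by blast
  thus "\<exists>Q. Q \<in> polys 2 \<and> (\<forall>z. z extreme_point_of K --> Q z = V z) \<and>
  (\<forall>e a b. e edge_of K --> ends e = (a, b) --> FD Q (at (midpoint a b)) (n e) = Dn e) \<and>
  (\<forall>x y h t. FD Q (at (linepath x y t)) h = (1 - t) * FD Q (at x) h + t * FD Q (at y) h)" by blast
 qed
 from bchoice[OF this] obtain Q where Q': "\<forall>K\<in>\<T>. Q K \<in> polys 2 \<and> (\<forall>z. z extreme_point_of K --> Q K z = V z) \<and>
  (\<forall>e a b. e edge_of K --> ends e = (a, b) --> FD (Q K) (at (midpoint a b)) (n e) = Dn e) \<and>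
  (\<forall>x y h t. FD (Q K) (at (linepath x y t)) h = (1 - t) * FD (Q K) (at x) h + t * FD (Q K) (at y) h)"
  by blast
 hence Q: "!!K. K \<in> \<T> ==> Q K \<in> polys 2" "!!K z. K \<in> \<T> ==> z extreme_point_of K ==> Q K z = V z"
  "!!K e a b. K \<in> \<T> ==> e edge_of K ==> ends e = (a, b) ==> FD (Q K) (at (midpoint a b)) (n e) = Dn e"
  "!!K x y h t. K \<in> \<T> ==> FD (Q K) (at (linepath x y t)) h = (1 - t) * FD (Q K) (at x) h + t * FD (Q K) (at y) h"
  by blast+
 have Qs: "smooth (Q K)" if "K \<in> \<T>" for K using Q(1)[OF that] by (rule smooth_polys)
 \<comment> \<open>On the edges, which form a null set, the value is arbitrary.\<close>
 define w where "w = (%x. Q (SOME K. K \<in> \<T> \<and> x \<in> interior K) x)"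
 have wQ: "w x = Q K x" if "K \<in> \<T>" "x \<in> interior K" for K x
 proof -
  let ?K = "SOME K. K \<in> \<T> \<and> x \<in> interior K"
  have "?K \<in> \<T> \<and> x \<in> interior ?K" by (rule someI[of "%K. K \<in> \<T> \<and> x \<in> interior K"]) (use that in blast)
  hence "?K = K" using interiors_disjoint[of ?K K] that interior_subset by blast
  thus ?thesis by (simp add: w_def)
 qed
 have wi: "ae_eq (interior K) w (Q K)" if "K \<in> \<T>" for K
  unfolding ae_eq_def by (rule AE_I2) (use wQ[OF that] in simp)
 have wK: "ae_eq K w (Q K)" if "K \<in> \<T>" for K using wi[OF that] ae_eq_interior[OF that] by blast
 have vert: "value_at K w z = V z" if zv: "z \<in> vertices \<T>" and zK: "K \<in> patch \<T> z" for z K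
 proof -
  have K: "K \<in> \<T>" "z \<in> K" using zK by (auto simp: patch_def)
  obtain K' where K': "K' \<in> \<T>" "z extreme_point_of K'" using zv unfolding vertices_def by blast
  have "z \<in> K'" using K'(2) by (simp add: extreme_point_of_def)
  \<comment> \<open>The intersection of two triangles is a face of both, so a vertex of
    \<open>K'\<close> that lies in \<open>K\<close> is a vertex of \<open>K\<close>: there are no
    hanging nodes.\<close>
  hence "z extreme_point_of (K' \<inter> K)" using extreme_point_of_face[OF face_T[OF K'(1) K(1)]] K'(2) K(2) by blast
  moreover have "(K' \<inter> K) face_of K" using face_T[OF K(1) K'(1)] by (simp add: Int_commute)
  ultimately have "z extreme_point_of K" using extreme_point_of_face by blast
  thus ?thesis using value_at_eq[OF K(1) smooth_continuous0[OF Qs[OF K(1)]] wK[OF K(1)] K(2)] Q(2)[OF K(1)] by simp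
 qed
 let ?nd = "%e K. lc (n e $ 1) (pds [1] (Q K)) (n e $ 2) (pds [2] (Q K))"
 have nds: "smooth (?nd e K)" if "K \<in> \<T>" for e K
  unfolding lc_def by (rule smooth_lin(2)[OF smooth_pds[OF Qs[OF that]] smooth_pds[OF Qs[OF that]]])
 have nde: "ae_eq (interior K) (normal_der (n e) w K) (?nd e K)" if "K \<in> \<T>" for e K
 proof -
  interpret bdom "interior K" by (rule bdom_T[OF that])
  have "ae_eq (interior K) (pw_der [i] w K) (pds [i] (Q K))" for i
   using wder_smooth[OF Qs[OF that], of "[i]"] unfolding pw_der_def wder_cong[OF wi[OF that]] by simp
  thus ?thesis unfolding normal_der_eq by (intro ae_eq_lc)
 qed
 have mid: "value_at K (normal_der (n e) w K) (edge_midpoint e) = Dn e" 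
  and mean: "edge_int e (trace_on K e (normal_der (n e) w K)) / diameter e = Dn e" if K: "K \<in> \<T>" and e: "e edge_of K" for K e
 proof -
  obtain a b c where E: "ends e = (a, b)" and es: "e = closed_segment a b" and ab: "a ~= b" using edge_repr[OF simplex_T[OF K] e] by metis
  have mK: "midpoint a b \<in> K" using edge_of_imp_subset[OF e] midpoint_in_closed_segment[of a b] unfolding es by blast
  have ndK: "ae_eq K (normal_der (n e) w K) (?nd e K)" using nde[OF K] ae_eq_interior[OF K] by blast
  have fm: "FD (Q K) (at (midpoint a b)) (n e) = Dn e" by (rule Q(3)[OF K e E])
  have "value_at K (normal_der (n e) w K) (midpoint a b) = ?nd e K (midpoint a b)"
   by (rule value_at_eq[OF K smooth_continuous0[OF nds[OF K]] ndK mK])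
  thus "value_at K (normal_der (n e) w K) (edge_midpoint e) = Dn e"
   unfolding normal_der_frechet[OF Qs[OF K]] fm by (simp only: edge_midpoint_def E prod.case)
  have t: "eae e (trace_on K e (normal_der (n e) w K)) (?nd e K)" by (rule trace_on_eae[OF simplex_T[OF K] e nds[OF K] nde[OF K]])
  hence "ecn e (trace_on K e (normal_der (n e) w K))" unfolding ecn_def using smooth_continuous0[OF nds[OF K]] by blast
  from edge_int_cong[OF t this] have "edge_int e (trace_on K e (normal_der (n e) w K)) = edge_int e (?nd e K)" .
  also have "... = norm (b - a) * Dn e"
  proof -
   let ?A = "FD (Q K) (at a) (n e)" and ?B = "FD (Q K) (at b) (n e)"
   have "?nd e K (linepath a b t) = ?A + t * (?B - ?A)" for t
    unfolding normal_der_frechet[OF Qs[OF K]] Q(4)[OF K] by (simp add: algebra_simps)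
   moreover have "(LINT t|L01. ?A + t * (?B - ?A)) = (?A + ?B) / 2"
   proof -
    have "((%t. ?A + t * (?B - ?A)) has_integral ((?A * 1 + 1^2 / 2 * (?B - ?A)) - (?A * 0 + 0^2 / 2 * (?B - ?A)))) {0..1}"
     by (rule fundamental_theorem_of_calculus) (auto intro!: derivative_eq_intros simp: has_real_derivative_iff_has_vector_derivative[symmetric])
    hence "integral {0..1} (%t. ?A + t * (?B - ?A)) = (?A + ?B) / 2" by (simp add: integral_unique field_simps)
    moreover have "(LINT t|L01. ?A + t * (?B - ?A)) = integral {0..1} (%t. ?A + t * (?B - ?A))"
    proof (rule lebesgue_integral_eq_integral)
     have "continuous_on {0..1} (%t. ?A + t * (?B - ?A))" by (intro continuous_intros)
     from absolutely_integrable_continuous_real[OF this] show "integrable (L01) (%t. ?A + t * (?B - ?A))"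
      by (simp add: absolutely_integrable_imp_integrable)
    qed simp
    ultimately show ?thesis by simp
   qed
   moreover have "midpoint a b = linepath a b (1/2)" by (simp add: midpoint_def linepath_def scaleR_add_right)
   hence "(?A + ?B) / 2 = Dn e" using fm Q(4)[OF K, of a b "1/2"] by simp
   ultimately show ?thesis unfolding edge_int_def E prod.case by simp
  qed
  finally show "edge_int e (trace_on K e (normal_der (n e) w K)) / diameter e = Dn e"
   using ab by (simp add: es diameter_closed_segment dist_norm norm_minus_commute)
 qed
 have "w \<in> pw_polys 2 \<T>" unfolding pw_polys_def using wK Q(1) by blast
 hence "w \<in> morley Z \<T> n"
  unfolding morley_def using vert mid by (auto simp: V_def Dn_def bd_edges_def edges_def)
 moreover have "\<forall>z\<in>vertices \<T> \<inter> Z. \<forall>K\<in>patch \<T> z. value_at K w z = patch_mean \<T> (%_. v) z"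
  using vert by (auto simp: V_def)
 moreover have "\<forall>e\<in>edges \<T> - bd_edges Z \<T>. \<forall>K\<in>\<T>. e edge_of K -->
    edge_int e (trace_on K e (normal_der (n e) w K)) / diameter e = edge_int e (avg Z \<T> n e (normal_der (n e) v)) / diameter e"
  using mean by (simp add: Dn_def)
 ultimately show ?thesis unfolding is_morley_interp_def by blast
qed

text \<open>With the existence of the interpolant, the choice behind it is a Morley function for
  every argument, and the companion operator applies to it.\<close>

lemma smoother_Hs0: "companion Z \<T> n \<Lambda> J ==> smoother Z \<T> n J v \<in> Hs0 Z 2"
proof -
 assume c: "companion Z \<T> n \<Lambda> J"
 have "is_morley_interp Z \<T> n v (morley_interp Z \<T> n v)" unfolding morley_interp_def by (rule someI_ex[OF morley_interp_exists])
 hence "morley_interp Z \<T> n v \<in> morley Z \<T> n" by (simp add: is_morley_interp_def)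
 thus ?thesis using c unfolding companion_def smoother_def by blast
qed

end

section \<open>Broken Sobolev norms and the smoothing operator\<close>

lemma L2_restrict:
 assumes "bdom U" "bdom V" "V \<subseteq> U" "v \<in> L2 U" shows "v \<in> L2 V"
proof -
 have s: "U \<in> sets lebesgue" "V \<in> sets lebesgue" using assms(1,2) by (auto intro: bdom.U_sets)
 have "v \<in> borel_measurable (lebesgue_on U)" using assms(4) by (simp add: L2_def)
 hence "v \<in> borel_measurable (lebesgue_on V)" by (rule measurable_restrict_mono) (rule assms(3))
 moreover have "integrable (lebesgue_on V) (%x. (v x)^2)"
 proof -
  have "integrable (lebesgue_on U) (%x. (v x)^2)" using assms(4) by (simp add: L2_def)
  hence "integrable lebesgue (%x. indicator U x *\<^sub>R (v x)^2)" using s by (subst (asm) integrable_restrict_space) auto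
  from integrable_mult_indicator[OF s(2) this] have "integrable lebesgue (%x. indicator V x *\<^sub>R (indicator U x *\<^sub>R (v x)^2))" .
  moreover have "(%x. indicator V x *\<^sub>R (indicator U x *\<^sub>R (v x)^2)) = (%x. indicator V x *\<^sub>R (v x)^2)"
   using assms(3) by (intro ext) (auto simp: indicator_def)
  ultimately show ?thesis using s by (subst integrable_restrict_space) auto
 qed
 ultimately show ?thesis by (simp add: L2_def)
qed

lemma ip_restrict:
 assumes "bdom U" "bdom V" "V \<subseteq> U" "!!x. x \<notin> V ==> g x = 0" shows "ip U f g = ip V f g"
proof -
 have s: "U \<in> sets lebesgue" "V \<in> sets lebesgue" using assms(1,2) by (auto intro: bdom.U_sets)
 have "(%x. indicator U x *\<^sub>R (f x * g x)) = (%x. indicator V x *\<^sub>R (f x * g x))"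
 proof (rule ext)
  fix x show "indicator U x *\<^sub>R (f x * g x) = indicator V x *\<^sub>R (f x * g x)"
   using assms(3) assms(4)[of x] by (cases "x \<in> V") (auto simp: indicator_def)
 qed
 thus ?thesis unfolding ip_def using s by (subst (1 2) integral_restrict_space) auto
qed

lemma weak_deriv_restrict:
 assumes "bdom U" "bdom V" "V \<subseteq> U" "weak_deriv U is v g" shows "weak_deriv V is v g"
 unfolding weak_deriv_def
proof (intro conjI ballI)
 show "v \<in> L2 V" "g \<in> L2 V" using L2_restrict[OF assms(1-3)] assms(4) by (auto simp: weak_deriv_def)
 fix phi assume phi: "phi \<in> test_fun V"
 have "ip V v (pds is phi) = ip U v (pds is phi)" using ip_restrict[OF assms(1-3)] test_fun_zero[OF test_fun_pds[OF phi]] by simp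
 also have "... = (-1) ^ length is * ip U g phi" using assms(4) test_fun_mono[OF phi assms(3)] by (simp add: weak_deriv_def)
 also have "ip U g phi = ip V g phi" using ip_restrict[OF assms(1-3)] test_fun_zero[OF phi] by simp
 finally show "ip V v (pds is phi) = (-1) ^ length is * ip V g phi" .
qed

lemma Hk_restrict:
 assumes "bdom U" "bdom V" "V \<subseteq> U" "v \<in> Hk U m"
 shows "v \<in> Hk V m" "length is <= m ==> ae_eq V (wder V is v) (wder U is v)"
proof -
 have w: "weak_deriv V is v (wder U is v)" if "length is <= m" for "is"
  by (rule weak_deriv_restrict[OF assms(1-3) bdom.Hk_wder[OF assms(1,4) that]])
 show "v \<in> Hk V m" unfolding Hk_def using w L2_restrict[OF assms(1-3) bdom.Hk_L2[OF assms(1,4)]] by blast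
 show "length is <= m ==> ae_eq V (wder V is v) (wder U is v)" by (rule bdom.wder_eqI[OF assms(2) w])
qed

context tri_mesh
begin

text \<open>Off the finitely many boundaries of triangles, a null set, a point of the domain lies in
  the interior of exactly one triangle and any other point in none.\<close>

lemma ip_cells: assumes f: "f \<in> L2 Z" shows "ip Z f f = (\<Sum>K\<in>\<T>. ip (interior K) f f)"
proof -
 have sZ: "Z \<in> sets lebesgue" by (rule bdom.U_sets[OF bdom_Z])
 have sK: "interior K \<in> sets lebesgue" if "K \<in> \<T>" for K by (rule bdom.U_sets[OF bdom_T[OF that]])
 have "AE x in lebesgue. \<forall>K\<in>\<T>. x \<notin> frontier K"
  using finite_T
 proof (rule AE_finite_allI)
  fix K assume "K \<in> \<T>"
  hence "frontier K \<in> null_sets lebesgue" using negligible_convex_frontier[OF convex_T] by (simp add: negligible_iff_null_sets)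
  thus "AE x in lebesgue. x \<notin> frontier K" by (rule AE_not_in)
 qed
 hence ae: "AE x in lebesgue. indicator Z x *\<^sub>R (f x * f x) = (\<Sum>K\<in>\<T>. indicator (interior K) x *\<^sub>R (f x * f x))"
 proof eventually_elim
  case (elim x)
  show ?case
  proof (cases "x \<in> Z")
   case False
   hence "x \<notin> interior K" if "K \<in> \<T>" for K using int_subset[OF that] by blast
   thus ?thesis using False by (simp add: indicator_def)
  next
   case True
   hence "x \<in> \<Union>\<T>" using cover_T closure_subset by blast
   then obtain K where K: "K \<in> \<T>" "x \<in> K" by blast
   hence xi: "x \<in> interior K" using elim closure_subset unfolding frontier_def by blast
   have o: "x \<notin> interior K'" if "K' \<in> \<T>" "K' ~= K" for K'
    using interiors_disjoint[OF K(1) that(1)] that(2) xi interior_subset[of K'] by blast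
   have "(\<Sum>K\<in>\<T>. indicator (interior K) x *\<^sub>R (f x * f x)) = (\<Sum>K'\<in>\<T>. if K' = K then f x * f x else 0)"
   proof (rule sum.cong[OF refl])
    fix K' assume K': "K' \<in> \<T>"
    show "indicator (interior K') x *\<^sub>R (f x * f x) = (if K' = K then f x * f x else 0)"
     using xi o[OF K'] by (cases "K' = K") (auto simp: indicator_def)
   qed
   also have "... = f x * f x" using finite_T K(1) by simp
   finally show ?thesis using True by simp
  qed
 qed
 have iZ: "integrable lebesgue (%x. indicator Z x *\<^sub>R (f x * f x))"
  using bdom.L2_mult_integrable[OF bdom_Z f f] sZ by (subst (asm) integrable_restrict_space) auto
 have iK: "integrable lebesgue (%x. indicator (interior K) x *\<^sub>R (f x * f x))" if "K \<in> \<T>" for K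
  using bdom.L2_mult_integrable[OF bdom_T[OF that] L2_restrict[OF bdom_Z bdom_T[OF that] int_subset[OF that] f] L2_restrict[OF bdom_Z bdom_T[OF that] int_subset[OF that] f]] sK[OF that]
  by (subst (asm) integrable_restrict_space) auto
 have "ip Z f f = (LINT x|lebesgue. indicator Z x *\<^sub>R (f x * f x))" unfolding ip_def using sZ by (subst integral_restrict_space) auto
 also have "... = (LINT x|lebesgue. (\<Sum>K\<in>\<T>. indicator (interior K) x *\<^sub>R (f x * f x)))"
  by (rule integral_cong_AE[OF borel_measurable_integrable[OF iZ] borel_measurable_integrable ae]) (intro Bochner_Integration.integrable_sum iK)
 also have "... = (\<Sum>K\<in>\<T>. LINT x|lebesgue. indicator (interior K) x *\<^sub>R (f x * f x))"
  by (rule Bochner_Integration.integral_sum[OF iK])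
 also have "... = (\<Sum>K\<in>\<T>. ip (interior K) f f)"
  unfolding ip_def by (intro sum.cong refl) (subst integral_restrict_space, use sK in auto)
 finally show ?thesis .
qed

lemma wder_cells:
 assumes f: "f \<in> Hk Z m" "length is <= m"
 shows "(l2norm Z (wder Z is f))^2 = (\<Sum>K\<in>\<T>. (l2norm (interior K) (wder (interior K) is f))^2)"
proof -
 have L: "wder Z is f \<in> L2 Z" by (rule bdom.wder_L2[OF bdom_Z f])
 have "(l2norm (interior K) (wder (interior K) is f))^2 = ip (interior K) (wder Z is f) (wder Z is f)" if K: "K \<in> \<T>" for K
 proof -
  interpret bdom "interior K" by (rule bdom_T[OF K])
  have e: "ae_eq (interior K) (wder (interior K) is f) (wder Z is f)" by (rule Hk_restrict(2)[OF bdom_Z bdom_T[OF K] int_subset[OF K] f])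
  have "wder Z is f \<in> L2 (interior K)" by (rule L2_restrict[OF bdom_Z bdom_T[OF K] int_subset[OF K] L])
  hence "l2norm (interior K) (wder Z is f) = l2norm (interior K) (wder (interior K) is f)" by (rule l2norm_cong[OF ae_eq_sym[OF e]])
  thus ?thesis using l2norm_sq[of "wder Z is f"] by simp
 qed
 thus ?thesis using ip_cells[OF L] bdom.l2norm_sq[OF bdom_Z] by simp
qed

lemma cells_le_pw_sob:
 assumes f: "!!K. K \<in> \<T> ==> f \<in> Hk (interior K) k" "length is <= k"
 shows "(\<Sum>K\<in>\<T>. (l2norm (interior K) (wder (interior K) is f))^2) <= (pw_sob_norm \<T> (real k) f)^2"
proof -
 have "(\<Sum>K\<in>\<T>. (l2norm (interior K) (wder (interior K) is f))^2) <= (\<Sum>K\<in>\<T>. (sob_norm (interior K) (real k) f)^2)"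
 proof (intro sum_mono power_mono)
  fix K assume K: "K \<in> \<T>"
  show "l2norm (interior K) (wder (interior K) is f) <= sob_norm (interior K) (real k) f"
   by (rule bdom.wder_le_sob_norm[OF bdom_T[OF K] f(1)[OF K] f(2)])
  show "0 <= l2norm (interior K) (wder (interior K) is f)" by (rule bdom.l2norm_nonneg[OF bdom_T[OF K]])
 qed
 also have "... = (pw_sob_norm \<T> (real k) f)^2" unfolding pw_sob_norm_def by (simp add: sum_nonneg)
 finally show ?thesis .
qed

lemma Vh_lc: assumes "v \<in> Vh Z \<T>" "w \<in> Vh Z \<T>" shows "lc a v b w \<in> Vh Z \<T>"
proof -
 have "\<exists>q\<in>polys 2. ae_eq K (lc a v b w) q" if K: "K \<in> \<T>" for K
 proof -
  obtain q s where qs: "q \<in> polys 2" "ae_eq K v q" "s \<in> polys 2" "ae_eq K w s" using assms K unfolding Vh_def pw_polys_def by blast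
  have "ae_eq K (lc a v b w) (lc a q b s)" by (rule bdom.ae_eq_lc[OF bdom_Z qs(2,4)])
  thus ?thesis using polys_lc[OF qs(1,3)] by blast
 qed
 moreover have "lc a v b w \<in> Hs0 Z 1" using bdom.Hs0_lc[OF bdom_Z, of v 1 w] assms by (simp add: Vh_def)
 ultimately show ?thesis by (simp add: Vh_def pw_polys_def)
qed

lemma Wh_lc: assumes "v \<in> Wh Z \<T>" "w \<in> Wh Z \<T>" shows "lc a v b w \<in> Wh Z \<T>"
proof -
 have "\<exists>q\<in>polys 1. ae_eq K (lc a v b w) q" if K: "K \<in> \<T>" for K
 proof -
  obtain q s where qs: "q \<in> polys 1" "ae_eq K v q" "s \<in> polys 1" "ae_eq K w s" using assms K unfolding Wh_def pw_polys_def by blast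
  have "ae_eq K (lc a v b w) (lc a q b s)" by (rule bdom.ae_eq_lc[OF bdom_Z qs(2,4)])
  thus ?thesis using polys_lc[OF qs(1,3)] by blast
 qed
 moreover have "lc a v b w \<in> Hs0 Z 1" using bdom.Hs0_lc[OF bdom_Z, of v 1 w] assms by (simp add: Wh_def)
 ultimately show ?thesis by (simp add: Wh_def pw_polys_def)
qed

lemma mesh_size_pos: "0 < mesh_size \<T>" and mesh_size_le: "(!!x. x \<in> Z ==> norm x <= R) ==> mesh_size \<T> <= 2 * R"
proof -
 have "\<T> ~= {}" using cover_T nonempty_Z closure_subset by blast
 hence ne: "diameter ` \<T> ~= {}" "finite (diameter ` \<T>)" using finite_T by auto
 hence "mesh_size \<T> \<in> diameter ` \<T>" unfolding mesh_size_def by (intro Max_in)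
 then obtain K where K: "K \<in> \<T>" "mesh_size \<T> = diameter K" by blast
 obtain x where xi: "x \<in> interior K" using int_nonempty[OF K(1)] by blast
 obtain e where x: "0 < e" "ball x e \<subseteq> interior K" by (rule openE[OF open_interior xi])
 have "x + (e / 2) *\<^sub>R axis 1 1 \<in> ball x e" using x(1) by (simp add: dist_norm)
 hence "x + (e / 2) *\<^sub>R axis 1 1 \<in> interior K" by (rule subsetD[OF x(2)])
 hence m: "x + (e / 2) *\<^sub>R axis 1 1 \<in> K" "x \<in> K" using xi by (blast intro: subsetD[OF interior_subset])+
 have "dist (x + (e / 2) *\<^sub>R axis 1 1) x <= diameter K" by (rule diameter_bounded_bound[OF compact_imp_bounded[OF compact_T[OF K(1)]] m])
 thus "0 < mesh_size \<T>" using x(1) K(2) by (simp add: dist_norm)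
 assume R: "!!x. x \<in> Z ==> norm x <= R"
 have "closure Z \<subseteq> cball 0 R" by (rule closure_minimal) (use R in auto)
 have nR: "norm y <= R" if "y \<in> K" for y
 proof -
  have "y \<in> \<Union>\<T>" using K(1) that by blast
  hence "y \<in> cball 0 R" unfolding cover_T using \<open>closure Z \<subseteq> cball 0 R\<close> by blast
  thus ?thesis by simp
 qed
 show "mesh_size \<T> <= 2 * R" unfolding K(2)
 proof (rule diameter_le)
  show "K ~= {} \<or> 0 <= 2 * R" using m by auto
  fix y z assume "y \<in> K" "z \<in> K"
  hence "norm y <= R" "norm z <= R" using nR by auto
  thus "norm (y - z) <= 2 * R" using norm_triangle_ineq4[of y z] by linarith
 qed
qed

end

text \<open>\<open>Rd\<close> bounds the domain; it enters the constants through the Poincare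
  inequality and the bound 2 Rd for the mesh size. Being at least 1, it can be replaced by its
  powers.\<close>

locale disc = tri_mesh +
 fixes sgIP CCoer CCont C1 \<Lambda> Rd :: real and J :: "scalar_field => scalar_field"
 assumes coer: "coercive_continuous Z \<T> n sgIP CCoer CCont" and CCoer: "0 < CCoer" and C1: "0 < C1"
  and comp: "companion Z \<T> n \<Lambda> J" and smb: "smoother_bound Z \<T> n sgIP J C1"
  and Rd: "1 <= Rd" "!!x. x \<in> Z ==> norm x <= Rd"
begin

sublocale O: bdom Z by (rule bdom_Z)

abbreviation "h \<equiv> mesh_size \<T>"
abbreviation "a \<equiv> ah Z \<T> n sgIP"
abbreviation "N \<equiv> h_norm Z \<T> n sgIP"
abbreviation "Q \<equiv> smoother Z \<T> n J"
abbreviation "V \<equiv> Vh Z \<T>"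

section \<open>Finite element functions and their smoothed images\<close>

lemma s_pos: "0 < sgIP" using coer by (simp add: coercive_continuous_def)

lemma N_nonneg: "0 <= N v" by (rule h_norm_nonneg[OF s_pos])

lemma Q_Hs0: "Q v \<in> Hs0 Z 2" by (rule smoother_Hs0[OF comp])

lemma Q_Hk: "Q v \<in> Hk Z 2" using O.Hs0_Hk[of "Q v" 2] Q_Hs0 by simp

lemma V_Hs0: "v \<in> V ==> v \<in> Hs0 Z 1" by (simp add: Vh_def)

lemma V_Hk: "v \<in> V ==> v \<in> Hk Z 1" using O.Hs0_Hk[of v 1] V_Hs0 by simp

lemma coercive: "v \<in> V ==> CCoer * (N v)^2 <= a v v" using coer by (simp add: coercive_continuous_def)

lemma N_scale: assumes v: "v \<in> V" shows "N (lc 0 v c v) = \<bar>c\<bar> * N v"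
proof -
 have p: "v \<in> PS" using Vh_PS[OF v] .
 have p2: "lc 0 v c v \<in> PS" using Vh_PS[OF Vh_lc[OF v v]] .
 have "pw_hess_ip \<T> (lc 0 v c v) (lc 0 v c v) = c * pw_hess_ip \<T> v (lc 0 v c v)" using pw_hess_lc[OF p p p2] by simp
 also have "pw_hess_ip \<T> v (lc 0 v c v) = pw_hess_ip \<T> (lc 0 v c v) v" by (simp add: pw_hess_ip_def hess_ip_commute[of _ v])
 also have "... = c * pw_hess_ip \<T> v v" using pw_hess_lc[OF p p p] by simp
 finally have 1: "pw_hess_ip \<T> (lc 0 v c v) (lc 0 v c v) = c^2 * pw_hess_ip \<T> v v" by (simp add: power2_eq_square)
 have "penalty Z \<T> n sgIP (lc 0 v c v) (lc 0 v c v) = c * penalty Z \<T> n sgIP v (lc 0 v c v)" using penalty_lc[OF p p p2] by simp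
 also have "penalty Z \<T> n sgIP v (lc 0 v c v) = penalty Z \<T> n sgIP (lc 0 v c v) v" by (simp add: penalty_def mult.commute)
 also have "... = c * penalty Z \<T> n sgIP v v" using penalty_lc[OF p p p] by simp
 finally have 2: "penalty Z \<T> n sgIP (lc 0 v c v) (lc 0 v c v) = c^2 * penalty Z \<T> n sgIP v v" by (simp add: power2_eq_square)
 show ?thesis unfolding h_norm_def 1 2 by (simp add: distrib_left[symmetric] real_sqrt_mult)
qed

text \<open>The zero function competes in the infimum over H^2_0, so the distance from that space is
  at most the broken norm of \<open>v\<close>.\<close>

lemma smoother_pw: 
 assumes v: "v \<in> V" and s: "s \<in> {0..2}"
 shows "pw_sob_norm \<T> s (v - Q v) <= C1 * h powr (2 - s) * N v"
proof -
 let ?I = "INF w\<in>Hs0 Z 2. N (w - v)"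
 have z: "(%_. 0) \<in> Hs0 Z 2" using O.test_Hs0[OF test_fun_zero_mem, of 2] by simp
 have e: "(%_. 0) - v = lc 0 v (-1) v" by (rule ext) (simp add: lc_def)
 have "?I <= N ((%_. 0) - v)"
  by (rule cINF_lower[OF _ z]) (rule bdd_belowI2[where m = 0], rule N_nonneg)
 hence I: "?I <= N v" unfolding e N_scale[OF v] by simp
 have "pw_sob_norm \<T> s (v - Q v) <= C1 * h powr (2 - s) * ?I" using smb v s by (simp add: smoother_bound_def)
 also have "... <= C1 * h powr (2 - s) * N v" using C1 I by (intro mult_left_mono) auto
 finally show ?thesis .
qed

lemma d_cell: assumes v: "v \<in> V" "K \<in> \<T>" shows "v - Q v \<in> Hk (interior K) 2" "Q v \<in> Hk (interior K) 2" "v \<in> Hk (interior K) 2"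
proof -
 interpret bdom "interior K" by (rule bdom_T[OF v(2)])
 show 1: "Q v \<in> Hk (interior K) 2" by (rule Hk_restrict(1)[OF bdom_Z bdom_T[OF v(2)] int_subset[OF v(2)] Q_Hk])
 show 2: "v \<in> Hk (interior K) 2" by (rule PS_Hk[OF Vh_PS[OF v(1)] v(2)])
 show "v - Q v \<in> Hk (interior K) 2" unfolding diff_eq_lc using 1 2 by simp
qed

lemma d_Hs0: "v \<in> V ==> v - Q v \<in> Hs0 Z 1"
 unfolding diff_eq_lc using O.Hs0_lc[of v 1 "Q v" 1 "-1"] V_Hs0 O.Hs0_2_1[OF Q_Hs0] by simp

lemma d_Hk: "v \<in> V ==> v - Q v \<in> Hk Z 1" using O.Hs0_Hk[of "v - Q v" 1] d_Hs0 by simp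

lemma cells_root:
 assumes "f \<in> Hk Z m" "length is <= m" "length is <= k" "!!K. K \<in> \<T> ==> f \<in> Hk (interior K) k"
 shows "l2norm Z (wder Z is f) <= pw_sob_norm \<T> (real k) f"
proof (rule power2_le_imp_le)
 show "(l2norm Z (wder Z is f))^2 <= (pw_sob_norm \<T> (real k) f)^2"
  unfolding wder_cells[OF assms(1,2)] by (rule cells_le_pw_sob[OF assms(4,3)])
 show "0 <= pw_sob_norm \<T> (real k) f" unfolding pw_sob_norm_def by (simp add: sum_nonneg)
qed

lemma sm0: assumes v: "v \<in> V" shows "l2norm Z (v - Q v) <= C1 * h^2 * N v"
proof -
 have L: "v - Q v \<in> L2 Z" using O.Hk_L2[OF d_Hk[OF v]] .
 have "l2norm Z (v - Q v) = l2norm Z (wder Z [] (v - Q v))" using O.l2norm_cong[OF O.ae_eq_sym[OF O.wder_Nil[OF L]] L] .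
 also have "... <= pw_sob_norm \<T> (real 0) (v - Q v)"
  by (rule cells_root[OF d_Hk[OF v]]) (use bdom.Hk_mono[OF bdom_T d_cell(1)[OF v]] in auto)
 also have "... <= C1 * h powr (2 - 0) * N v" using smoother_pw[OF v, of 0] by simp
 also have "h powr (2 - 0) = h^2" using mesh_size_pos by (simp add: powr_numeral)
 finally show ?thesis .
qed

lemma sm1: assumes v: "v \<in> V" shows "l2norm Z (wder Z [i] (v - Q v)) <= C1 * h * N v"
proof -
 have "l2norm Z (wder Z [i] (v - Q v)) <= pw_sob_norm \<T> (real 1) (v - Q v)"
  by (rule cells_root[OF d_Hk[OF v]]) (use bdom.Hk_mono[OF bdom_T d_cell(1)[OF v]] in auto)
 also have "... <= C1 * h powr (2 - 1) * N v" using smoother_pw[OF v, of 1] by simp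
 also have "h powr (2 - 1) = h" using mesh_size_pos by simp
 finally show ?thesis .
qed

lemma sm1g: assumes v: "v \<in> V" shows "grad_norm Z (v - Q v) <= 2 * C1 * h * N v"
 using O.grad_norm_le_sum[of "v - Q v"] sm1[OF v, of 1] sm1[OF v, of 2] by simp

text \<open>On each triangle Q v = v - (v - Q v). The second derivatives of \<open>v\<close> belong
  to the broken norm, and for s = 2 the smoothing bound contains no power of the mesh size.\<close>

lemma sm2: assumes v: "v \<in> V" shows "l2norm Z (wder Z [i, j] (Q v)) <= 2 * (1 + C1) * N v"
proof (rule power2_le_imp_le)
 let ?d = "v - Q v" and ?l = "%K f. l2norm (interior K) (wder (interior K) [i, j] f)"
 have each: "(?l K (Q v))^2 <= 2 * (?l K v)^2 + 2 * (?l K ?d)^2" if K: "K \<in> \<T>" for K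
 proof -
  interpret bdom "interior K" by (rule bdom_T[OF K])
  have e: "Q v = lc 1 v (-1) ?d" by (rule ext) (simp add: lc_def)
  have H: "v \<in> Hk (interior K) 2" "?d \<in> Hk (interior K) 2" using d_cell[OF v K] by auto
  have L: "wder (interior K) [i, j] v \<in> L2 (interior K)" "wder (interior K) [i, j] ?d \<in> L2 (interior K)" using wder_L2[OF H(1)] wder_L2[OF H(2)] by auto
  have "ae_eq (interior K) (wder (interior K) [i, j] (lc 1 v (-1) ?d)) (lc 1 (wder (interior K) [i, j] v) (-1) (wder (interior K) [i, j] ?d))"
   using wder_lc[OF H] by simp
  hence "?l K (Q v) = l2norm (interior K) (lc 1 (wder (interior K) [i, j] v) (-1) (wder (interior K) [i, j] ?d))"
   unfolding e[symmetric] using l2norm_cong[OF ae_eq_sym L2_lc[OF L]] by metis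
  also have "... <= \<bar>1\<bar> * ?l K v + \<bar>-1\<bar> * ?l K ?d" by (rule l2norm_lc[OF L])
  finally have "?l K (Q v) <= ?l K v + ?l K ?d" by simp
  hence "(?l K (Q v))^2 <= (?l K v + ?l K ?d)^2" by (rule power_mono) simp
  also have "... <= 2 * (?l K v)^2 + 2 * (?l K ?d)^2"
  proof -
   have "(x + y)^2 <= 2 * x^2 + 2 * y^2" for x y :: real using zero_le_power2[of "x - y"] by (simp add: power2_sum power2_diff)
   thus ?thesis .
  qed
  finally show ?thesis .
 qed
 have h1: "(\<Sum>K\<in>\<T>. (?l K v)^2) <= (N v)^2"
 proof -
  have "(\<Sum>K\<in>\<T>. (?l K v)^2) <= pw_hess_ip \<T> v v" unfolding pw_hess_ip_def
  proof (rule sum_mono)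
   fix K assume K: "K \<in> \<T>"
   interpret bdom "interior K" by (rule bdom_T[OF K])
   have "hess_ip (interior K) v v = (\<Sum>ij\<in>UNIV \<times> UNIV. (l2norm (interior K) (wder (interior K) [fst ij, snd ij] v))^2)"
    unfolding hess_ip_def sum.cartesian_product l2norm_sq by (simp add: case_prod_beta)
   moreover have "(l2norm (interior K) (wder (interior K) [fst (i, j), snd (i, j)] v))^2 <= (\<Sum>ij\<in>UNIV \<times> UNIV. (l2norm (interior K) (wder (interior K) [fst ij, snd ij] v))^2)"
    by (rule member_le_sum) auto
   ultimately show "(?l K v)^2 <= hess_ip (interior K) v v" by simp
  qed
  also have "... <= (N v)^2" using h_norm_sq[OF s_pos] penalty_nonneg[OF s_pos] by simp
  finally show ?thesis .
 qed
 have "pw_sob_norm \<T> (real 2) ?d <= C1 * h powr (2 - 2) * N v" using smoother_pw[OF v, of 2] by simp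
 also have "... = C1 * N v" using mesh_size_pos by simp
 finally have "(pw_sob_norm \<T> (real 2) ?d)^2 <= (C1 * N v)^2" by (rule power_mono) (simp add: pw_sob_norm_def sum_nonneg)
 hence h2: "(\<Sum>K\<in>\<T>. (?l K ?d)^2) <= (C1 * N v)^2"
  using cells_le_pw_sob[OF d_cell(1)[OF v], of "[i, j]"] by simp
 have "(l2norm Z (wder Z [i, j] (Q v)))^2 = (\<Sum>K\<in>\<T>. (?l K (Q v))^2)" by (rule wder_cells[OF Q_Hk]) simp
 also have "... <= (\<Sum>K\<in>\<T>. 2 * (?l K v)^2 + 2 * (?l K ?d)^2)" by (rule sum_mono) (rule each)
 also have "... = 2 * (\<Sum>K\<in>\<T>. (?l K v)^2) + 2 * (\<Sum>K\<in>\<T>. (?l K ?d)^2)" by (simp add: sum.distrib sum_distrib_left)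
 also have "... <= 2 * (N v)^2 + 2 * (C1 * N v)^2" using h1 h2 by linarith
 also have "... <= (2 * (1 + C1) * N v)^2"
 proof -
  have "2 * x^2 + 2 * (c * x)^2 <= (2 * (1 + c) * x)^2" if "0 < c" for c x :: real
  proof -
   have "(2 * (1 + c) * x)^2 - (2 * x^2 + 2 * (c * x)^2) = (2 + 8 * c + 2 * c^2) * x^2" by (simp add: power2_eq_square algebra_simps)
   moreover have "0 <= (2 + 8 * c + 2 * c^2) * x^2" using that by (intro mult_nonneg_nonneg) auto
   ultimately show ?thesis by linarith
  qed
  thus ?thesis using C1 by blast
 qed
 finally show "(l2norm Z (wder Z [i, j] (Q v)))^2 <= (2 * (1 + C1) * N v)^2" .
 show "0 <= 2 * (1 + C1) * N v" using C1 N_nonneg by simp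
qed

text \<open>A Poincare inequality for the broken norm. \<open>v\<close> itself is only in H^1_0, but
  Q v is in H^2_0, where the Poincare inequality can be used twice; in v - Q v the powers of the
  mesh size are bounded by powers of 2 Rd. In both estimates 12 is the sum of 4 and 8 from these two
  parts.\<close>

lemma V_le_N: assumes v: "v \<in> V" shows "l2norm Z v <= 12 * Rd^2 * (1 + C1) * N v" "grad_norm Z v <= 12 * Rd^2 * (1 + C1) * N v"
proof -
 let ?m = "(1 + C1) * N v"
 have m: "0 <= ?m" "C1 * N v <= ?m" using C1 N_nonneg[of v] by (auto intro: mult_right_mono)
 have h: "0 < h" "h <= 2 * Rd" using mesh_size_pos mesh_size_le[OF Rd(2)] by auto
 have q2: "Q v \<in> Hs0 Z (real 2)" using Q_Hs0 by simp
 have q1: "l2norm Z (wder Z [i] (Q v)) <= 4 * Rd * ?m" for i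
 proof -
  have "l2norm Z (wder Z [i] (Q v)) <= 2 * Rd * l2norm Z (wder Z ([i] @ [i]) (Q v))" by (rule O.Poincare[OF Rd(2) q2]) simp_all
  also have "... <= 2 * Rd * (2 * (1 + C1) * N v)" using Rd(1) sm2[OF v, of i i] by (intro mult_left_mono) auto
  also have "... = 4 * Rd * ?m" by (simp add: algebra_simps)
  finally show ?thesis .
 qed
 have L: "Q v \<in> L2 Z" by (rule O.Hk_L2[OF Q_Hk])
 have "l2norm Z (Q v) = l2norm Z (wder Z [] (Q v))" by (rule O.l2norm_cong[OF O.ae_eq_sym[OF O.wder_Nil[OF L]] L])
 also have "... <= 2 * Rd * l2norm Z (wder Z ([] @ [1]) (Q v))" by (rule O.Poincare[OF Rd(2) q2]) simp_all
 also have "... <= 2 * Rd * (4 * Rd * ?m)" using Rd(1) q1[of 1] by (intro mult_left_mono) auto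
 also have "... = 8 * Rd^2 * ?m" by (simp add: power2_eq_square)
 finally have q0: "l2norm Z (Q v) <= 8 * Rd^2 * ?m" .
 have d0: "l2norm Z (v - Q v) <= 4 * Rd^2 * ?m"
 proof -
  have "C1 * h^2 * N v = h^2 * (C1 * N v)" by simp
  also have "... <= (2 * Rd)^2 * ?m" using h m C1 N_nonneg[of v] by (intro mult_mono power_mono) auto
  also have "... = 4 * Rd^2 * ?m" by (simp add: power_mult_distrib)
  finally show ?thesis using sm0[OF v] by linarith
 qed
 have d1: "l2norm Z (wder Z [i] (v - Q v)) <= 2 * Rd * ?m" for i
 proof -
  have "C1 * h * N v = h * (C1 * N v)" by simp
  also have "... <= (2 * Rd) * ?m" using h m C1 N_nonneg[of v] by (intro mult_mono) auto
  finally show ?thesis using sm1[OF v, of i] by linarith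
 qed
 have e: "v = lc 1 (v - Q v) 1 (Q v)" by (rule ext) (simp add: lc_def)
 have "l2norm Z (lc 1 (v - Q v) 1 (Q v)) <= \<bar>1\<bar> * l2norm Z (v - Q v) + \<bar>1\<bar> * l2norm Z (Q v)"
  by (rule O.l2norm_lc[OF O.Hk_L2[OF d_Hk[OF v]] O.Hk_L2[OF Q_Hk]])
 hence "l2norm Z v <= l2norm Z (v - Q v) + l2norm Z (Q v)" unfolding e[symmetric] by simp
 hence "l2norm Z v <= 4 * Rd^2 * ?m + 8 * Rd^2 * ?m" using d0 q0 by linarith
 also have "... = 12 * Rd^2 * (1 + C1) * N v" by (simp add: algebra_simps)
 finally show "l2norm Z v <= 12 * Rd^2 * (1 + C1) * N v" .
 have "grad_norm Z (lc 1 (v - Q v) 1 (Q v)) <= \<bar>1\<bar> * grad_norm Z (v - Q v) + \<bar>1\<bar> * grad_norm Z (Q v)"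
  by (rule O.grad_norm_lc[OF d_Hk[OF v] O.Hk_mono[OF Q_Hk]]) simp
 hence "grad_norm Z v <= grad_norm Z (v - Q v) + grad_norm Z (Q v)" unfolding e[symmetric] by simp
 hence "grad_norm Z v <= (2 * Rd * ?m + 2 * Rd * ?m) + (4 * Rd * ?m + 4 * Rd * ?m)"
  using O.grad_norm_le_sum[of "v - Q v"] O.grad_norm_le_sum[of "Q v"] d1[of 1] d1[of 2] q1[of 1] q1[of 2] by linarith
 also have "... = 12 * (Rd * ?m)" by (simp add: algebra_simps)
 also have "... <= 12 * (Rd^2 * ?m)" using Rd(1) m(1) by (intro mult_left_mono mult_right_mono) (auto simp: power2_eq_square)
 also have "... = 12 * Rd^2 * (1 + C1) * N v" by simp
 finally show "grad_norm Z v <= 12 * Rd^2 * (1 + C1) * N v" .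
qed

text \<open>By coercivity zero energy forces a zero broken norm. This identifies discrete functions
  that are known only through their defining equations.\<close>

lemma V_kernel: assumes v: "v \<in> V" and z: "a v v = 0" shows "l2norm Z v = 0" "grad_norm Z v = 0"
proof -
 have "CCoer * (N v)^2 <= CCoer * 0" using coercive[OF v] z by simp
 hence "(N v)^2 <= 0" using CCoer by (simp only: mult_le_cancel_left_pos)
 hence "N v = 0" by simp
 thus "l2norm Z v = 0" "grad_norm Z v = 0" using V_le_N[OF v] O.l2norm_nonneg[of v] O.grad_norm_nonneg[of v] by auto
qed

end

section \<open>The residual functional\<close>

text \<open>A strict violation at one time would persist on an interval, which has positive
  measure.\<close>

lemma AE_bound_everywhere:
 fixes g :: "real => real"
 assumes ae: "AE t in lebesgue_on {0<..<T}. \<bar>g t\<bar> <= B" and c: "continuous_on {0..T} g" and T: "0 < T" and t: "t \<in> {0..T}"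
 shows "\<bar>g t\<bar> <= B"
proof (rule ccontr)
 assume "\<not> \<bar>g t\<bar> <= B"
 hence e: "0 < \<bar>g t\<bar> - B" by simp
 obtain r where r: "0 < r" "!!s. s \<in> {0..T} ==> dist s t < r ==> dist (g s) (g t) < \<bar>g t\<bar> - B"
  using c t e unfolding continuous_on_iff by blast
 have "max 0 (t - r) < min T (t + r)" using r(1) t T by auto
 from AE_interval_dense[OF ae _ this] obtain s where s: "max 0 (t - r) < s" "s < min T (t + r)" "\<bar>g s\<bar> <= B" by auto
 hence "dist (g s) (g t) < \<bar>g t\<bar> - B" by (intro r(2)) (auto simp: dist_real_def)
 thus False using s(3) by (simp add: dist_real_def)
qed

text \<open>The functional F with its Laplacians integrated by parts, which gives it a meaning for
  every \<open>v\<close> in H^1_0 when the other arguments are in H^1.\<close>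

definition residual ::
 "pt set => coeffs => scalar_field => scalar_field => scalar_field => scalar_field => scalar_field => real" where
 "residual U c f w th p v = ip U f v - ip U w v - a\<^sub>0 c * grad_ip U w v + alpha c * grad_ip U th v + beta c * grad_ip U p v"

context bdom
begin

lemma residual_lc:
 assumes "f \<in> L2 U" "w \<in> Hk U 1" "th \<in> Hk U 1" "p \<in> Hk U 1" "v \<in> Hk U 1" "z \<in> Hk U 1"
 shows "residual U c f w th p (lc a v b z) = a * residual U c f w th p v + b * residual U c f w th p z"
 unfolding residual_def using assms Hk_L2[of _ 1] by (simp add: ip_lc_right grad_ip_lc_right algebra_simps)

lemma hess_ip_test:
 assumes v: "v \<in> Hk U 2" and ta: "ta \<in> test_fun U"
 shows "hess_ip U v ta = (\<Sum>i\<in>UNIV. \<Sum>j\<in>UNIV. ip U v (pds [i, j] (pds [j, i] ta)))"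
proof -
 have "ip U (wU [i, j] v) (wU [i, j] ta) = ip U v (pds [i, j] (pds [j, i] ta))" for i j
 proof -
  have w: "weak_deriv U [i, j] v (wU [i, j] v)" by (rule Hk_wder[OF v]) simp
  have L: "wU [i, j] v \<in> L2 U" "pds [j, i] ta \<in> L2 U" using w test_L2[OF ta, of "[j, i]"] by (auto simp: weak_deriv_def)
  have e: "ae_eq U (wU [i, j] ta) (pds [j, i] ta)" using wder_smooth[OF test_fun_smooth[OF ta], of "[i, j]"] by simp
  have "ip U (wU [i, j] v) (wU [i, j] ta) = ip U (wU [i, j] v) (pds [j, i] ta)"
   by (rule ip_cong[OF ae_eq_refl e L(1) L2_cong[OF L(2) ae_eq_sym[OF e]] L])
  also have "... = ip U v (pds [i, j] (pds [j, i] ta))"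
   using w test_fun_pds[OF ta, of "[j, i]"] unfolding weak_deriv_def by fastforce
  finally show ?thesis .
 qed
 thus ?thesis by (simp only: hess_ip_def)
qed

text \<open>The bound on F is given for almost every time but used at the times 0 and dt. On a test
  function the weak equation expresses the residual by products of u(t) with fourth derivatives of
  the test function, which are continuous in time; density extends the bound to H^1_0.\<close>

lemma residual_bound:
 assumes ws: "weak_solution U T c f phi g u0 us0 th0 p0 u ut utt th tht p pt" and Fb: "F_bound U T c f utt th p CF"
  and fL: "!!t. t \<in> {0..T} ==> f t \<in> L2 U" and T: "0 < T" and t: "t \<in> {0..T}" and v: "v \<in> Hs0 U 1"
 shows "\<bar>residual U c (f t) (utt t) (th t) (p t) v\<bar> <= \<bar>CF\<bar> * nU v"
proof -
 let ?r = "%t v. residual U c (f t) (utt t) (th t) (p t) v"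
 have H: "u t \<in> Hs0 U 2" "utt t \<in> Hs0 U 1" "th t \<in> Hs0 U 1" "p t \<in> Hs0 U 1" "has_time_deriv U T u t (ut t)" if "t \<in> {0..T}" for t
  using ws that unfolding weak_solution_def by blast+
 have weak: "ip U (utt t) v + a\<^sub>0 c * grad_ip U (utt t) v + d\<^sub>0 c * hess_ip U (u t) v - alpha c * grad_ip U (th t) v - beta c * grad_ip U (p t) v = ip U (f t) v"
  if "t \<in> {0..T}" "v \<in> Hs0 U 2" for t v using ws that unfolding weak_solution_def by blast
 have H1: "x \<in> Hk U 1" if "x \<in> Hs0 U 1" for x using Hs0_Hk[of x 1] that by simp
 have H2: "x \<in> Hk U 2" if "x \<in> Hs0 U 2" for x using Hs0_Hk[of x 2] that by simp
 have tst: "\<bar>?r t ta\<bar> <= \<bar>CF\<bar> * nU ta" if ta: "ta \<in> test_fun U" for ta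
 proof (rule AE_bound_everywhere[OF _ _ T t])
  have ta2: "ta \<in> Hs0 U 2" using test_Hs0[OF ta, of 2] by simp
  have tL: "ta \<in> L2 U" using test_L2[OF ta, of "[]"] by simp
  let ?z = "%i j. pds [i, j] (pds [j, i] ta)"
  have zL: "?z i j \<in> L2 U" for i j by (rule test_L2[OF test_fun_pds[OF ta]])
  have eq: "?r s ta = d\<^sub>0 c * (\<Sum>i\<in>UNIV. \<Sum>j\<in>UNIV. ip U (u s) (?z i j))" if "s \<in> {0..T}" for s
   using weak[OF that ta2] hess_ip_test[OF H2[OF H(1)[OF that]] ta] by (simp add: residual_def)
  have ci: "continuous_on {0..T} (%s. ip U (u s) z)" if "z \<in> L2 U" for z
  proof (rule DERIV_continuous_on)
   fix s assume s: "s \<in> {0..T}"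
   show "((%s. ip U (u s) z) has_real_derivative ip U (ut s) z) (at s within {0..T})" by (rule has_time_deriv_ip[OF H(5)[OF s] s that])
  qed
  have "continuous_on {0..T} (%s. d\<^sub>0 c * (\<Sum>i\<in>UNIV. \<Sum>j\<in>UNIV. ip U (u s) (?z i j)))"
   by (intro continuous_on_mult continuous_on_const continuous_on_sum ci zL)
  thus "continuous_on {0..T} (%s. ?r s ta)" by (rule continuous_on_eq) (use eq in simp)
  have "AE s in lebesgue_on {0<..<T}. \<exists>F\<in>L2 U. nU F <= CF \<and> (\<forall>ta\<in>test_fun U. ip U F ta =
      ip U (f s) ta - ip U (utt s) ta + a\<^sub>0 c * ip U (utt s) (lap ta) - alpha c * ip U (th s) (lap ta) - beta c * ip U (p s) (lap ta))"
   using Fb unfolding F_bound_def .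
  moreover have "AE s in lebesgue_on {0<..<T}. s \<in> {0..T}" by (rule AE_I2) simp
  ultimately show "AE s in lebesgue_on {0<..<T}. \<bar>?r s ta\<bar> <= \<bar>CF\<bar> * nU ta"
  proof eventually_elim
   case (elim s)
   then obtain F where F: "F \<in> L2 U" "nU F <= CF" "ip U F ta =
      ip U (f s) ta - ip U (utt s) ta + a\<^sub>0 c * ip U (utt s) (lap ta) - alpha c * ip U (th s) (lap ta) - beta c * ip U (p s) (lap ta)" using ta by blast
   have "?r s ta = ip U F ta" unfolding residual_def F(3)
    using grad_ip_test[OF H1[OF H(2)[OF elim(2)]] ta] grad_ip_test[OF H1[OF H(3)[OF elim(2)]] ta] grad_ip_test[OF H1[OF H(4)[OF elim(2)]] ta] by simp
   hence "\<bar>?r s ta\<bar> <= nU F * nU ta" using Cauchy_Schwarz[OF F(1) tL] by simp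
   also have "... <= \<bar>CF\<bar> * nU ta" using F(2) by (intro mult_right_mono) auto
   finally show ?case .
  qed
 qed
 obtain ta where ta: "!!n::nat. ta n \<in> test_fun U" "(%n. nU (v - ta n)) ----> 0" "(%n. grad_norm U (v - ta n)) ----> 0" using Hs0_1_seq[OF v] by metis
 have v1: "v \<in> Hk U 1" and ta1: "ta n \<in> Hk U 1" for n using H1[OF v] test_Hk[OF ta(1)] by auto
 have vL: "v \<in> L2 U" and taL: "ta n \<in> L2 U" for n using Hk_L2[OF v1] Hk_L2[OF ta1] by auto
 have ti: "(%n. ip U x (ta n)) ----> ip U x v" if "x \<in> L2 U" for x
  using ip_tendsto[OF vL taL that ta(2)] by (simp add: ip_commute[of x])
 have tg: "(%n. grad_ip U x (ta n)) ----> grad_ip U x v" if "x \<in> Hs0 U 1" for x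
  by (rule grad_ip_tendsto[OF v1 ta1 H1[OF that] ta(3)])
 have "(%n. ?r t (ta n)) ----> ?r t v" unfolding residual_def
  by (intro tendsto_add tendsto_diff tendsto_mult_left ti tg fL[OF t] H(2-4)[OF t] Hk_L2[OF H1[OF H(2)[OF t]]])
 hence "(%n. \<bar>?r t (ta n)\<bar>) ----> \<bar>?r t v\<bar>" by (rule tendsto_rabs)
 moreover have "(%n. \<bar>CF\<bar> * nU (ta n)) ----> \<bar>CF\<bar> * nU v" by (intro tendsto_mult_left l2norm_tendsto[OF vL taL ta(2)])
 ultimately show ?thesis by (rule LIMSEQ_le) (use tst[OF ta(1)] in blast)
qed

lemma sob_norm_leI:
 assumes "sqU s v <= ennreal (2 * M)" "0 <= M" shows "v \<in> Hs U s" "sob_norm U s v <= 2 * sqrt M"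
proof -
 show "v \<in> Hs U s" using assms(1) le_less_trans[OF _ ennreal_less_top] by (auto simp: Hs_def)
 \<comment> \<open>2 M is enlarged to 4 M for the sake of the square root 2 sqrt M.\<close>
 have "enn2real (sqU s v) <= 4 * M" using order_trans[OF assms(1), of "ennreal (4 * M)"] assms(2) by (intro enn2real_leI) auto
 from real_sqrt_le_mono[OF this] show "sob_norm U s v <= 2 * sqrt M" unfolding sob_norm_def by (simp add: real_sqrt_mult)
qed

end

section \<open>The energy estimate\<close>

text \<open>The real numbers with names \<open>E\<close>, \<open>a\<close>, \<open>k\<close>, \<open>F\<close> and a suffix stand for the linear functionals of the first equation
 of the scheme, applied to the various functions.\<close>

lemma combine_u:
 fixes r s :: real
 assumes "r * EU + d0 * aU - al * kT - be * kP = mf" "EU = ER - ED" "aU = aR - aZ" "kT = kPT - kPsi" "kP = kPP - kXi"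
  "d0 * aR = (F0q + F1q) / 2" "F0q = F0v - F0d" "F1q = F1v - F1d" "(F0v + F1v) / 2 = mf - Eu + al * kth + be * kp"
  "kth = kPT + kWT" "kp = kPP + kWP" "EW = ER - s * Eu" "r * s = 1"
 shows "r * ED + d0 * aZ - al * kPsi - be * kXi = r * EW + al * kWT + be * kWP - (F0d + F1d) / 2"
proof -
 have "r * EW = r * ER - Eu" using assms(12,13) by (simp add: right_diff_distrib mult.assoc[symmetric])
 moreover have "r * EU = r * ER - r * ED" using assms(2) by (simp add: right_diff_distrib)
 moreover have "d0 * aU = (F0q + F1q) / 2 - d0 * aZ" using assms(3,6) by (simp add: right_diff_distrib)
 moreover have "al * kT = al * kPT - al * kPsi" "be * kP = be * kPP - be * kXi" using assms(4,5) by (simp_all add: right_diff_distrib)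
 moreover have "al * kth = al * kPT + al * kWT" "be * kp = be * kPP + be * kWP" using assms(10,11) by (simp_all add: distrib_left)
 moreover have "(F0q + F1q) / 2 = (F0v + F1v) / 2 - (F0d + F1d) / 2" using assms(7,8) by (simp add: field_simps)
 ultimately show ?thesis using assms(1,9) by linarith
qed

text \<open>Names with \<open>m\<close> and \<open>k\<close> stand for L^2 and gradient products
  with the average error, \<open>s\<close> for the time step. Since the initial error is null,
  \<open>s\<close> times the difference quotient of an error is twice its average; this produces the
  squares on the left.\<close>

lemma combine_theta:
 fixes s :: real
 assumes "A * mDT - G * mDP + B * mT + C * kT + al * kU = mphi" "A * mtt - G * mtp + B * mth + C * kth + al * kut = mphi"
  "mDT = mDPT - mDPsi" "mDP = mDPP - mDXi" "mT = mPT - mPsi" "kT = kPT - kPsi" "kU = kR - kD" "kPT = kth"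
  "s * mDPsi = 2 * mPsi" "s * mDXi = 2 * mXi"
 shows "2 * A * mPsi - 2 * G * mXi + s * (B * mPsi + C * kPsi) + s * al * kD =
  A * (s * (mDPT - mtt)) - G * (s * (mDPP - mtp)) + s * B * (mPT - mth) + s * al * (kR - kut)"
proof -
 have "s * (A * (mDPT - mDPsi) - G * (mDPP - mDXi) + B * (mPT - mPsi) + C * (kPT - kPsi) + al * (kR - kD))
  = s * (A * mtt - G * mtp + B * mth + C * kth + al * kut)" using assms(1-7) by simp
 moreover have "A * (s * mDPsi) = A * (2 * mPsi)" "G * (s * mDXi) = G * (2 * mXi)" using assms(9,10) by simp_all
 moreover have "s * (A * (mDPT - mDPsi) - G * (mDPP - mDXi) + B * (mPT - mPsi) + C * (kPT - kPsi) + al * (kR - kD))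
  = A * (s * mDPT) - A * (s * mDPsi) - G * (s * mDPP) + G * (s * mDXi) + s * B * mPT - s * B * mPsi + s * C * kPT - s * C * kPsi + s * al * kR - s * al * kD"
  by (simp add: algebra_simps)
 moreover have "s * (A * mtt - G * mtp + B * mth + C * kth + al * kut) = A * (s * mtt) - G * (s * mtp) + s * B * mth + s * C * kPT + s * al * kut"
  unfolding assms(8) by (simp add: algebra_simps)
 moreover have "2 * A * mPsi - 2 * G * mXi + s * (B * mPsi + C * kPsi) + s * al * kD = A * (2 * mPsi) - G * (2 * mXi) + s * B * mPsi + s * C * kPsi + s * al * kD"
  by (simp add: algebra_simps)
 moreover have "A * (s * (mDPT - mtt)) - G * (s * (mDPP - mtp)) + s * B * (mPT - mth) + s * al * (kR - kut)
  = A * (s * mDPT) - A * (s * mtt) - G * (s * mDPP) + G * (s * mtp) + s * B * mPT - s * B * mth + s * al * kR - s * al * kut"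
  by (simp add: algebra_simps)
 ultimately show ?thesis by linarith
qed

text \<open>Each square is a variable here, so that the absorption is a matter of linear
  arithmetic.\<close>

lemma absorb_linear:
 fixes x y q p s b e :: real
 assumes "2 * x + 2 * y + q / 2 + 2 * p + 2 * s + (b + e) <= xD + yD + nD + pD + sD + gD"
  "xD <= x + wx" "yD <= y + wy" "nD <= q / 4 + wn" "pD <= p + wp" "sD <= s + ws" "gD <= e / 2 + wg" "wg <= wt"
  "z <= q / 4" "0 <= b" "0 <= z" "0 <= x" "0 <= y" "0 <= p" "0 <= s"
 shows "x + y + z + p + s + (b + e) <= 2 * (wx + wy + wn + wp + ws + wt)"
proof -
 have "xD + yD + nD + pD + sD + gD <= (x + wx) + (y + wy) + (q / 4 + wn) + (p + wp) + (s + ws) + (e / 2 + wt)"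
  using assms(8) by (intro add_mono assms(2-6) order_trans[OF assms(7)]) simp_all
 with assms(1) have "2 * x + 2 * y + q / 2 + 2 * p + 2 * s + (b + e) <= (x + wx) + (y + wy) + (q / 4 + wn) + (p + wp) + (s + ws) + (e / 2 + wt)"
  by (rule order_trans)
 hence "x + y + q / 4 + p + s + b + e / 2 <= wx + wy + wn + wp + ws + wt" by simp
 hence "2 * (x + y + q / 4 + p + s + b + e / 2) <= 2 * (wx + wy + wn + wp + ws + wt)" by simp
 moreover have "x + y + z + p + s + (b + e) <= 2 * (x + y + q / 4 + p + s + b + e / 2)"
  using assms(9-15) by simp
 ultimately show ?thesis by (rule order_trans[rotated])
qed

lemma young:
 fixes x B m :: real
 assumes "0 < m" shows "x * B <= m * x^2 + B^2 / (4 * m)"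
proof -
 have "m * x^2 + B^2 / (4 * m) - x * B = (2 * m * x - B)^2 / (4 * m)"
  using assms by (simp add: power2_eq_square field_simps)
 moreover have "0 <= (2 * m * x - B)^2 / (4 * m)" using assms by simp
 ultimately show ?thesis by linarith
qed

text \<open>Of the two copies of each square on the left, Young's inequality uses up one. Half of
  the energy term pays for the broken norm of the increment, and the other half bounds that of the
  average. The gradients carry the factor of the time step on both sides, so there is no division by
  it.\<close>

lemma absorb:
 fixes X Y P S NN GP GS :: real
 assumes pos: "0 < a0" "0 < d0" "0 < CC" "0 < A1" "0 < A2" "0 < b1" "0 < c1" "0 < k" "0 <= \<delta>" "\<delta> <= T"
  and NA: "CC * NN^2 <= A" "CC * NZ^2 <= A / 4"
  and main: "2 * X^2 + 2 * a0 * Y^2 + d0 * A / 2 + 2 * A1 * P^2 + 2 * A2 * S^2 + \<delta> * (b1 * P^2 + c1 * GP^2 + k * GS^2)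
   <= D * (X + Y + NN + P + S) + \<delta> * (D * (GP + GS))"
 shows "X^2 + a0 * Y^2 + d0 * CC * NZ^2 + A1 * P^2 + A2 * S^2 + \<delta> * (b1 * P^2 + c1 * GP^2 + k * GS^2)
  <= 2 * (1 / 4 + 1 / (4 * a0) + 1 / (d0 * CC) + 1 / (4 * A1) + 1 / (4 * A2) + T * (1 / (2 * c1) + 1 / (2 * k))) * D^2"
proof -
 have 1: "X * D <= X^2 + D^2 / (4 * 1)" using young[of 1 X D] by simp
 have 2: "Y * D <= a0 * Y^2 + D^2 / (4 * a0)" by (rule young[OF pos(1)])
 have "NN * D <= (d0 * CC / 4) * NN^2 + D^2 / (4 * (d0 * CC / 4))" using pos by (intro young) auto
 moreover have "(d0 * CC / 4) * NN^2 <= d0 * A / 4" using mult_left_mono[OF NA(1), of "d0 / 4"] pos by simp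
 ultimately have 3: "NN * D <= d0 * A / 4 + D^2 / (d0 * CC)" by simp
 have 4: "P * D <= A1 * P^2 + D^2 / (4 * A1)" by (rule young[OF pos(4)])
 have 5: "S * D <= A2 * S^2 + D^2 / (4 * A2)" by (rule young[OF pos(5)])
 have "GP * D <= (c1 / 2) * GP^2 + D^2 / (4 * (c1 / 2))" "GS * D <= (k / 2) * GS^2 + D^2 / (4 * (k / 2))" using pos by (intro young; simp)+
 hence "D * (GP + GS) <= (c1 * GP^2 + k * GS^2) / 2 + (1 / (2 * c1) + 1 / (2 * k)) * D^2" by (simp add: algebra_simps add_divide_distrib)
 from mult_left_mono[OF this pos(9)]
 have 6: "\<delta> * (D * (GP + GS)) <= \<delta> * (c1 * GP^2 + k * GS^2) / 2 + \<delta> * ((1 / (2 * c1) + 1 / (2 * k)) * D^2)" by (simp add: distrib_left)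
 have 7: "\<delta> * ((1 / (2 * c1) + 1 / (2 * k)) * D^2) <= T * ((1 / (2 * c1) + 1 / (2 * k)) * D^2)" using pos by (intro mult_right_mono) auto
 have 8: "d0 * CC * NZ^2 <= d0 * A / 4" using mult_left_mono[OF NA(2), of d0] pos by simp
 have 9: "0 <= \<delta> * (b1 * P^2)" "0 <= d0 * CC * NZ^2" "0 <= X^2" "0 <= a0 * Y^2" "0 <= A1 * P^2" "0 <= A2 * S^2" using pos by simp_all
 have 10: "\<delta> * (b1 * P^2 + c1 * GP^2 + k * GS^2) = \<delta> * (b1 * P^2) + \<delta> * (c1 * GP^2 + k * GS^2)" by (simp add: algebra_simps)
 have 11: "D * (X + Y + NN + P + S) = X * D + Y * D + NN * D + P * D + S * D" by (simp add: algebra_simps)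
 define W where "W = (1 / 4 + 1 / (4 * a0) + 1 / (d0 * CC) + 1 / (4 * A1) + 1 / (4 * A2) + T * (1 / (2 * c1) + 1 / (2 * k))) * D^2"
 have W: "W = D^2 / (4 * 1) + D^2 / (4 * a0) + D^2 / (d0 * CC) + D^2 / (4 * A1) + D^2 / (4 * A2) + T * ((1 / (2 * c1) + 1 / (2 * k)) * D^2)"
  unfolding W_def by (simp add: distrib_right)
 have "X^2 + a0 * Y^2 + d0 * CC * NZ^2 + A1 * P^2 + A2 * S^2 + \<delta> * (b1 * P^2 + c1 * GP^2 + k * GS^2) <= 2 * W"
  unfolding 10 W
 proof (rule absorb_linear[OF _ 1 2 3 4 5 6 7 8 9])
  show "2 * X^2 + 2 * (a0 * Y^2) + d0 * A / 2 + 2 * (A1 * P^2) + 2 * (A2 * S^2) + (\<delta> * (b1 * P^2) + \<delta> * (c1 * GP^2 + k * GS^2))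
   <= X * D + Y * D + NN * D + P * D + S * D + \<delta> * (D * (GP + GS))"
   using main unfolding 10 11 by (simp only: mult.assoc)
 qed
 thus ?thesis unfolding W_def by (simp only: mult.assoc)
qed

text \<open>\<open>al\<close> and \<open>be\<close> are the coupling terms: the first estimate
  contains them with a minus sign and the other two with a plus sign. \<open>g1\<close> is the mixed
  term, which occurs once in each of the parabolic estimates.\<close>

lemma add_estimates:
 fixes q al be t s tt ss :: real
 assumes "q - al - be <= u1 + u2" "t - g1 + tt + al <= u3 + u5" "s - g1 + ss + be <= u4 + u6" "t' + s' <= t + s - g2" "g2 = 2 * g1"
  "u1 <= v1" "u2 <= v2" "u3 <= v3" "u4 <= v4" "u5 <= v5" "u6 <= v6"
 shows "q + t' + s' + (tt + ss) <= v1 + v2 + v3 + v4 + (v5 + v6)"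
 using assms by linarith

lemma add_bounds:
 fixes L x :: real
 assumes "L + x = p - q + r + s" "x = x'" "p <= p'" "- q <= q'" "r <= r'" "s <= s'"
 shows "L + x' <= p' + q' + r' + s'"
 using assms by linarith

text \<open>The sum of the constants that Young's inequality leaves in
  \<open>absorb\<close>.\<close>

definition energy_const :: "coeffs => real => real => real => real" where
 "energy_const c \<gamma>0 CCoer T = 2 * (1 / 4 + 1 / (4 * a\<^sub>0 c) + 1 / (d\<^sub>0 c * CCoer) + 1 / (4 * (a\<^sub>1 c - \<bar>gam c\<bar> / \<gamma>0)) + 1 / (4 * (a\<^sub>2 c - \<bar>gam c\<bar> * \<gamma>0))
   + T * (1 / (2 * c\<^sub>1 c) + 1 / (2 * kappa c)))"

text \<open>The summands belong, in this order, to the starting formula, to the projection errors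
  and the residual tested with the increment, to the increments of theta and p in time, to the
  zero-order term and to the coupling terms with u_t.\<close>

definition data_const :: "coeffs => real => real => real => real => real => real => real" where
 "data_const c CF C1 C2 C3 R T = 2 * (1 + a\<^sub>0 c) * (2 * C2 + 1)
  + ((alpha c + beta c) * ((4 * R * C1 + 4 * (1 + C1)) * (2 * C3)) + \<bar>CF\<bar> * C1 * (4 * R^2))
  + (a\<^sub>1 c + a\<^sub>2 c + \<bar>gam c\<bar>) * (4 * C3 + sqrt T) + T * b\<^sub>1 c * (2 * C3) + (alpha c + beta c) * (2 * C2 + 1)"

text \<open>\<open>Lr\<close> and \<open>Mr\<close> stand in for the regularity constants. These are
  extended reals and infima, so real numbers strictly above them are used, and the slack is chosen
  at the very end.\<close>

locale first_time_step = disc +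
 fixes c :: coeffs and T \<gamma>0 sg CF C2 C3 dt Lr Mr :: real
  and f phi g :: "real => scalar_field" and u0 us0 th0 p0 :: scalar_field
  and u ut utt th tht p pt :: "real => scalar_field"
  and R Pih :: "scalar_field => scalar_field" and U1 \<Theta>1 P1 :: scalar_field
 assumes T: "0 < T" and dt: "0 < dt" "dt <= T" and adm: "admissible c \<gamma>0" and sg: "1 / 2 < sg" "sg <= 1" and C23: "0 < C2" "0 < C3"
  and dL: "!!t. t \<in> {0..T} ==> f t \<in> L2 Z" "!!t. t \<in> {0..T} ==> phi t \<in> L2 Z" "!!t. t \<in> {0..T} ==> g t \<in> L2 Z"
  and i0: "us0 \<in> Hs0 Z 1"
  and ws: "weak_solution Z T c f phi g u0 us0 th0 p0 u ut utt th tht p pt" and Fb: "F_bound Z T c f utt th p CF"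
  and Rh: "is_Rh Z \<T> n sgIP J R" and Rb: "Rh_bound Z \<T> n sgIP R sg C2"
  and Pi: "is_Pih Z \<T> Pih" and Pb: "Pih_bound Z \<T> Pih sg C3"
  and fs: "first_step Z \<T> n sgIP c dt f phi g us0 (R u0) (Pih th0) (Pih p0) U1 \<Theta>1 P1"
  and Lr: "0 <= Lr" "Linf_sq Z (2 + sg) 1 dt u < ennreal Lr" "Linf_sq Z (1 + sg) 0 dt th < ennreal Lr" "Linf_sq Z (1 + sg) 0 dt p < ennreal Lr"
  and Mr: "0 <= Mr" "Linf_sq Z 1 3 dt u < ennreal Mr" "L2_sq Z 0 3 dt th < ennreal Mr" "L2_sq Z 0 3 dt p < ennreal Mr"
begin

abbreviation "m \<equiv> ip Z"
abbreviation "gr \<equiv> grad_ip Z"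
abbreviation "nm \<equiv> l2norm Z"
abbreviation "gn \<equiv> grad_norm Z"
abbreviation "HL \<equiv> h powr (2 * sg) * sqrt Lr"
abbreviation "DM \<equiv> dt^2 * sqrt Mr"

lemma t0dt: "0 \<in> {0..T}" "dt \<in> {0..T}" using dt by auto

lemma H1: "x \<in> Hs0 Z 1 ==> x \<in> Hk Z 1" using O.Hs0_Hk[of x 1] by simp

lemma HL2: "x \<in> Hs0 Z 1 ==> x \<in> L2 Z" by (rule O.Hk_L2[OF H1])

lemma H1lc: "x \<in> Hs0 Z 1 ==> y \<in> Hs0 Z 1 ==> lc a x b y \<in> Hs0 Z 1" for a b using O.Hs0_lc[of x 1 y] by simp

lemma sol: assumes "t \<in> {0..T}"
 shows "u t \<in> Hs0 Z 2" "u t \<in> Hs0 Z 1" "ut t \<in> Hs0 Z 1" "utt t \<in> Hs0 Z 1" "th t \<in> Hs0 Z 1" "p t \<in> Hs0 Z 1"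
  "has_time_deriv Z T u t (ut t)" "has_time_deriv Z T ut t (utt t)" "has_time_deriv Z T th t (tht t)" "has_time_deriv Z T p t (pt t)"
  "tht t \<in> L2 Z" "pt t \<in> L2 Z"
proof -
 show 1: "u t \<in> Hs0 Z 2" "ut t \<in> Hs0 Z 1" "utt t \<in> Hs0 Z 1" "th t \<in> Hs0 Z 1" "p t \<in> Hs0 Z 1"
  and 2: "has_time_deriv Z T u t (ut t)" "has_time_deriv Z T ut t (utt t)" "has_time_deriv Z T th t (tht t)" "has_time_deriv Z T p t (pt t)"
  using ws assms unfolding weak_solution_def by blast+
 show "u t \<in> Hs0 Z 1" by (rule O.Hs0_2_1[OF 1(1)])
 show "tht t \<in> L2 Z" "pt t \<in> L2 Z" using O.has_time_deriv_L2(2)[OF 2(3)] O.has_time_deriv_L2(2)[OF 2(4)] by auto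
qed

lemma init: "ae_eq Z (u 0) u0" "ae_eq Z (ut 0) us0" "ae_eq Z (th 0) th0" "ae_eq Z (p 0) p0" 
 using ws unfolding weak_solution_def by blast+

section \<open>Projections of the solution and initial errors\<close>

lemma R_V: "w \<in> Hs0 Z 2 ==> R w \<in> V" using Rh by (simp add: is_Rh_def)
lemma R_eq: "w \<in> Hs0 Z 2 ==> v \<in> V ==> a (R w) v = hess_ip Z w (Q v)" using Rh by (simp add: is_Rh_def)

lemma u0_Hs0: "u0 \<in> Hs0 Z 2" using O.Hs0_cong[of "u 0" 2 u0] sol(1)[OF t0dt(1)] init(1) by simp
lemma th0_Hs0: "th0 \<in> Hs0 Z 1" using O.Hs0_cong[of "th 0" 1 th0] sol(5)[OF t0dt(1)] init(3) by simp
lemma p0_Hs0: "p0 \<in> Hs0 Z 1" using O.Hs0_cong[of "p 0" 1 p0] sol(6)[OF t0dt(1)] init(4) by simp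

lemma W_Hs0: "w \<in> Wh Z \<T> ==> w \<in> Hs0 Z 1" by (simp add: Wh_def)
lemma Pih_W: "w \<in> Hs0 Z 1 ==> Pih w \<in> Wh Z \<T>" using Pi by (simp add: is_Pih_def)
lemma Pih_eq: "w \<in> Hs0 Z 1 ==> v \<in> Wh Z \<T> ==> gr (Pih w) v = gr w v" using Pi by (simp add: is_Pih_def)

lemma Poincare1: assumes w: "w \<in> Hs0 Z 1" shows "nm w <= 2 * Rd * gn w"
proof -
 have "nm w = nm (wder Z [] w)" by (rule O.l2norm_cong[OF O.ae_eq_sym[OF O.wder_Nil[OF HL2[OF w]]] HL2[OF w]])
 also have "... <= 2 * Rd * nm (wder Z ([] @ [1]) w)" using w by (intro O.Poincare[OF Rd(2), of _ 1]) simp_all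
 also have "... <= 2 * Rd * gn w" using Rd(1) O.wder_le_grad_norm[of 1 w] by (intro mult_left_mono) simp_all
 finally show ?thesis .
qed

text \<open>The projections of two representatives of the same function may differ on a null set only.\<close>

lemma Pih_start:
 assumes "x \<in> Hs0 Z 1" "y \<in> Hs0 Z 1" "ae_eq Z x y"
 shows "lc 1 (Pih x) (-1) (Pih y) \<in> Wh Z \<T>" "nm (lc 1 (Pih x) (-1) (Pih y)) = 0" "gn (lc 1 (Pih x) (-1) (Pih y)) = 0"
proof -
 let ?z = "lc 1 (Pih x) (-1) (Pih y)"
 show zW: "?z \<in> Wh Z \<T>" by (intro Wh_lc Pih_W assms)
 have P: "Pih x \<in> Hk Z 1" "Pih y \<in> Hk Z 1" "?z \<in> Hk Z 1" by (rule H1[OF W_Hs0[OF Pih_W[OF assms(1)]]], rule H1[OF W_Hs0[OF Pih_W[OF assms(2)]]], rule H1[OF W_Hs0[OF zW]])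
 have "gr ?z ?z = gr (Pih x) ?z - gr (Pih y) ?z" by (subst O.grad_ip_lc_left[OF P]) simp
 also have "... = gr x ?z - gr y ?z" using Pih_eq[OF assms(1) zW] Pih_eq[OF assms(2) zW] by simp
 also have "... = 0" using O.grad_ip_cong[OF assms(3) O.ae_eq_refl] by simp
 finally have "(gn ?z)^2 = 0" unfolding O.grad_norm_sq .
 thus gz: "gn ?z = 0" by simp
 show "nm ?z = 0" using Poincare1[OF W_Hs0[OF zW]] O.l2norm_nonneg[of ?z] unfolding gz by simp
qed

lemma null_ip: "x \<in> L2 Z ==> y \<in> L2 Z ==> nm x = 0 ==> m x y = 0" using O.Cauchy_Schwarz[of x y] by simp
lemma null_grad: "x \<in> Hk Z 1 ==> y \<in> Hk Z 1 ==> gn x = 0 ==> gr x y = 0" using O.grad_Cauchy_Schwarz[of x y] by simp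

lemma hpos: "0 < h" "h <= 2 * Rd" using mesh_size_pos mesh_size_le[OF Rd(2)] by auto

text \<open>The smoothing operator gains full powers of the mesh size. As sigma is at most 1 and the
  mesh size is bounded, these are at least as good as the powers sigma and 2 sigma.\<close>

lemma h_powr: "h <= 2 * Rd * h powr sg" "h^2 <= 4 * Rd^2 * h powr (2 * sg)"
proof -
 have "h = h powr (1 - sg) * h powr sg" using hpos by (simp add: powr_add[symmetric])
 also have "... <= (2 * Rd) * h powr sg"
 proof (rule mult_right_mono)
  have "h powr (1 - sg) <= (2 * Rd) powr (1 - sg)" using hpos sg by (intro powr_mono2) auto
  also have "... <= (2 * Rd) powr 1" using Rd(1) sg by (intro powr_mono) auto
  finally show "h powr (1 - sg) <= 2 * Rd" using Rd(1) by simp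
 qed simp
 finally show k: "h <= (2 * Rd) * h powr sg" .
 have "h^2 <= ((2 * Rd) * h powr sg)^2" using k hpos by (intro power_mono) auto
 also have "... = 4 * Rd^2 * h powr (2 * sg)" by (simp add: power_mult_distrib power2_eq_square powr_add[symmetric])
 finally show "h^2 <= 4 * Rd^2 * h powr (2 * sg)" .
qed

abbreviation "Z0 \<equiv> R (u 0) - R u0"
abbreviation "Z1 \<equiv> R (u dt) - U1"
abbreviation "\<Psi>0 \<equiv> Pih (th 0) - Pih th0"
abbreviation "\<Psi>1 \<equiv> Pih (th dt) - \<Theta>1"
abbreviation "\<xi>0 \<equiv> Pih (p 0) - Pih p0"
abbreviation "\<xi>1 \<equiv> Pih (p dt) - P1"

lemma U1_V: "U1 \<in> V" and \<Theta>1_W: "\<Theta>1 \<in> Wh Z \<T>" and P1_W: "P1 \<in> Wh Z \<T>"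
 using fs by (simp_all add: first_step_def)

lemma V_mem: "R (u 0) \<in> V" "R (u dt) \<in> V" "R u0 \<in> V" "U1 \<in> V"
 using R_V sol(1)[OF t0dt(1)] sol(1)[OF t0dt(2)] u0_Hs0 U1_V by auto

lemma W_mem: "Pih (th 0) \<in> Wh Z \<T>" "Pih (th dt) \<in> Wh Z \<T>" "Pih th0 \<in> Wh Z \<T>" "\<Theta>1 \<in> Wh Z \<T>"
 "Pih (p 0) \<in> Wh Z \<T>" "Pih (p dt) \<in> Wh Z \<T>" "Pih p0 \<in> Wh Z \<T>" "P1 \<in> Wh Z \<T>"
 using Pih_W sol(5,6)[OF t0dt(1)] sol(5,6)[OF t0dt(2)] th0_Hs0 p0_Hs0 \<Theta>1_W P1_W by auto

lemma H_mem: "R (u 0) \<in> Hk Z 1" "R (u dt) \<in> Hk Z 1" "R u0 \<in> Hk Z 1" "U1 \<in> Hk Z 1"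
 "Pih (th 0) \<in> Hk Z 1" "Pih (th dt) \<in> Hk Z 1" "Pih th0 \<in> Hk Z 1" "\<Theta>1 \<in> Hk Z 1"
 "Pih (p 0) \<in> Hk Z 1" "Pih (p dt) \<in> Hk Z 1" "Pih p0 \<in> Hk Z 1" "P1 \<in> Hk Z 1"
 "us0 \<in> Hk Z 1" "u 0 \<in> Hk Z 1" "u dt \<in> Hk Z 1" "ut 0 \<in> Hk Z 1" "ut dt \<in> Hk Z 1" "utt 0 \<in> Hk Z 1" "utt dt \<in> Hk Z 1"
 "th 0 \<in> Hk Z 1" "th dt \<in> Hk Z 1" "p 0 \<in> Hk Z 1" "p dt \<in> Hk Z 1"
 using V_mem[THEN V_Hk] W_mem[THEN W_Hs0, THEN H1] i0[THEN H1] sol(2-6)[OF t0dt(1), THEN H1] sol(2-6)[OF t0dt(2), THEN H1] by auto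

lemma L_mem: "tht 0 \<in> L2 Z" "tht dt \<in> L2 Z" "pt 0 \<in> L2 Z" "pt dt \<in> L2 Z" "f 0 \<in> L2 Z" "f dt \<in> L2 Z" "phi 0 \<in> L2 Z" "phi dt \<in> L2 Z" "g 0 \<in> L2 Z" "g dt \<in> L2 Z"
 using sol(11,12)[OF t0dt(1)] sol(11,12)[OF t0dt(2)] dL[OF t0dt(1)] dL[OF t0dt(2)] by auto

lemmas mem = H_mem H_mem[THEN O.Hk_L2] L_mem
lemmas lin = diff_eq_lc half_eq_lc diffq_eq_lc
lemmas lin_ip = O.ip_lc_left O.grad_ip_lc_left

lemma hess_ip_lc_left:
 assumes "x \<in> Hk Z 2" "y \<in> Hk Z 2" "z \<in> Hk Z 2"
 shows "hess_ip Z (lc r x s y) z = r * hess_ip Z x z + s * hess_ip Z y z"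
proof -
 have "m (wder Z [i, j] (lc r x s y)) (wder Z [i, j] z) = r * m (wder Z [i, j] x) (wder Z [i, j] z) + s * m (wder Z [i, j] y) (wder Z [i, j] z)" for i j
 proof -
  have "m (wder Z [i, j] (lc r x s y)) (wder Z [i, j] z) = m (lc r (wder Z [i, j] x) s (wder Z [i, j] y)) (wder Z [i, j] z)"
   using assms by (intro O.ip_cong O.wder_lc O.wder_L2[of _ 2] O.L2_lc) auto
  also have "... = r * m (wder Z [i, j] x) (wder Z [i, j] z) + s * m (wder Z [i, j] y) (wder Z [i, j] z)"
   using assms by (intro O.ip_lc_left O.wder_L2[of _ 2]) auto
  finally show ?thesis .
 qed
 thus ?thesis by (simp add: hess_ip_def sum_2 algebra_simps)
qed

lemma Hs0_2_Hk: "x \<in> Hs0 Z 2 ==> x \<in> Hk Z 2" using O.Hs0_Hk[of x 2] by simp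

text \<open>\<open>R\<close> is known only through its defining equation, one argument at a time.
  Coercivity makes it linear up to functions of norm zero, which the estimates do not see.\<close>

lemma R_lc:
 assumes "x \<in> Hs0 Z 2" "y \<in> Hs0 Z 2" "z \<in> Hs0 Z 2" "ae_eq Z z (lc r x s y)"
 shows "lc r (R x) s (R y) - R z \<in> V" "v \<in> V ==> a (lc r (R x) s (R y) - R z) v = 0"
  "nm (lc r (R x) s (R y) - R z) = 0" "gn (lc r (R x) s (R y) - R z) = 0"
proof -
 let ?d = "lc r (R x) s (R y) - R z"
 have V1: "lc r (R x) s (R y) \<in> V" by (intro Vh_lc R_V assms)
 show V2: "?d \<in> V" unfolding diff_eq_lc by (intro Vh_lc V1 R_V assms)
 show orth: "a ?d v = 0" if v: "v \<in> V" for v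
 proof -
  have "a ?d v = 1 * a (lc r (R x) s (R y)) v + (- 1) * a (R z) v" unfolding diff_eq_lc
   by (rule ah_lc[OF V1[THEN Vh_PS] R_V[OF assms(3), THEN Vh_PS] Vh_PS[OF v]])
  also have "... = r * hess_ip Z x (Q v) + s * hess_ip Z y (Q v) - hess_ip Z z (Q v)"
   using ah_lc[OF R_V[OF assms(1), THEN Vh_PS] R_V[OF assms(2), THEN Vh_PS] Vh_PS[OF v], of sgIP r s] R_eq[OF assms(1) v] R_eq[OF assms(2) v] R_eq[OF assms(3) v] by simp
  also have "hess_ip Z z (Q v) = hess_ip Z (lc r x s y) (Q v)" by (rule O.hess_ip_cong[OF assms(4) O.ae_eq_refl])
  also have "... = r * hess_ip Z x (Q v) + s * hess_ip Z y (Q v)" by (intro hess_ip_lc_left Hs0_2_Hk assms Q_Hs0)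
  also have "r * hess_ip Z x (Q v) + s * hess_ip Z y (Q v) - (r * hess_ip Z x (Q v) + s * hess_ip Z y (Q v)) = 0" by simp
  finally show ?thesis .
 qed
 show "nm ?d = 0" "gn ?d = 0" using V_kernel[OF V2 orth[OF V2]] by auto
qed

lemma Z0_null: "Z0 \<in> V" "v \<in> V ==> a Z0 v = 0" "nm Z0 = 0" "gn Z0 = 0"
proof -
 have e: "lc 1 (R (u 0)) 0 (R (u 0)) = R (u 0)" by (rule ext) (simp add: lc_def)
 have "ae_eq Z u0 (lc 1 (u 0) 0 (u 0))" using init(1) O.ae_eq_sym by (simp add: lc_def)
 from R_lc[OF sol(1)[OF t0dt(1)] sol(1)[OF t0dt(1)] u0_Hs0 this]
 show "Z0 \<in> V" "v \<in> V ==> a Z0 v = 0" "nm Z0 = 0" "gn Z0 = 0" unfolding e by blast+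
qed

text \<open>The increment of the error serves as test function in the first equation. It is
  \<open>dt\<close> times the difference quotient, and its broken norm is bounded by the energy
  without a factor 1 / dt.\<close>

abbreviation "w \<equiv> Z1 - Z0"

lemma w_V: "w \<in> V" and Z1_V: "Z1 \<in> V"
 unfolding diff_eq_lc by (intro Vh_lc V_mem)+

lemma diffq_w: "diffq dt Z0 Z1 = lc (1 / dt) w 0 w"
 by (rule ext) (simp add: diffq_def lc_def)

lemma norm_w: "nm w = dt * nm (diffq dt Z0 Z1)" "gn w = dt * gn (diffq dt Z0 Z1)"
proof -
 have w1: "w \<in> Hk Z 1" by (rule V_Hk[OF w_V])
 have "(nm w)^2 = (dt * nm (diffq dt Z0 Z1))^2"
  unfolding power_mult_distrib O.l2norm_sq diffq_w using O.Hk_L2[OF w1] dt by (simp add: O.ip_lc_left O.ip_lc_right power2_eq_square)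
 thus "nm w = dt * nm (diffq dt Z0 Z1)" using dt by (simp add: power2_eq_iff_nonneg)
 have "(gn w)^2 = (dt * gn (diffq dt Z0 Z1))^2"
  unfolding power_mult_distrib O.grad_norm_sq diffq_w using w1 dt by (simp add: O.grad_ip_lc_left O.grad_ip_lc_right power2_eq_square)
 thus "gn w = dt * gn (diffq dt Z0 Z1)" using dt by (simp add: power2_eq_iff_nonneg)
qed

text \<open>The average is the initial error plus half of the increment, and the initial error is
  orthogonal to the discrete space.\<close>

lemma energy_Z: "a (half Z0 Z1) w = a w w / 2" "CCoer * (N (half Z0 Z1))^2 <= a w w / 4"
proof -
 have P: "Z0 \<in> PS" "Z1 \<in> PS" "w \<in> PS" using Z0_null(1) Z1_V w_V by (auto intro: Vh_PS)
 have h: "half Z0 Z1 = lc 1 Z0 (1 / 2) w" by (rule ext) (simp add: half_def lc_def field_simps)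
 have hV: "half Z0 Z1 \<in> V" unfolding h by (intro Vh_lc Z0_null(1) w_V)
 show 1: "a (half Z0 Z1) w = a w w / 2" unfolding h using ah_lc[OF P(1,3,3)] Z0_null(2)[OF w_V] by simp
 have "a (half Z0 Z1) (half Z0 Z1) = a Z0 (half Z0 Z1) + 1 / 2 * a w (half Z0 Z1)"
  using ah_lc[OF P(1,3) Vh_PS[OF hV], of sgIP 1 "1 / 2"] unfolding h[symmetric] by simp
 also have "... = 1 / 2 * a (half Z0 Z1) w" using Z0_null(2)[OF hV] ah_commute[of sgIP w "half Z0 Z1"] by simp
 finally have "a (half Z0 Z1) (half Z0 Z1) = a w w / 4" unfolding 1 by simp
 thus "CCoer * (N (half Z0 Z1))^2 <= a w w / 4" using coercive[OF hV] by simp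
qed

abbreviation "DR \<equiv> diffq dt (R (u 0)) (R (u dt))"
abbreviation "DU \<equiv> diffq dt (u 0) (u dt)"

text \<open>The projection bound is applied to the difference quotient of the solution, whose H^(2 +
  sigma) norm is controlled by that of u_t. Bounding the errors at the two times separately would
  cost a factor 1 / dt.\<close>

lemma DR_error: "nm (DR - DU) <= 2 * C2 * HL" "gn (DR - DU) <= 2 * C2 * HL"
proof -
 have D: "DU \<in> Hs0 Z 2" unfolding diffq_eq_lc using O.Hs0_lc[of "u dt" 2 "u 0"] sol(1)[OF t0dt(1)] sol(1)[OF t0dt(2)] by simp
 have "sob_sq Z (2 + sg) DU <= ennreal (2 * Lr)"
  by (rule O.Linf_sq_1_bound[OF Lr(2,1) dt]) (rule sol(7), assumption, rule sol(8), assumption)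
 note S = O.sob_norm_leI[OF this Lr(1)]
 have "nm (DU - R DU) + gn (DU - R DU) + h powr sg * N (DU - R DU) <= C2 * h powr (2 * sg) * sob_norm Z (2 + sg) DU"
  using Rb D S(1) by (simp add: Rh_bound_def)
 also have "... <= C2 * h powr (2 * sg) * (2 * sqrt Lr)" using S(2) C23 by (intro mult_left_mono) auto
 also have "... = 2 * C2 * HL" by simp
 finally have e: "nm (DU - R DU) <= 2 * C2 * HL" "gn (DU - R DU) <= 2 * C2 * HL"
  using O.l2norm_nonneg[of "DU - R DU"] O.grad_norm_nonneg[of "DU - R DU"] mult_nonneg_nonneg[OF powr_ge_zero N_nonneg, of h sg "DU - R DU"] by linarith+
 have d: "lc (1 / dt) (R (u dt)) (- 1 / dt) (R (u 0)) - R DU \<in> V" "nm (lc (1 / dt) (R (u dt)) (- 1 / dt) (R (u 0)) - R DU) = 0"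
  "gn (lc (1 / dt) (R (u dt)) (- 1 / dt) (R (u 0)) - R DU) = 0"
  by (rule R_lc[OF sol(1)[OF t0dt(2)] sol(1)[OF t0dt(1)] D]; simp add: diffq_eq_lc)+
 have D1: "DU - R DU \<in> Hk Z 1" unfolding diff_eq_lc using H1[OF O.Hs0_2_1[OF D]] V_Hk[OF R_V[OF D]] by simp
 have d': "DR - R DU \<in> Hk Z 1" "nm (DR - R DU) = 0" "gn (DR - R DU) = 0" using d V_Hk unfolding diffq_eq_lc by auto
 have "DR - DU = lc 1 (DR - R DU) (-1) (DU - R DU)" by (rule ext) (simp add: lc_def)
 thus "nm (DR - DU) <= 2 * C2 * HL" "gn (DR - DU) <= 2 * C2 * HL"
  using O.l2norm_lc[OF O.Hk_L2[OF d'(1)] O.Hk_L2[OF D1], of 1 "-1"] O.grad_norm_lc[OF d'(1) D1, of 1 "-1"] d' e by simp_all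
qed

lemma Pih_error:
 assumes "Linf_sq Z (1 + sg) 0 dt y < ennreal Lr" "!!t. t \<in> {0..T} ==> has_time_deriv Z T y t (y' t)" "y t \<in> Hs0 Z 1" "t \<in> {0..dt}"
 shows "nm (y t - Pih (y t)) <= 2 * C3 * HL" "h powr sg * gn (y t - Pih (y t)) <= 2 * C3 * HL"
proof -
 note S = O.sob_norm_leI[OF O.Linf_sq_0_bound[OF assms(1) Lr(1) dt assms(2,4)] Lr(1)]
 have "nm (y t - Pih (y t)) + h powr sg * gn (y t - Pih (y t)) <= C3 * h powr (2 * sg) * sob_norm Z (1 + sg) (y t)"
  using Pb assms(3) S(1) by (simp add: Pih_bound_def)
 also have "... <= C3 * h powr (2 * sg) * (2 * sqrt Lr)" using S(2) C23 by (intro mult_left_mono) auto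
 also have "... = 2 * C3 * HL" by simp
 finally show "nm (y t - Pih (y t)) <= 2 * C3 * HL" "h powr sg * gn (y t - Pih (y t)) <= 2 * C3 * HL"
  using O.l2norm_nonneg[of "y t - Pih (y t)"] mult_nonneg_nonneg[OF powr_ge_zero O.grad_norm_nonneg, of h sg "y t - Pih (y t)"] by linarith+
qed

text \<open>The gradient of \<open>y\<close> may be as large as B h^(-sigma). Against v - Q v this
  loss is compensated by the factor h; against Q v it is avoided, since moving the derivative leaves
  the L^2 norm of \<open>y\<close> and second derivatives of Q v.\<close>

lemma smoothed_pairing:
 assumes y: "y \<in> Hs0 Z 1" and B: "nm y <= B" "h powr sg * gn y <= B" and v: "v \<in> V"
 shows "\<bar>gr y v\<bar> <= (4 * Rd * C1 + 4 * (1 + C1)) * B * N v"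
proof -
 have B0: "0 <= B" using B(1) O.l2norm_nonneg[of y] by linarith
 have y1: "y \<in> Hk Z 1" and yL: "y \<in> L2 Z" using H1[OF y] HL2[OF y] .
 have e: "v = lc 1 (v - Q v) 1 (Q v)" by (rule ext) (simp add: lc_def)
 have "gr y (lc 1 (v - Q v) 1 (Q v)) = gr y (v - Q v) + gr y (Q v)"
  using O.grad_ip_lc_right[OF d_Hk[OF v] O.Hk_mono[OF Q_Hk] y1, of 1 1 v] by simp
 hence s: "gr y v = gr y (v - Q v) + gr y (Q v)" unfolding e[symmetric] .
 have "\<bar>gr y (v - Q v)\<bar> <= gn y * gn (v - Q v)" by (rule O.grad_Cauchy_Schwarz[OF y1 d_Hk[OF v]])
 also have "... <= gn y * (2 * C1 * h * N v)" by (intro mult_left_mono sm1g[OF v]) simp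
 also have "... <= gn y * (2 * C1 * (2 * Rd * h powr sg) * N v)"
  using C1 N_nonneg[of v] h_powr(1) by (intro mult_left_mono mult_right_mono) auto
 also have "... = (4 * Rd * C1 * N v) * (h powr sg * gn y)" by simp
 also have "... <= (4 * Rd * C1 * N v) * B" using C1 Rd(1) N_nonneg[of v] by (intro mult_left_mono B) auto
 finally have 1: "\<bar>gr y (v - Q v)\<bar> <= 4 * Rd * C1 * B * N v" by (simp add: mult_ac)
 have z: "\<bar>m (wder Z [i] y) (wder Z [i] (Q v))\<bar> <= B * (2 * (1 + C1) * N v)" for i
 proof -
  have "\<bar>m (wder Z [i] y) (wder Z [i] (Q v))\<bar> = \<bar>m y (wder Z [i, i] (Q v))\<bar>" unfolding O.wder_by_parts[OF y Q_Hk] by simp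
  also have "... <= nm y * nm (wder Z [i, i] (Q v))" by (intro O.Cauchy_Schwarz yL O.wder_L2[OF Q_Hk]) simp
  also have "... <= B * (2 * (1 + C1) * N v)" by (intro mult_mono B sm2[OF v] B0) simp
  finally show ?thesis .
 qed
 have "\<bar>gr y (Q v)\<bar> <= B * (2 * (1 + C1) * N v) + B * (2 * (1 + C1) * N v)"
  unfolding grad_ip_def sum_2 using z[of 1] z[of 2] by linarith
 also have "... = 4 * (1 + C1) * B * N v" by (simp add: algebra_simps)
 finally have 2: "\<bar>gr y (Q v)\<bar> <= 4 * (1 + C1) * B * N v" .
 have "\<bar>gr y v\<bar> <= 4 * Rd * C1 * B * N v + 4 * (1 + C1) * B * N v" using 1 2 unfolding s by linarith
 also have "... = (4 * Rd * C1 + 4 * (1 + C1)) * B * N v" by (simp add: distrib_right)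
 finally show ?thesis .
qed

text \<open>What the projected solution leaves over in the starting formula, times dt / 2.\<close>

abbreviation "WW \<equiv> lc 1 (DR - us0) (- (dt / 2)) (half (utt 0) (utt dt))"

lemma WW_bound: "WW \<in> Hk Z 1" "nm WW <= 2 * C2 * HL + DM" "gn WW <= 2 * C2 * HL + DM"
proof -
 let ?t = "O.taylor_defect dt u ut utt"
 show H: "WW \<in> Hk Z 1" using mem by (simp add: lin)
 have t: "nm ?t <= dt ^ 3 * sqrt Mr" "gn ?t <= dt ^ 3 * sqrt Mr" "?t \<in> Hs0 Z 1"
  by (rule O.taylor_defect_bound[OF Mr(2,1) dt]; erule sol(7) sol(8) sol(2) sol(3) sol(4))+
 have t1: "?t \<in> Hk Z 1" by (rule H1[OF t(3)])
 have d1: "DR - DU \<in> Hk Z 1" using mem by (simp add: lin)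
 \<comment> \<open>The equality holds only almost everywhere, since the scheme starts from
   \<open>us0\<close> and the Taylor formula from \<open>ut 0\<close>.\<close>
 have ae: "ae_eq Z (lc 1 (DR - DU) (1 / dt) ?t) WW"
  using init(2) unfolding ae_eq_def
 proof eventually_elim
  case (elim x)
  thus ?case using dt by (simp add: O.taylor_defect_def lc_def diffq_def half_def field_simps power2_eq_square)
 qed
 have L: "lc 1 (DR - DU) (1 / dt) ?t \<in> L2 Z" using O.Hk_L2[OF d1] O.Hk_L2[OF t1] by simp
 have 1: "1 / dt * x <= DM" if "x <= dt ^ 3 * sqrt Mr" for x
  using mult_left_mono[OF that, of "1 / dt"] dt by (simp add: power2_eq_square power3_eq_cube)
 show "nm WW <= 2 * C2 * HL + DM"
  using O.l2norm_lc[OF O.Hk_L2[OF d1] O.Hk_L2[OF t1], of 1 "1 / dt"] 1[OF t(1)] DR_error(1) dt unfolding O.l2norm_cong[OF ae L] by simp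
 show "gn WW <= 2 * C2 * HL + DM"
  using O.grad_norm_lc[OF d1 t1, of 1 "1 / dt"] 1[OF t(2)] DR_error(2) dt unfolding O.grad_norm_cong[OF ae] by simp
qed

text \<open>In the coupling terms the scheme has the difference quotient where the averaged equation
  has the mean of u_t.\<close>

lemma DR_ut_error:
 shows "lc 1 DR (-1) (half (ut 0) (ut dt)) \<in> Hk Z 1" "gn (lc 1 DR (-1) (half (ut 0) (ut dt))) <= 2 * C2 * HL + DM"
proof -
 let ?t = "lc 1 (lc 1 (u dt) (-1) (u 0)) (- (dt / 2)) (lc 1 (ut 0) 1 (ut dt))"
 show "lc 1 DR (-1) (half (ut 0) (ut dt)) \<in> Hk Z 1" using mem by (simp add: lin)
 have t: "gn ?t <= dt ^ 3 * sqrt Mr" "?t \<in> Hs0 Z 1"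
  by (rule O.trapezoid_grad[OF Mr(2,1) dt]; erule sol(7) sol(2) sol(3))+
 have t1: "?t \<in> Hk Z 1" by (rule H1[OF t(2)])
 have d1: "DR - DU \<in> Hk Z 1" using mem by (simp add: lin)
 have 1: "1 / dt * gn ?t <= DM"
  using mult_left_mono[OF t(1), of "1 / dt"] dt by (simp add: power2_eq_square power3_eq_cube)
 have e: "lc 1 DR (-1) (half (ut 0) (ut dt)) = lc 1 (DR - DU) (1 / dt) ?t"
  using dt by (intro ext) (simp add: lc_def diffq_def half_def field_simps)
 show "gn (lc 1 DR (-1) (half (ut 0) (ut dt))) <= 2 * C2 * HL + DM"
  using O.grad_norm_lc[OF d1 t1, of 1 "1 / dt"] 1 DR_error(2) dt unfolding e by simp
qed

text \<open>The factor \<open>dt\<close> is kept with the difference quotient: the projection errors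
  of theta and p are bounded at each time, but nothing is known about their time
  derivatives.\<close>

lemma increment_error:
 assumes y: "Linf_sq Z (1 + sg) 0 dt y < ennreal Lr" "L2_sq Z 0 3 dt y < ennreal Mr"
  "!!t. t \<in> {0..T} ==> has_time_deriv Z T y t (y' t)" "!!t. t \<in> {0..T} ==> y t \<in> Hs0 Z 1"
 shows "lc dt (diffq dt (Pih (y 0)) (Pih (y dt))) (- dt) (half (y' 0) (y' dt)) \<in> L2 Z"
  "nm (lc dt (diffq dt (Pih (y 0)) (Pih (y dt))) (- dt) (half (y' 0) (y' dt))) <= 4 * C3 * HL + sqrt T * DM"
proof -
 let ?E = "lc 1 (y dt - Pih (y dt)) (-1) (y 0 - Pih (y 0))" and ?t = "lc 1 (lc 1 (y dt) (-1) (y 0)) (- (dt / 2)) (lc 1 (y' 0) 1 (y' dt))"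
 have m: "y 0 \<in> Hs0 Z 1" "y dt \<in> Hs0 Z 1" using y(4) t0dt by auto
 have L: "y 0 \<in> L2 Z" "y dt \<in> L2 Z" "Pih (y 0) \<in> L2 Z" "Pih (y dt) \<in> L2 Z" "y' 0 \<in> L2 Z" "y' dt \<in> L2 Z"
  using HL2[OF m(1)] HL2[OF m(2)] HL2[OF W_Hs0[OF Pih_W[OF m(1)]]] HL2[OF W_Hs0[OF Pih_W[OF m(2)]]]
   O.has_time_deriv_L2(2)[OF y(3)[OF t0dt(1)]] O.has_time_deriv_L2(2)[OF y(3)[OF t0dt(2)]] by auto
 have e1: "nm (y 0 - Pih (y 0)) <= 2 * C3 * HL" by (rule Pih_error(1)[OF y(1,3) m(1)]) (use dt in auto)
 have e2: "nm (y dt - Pih (y dt)) <= 2 * C3 * HL" by (rule Pih_error(1)[OF y(1,3) m(2)]) (use dt in auto)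
 have e: "lc dt (diffq dt (Pih (y 0)) (Pih (y dt))) (- dt) (half (y' 0) (y' dt)) = lc (-1) ?E 1 ?t"
  using dt by (intro ext) (simp add: lc_def diffq_def half_def field_simps)
 have EL: "y dt - Pih (y dt) \<in> L2 Z" "y 0 - Pih (y 0) \<in> L2 Z" "?E \<in> L2 Z" "?t \<in> L2 Z" using L by (simp_all add: diff_eq_lc)
 have "nm ?t <= dt^2 * (sqrt dt * sqrt Mr)" by (rule O.trapezoid_L2[OF y(2) Mr(1) dt]) (rule y(3))
 also have "... <= dt^2 * (sqrt T * sqrt Mr)" using dt Mr(1) by (intro mult_left_mono mult_right_mono) auto
 finally have t: "nm ?t <= sqrt T * DM" by (simp add: mult_ac)
 show "lc dt (diffq dt (Pih (y 0)) (Pih (y dt))) (- dt) (half (y' 0) (y' dt)) \<in> L2 Z" unfolding e using EL(3,4) by simp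
 show "nm (lc dt (diffq dt (Pih (y 0)) (Pih (y dt))) (- dt) (half (y' 0) (y' dt))) <= 4 * C3 * HL + sqrt T * DM"
  using O.l2norm_lc[OF EL(3,4), of "-1" 1] O.l2norm_lc[OF EL(1,2), of 1 "-1"] e1 e2 t unfolding e by simp
qed

text \<open>One argument serves the second and the third equation. \<open>y\<close> is the unknown
  with the coefficient \<open>A\<close>, \<open>x\<close> the one in the mixed term, and the test
  function is the average error \<open>e\<close> of \<open>y\<close>.\<close>

lemma parabolic_estimate:
 fixes A G B K al :: real and x x' y y' q :: "real => scalar_field" and x0 y0 X1 Y1 :: scalar_field
 defines "e \<equiv> half (Pih (y 0) - Pih y0) (Pih (y dt) - Y1)" and "d \<equiv> half (Pih (x 0) - Pih x0) (Pih (x dt) - X1)"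
 assumes y: "Linf_sq Z (1 + sg) 0 dt y < ennreal Lr" "L2_sq Z 0 3 dt y < ennreal Mr"
  "!!t. t \<in> {0..T} ==> has_time_deriv Z T y t (y' t)" "!!t. t \<in> {0..T} ==> y t \<in> Hs0 Z 1"
  and x: "Linf_sq Z (1 + sg) 0 dt x < ennreal Lr" "L2_sq Z 0 3 dt x < ennreal Mr"
  "!!t. t \<in> {0..T} ==> has_time_deriv Z T x t (x' t)" "!!t. t \<in> {0..T} ==> x t \<in> Hs0 Z 1"
  and y0: "y0 \<in> Hs0 Z 1" "ae_eq Z (y 0) y0" "Y1 \<in> Wh Z \<T>"
  and x0: "x0 \<in> Hs0 Z 1" "ae_eq Z (x 0) x0" "X1 \<in> Wh Z \<T>"
  and q: "q 0 \<in> L2 Z" "q dt \<in> L2 Z"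
  and scheme: "!!psi. psi \<in> Wh Z \<T> ==> A * m (diffq dt (Pih y0) Y1) psi - G * m (diffq dt (Pih x0) X1) psi
    + B * m (half (Pih y0) Y1) psi + K * gr (half (Pih y0) Y1) psi + al * gr (diffq dt (R u0) U1) psi = m (half (q 0) (q dt)) psi"
  and weak: "!!t psi. t \<in> {0..T} ==> psi \<in> Hs0 Z 1 ==> A * m (y' t) psi - G * m (x' t) psi
    + B * m (y t) psi + K * gr (y t) psi + al * gr (ut t) psi = m (q t) psi"
  and nn: "0 <= A" "0 <= B" "0 <= al"
 shows "2 * A * (nm e)^2 - 2 * G * m d e + dt * (B * (nm e)^2 + K * (gn e)^2) + al * gr e w
  <= ((A + \<bar>G\<bar>) * (4 * C3 * HL + sqrt T * DM) + T * B * (2 * C3 * HL)) * nm e + dt * (al * (2 * C2 * HL + DM)) * gn e"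
proof -
 have ym: "y 0 \<in> Hs0 Z 1" "y dt \<in> Hs0 Z 1" and xm: "x 0 \<in> Hs0 Z 1" "x dt \<in> Hs0 Z 1" using y(4) x(4) t0dt by auto
 have W: "Pih (y 0) \<in> Wh Z \<T>" "Pih (y dt) \<in> Wh Z \<T>" "Pih y0 \<in> Wh Z \<T>" "Pih (x 0) \<in> Wh Z \<T>" "Pih (x dt) \<in> Wh Z \<T>" "Pih x0 \<in> Wh Z \<T>"
  using Pih_W ym xm y0(1) x0(1) by auto
 have eW: "e \<in> Wh Z \<T>" unfolding e_def lin by (intro Wh_lc W y0(3))
 have e0: "e \<in> Hs0 Z 1" by (rule W_Hs0[OF eW])
 have Hm: "y 0 \<in> Hk Z 1" "y dt \<in> Hk Z 1" "x 0 \<in> Hk Z 1" "x dt \<in> Hk Z 1" "Y1 \<in> Hk Z 1" "X1 \<in> Hk Z 1" "e \<in> Hk Z 1"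
  "Pih (y 0) \<in> Hk Z 1" "Pih (y dt) \<in> Hk Z 1" "Pih y0 \<in> Hk Z 1" "Pih (x 0) \<in> Hk Z 1" "Pih (x dt) \<in> Hk Z 1" "Pih x0 \<in> Hk Z 1"
  using ym[THEN H1] xm[THEN H1] W[THEN W_Hs0, THEN H1] eW[THEN W_Hs0, THEN H1] y0(3)[THEN W_Hs0, THEN H1] x0(3)[THEN W_Hs0, THEN H1] by auto
 note Lm = Hm[THEN O.Hk_L2]
 have Lt: "y' 0 \<in> L2 Z" "y' dt \<in> L2 Z" "x' 0 \<in> L2 Z" "x' dt \<in> L2 Z"
  using O.has_time_deriv_L2(2)[OF y(3)[OF t0dt(1)]] O.has_time_deriv_L2(2)[OF y(3)[OF t0dt(2)]] O.has_time_deriv_L2(2)[OF x(3)[OF t0dt(1)]] O.has_time_deriv_L2(2)[OF x(3)[OF t0dt(2)]] by auto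
 have null: "m (Pih (y 0) - Pih y0) e = 0" "m (Pih (x 0) - Pih x0) e = 0"
  using null_ip[OF _ Lm(7) Pih_start(2)[OF ym(1) y0(1,2)]] null_ip[OF _ Lm(7) Pih_start(2)[OF xm(1) x0(1,2)]] Lm by (simp_all add: diff_eq_lc)
 have nullR: "gr Z0 e = 0" using null_grad[OF V_Hk[OF Z0_null(1)] Hm(7) Z0_null(4)] .
 have wk: "A * m (half (y' 0) (y' dt)) e - G * m (half (x' 0) (x' dt)) e + B * m (half (y 0) (y dt)) e
   + K * gr (half (y 0) (y dt)) e + al * gr (half (ut 0) (ut dt)) e = m (half (q 0) (q dt)) e"
  using weak[OF t0dt(1) e0] weak[OF t0dt(2) e0] Lt Lm Hm q mem by (simp add: lin lin_ip) (simp add: algebra_simps diff_divide_distrib add_divide_distrib)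
 have Gal: "gr (half (Pih (y 0)) (Pih (y dt))) e = gr (half (y 0) (y dt)) e"
  using Pih_eq[OF ym(1) eW] Pih_eq[OF ym(2) eW] Hm by (simp add: lin lin_ip)
 let ?Dy = "diffq dt (Pih (y 0)) (Pih (y dt))" and ?Dx = "diffq dt (Pih (x 0)) (Pih (x dt))" and ?hy = "half (y' 0) (y' dt)" and ?hx = "half (x' 0) (x' dt)"
 have "2 * A * m e e - 2 * G * m d e + dt * (B * m e e + K * gr e e) + dt * al * gr (diffq dt Z0 Z1) e =
  A * (dt * (m ?Dy e - m ?hy e)) - G * (dt * (m ?Dx e - m ?hx e))
   + dt * B * (m (half (Pih (y 0)) (Pih (y dt))) e - m (half (y 0) (y dt)) e) + dt * al * (gr DR e - gr (half (ut 0) (ut dt)) e)"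
 proof (rule combine_theta[OF scheme[OF eW] wk, where
   mDPsi = "m (diffq dt (Pih (y 0) - Pih y0) (Pih (y dt) - Y1)) e" and mDXi = "m (diffq dt (Pih (x 0) - Pih x0) (Pih (x dt) - X1)) e"
   and kPT = "gr (half (Pih (y 0)) (Pih (y dt))) e"])
  show "m (diffq dt (Pih y0) Y1) e = m ?Dy e - m (diffq dt (Pih (y 0) - Pih y0) (Pih (y dt) - Y1)) e"
   using Lm by (simp add: lin lin_ip) (simp add: algebra_simps diff_divide_distrib add_divide_distrib)
  show "m (diffq dt (Pih x0) X1) e = m ?Dx e - m (diffq dt (Pih (x 0) - Pih x0) (Pih (x dt) - X1)) e"
   using Lm by (simp add: lin lin_ip) (simp add: algebra_simps diff_divide_distrib add_divide_distrib)
  have e': "m e e = m (half (Pih (y 0) - Pih y0) (Pih (y dt) - Y1)) e" "gr e e = gr (half (Pih (y 0) - Pih y0) (Pih (y dt) - Y1)) e"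
   unfolding e_def by simp_all
  show "m (half (Pih y0) Y1) e = m (half (Pih (y 0)) (Pih (y dt))) e - m e e"
   unfolding e' using Lm by (simp add: lin lin_ip) (simp add: algebra_simps diff_divide_distrib add_divide_distrib)
  show "gr (half (Pih y0) Y1) e = gr (half (Pih (y 0)) (Pih (y dt))) e - gr e e"
   unfolding e' using Hm by (simp add: lin lin_ip) (simp add: algebra_simps diff_divide_distrib add_divide_distrib)
  show "gr (diffq dt (R u0) U1) e = gr DR e - gr (diffq dt Z0 Z1) e"
   using Hm mem by (simp add: lin lin_ip) (simp add: algebra_simps diff_divide_distrib add_divide_distrib)
  show "dt * m (diffq dt (Pih (y 0) - Pih y0) (Pih (y dt) - Y1)) e = 2 * m e e"
   unfolding e' using null(1) Lm dt by (simp add: lin lin_ip)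
  show "dt * m (diffq dt (Pih (x 0) - Pih x0) (Pih (x dt) - X1)) e = 2 * m d e"
   unfolding d_def using null(2) Lm dt by (simp add: lin lin_ip)
 qed (rule Gal)
 \<comment> \<open>The difference quotient has become the increment, the form in which this term
   cancels against the first equation.\<close>
 moreover have "dt * al * gr (diffq dt Z0 Z1) e = al * gr e w"
  unfolding diffq_w O.grad_ip_commute[of e] using O.grad_ip_lc_left[OF V_Hk[OF w_V] V_Hk[OF w_V] Hm(7), of "1 / dt" 0] dt by simp
 moreover have inc: "A * (dt * (m ?Dy e - m ?hy e)) <= A * ((4 * C3 * HL + sqrt T * DM) * nm e)"
  "- (G * (dt * (m ?Dx e - m ?hx e))) <= \<bar>G\<bar> * ((4 * C3 * HL + sqrt T * DM) * nm e)"
 proof -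
  have b: "\<bar>dt * (m (diffq dt (Pih (z 0)) (Pih (z dt))) e - m (half (z' 0) (z' dt)) e)\<bar> <= (4 * C3 * HL + sqrt T * DM) * nm e"
   if z: "lc dt (diffq dt (Pih (z 0)) (Pih (z dt))) (- dt) (half (z' 0) (z' dt)) \<in> L2 Z"
    "nm (lc dt (diffq dt (Pih (z 0)) (Pih (z dt))) (- dt) (half (z' 0) (z' dt))) <= 4 * C3 * HL + sqrt T * DM"
    and zL: "Pih (z 0) \<in> L2 Z" "Pih (z dt) \<in> L2 Z" "z' 0 \<in> L2 Z" "z' dt \<in> L2 Z" for z z' :: "real => scalar_field"
  proof -
   have eq: "dt * (m (diffq dt (Pih (z 0)) (Pih (z dt))) e - m (half (z' 0) (z' dt)) e) = m (lc dt (diffq dt (Pih (z 0)) (Pih (z dt))) (- dt) (half (z' 0) (z' dt))) e"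
    using zL Lm by (simp add: lin lin_ip) (simp add: algebra_simps diff_divide_distrib add_divide_distrib)
   show ?thesis unfolding eq by (rule order_trans[OF O.Cauchy_Schwarz[OF z(1) Lm(7)] mult_right_mono[OF z(2) O.l2norm_nonneg]])
  qed
  show "A * (dt * (m ?Dy e - m ?hy e)) <= A * ((4 * C3 * HL + sqrt T * DM) * nm e)"
   by (rule mult_left_mono[OF order_trans[OF abs_ge_self b[of y y', OF increment_error[OF y] Lm(8,9) Lt(1,2)]] nn(1)])
  have neg: "- (G * X) <= \<bar>G\<bar> * Y" if "\<bar>X\<bar> <= Y" for X Y
  proof -
   have "- (G * X) <= \<bar>G * X\<bar>" by simp
   also have "... = \<bar>G\<bar> * \<bar>X\<bar>" by (simp add: abs_mult)
   also have "... <= \<bar>G\<bar> * Y" using that by (intro mult_left_mono) auto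
   finally show ?thesis .
  qed
  show "- (G * (dt * (m ?Dx e - m ?hx e))) <= \<bar>G\<bar> * ((4 * C3 * HL + sqrt T * DM) * nm e)"
   by (rule neg[OF b[of x x', OF increment_error[OF x] Lm(11,12) Lt(3,4)]])
 qed
 moreover have "dt * B * (m (half (Pih (y 0)) (Pih (y dt))) e - m (half (y 0) (y dt)) e) <= T * B * (2 * C3 * HL * nm e)"
 proof -
  have b: "\<bar>m (y t - Pih (y t)) e\<bar> <= 2 * C3 * HL * nm e" if "t \<in> {0, dt}" for t
  proof -
   have t: "t \<in> {0..dt}" "t \<in> {0..T}" using that dt by auto
   have "\<bar>m (y t - Pih (y t)) e\<bar> <= nm (y t - Pih (y t)) * nm e"
    using that Lm by (intro O.Cauchy_Schwarz) (auto simp: diff_eq_lc)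
   also have "... <= 2 * C3 * HL * nm e" by (intro mult_right_mono Pih_error(1)[OF y(1,3) y(4)[OF t(2)] t(1)]) auto
   finally show ?thesis .
  qed
  have "m (half (Pih (y 0)) (Pih (y dt))) e - m (half (y 0) (y dt)) e = - (m (y 0 - Pih (y 0)) e + m (y dt - Pih (y dt)) e) / 2"
   using Lm by (simp add: lin lin_ip)
  also have "... <= 2 * C3 * HL * nm e" using b[of 0] b[of dt] by simp
  finally have "dt * B * (m (half (Pih (y 0)) (Pih (y dt))) e - m (half (y 0) (y dt)) e) <= dt * B * (2 * C3 * HL * nm e)"
   using dt nn by (intro mult_left_mono) auto
  also have "... <= T * B * (2 * C3 * HL * nm e)" using dt nn C23 Lr(1) by (intro mult_right_mono) auto
  finally show ?thesis .
 qed
 moreover have "dt * al * (gr DR e - gr (half (ut 0) (ut dt)) e) <= dt * al * ((2 * C2 * HL + DM) * gn e)"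
 proof (rule mult_left_mono)
  have "gr DR e - gr (half (ut 0) (ut dt)) e = gr (lc 1 DR (-1) (half (ut 0) (ut dt))) e"
   using Hm mem by (simp add: lin lin_ip)
  also have "... <= gn (lc 1 DR (-1) (half (ut 0) (ut dt))) * gn e"
   using O.grad_Cauchy_Schwarz[OF DR_ut_error(1) Hm(7)] by simp
  also have "... <= (2 * C2 * HL + DM) * gn e" by (intro mult_right_mono DR_ut_error(2)) simp
  finally show "gr DR e - gr (half (ut 0) (ut dt)) e <= (2 * C2 * HL + DM) * gn e" .
 qed (use dt nn in simp)
 ultimately have "2 * A * m e e - 2 * G * m d e + dt * (B * m e e + K * gr e e) + al * gr e w
   <= A * ((4 * C3 * HL + sqrt T * DM) * nm e) + \<bar>G\<bar> * ((4 * C3 * HL + sqrt T * DM) * nm e) + T * B * (2 * C3 * HL * nm e) + dt * al * ((2 * C2 * HL + DM) * gn e)"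
  by (rule add_bounds)
 thus ?thesis unfolding O.l2norm_sq O.grad_norm_sq by (simp only: distrib_right mult.assoc)
qed

abbreviation "WT \<equiv> half (th 0 - Pih (th 0)) (th dt - Pih (th dt))"
abbreviation "WP \<equiv> half (p 0 - Pih (p 0)) (p dt - Pih (p dt))"
abbreviation "Fr t v \<equiv> residual Z c (f t) (utt t) (th t) (p t) v"

text \<open>The scheme is tested with \<open>v\<close> but the exact equation with Q v, which lies
  in H^2_0 and is what \<open>R\<close> involves. The mismatch between the two is the residual on v
  - Q v.\<close>

lemma u_identity:
 assumes v: "v \<in> V"
 shows   "2 / dt * (m (diffq dt Z0 Z1) v + a\<^sub>0 c * gr (diffq dt Z0 Z1) v) + d\<^sub>0 c * a (half Z0 Z1) v
   - alpha c * gr (half \<Psi>0 \<Psi>1) v - beta c * gr (half \<xi>0 \<xi>1) v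
  = 2 / dt * (m WW v + a\<^sub>0 c * gr WW v) + alpha c * gr WT v + beta c * gr WP v
   - (Fr 0 (v - Q v) + Fr dt (v - Q v)) / 2"
proof -
 let ?E = "%x. m x v + a\<^sub>0 c * gr x v"
 have wm: "v \<in> Hk Z 1" "v \<in> L2 Z" using V_Hk[OF v] O.Hk_L2[OF V_Hk[OF v]] .
 have Qm: "Q v \<in> Hk Z 1" "v - Q v \<in> Hk Z 1" using O.Hk_mono[OF Q_Hk, of 1] d_Hk[OF v] by auto
 have sc: "2 / dt * (m (diffq dt (R u0) U1 - us0) v + a\<^sub>0 c * (gr (diffq dt (R u0) U1) v - gr us0 v))
    + d\<^sub>0 c * a (half (R u0) U1) v - alpha c * gr (half (Pih th0) \<Theta>1) v - beta c * gr (half (Pih p0) P1) v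
    = m (half (f 0) (f dt)) v"
  using fs v by (simp add: first_step_def)
 \<comment> \<open>The exact equation turns the Hessian term into the residual on Q v; written as
   residual on \<open>v\<close> minus residual on v - Q v, its first part cancels against the load
   and the lower order terms of the scheme.\<close>
 have res: "Fr t (Q v) = Fr t v - Fr t (v - Q v)" "d\<^sub>0 c * hess_ip Z (u t) (Q v) = Fr t (Q v)" if t: "t \<in> {0..T}" for t
 proof -
  have e: "Q v = lc 1 v (-1) (v - Q v)" by (rule ext) (simp add: lc_def)
  have "Fr t (lc 1 v (-1) (v - Q v)) = 1 * Fr t v + (-1) * Fr t (v - Q v)"
   by (rule O.residual_lc[OF dL(1)[OF t] sol(4-6)[OF t, THEN H1] wm(1) Qm(2)])
  thus "Fr t (Q v) = Fr t v - Fr t (v - Q v)" unfolding e[symmetric] by simp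
  have "m (utt t) (Q v) + a\<^sub>0 c * gr (utt t) (Q v) + d\<^sub>0 c * hess_ip Z (u t) (Q v)
    - alpha c * gr (th t) (Q v) - beta c * gr (p t) (Q v) = m (f t) (Q v)"
   using ws t Q_Hs0[of v] unfolding weak_solution_def by blast
  thus "d\<^sub>0 c * hess_ip Z (u t) (Q v) = Fr t (Q v)" by (simp add: residual_def)
 qed
 have ah_half: "a (half x y) v = (a y v + a x v) / 2" if "x \<in> V" "y \<in> V" for x y
  unfolding half_eq_lc using ah_lc[OF Vh_PS[OF that(2)] Vh_PS[OF that(1)] Vh_PS[OF v], of sgIP "1 / 2" "1 / 2"] by simp
 have ah_diff: "a (x - y) v = a x v - a y v" if "x \<in> V" "y \<in> V" for x y
 proof -
  have "a (x - y) v = 1 * a x v + (-1) * a y v" unfolding diff_eq_lc by (rule ah_lc[OF Vh_PS[OF that(1)] Vh_PS[OF that(2)] Vh_PS[OF v]])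
  thus ?thesis by simp
 qed
 show ?thesis
 proof (rule combine_u[where
   EU = "?E (diffq dt (R u0) U1) - ?E us0" and ER = "?E DR - ?E us0"
   and aU = "a (half (R u0) U1) v" and aR = "a (half (R (u 0)) (R (u dt))) v"
   and kT = "gr (half (Pih th0) \<Theta>1) v" and kP = "gr (half (Pih p0) P1) v" and mf = "m (half (f 0) (f dt)) v"
   and kPT = "gr (half (Pih (th 0)) (Pih (th dt))) v" and kPP = "gr (half (Pih (p 0)) (Pih (p dt))) v"
   and F0q = "Fr 0 (Q v)" and F1q = "Fr dt (Q v)" and F0v = "Fr 0 v" and F1v = "Fr dt v"
   and Eu = "?E (half (utt 0) (utt dt))" and kth = "gr (half (th 0) (th dt)) v" and kp = "gr (half (p 0) (p dt)) v" and s = "dt / 2"])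
  show "2 / dt * (?E (diffq dt (R u0) U1) - ?E us0) + d\<^sub>0 c * a (half (R u0) U1) v
    - alpha c * gr (half (Pih th0) \<Theta>1) v - beta c * gr (half (Pih p0) P1) v = m (half (f 0) (f dt)) v"
  proof -
   have "m (diffq dt (R u0) U1 - us0) v = m (diffq dt (R u0) U1) v - m us0 v" using mem wm by (simp add: lin lin_ip)
   hence "m (diffq dt (R u0) U1 - us0) v + a\<^sub>0 c * (gr (diffq dt (R u0) U1) v - gr us0 v)
    = ?E (diffq dt (R u0) U1) - ?E us0" by (simp add: algebra_simps)
   thus ?thesis using sc by (simp only:)
  qed
  have dq: "m (diffq dt (R u0) U1) v = m DR v - m (diffq dt Z0 Z1) v" "gr (diffq dt (R u0) U1) v = gr DR v - gr (diffq dt Z0 Z1) v"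
  proof -
   have e: "diffq dt (R u0) U1 = lc 1 DR (-1) (diffq dt Z0 Z1)" by (rule ext) (simp add: diffq_def lc_def diff_divide_distrib)
   have m: "DR \<in> Hk Z 1" "diffq dt Z0 Z1 \<in> Hk Z 1" using mem by (simp_all add: lin)
   show "m (diffq dt (R u0) U1) v = m DR v - m (diffq dt Z0 Z1) v"
    unfolding e using O.ip_lc_left[OF O.Hk_L2[OF m(1)] O.Hk_L2[OF m(2)] wm(2), of 1 "-1"] by simp
   show "gr (diffq dt (R u0) U1) v = gr DR v - gr (diffq dt Z0 Z1) v"
    unfolding e using O.grad_ip_lc_left[OF m wm(1), of 1 "-1"] by simp
  qed
  show "?E (diffq dt (R u0) U1) - ?E us0 = (?E DR - ?E us0) - ?E (diffq dt Z0 Z1)" unfolding dq by (simp add: algebra_simps)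
  show "a (half (R u0) U1) v = a (half (R (u 0)) (R (u dt))) v - a (half Z0 Z1) v"
   using V_mem Z0_null(1) Z1_V by (simp add: ah_half ah_diff) (simp add: field_simps)
  have kd: "gr (half x y) v = gr (half x' y') v - gr (half (x' - x) (y' - y)) v"
   if "x \<in> Hk Z 1" "y \<in> Hk Z 1" "x' \<in> Hk Z 1" "y' \<in> Hk Z 1" for x y x' y'
  proof -
   have e: "half x y = lc 1 (half x' y') (-1) (half (x' - x) (y' - y))" by (rule ext) (simp add: half_def lc_def field_simps)
   have m: "half x' y' \<in> Hk Z 1" "half (x' - x) (y' - y) \<in> Hk Z 1" using that by (simp_all add: lin)
   show ?thesis using O.grad_ip_lc_left[OF m wm(1), of 1 "-1"] unfolding e[symmetric] by simp
  qed
  show "gr (half (Pih th0) \<Theta>1) v = gr (half (Pih (th 0)) (Pih (th dt))) v - gr (half \<Psi>0 \<Psi>1) v"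
   "gr (half (Pih p0) P1) v = gr (half (Pih (p 0)) (Pih (p dt))) v - gr (half \<xi>0 \<xi>1) v"
   by (rule kd; rule mem)+
  show "d\<^sub>0 c * a (half (R (u 0)) (R (u dt))) v = (Fr 0 (Q v) + Fr dt (Q v)) / 2"
   unfolding ah_half[OF V_mem(1,2)] R_eq[OF sol(1)[OF t0dt(1)] v] R_eq[OF sol(1)[OF t0dt(2)] v] res(2)[OF t0dt(1), symmetric] res(2)[OF t0dt(2), symmetric]
   by (simp add: algebra_simps)
  show "Fr 0 (Q v) = Fr 0 v - Fr 0 (v - Q v)" "Fr dt (Q v) = Fr dt v - Fr dt (v - Q v)" by (rule res(1)[OF t0dt(1)], rule res(1)[OF t0dt(2)])
  have ih: "m (half x y) v = (m y v + m x v) / 2" if "x \<in> L2 Z" "y \<in> L2 Z" for x y using that wm by (simp add: lin lin_ip)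
  have kh: "gr (half x y) v = (gr y v + gr x v) / 2" if "x \<in> Hk Z 1" "y \<in> Hk Z 1" for x y using that wm by (simp add: lin lin_ip)
  show "(Fr 0 v + Fr dt v) / 2 = m (half (f 0) (f dt)) v - ?E (half (utt 0) (utt dt)) + alpha c * gr (half (th 0) (th dt)) v + beta c * gr (half (p 0) (p dt)) v"
   using mem by (simp add: ih kh residual_def) (simp add: field_simps)
  show "gr (half (th 0) (th dt)) v = gr (half (Pih (th 0)) (Pih (th dt))) v + gr WT v"
   "gr (half (p 0) (p dt)) v = gr (half (Pih (p 0)) (Pih (p dt))) v + gr WP v"
   using kd[OF mem(5,6) mem(20,21)] kd[OF mem(9,10) mem(22,23)] by simp_all
  show "?E WW = ?E DR - ?E us0 - dt / 2 * ?E (half (utt 0) (utt dt))"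
  proof -
   have m: "DR - us0 \<in> Hk Z 1" "DR \<in> Hk Z 1" "half (utt 0) (utt dt) \<in> Hk Z 1" "us0 \<in> Hk Z 1" using mem by (simp_all add: lin)
   have "m WW v = m DR v - m us0 v - dt / 2 * m (half (utt 0) (utt dt)) v"
    using O.ip_lc_left[OF m(1,3)[THEN O.Hk_L2] wm(2), of 1 "- (dt / 2)"] O.ip_lc_left[OF m(2,4)[THEN O.Hk_L2] wm(2), of 1 "-1"] unfolding diff_eq_lc[symmetric] by simp
   moreover have "gr WW v = gr DR v - gr us0 v - dt / 2 * gr (half (utt 0) (utt dt)) v"
    using O.grad_ip_lc_left[OF m(1,3) wm(1), of 1 "- (dt / 2)"] O.grad_ip_lc_left[OF m(2,4) wm(1), of 1 "-1"] unfolding diff_eq_lc[symmetric] by simp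
   ultimately show ?thesis by (simp only:) (simp add: algebra_simps)
  qed
  show "2 / dt * (dt / 2) = 1" using dt by simp
 qed
qed

lemma projection_pairing: "\<bar>gr WT w\<bar> <= (4 * Rd * C1 + 4 * (1 + C1)) * (2 * C3 * HL) * N w" "\<bar>gr WP w\<bar> <= (4 * Rd * C1 + 4 * (1 + C1)) * (2 * C3 * HL) * N w"
proof -
 have b: "\<bar>gr (half (y 0 - Pih (y 0)) (y dt - Pih (y dt))) w\<bar> <= (4 * Rd * C1 + 4 * (1 + C1)) * (2 * C3 * HL) * N w"
  if y: "Linf_sq Z (1 + sg) 0 dt y < ennreal Lr" "!!t. t \<in> {0..T} ==> has_time_deriv Z T y t (y' t)" "!!t. t \<in> {0..T} ==> y t \<in> Hs0 Z 1" for y y'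
 proof -
  have d: "y t - Pih (y t) \<in> Hs0 Z 1" if "t \<in> {0..T}" for t unfolding diff_eq_lc by (intro H1lc y(3) W_Hs0 Pih_W that)
  have g: "\<bar>gr (y t - Pih (y t)) w\<bar> <= (4 * Rd * C1 + 4 * (1 + C1)) * (2 * C3 * HL) * N w" if "t \<in> {0, dt}" for t
  proof -
   have t: "t \<in> {0..dt}" "t \<in> {0..T}" using that dt by auto
   show ?thesis by (rule smoothed_pairing[OF d[OF t(2)] Pih_error[OF y(1,2) y(3)[OF t(2)] t(1)] w_V])
  qed
  have "gr (half (y 0 - Pih (y 0)) (y dt - Pih (y dt))) w = (gr (y dt - Pih (y dt)) w + gr (y 0 - Pih (y 0)) w) / 2"
   unfolding half_eq_lc using O.grad_ip_lc_left[OF d[OF t0dt(2), THEN H1] d[OF t0dt(1), THEN H1] V_Hk[OF w_V], of "1 / 2" "1 / 2"] by simp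
  thus ?thesis using g[of 0] g[of dt] by simp
 qed
 show "\<bar>gr WT w\<bar> <= (4 * Rd * C1 + 4 * (1 + C1)) * (2 * C3 * HL) * N w" by (rule b[OF Lr(3) sol(9) sol(5)])
 show "\<bar>gr WP w\<bar> <= (4 * Rd * C1 + 4 * (1 + C1)) * (2 * C3 * HL) * N w" by (rule b[OF Lr(4) sol(10) sol(6)])
qed

lemma residual_pairing: "t \<in> {0..T} ==> \<bar>Fr t (w - Q w)\<bar> <= \<bar>CF\<bar> * C1 * (4 * Rd^2) * h powr (2 * sg) * N w"
proof -
 assume t: "t \<in> {0..T}"
 have "\<bar>Fr t (w - Q w)\<bar> <= \<bar>CF\<bar> * nm (w - Q w)" by (rule O.residual_bound[OF ws Fb dL(1) T t d_Hs0[OF w_V]])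
 also have "... <= \<bar>CF\<bar> * (C1 * h^2 * N w)" by (intro mult_left_mono sm0[OF w_V]) simp
 also have "... <= \<bar>CF\<bar> * (C1 * (4 * Rd^2 * h powr (2 * sg)) * N w)"
  using C1 N_nonneg[of w] h_powr(2) by (intro mult_left_mono mult_right_mono) auto
 also have "... = \<bar>CF\<bar> * C1 * (4 * Rd^2) * h powr (2 * sg) * N w" by simp
 finally show ?thesis .
qed

section \<open>Estimates of the three error equations and their sum\<close>

abbreviation "P \<equiv> nm (half \<Psi>0 \<Psi>1)"
abbreviation "S \<equiv> nm (half \<xi>0 \<xi>1)"
abbreviation "GP \<equiv> gn (half \<Psi>0 \<Psi>1)"
abbreviation "GS \<equiv> gn (half \<xi>0 \<xi>1)"
abbreviation "X \<equiv> nm (diffq dt Z0 Z1)"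
abbreviation "Y \<equiv> gn (diffq dt Z0 Z1)"

lemma coeffs_pos: "0 < a\<^sub>0 c" "0 < d\<^sub>0 c" "0 < alpha c" "0 < beta c" "0 < a\<^sub>1 c" "0 < b\<^sub>1 c" "0 < c\<^sub>1 c" "0 < a\<^sub>2 c" "0 < kappa c"
 "0 < \<gamma>0" "0 < a\<^sub>1 c - \<bar>gam c\<bar> / \<gamma>0" "0 < a\<^sub>2 c - \<bar>gam c\<bar> * \<gamma>0"
 using adm by (simp_all add: admissible_def)

lemma u_estimate:
 "2 * X^2 + 2 * a\<^sub>0 c * Y^2 + d\<^sub>0 c * a w w / 2 - alpha c * gr (half \<Psi>0 \<Psi>1) w - beta c * gr (half \<xi>0 \<xi>1) w
  <= 2 * (1 + a\<^sub>0 c) * (2 * C2 * HL + DM) * (X + Y)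
   + ((alpha c + beta c) * ((4 * Rd * C1 + 4 * (1 + C1)) * (2 * C3 * HL)) + \<bar>CF\<bar> * C1 * (4 * Rd^2) * h powr (2 * sg)) * N w"
proof -
 let ?B = "2 * C2 * HL + DM" and ?W = "(4 * Rd * C1 + 4 * (1 + C1)) * (2 * C3 * HL)"
 have B0: "0 <= ?B" using C23 Lr(1) Mr(1) by simp
 have wm: "w \<in> Hk Z 1" "w \<in> L2 Z" using V_Hk[OF w_V] O.Hk_L2[OF V_Hk[OF w_V]] .
 \<comment> \<open>The increment is \<open>dt\<close> times the difference quotient, which cancels
   the factor 2 / dt up to 2.\<close>
 have sq: "2 / dt * (m (diffq dt Z0 Z1) w + a\<^sub>0 c * gr (diffq dt Z0 Z1) w) = 2 * X^2 + 2 * a\<^sub>0 c * Y^2"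
 proof -
  have e: "w = lc dt (diffq dt Z0 Z1) 0 (diffq dt Z0 Z1)" using dt by (intro ext) (simp add: lc_def diffq_def)
  have m: "diffq dt Z0 Z1 \<in> Hk Z 1" using mem by (simp add: lin)
  have "m (diffq dt Z0 Z1) w = dt * X^2" "gr (diffq dt Z0 Z1) w = dt * Y^2"
   unfolding O.l2norm_sq O.grad_norm_sq using O.ip_lc_right[OF O.Hk_L2[OF m] O.Hk_L2[OF m] O.Hk_L2[OF m], of dt 0] O.grad_ip_lc_right[OF m m m, of dt 0]
   unfolding e[symmetric] by simp_all
  thus ?thesis using dt by (simp add: field_simps)
 qed
 have 1: "2 / dt * (m WW w + a\<^sub>0 c * gr WW w) <= 2 * (1 + a\<^sub>0 c) * ?B * (X + Y)"
 proof -
  have "m WW w <= nm WW * nm w" using O.Cauchy_Schwarz[OF O.Hk_L2[OF WW_bound(1)] wm(2)] by simp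
  also have "... <= ?B * (dt * X)" unfolding norm_w using dt by (intro mult_right_mono WW_bound) auto
  finally have i: "m WW w <= dt * (?B * X)" by (simp only: mult_ac)
  have "gr WW w <= gn WW * gn w" using O.grad_Cauchy_Schwarz[OF WW_bound(1) wm(1)] by simp
  also have "... <= ?B * (dt * Y)" unfolding norm_w using dt by (intro mult_right_mono WW_bound) auto
  finally have g: "gr WW w <= dt * (?B * Y)" by (simp only: mult_ac)
  have "m WW w + a\<^sub>0 c * gr WW w <= dt * (?B * X) + a\<^sub>0 c * (dt * (?B * Y))"
   using coeffs_pos(1) by (intro add_mono i mult_left_mono g) auto
  hence "2 / dt * (m WW w + a\<^sub>0 c * gr WW w) <= 2 / dt * (dt * (?B * X) + a\<^sub>0 c * (dt * (?B * Y)))"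
   using dt by (intro mult_left_mono) auto
  also have "... = 2 * ?B * X + 2 * a\<^sub>0 c * ?B * Y" using dt by (simp add: field_simps)
  also have "... <= 2 * (1 + a\<^sub>0 c) * ?B * X + 2 * (1 + a\<^sub>0 c) * ?B * Y"
   using coeffs_pos(1) B0 by (intro add_mono mult_right_mono) auto
  finally show ?thesis by (simp only: distrib_left)
 qed
 have 2: "alpha c * gr WT w + beta c * gr WP w <= (alpha c + beta c) * ?W * N w"
 proof -
  have "alpha c * gr WT w <= alpha c * (?W * N w)" "beta c * gr WP w <= beta c * (?W * N w)"
   using projection_pairing coeffs_pos(3,4) by (intro mult_left_mono; force)+
  thus ?thesis by (simp add: algebra_simps)
 qed
 have 3: "- (Fr 0 (w - Q w) + Fr dt (w - Q w)) / 2 <= \<bar>CF\<bar> * C1 * (4 * Rd^2) * h powr (2 * sg) * N w"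
  using residual_pairing[OF t0dt(1)] residual_pairing[OF t0dt(2)] by simp
 have "2 * X^2 + 2 * a\<^sub>0 c * Y^2 + d\<^sub>0 c * a w w / 2 - alpha c * gr (half \<Psi>0 \<Psi>1) w - beta c * gr (half \<xi>0 \<xi>1) w
  = 2 / dt * (m WW w + a\<^sub>0 c * gr WW w) + alpha c * gr WT w + beta c * gr WP w - (Fr 0 (w - Q w) + Fr dt (w - Q w)) / 2"
  using u_identity[OF w_V] unfolding sq energy_Z(1) by simp
 also have "... <= 2 * (1 + a\<^sub>0 c) * ?B * (X + Y) + (alpha c + beta c) * ?W * N w + \<bar>CF\<bar> * C1 * (4 * Rd^2) * h powr (2 * sg) * N w"
  using 1 2 3 by linarith
 finally show ?thesis by (simp only: distrib_right add.assoc)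
qed

lemma theta_estimate:
 "2 * a\<^sub>1 c * P^2 - 2 * gam c * m (half \<xi>0 \<xi>1) (half \<Psi>0 \<Psi>1) + dt * (b\<^sub>1 c * P^2 + c\<^sub>1 c * GP^2) + alpha c * gr (half \<Psi>0 \<Psi>1) w
  <= ((a\<^sub>1 c + \<bar>gam c\<bar>) * (4 * C3 * HL + sqrt T * DM) + T * b\<^sub>1 c * (2 * C3 * HL)) * P + dt * (alpha c * (2 * C2 * HL + DM)) * GP"
proof (rule parabolic_estimate[where y = th and y' = tht and x = p and x' = pt and q = phi,
  OF Lr(3) Mr(3) sol(9) sol(5) Lr(4) Mr(4) sol(10) sol(6) th0_Hs0 init(3) \<Theta>1_W p0_Hs0 init(4) P1_W L_mem(7,8)])
 show "a\<^sub>1 c * m (diffq dt (Pih th0) \<Theta>1) psi - gam c * m (diffq dt (Pih p0) P1) psi + b\<^sub>1 c * m (half (Pih th0) \<Theta>1) psi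
   + c\<^sub>1 c * gr (half (Pih th0) \<Theta>1) psi + alpha c * gr (diffq dt (R u0) U1) psi = m (half (phi 0) (phi dt)) psi" if "psi \<in> Wh Z \<T>" for psi
  using fs that unfolding first_step_def by blast
 show "a\<^sub>1 c * m (tht t) psi - gam c * m (pt t) psi + b\<^sub>1 c * m (th t) psi + c\<^sub>1 c * gr (th t) psi + alpha c * gr (ut t) psi = m (phi t) psi"
  if "t \<in> {0..T}" "psi \<in> Hs0 Z 1" for t psi using ws that unfolding weak_solution_def by blast
qed (use coeffs_pos in simp_all)

text \<open>The third equation has no zero-order term, whence the coefficient 0.\<close>

lemma p_estimate:
 "2 * a\<^sub>2 c * S^2 - 2 * gam c * m (half \<Psi>0 \<Psi>1) (half \<xi>0 \<xi>1) + dt * (0 * S^2 + kappa c * GS^2) + beta c * gr (half \<xi>0 \<xi>1) w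
  <= ((a\<^sub>2 c + \<bar>gam c\<bar>) * (4 * C3 * HL + sqrt T * DM) + T * 0 * (2 * C3 * HL)) * S + dt * (beta c * (2 * C2 * HL + DM)) * GS"
proof (rule parabolic_estimate[where y = p and y' = pt and x = th and x' = tht and q = g,
  OF Lr(4) Mr(4) sol(10) sol(6) Lr(3) Mr(3) sol(9) sol(5) p0_Hs0 init(4) P1_W th0_Hs0 init(3) \<Theta>1_W L_mem(9,10)])
 show "a\<^sub>2 c * m (diffq dt (Pih p0) P1) psi - gam c * m (diffq dt (Pih th0) \<Theta>1) psi + 0 * m (half (Pih p0) P1) psi
   + kappa c * gr (half (Pih p0) P1) psi + beta c * gr (diffq dt (R u0) U1) psi = m (half (g 0) (g dt)) psi" if "psi \<in> Wh Z \<T>" for psi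
 proof -
  have "a\<^sub>2 c * m (diffq dt (Pih p0) P1) psi - gam c * m (diffq dt (Pih th0) \<Theta>1) psi
   + kappa c * gr (half (Pih p0) P1) psi + beta c * gr (diffq dt (R u0) U1) psi = m (half (g 0) (g dt)) psi"
   using fs that unfolding first_step_def by blast
  thus ?thesis by simp
 qed
 show "a\<^sub>2 c * m (pt t) psi - gam c * m (tht t) psi + 0 * m (p t) psi + kappa c * gr (p t) psi + beta c * gr (ut t) psi = m (g t) psi"
  if "t \<in> {0..T}" "psi \<in> Hs0 Z 1" for t psi
 proof -
  have "a\<^sub>2 c * m (pt t) psi - gam c * m (tht t) psi + kappa c * gr (p t) psi + beta c * gr (ut t) psi = m (g t) psi"
   using ws that unfolding weak_solution_def by blast
  thus ?thesis by simp
 qed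
qed (use coeffs_pos in simp_all)

text \<open>Young's inequality with weight \<gamma>0 / 2 distributes the mixed terms of both
  parabolic equations so that the coefficients assumed to be positive remain.\<close>

lemma cross_term:
 "2 * (a\<^sub>1 c - \<bar>gam c\<bar> / \<gamma>0) * P^2 + 2 * (a\<^sub>2 c - \<bar>gam c\<bar> * \<gamma>0) * S^2
  <= 2 * a\<^sub>1 c * P^2 + 2 * a\<^sub>2 c * S^2 - 4 * gam c * m (half \<xi>0 \<xi>1) (half \<Psi>0 \<Psi>1)"
proof -
 have m: "half \<xi>0 \<xi>1 \<in> L2 Z" "half \<Psi>0 \<Psi>1 \<in> L2 Z" using mem by (simp_all add: lin)
 have "gam c * m (half \<xi>0 \<xi>1) (half \<Psi>0 \<Psi>1) <= \<bar>gam c\<bar> * \<bar>m (half \<xi>0 \<xi>1) (half \<Psi>0 \<Psi>1)\<bar>" unfolding abs_mult[symmetric] by (rule abs_ge_self)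
 also have "... <= \<bar>gam c\<bar> * (S * P)" by (intro mult_left_mono O.Cauchy_Schwarz m) simp
 also have "... <= \<bar>gam c\<bar> * (\<gamma>0 / 2 * S^2 + P^2 / (4 * (\<gamma>0 / 2)))" using coeffs_pos(10) by (intro mult_left_mono young) auto
 finally have "gam c * m (half \<xi>0 \<xi>1) (half \<Psi>0 \<Psi>1) <= \<bar>gam c\<bar> * \<gamma>0 * S^2 / 2 + \<bar>gam c\<bar> / \<gamma>0 * P^2 / 2" by (simp add: distrib_left)
 thus ?thesis by (simp add: left_diff_distrib right_diff_distrib)
qed

text \<open>The three sources of error before squaring: the residual, the projections and the time
  discretization.\<close>

abbreviation "GG \<equiv> h powr (2 * sg) + HL + DM"

lemma energy_estimate:
 "X^2 + a\<^sub>0 c * Y^2 + d\<^sub>0 c * CCoer * (N (half Z0 Z1))^2 + (a\<^sub>1 c - \<bar>gam c\<bar> / \<gamma>0) * P^2 + (a\<^sub>2 c - \<bar>gam c\<bar> * \<gamma>0) * S^2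
  + dt * (b\<^sub>1 c * P^2 + c\<^sub>1 c * GP^2 + kappa c * GS^2) <= energy_const c \<gamma>0 CCoer T * (data_const c CF C1 C2 C3 Rd T * GG)^2"
proof -
 define k1 k2 k3 k4 k5 where "k1 = 2 * (1 + a\<^sub>0 c) * (2 * C2 + 1)"
  and "k2 = (alpha c + beta c) * ((4 * Rd * C1 + 4 * (1 + C1)) * (2 * C3)) + \<bar>CF\<bar> * C1 * (4 * Rd^2)"
  and "k3 = (a\<^sub>1 c + a\<^sub>2 c + \<bar>gam c\<bar>) * (4 * C3 + sqrt T)" and "k4 = T * b\<^sub>1 c * (2 * C3)" and "k5 = (alpha c + beta c) * (2 * C2 + 1)"
 define G where "G = GG"
 define K where "K = data_const c CF C1 C2 C3 Rd T"
 have K: "K = k1 + k2 + k3 + k4 + k5" unfolding K_def data_const_def k1_def k2_def k3_def k4_def k5_def by (rule refl)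
 have k: "0 <= k1" "0 <= k2" "0 <= k3" "0 <= k4" "0 <= k5"
  unfolding k1_def k2_def k3_def k4_def k5_def using coeffs_pos C23 C1 Rd(1) T
  by (auto intro!: add_nonneg_nonneg mult_nonneg_nonneg)
 have nn: "0 <= h powr (2 * sg)" "0 <= HL" "0 <= DM" using Lr(1) Mr(1) by simp_all
 have G0: "0 <= G" "h powr (2 * sg) <= G" "HL <= G" "DM <= G" unfolding G_def using nn by linarith+
 have lin2: "q1 * x + q2 * y <= (q1 + q2) * G" if "0 <= q1" "0 <= q2" "x <= G" "y <= G" for q1 q2 x y
  unfolding distrib_right using that by (intro add_mono mult_left_mono)
 have b0: "2 * C2 * HL + DM <= (2 * C2 + 1) * G" using lin2[of "2 * C2" 1, OF _ _ G0(3,4)] C23 by simp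
 have c1: "2 * (1 + a\<^sub>0 c) * (2 * C2 * HL + DM) <= k1 * G"
  using mult_left_mono[OF b0, of "2 * (1 + a\<^sub>0 c)"] coeffs_pos(1) unfolding k1_def by (simp only: mult.assoc) simp
 have c2: "(alpha c + beta c) * ((4 * Rd * C1 + 4 * (1 + C1)) * (2 * C3 * HL)) + \<bar>CF\<bar> * C1 * (4 * Rd^2) * h powr (2 * sg) <= k2 * G"
 proof -
  have e: "(alpha c + beta c) * ((4 * Rd * C1 + 4 * (1 + C1)) * (2 * C3 * HL)) = (alpha c + beta c) * ((4 * Rd * C1 + 4 * (1 + C1)) * (2 * C3)) * HL" by (simp only: mult.assoc)
  show ?thesis unfolding e k2_def
   by (intro lin2 G0 mult_nonneg_nonneg add_nonneg_nonneg) (use coeffs_pos C23 C1 Rd(1) in auto)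
 qed
 have b3: "4 * C3 * HL + sqrt T * DM <= (4 * C3 + sqrt T) * G" by (intro lin2 G0) (use T C23 in auto)
 have c3: "(x + \<bar>gam c\<bar>) * (4 * C3 * HL + sqrt T * DM) <= k3 * G" if "0 <= x" "x <= a\<^sub>1 c + a\<^sub>2 c" for x
 proof -
  have "(x + \<bar>gam c\<bar>) * (4 * C3 * HL + sqrt T * DM) <= (a\<^sub>1 c + a\<^sub>2 c + \<bar>gam c\<bar>) * ((4 * C3 + sqrt T) * G)"
   using that Lr(1) Mr(1) T C23 coeffs_pos by (intro mult_mono b3 add_nonneg_nonneg mult_nonneg_nonneg) auto
  thus ?thesis unfolding k3_def by (simp only: mult.assoc)
 qed
 have c4: "T * b\<^sub>1 c * (2 * C3 * HL) <= k4 * G"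
  using mult_left_mono[OF G0(3) k(4)] unfolding k4_def by (simp only: mult.assoc)
 have c5: "x * (2 * C2 * HL + DM) <= k5 * G" if "0 <= x" "x <= alpha c + beta c" for x
 proof -
  have "x * (2 * C2 * HL + DM) <= (alpha c + beta c) * ((2 * C2 + 1) * G)"
   using that Lr(1) Mr(1) C23 coeffs_pos by (intro mult_mono b0 add_nonneg_nonneg mult_nonneg_nonneg) auto
  thus ?thesis unfolding k5_def by (simp only: mult.assoc)
 qed
 have KG: "k1 * G <= K * G" "k2 * G <= K * G" "k3 * G + k4 * G <= K * G" "k3 * G <= K * G" "k5 * G <= K * G"
  unfolding distrib_right[symmetric] by (rule mult_right_mono[OF _ G0(1)]; use k in \<open>simp add: K\<close>)+
 have e1: "2 * (1 + a\<^sub>0 c) * (2 * C2 * HL + DM) * (X + Y) <= K * G * (X + Y)"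
  by (rule mult_right_mono[OF order_trans[OF c1 KG(1)]]) (intro add_nonneg_nonneg O.l2norm_nonneg O.grad_norm_nonneg)
 have e2: "((alpha c + beta c) * ((4 * Rd * C1 + 4 * (1 + C1)) * (2 * C3 * HL)) + \<bar>CF\<bar> * C1 * (4 * Rd^2) * h powr (2 * sg)) * N w <= K * G * N w"
  by (rule mult_right_mono[OF order_trans[OF c2 KG(2)] N_nonneg])
 have e3: "((a\<^sub>1 c + \<bar>gam c\<bar>) * (4 * C3 * HL + sqrt T * DM) + T * b\<^sub>1 c * (2 * C3 * HL)) * P <= K * G * P"
  by (rule mult_right_mono[OF order_trans[OF add_mono[OF c3 c4] KG(3)] O.l2norm_nonneg]) (use coeffs_pos in auto)
 have e4: "((a\<^sub>2 c + \<bar>gam c\<bar>) * (4 * C3 * HL + sqrt T * DM) + T * 0 * (2 * C3 * HL)) * S <= K * G * S"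
 proof -
  have "(a\<^sub>2 c + \<bar>gam c\<bar>) * (4 * C3 * HL + sqrt T * DM) * S <= K * G * S"
   by (rule mult_right_mono[OF order_trans[OF c3 KG(4)] O.l2norm_nonneg]) (use coeffs_pos in auto)
  thus ?thesis by (simp only: mult_zero_right mult_zero_left add_0_right)
 qed
 have e5: "dt * (x * (2 * C2 * HL + DM)) * y <= dt * (K * G) * y" if "0 <= x" "x <= alpha c + beta c" "0 <= y" for x y
  by (rule mult_right_mono[OF mult_left_mono[OF order_trans[OF c5[OF that(1,2)] KG(5)]] that(3)]) (use dt in simp)
 have e5': "dt * (alpha c * (2 * C2 * HL + DM)) * GP <= dt * (K * G) * GP" "dt * (beta c * (2 * C2 * HL + DM)) * GS <= dt * (K * G) * GS"
  by (rule e5; use coeffs_pos in simp)+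
 have ic: "m (half \<Psi>0 \<Psi>1) (half \<xi>0 \<xi>1) = m (half \<xi>0 \<xi>1) (half \<Psi>0 \<Psi>1)" by (rule O.ip_commute)
 have s: "dt * (b\<^sub>1 c * P^2 + c\<^sub>1 c * GP^2 + kappa c * GS^2) = dt * (b\<^sub>1 c * P^2 + c\<^sub>1 c * GP^2) + dt * (0 * S^2 + kappa c * GS^2)"
  by (simp only: distrib_left mult_zero_left add_0_left)
 have r: "K * G * (X + Y + N w + P + S) + dt * (K * G * (GP + GS))
   = K * G * (X + Y) + K * G * N w + K * G * P + K * G * S + (dt * (K * G) * GP + dt * (K * G) * GS)"
  by (simp only: distrib_left mult.assoc)
 \<comment> \<open>In the sum, the coupling terms of the first equation, tested with the increment,
   cancel those of the other two, tested with the averages.\<close>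
 have "2 * X^2 + 2 * a\<^sub>0 c * Y^2 + d\<^sub>0 c * a w w / 2 + 2 * (a\<^sub>1 c - \<bar>gam c\<bar> / \<gamma>0) * P^2 + 2 * (a\<^sub>2 c - \<bar>gam c\<bar> * \<gamma>0) * S^2
   + dt * (b\<^sub>1 c * P^2 + c\<^sub>1 c * GP^2 + kappa c * GS^2) <= K * G * (X + Y + N w + P + S) + dt * (K * G * (GP + GS))"
  unfolding s r by (rule add_estimates[OF u_estimate theta_estimate p_estimate[unfolded ic] cross_term _ e1 e2 e3 e4 e5']) (simp only: mult.assoc)
 thus ?thesis unfolding G_def[symmetric] K_def[symmetric] energy_const_def
  by (intro absorb[where T = T and A = "a w w" and NN = "N w"] coeffs_pos CCoer dt coercive[OF w_V] energy_Z(2) T less_imp_le[OF dt(1)])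
qed

lemma GG_sq: "GG^2 <= 3 * (h powr (4 * sg) + Lr * h powr (4 * sg) + Mr * dt ^ 4)"
proof -
 have "(x + y + z)^2 <= 3 * (x^2 + y^2 + z^2)" for x y z :: real
 proof -
  have "0 <= (x - y)^2 + (y - z)^2 + (x - z)^2" by simp
  thus ?thesis by (simp add: power2_eq_square algebra_simps)
 qed
 moreover have hs: "(h powr (2 * sg))^2 = h powr (4 * sg)" by (simp add: power2_eq_square powr_add[symmetric])
 moreover have "(DM)^2 = Mr * dt ^ 4" using Mr(1) by (simp add: power_mult_distrib)
 moreover have "(HL)^2 = Lr * h powr (4 * sg)" using Lr(1) by (simp add: power_mult_distrib hs)
 ultimately show ?thesis by metis
qed

lemma first_step_error:
 "X^2 + a\<^sub>0 c * Y^2 + d\<^sub>0 c * CCoer * (N (half Z0 Z1))^2 + (a\<^sub>1 c - \<bar>gam c\<bar> / \<gamma>0) * P^2 + (a\<^sub>2 c - \<bar>gam c\<bar> * \<gamma>0) * S^2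
  + dt * (b\<^sub>1 c * P^2 + c\<^sub>1 c * GP^2 + kappa c * GS^2)
  <= 3 * energy_const c \<gamma>0 CCoer T * (data_const c CF C1 C2 C3 Rd T)^2 * (h powr (4 * sg) + Lr * h powr (4 * sg) + Mr * dt ^ 4)"
proof -
 have "0 <= energy_const c \<gamma>0 CCoer T" unfolding energy_const_def using coeffs_pos CCoer T by auto
 hence "energy_const c \<gamma>0 CCoer T * (data_const c CF C1 C2 C3 Rd T)^2 * GG^2
  <= energy_const c \<gamma>0 CCoer T * (data_const c CF C1 C2 C3 Rd T)^2 * (3 * (h powr (4 * sg) + Lr * h powr (4 * sg) + Mr * dt ^ 4))"
  by (intro mult_left_mono GG_sq) auto
 from order_trans[OF energy_estimate[unfolded power_mult_distrib[of _ GG] mult.assoc[symmetric]] this] show ?thesis by (simp only: mult_ac)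
qed

end

theorem lemma4p2:
  fixes \<Omega> :: "(real^2) set" and c :: coeffs
    and T \<gamma>0 \<sigma> CF CCoer CCont C1 C2 C3 :: real
  assumes "lipschitz_domain \<Omega>" and "polygonal \<Omega>" and "regularity_index \<Omega> \<sigma>"
    and "0 < T" and "admissible c \<gamma>0"
    and "0 < CCoer" and "0 < CCont" and "0 < C1" and "0 < C2" and "0 < C3"
  shows "\<exists>C>0.
    \<forall>f \<phi> g u0 us0 \<theta>0 p0 u ut utt \<theta> \<theta>t p pt \<T> \<rho> n \<sigma>IP \<Lambda> J R Pih (N :: nat) U1 \<Theta>1 P1.
      smooth_data \<Omega> T c f \<phi> g u0 us0 \<theta>0 p0 \<and>
      weak_solution \<Omega> T c f \<phi> g u0 us0 \<theta>0 p0 u ut utt \<theta> \<theta>t p pt \<and>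
      F_bound \<Omega> T c f utt \<theta> p CF \<and>
      triangulation_of \<Omega> \<rho> \<T> \<and> edge_normals \<T> n \<and>
      coercive_continuous \<Omega> \<T> n \<sigma>IP CCoer CCont \<and>
      companion \<Omega> \<T> n \<Lambda> J \<and> smoother_bound \<Omega> \<T> n \<sigma>IP J C1 \<and>
      is_Rh \<Omega> \<T> n \<sigma>IP J R \<and> Rh_bound \<Omega> \<T> n \<sigma>IP R \<sigma> C2 \<and>
      is_Pih \<Omega> \<T> Pih \<and> Pih_bound \<Omega> \<T> Pih \<sigma> C3 \<and>
      0 < N \<and>
      first_step \<Omega> \<T> n \<sigma>IP c (T / real N) f \<phi> g us0 (R u0) (Pih \<theta>0) (Pih p0) U1 \<Theta>1 P1
      \<longrightarrow>
      (let h = mesh_size \<T>; \<delta> = T / real N;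
           \<zeta>0 = R (u 0) - R u0; \<zeta>1 = R (u \<delta>) - U1;
           \<Psi>0 = Pih (\<theta> 0) - Pih \<theta>0; \<Psi>1 = Pih (\<theta> \<delta>) - \<Theta>1;
           \<xi>0 = Pih (p 0) - Pih p0; \<xi>1 = Pih (p \<delta>) - P1
       in
         ennreal
          ((l2norm \<Omega> (diffq \<delta> \<zeta>0 \<zeta>1))\<^sup>2
           + a\<^sub>0 c * (grad_norm \<Omega> (diffq \<delta> \<zeta>0 \<zeta>1))\<^sup>2
           + d\<^sub>0 c * CCoer * (h_norm \<Omega> \<T> n \<sigma>IP (half \<zeta>0 \<zeta>1))\<^sup>2
           + (a\<^sub>1 c - \<bar>gam c\<bar> / \<gamma>0) * (l2norm \<Omega> (half \<Psi>0 \<Psi>1))\<^sup>2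
           + (a\<^sub>2 c - \<bar>gam c\<bar> * \<gamma>0) * (l2norm \<Omega> (half \<xi>0 \<xi>1))\<^sup>2
           + \<delta> * (b\<^sub>1 c * (l2norm \<Omega> (half \<Psi>0 \<Psi>1))\<^sup>2
                  + c\<^sub>1 c * (grad_norm \<Omega> (half \<Psi>0 \<Psi>1))\<^sup>2
                  + kappa c * (grad_norm \<Omega> (half \<xi>0 \<xi>1))\<^sup>2))
         \<le> ennreal C *
            (ennreal (h powr (4 * \<sigma>))
             + L_reg \<Omega> \<sigma> u \<theta> p \<delta> * ennreal (h powr (4 * \<sigma>))
             + M_reg \<Omega> u \<theta> p \<delta> * ennreal (\<delta> ^ 4)))"
proof -
 have bd: "bounded \<Omega>" using assms(1) by (simp add: lipschitz_domain_def)
 then obtain r where r: "!!x. x \<in> \<Omega> ==> norm x <= r" unfolding bounded_iff by blast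
 \<comment> \<open>At least 1, as \<open>disc\<close> requires, and fixed by the domain before any
   mesh or data are chosen.\<close>
 define Rd where "Rd = max 1 r"
 have Rd: "1 <= Rd" "!!x. x \<in> \<Omega> ==> norm x <= Rd" using r unfolding Rd_def by fastforce+
 define K where "K = 3 * energy_const c \<gamma>0 CCoer T * (data_const c CF C1 C2 C3 Rd T)^2"
 have sig: "1 / 2 < \<sigma>" "\<sigma> <= 1" using assms(3) by (auto simp: regularity_index_def)
 show ?thesis
 \<comment> \<open>The factor 3 absorbs the slack that is added to the two regularity constants
   below; the summand 1 makes the constant positive.\<close>
 proof (intro exI[of _ "3 * \<bar>K\<bar> + 1"] conjI allI impI, goal_cases)
  case 1
  thus ?case by simp
 next
  case (2 f \<phi> g u0 us0 \<theta>0 p0 u ut utt \<theta> \<theta>t p pt \<T> \<rho> n \<sigma>IP \<Lambda> J R Pih N U1 \<Theta>1 P1)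
  hence sd: "smooth_data \<Omega> T c f \<phi> g u0 us0 \<theta>0 p0" and ws: "weak_solution \<Omega> T c f \<phi> g u0 us0 \<theta>0 p0 u ut utt \<theta> \<theta>t p pt"
   and Fb: "F_bound \<Omega> T c f utt \<theta> p CF" and tr: "triangulation_of \<Omega> \<rho> \<T>" and nm: "edge_normals \<T> n"
   and co: "coercive_continuous \<Omega> \<T> n \<sigma>IP CCoer CCont" and cm: "companion \<Omega> \<T> n \<Lambda> J" and sm: "smoother_bound \<Omega> \<T> n \<sigma>IP J C1"
   and Rh: "is_Rh \<Omega> \<T> n \<sigma>IP J R" "Rh_bound \<Omega> \<T> n \<sigma>IP R \<sigma> C2" and Pi: "is_Pih \<Omega> \<T> Pih" "Pih_bound \<Omega> \<T> Pih \<sigma> C3"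
   and N: "0 < N" and fs: "first_step \<Omega> \<T> n \<sigma>IP c (T / real N) f \<phi> g us0 (R u0) (Pih \<theta>0) (Pih p0) U1 \<Theta>1 P1"
   by blast+
  interpret M: disc \<Omega> \<rho> \<T> n \<sigma>IP CCoer CCont C1 \<Lambda> Rd J
   by unfold_locales (use assms tr nm co cm sm Rd in auto)
  define \<delta> where "\<delta> = T / real N"
  have \<delta>: "0 < \<delta>" "\<delta> <= T" unfolding \<delta>_def using assms(4) N by (auto simp: field_simps)
  have fs': "first_step \<Omega> \<T> n \<sigma>IP c \<delta> f \<phi> g us0 (R u0) (Pih \<theta>0) (Pih p0) U1 \<Theta>1 P1" unfolding \<delta>_def by (rule fs)
  define H where "H = mesh_size \<T> powr (4 * \<sigma>)"
  have H: "0 < H" unfolding H_def using M.mesh_size_pos by simp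
  define E where "E = (l2norm \<Omega> (diffq \<delta> (R (u 0) - R u0) (R (u \<delta>) - U1)))^2
      + a\<^sub>0 c * (grad_norm \<Omega> (diffq \<delta> (R (u 0) - R u0) (R (u \<delta>) - U1)))^2
      + d\<^sub>0 c * CCoer * (h_norm \<Omega> \<T> n \<sigma>IP (half (R (u 0) - R u0) (R (u \<delta>) - U1)))^2
      + (a\<^sub>1 c - \<bar>gam c\<bar> / \<gamma>0) * (l2norm \<Omega> (half (Pih (\<theta> 0) - Pih \<theta>0) (Pih (\<theta> \<delta>) - \<Theta>1)))^2
      + (a\<^sub>2 c - \<bar>gam c\<bar> * \<gamma>0) * (l2norm \<Omega> (half (Pih (p 0) - Pih p0) (Pih (p \<delta>) - P1)))^2
      + \<delta> * (b\<^sub>1 c * (l2norm \<Omega> (half (Pih (\<theta> 0) - Pih \<theta>0) (Pih (\<theta> \<delta>) - \<Theta>1)))^2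
         + c\<^sub>1 c * (grad_norm \<Omega> (half (Pih (\<theta> 0) - Pih \<theta>0) (Pih (\<theta> \<delta>) - \<Theta>1)))^2
         + kappa c * (grad_norm \<Omega> (half (Pih (p 0) - Pih p0) (Pih (p \<delta>) - P1)))^2)"
  have "ennreal E <= ennreal (3 * \<bar>K\<bar> + 1) * (ennreal H + L_reg \<Omega> \<sigma> u \<theta> p \<delta> * ennreal H + M_reg \<Omega> u \<theta> p \<delta> * ennreal (\<delta> ^ 4))"
  \<comment> \<open>If a regularity constant is infinite, then so is the right-hand side, because
    the mesh size and the time step are positive.\<close>
  proof (cases "L_reg \<Omega> \<sigma> u \<theta> p \<delta> = \<infinity> \<or> M_reg \<Omega> u \<theta> p \<delta> = \<infinity>")
   case True
   hence "ennreal (3 * \<bar>K\<bar> + 1) * (ennreal H + L_reg \<Omega> \<sigma> u \<theta> p \<delta> * ennreal H + M_reg \<Omega> u \<theta> p \<delta> * ennreal (\<delta> ^ 4)) = \<infinity>"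
    using H \<delta> by (auto simp: ennreal_top_mult ennreal_mult_top)
   thus ?thesis by simp
  next
   case False
   define l where "l = enn2real (L_reg \<Omega> \<sigma> u \<theta> p \<delta>)"
   define m where "m = enn2real (M_reg \<Omega> u \<theta> p \<delta>)"
   have l: "L_reg \<Omega> \<sigma> u \<theta> p \<delta> = ennreal l" "0 <= l" and m: "M_reg \<Omega> u \<theta> p \<delta> = ennreal m" "0 <= m"
    using False unfolding l_def m_def by (simp_all add: less_top)
   have lt: "x < ennreal (y + z)" if "x <= ennreal y" "0 <= y" "0 < z" for x and y z :: real
    using that by (intro le_less_trans[OF that(1)] ennreal_lessI) auto
   have pL: "Linf_sq \<Omega> (2 + \<sigma>) 1 \<delta> u <= ennreal l" "Linf_sq \<Omega> (1 + \<sigma>) 0 \<delta> \<theta> <= ennreal l" "Linf_sq \<Omega> (1 + \<sigma>) 0 \<delta> p <= ennreal l"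
    unfolding l(1)[symmetric] L_reg_def by (auto intro: add_increasing add_increasing2)
   have pM: "Linf_sq \<Omega> 1 3 \<delta> u <= ennreal m" "L2_sq \<Omega> 0 3 \<delta> \<theta> <= ennreal m" "L2_sq \<Omega> 0 3 \<delta> p <= ennreal m"
    unfolding m(1)[symmetric] M_reg_def by (auto intro: add_increasing add_increasing2)
   \<comment> \<open>The slack in \<open>Mr\<close> is H / \<delta>^4, which times \<delta>^4 is the
     term \<open>H\<close> already present; the slack in \<open>Lr\<close> is 1, which times
     \<open>H\<close> gives the same. Together they turn \<open>H\<close> into 3 H.\<close>
   have z: "0 < H / \<delta> ^ 4" using H \<delta> by simp
   have tL: "f t \<in> L2 \<Omega>" "\<phi> t \<in> L2 \<Omega>" "g t \<in> L2 \<Omega>" if "t \<in> {0..T}" for t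
    using sd that by (auto simp: smooth_data_def H_time_def time_continuous_def)
   have us: "us0 \<in> Hs0 \<Omega> 1" using sd M.O.Hs0_2_1 unfolding smooth_data_def by blast
   interpret S: first_time_step \<Omega> \<rho> \<T> n \<sigma>IP CCoer CCont C1 \<Lambda> Rd J c T \<gamma>0 \<sigma> CF C2 C3 \<delta> "l + 1" "m + H / \<delta> ^ 4" f \<phi> g u0 us0 \<theta>0 p0 u ut utt \<theta> \<theta>t p pt R Pih U1 \<Theta>1 P1
    by unfold_locales (use assms(4,5,9,10) \<delta> sig tL us ws Fb Rh Pi fs' l(2) m(2) z lt[OF pL(1) l(2), of 1] lt[OF pL(2) l(2), of 1] lt[OF pL(3) l(2), of 1]
     lt[OF pM(1) m(2) z] lt[OF pM(2) m(2) z] lt[OF pM(3) m(2) z] in auto)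
   have "E <= K * (H + (l + 1) * H + (m + H / \<delta> ^ 4) * \<delta> ^ 4)"
    unfolding E_def K_def H_def by (rule S.first_step_error[unfolded H_def])
   also have "... = K * (3 * H + l * H + m * \<delta> ^ 4)" using \<delta> by (simp add: field_simps)
   also have "... <= \<bar>K\<bar> * (3 * H + l * H + m * \<delta> ^ 4)" using H l m \<delta> by (intro mult_right_mono) auto
   also have "... <= \<bar>K\<bar> * (3 * (H + l * H + m * \<delta> ^ 4))" using H l m \<delta> by (intro mult_left_mono) auto
   also have "... <= (3 * \<bar>K\<bar> + 1) * (H + l * H + m * \<delta> ^ 4)" using H l m \<delta> by (simp add: algebra_simps)
   finally have "ennreal E <= ennreal ((3 * \<bar>K\<bar> + 1) * (H + l * H + m * \<delta> ^ 4))" by (rule ennreal_leI)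
   also have "... = ennreal (3 * \<bar>K\<bar> + 1) * (ennreal H + ennreal l * ennreal H + ennreal m * ennreal (\<delta> ^ 4))"
    using H l m \<delta> by (simp add: ennreal_mult ennreal_plus)
   finally show ?thesis unfolding l m .
  qed
  thus ?case unfolding Let_def E_def H_def \<delta>_def .
 qed
qed

end
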